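(* Let $G$ be a reductive algebraic group over an algebraically closed field $\mathbb{K}$ of characteristic $p>0$, let $\mathfrak g=\mathrm{Lie}(G)$, and let $r\in\mathbb{N}$. Every irreducible $U^{[r]}(G)$-module is a $U^{[r]}_\chi(G)$-module for some $\chi\in\mathfrak{g}^{*}$ (i.e. the action of $U^{[r]}(G)$ factors through the quotient $U^{[r]}_\chi(G)$).
   Context: $\mathbb{N}=\{0,1,2,\dots\}$. With $I_1=\{f\in\mathbb{K}[G]: f(1)=0\}$, $\mathrm{Dist}_k(G)$ is the space of linear maps $\mu:\mathbb{K}[G]\to\mathbb{K}$ with $\mu(I_1^{k+1})=0$, $\mathrm{Dist}_k^{+}(G)=\{\mu\in\mathrm{Dist}_k(G):\mu(1)=0\}$, and $\mathrm{Dist}(G)=\bigcup_k\mathrm{Dist}_k(G)$ with product $\mu\rho=(\mu\otimes\rho)\circ\Delta$. One identifies $\mathfrak g=\mathrm{Dist}_1^+(G)$. $U^{[r]}(G)=T(\mathrm{Dist}^+_{p^{r+1}-1}(G))/Q$, where $T$ is the tensor algebra and $Q$ is the two-sided ideal generated by the relations (i) $x\otimes y=xy$ for $x\in\mathrm{Dist}^+_i(G)$, $y\in\mathrm{Dist}^+_j(G)$ with $i+j<p^{r+1}$; (ii) $x\otimes y-y\otimes x=[x,y]$ for $x\in\mathrm{Dist}^+_i(G)$, $y\in\mathrm{Dist}^+_j(G)$ with $i+j\le p^{r+1}$ (right-hand sides computed in $\mathrm{Dist}(G)$). If $\delta\in\mathrm{Dist}^+_{p^r}(G)$ then $\delta^p$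 (in $\mathrm{Dist}(G)$) lies in $\mathrm{Dist}^+_{p^{r+1}-1}(G)$; define $\xi_r:\mathrm{Dist}^+_{p^r}(G)\to U^{[r]}(G)$ by $\xi_r(\delta)=\delta^{\otimes p}-\delta^p$, where $\delta^{\otimes p}$ is the $p$-th power in $U^{[r]}(G)$ and $\delta^p$ is the class of the $p$-th power taken in $\mathrm{Dist}(G)$. A reductive group is defined over $\mathbb{F}_p$; fix the (split) form, so $\mathbb{K}[G]=\mathbb{F}_p[G]\otimes_{\mathbb{F}_p}\mathbb{K}$, and let $\Xi_r:\mathrm{Dist}(G)\to\mathrm{Dist}(G)$ be $\Xi_r(\delta)(f\otimes a)=\delta(f^{p^r}\otimes a)$. It maps $\mathrm{Dist}^+_{p^r}(G)$ onto $\mathrm{Dist}^+_1(G)=\mathfrak g$. A linear form $\chi\in\mathfrak g^*$ is also regarded as a linear form on $\mathrm{Dist}^+_{p^r}(G)$ by $\chi(\delta):=\chi(\Xi_r(\delta))$. Then $$U^{[r]}_\chi(G)=U^{[r]}(G)\big/\langle \xi_r(\delta)-\chi(\delta)^p : \delta\in\mathrm{Dist}^+_{p^r}(G)\rangle .$$ *)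

theory Defs
  imports
    "HOL-Algebra.QuotRing"
    "HOL-Computational_Algebra.Polynomial"
    "HOL-Library.Function_Algebras"
    "HOL-Library.Indicator_Function"
    "HOL-Library.FuncSet"
    "HOL-Library.Poly_Mapping"
begin

section \<open>Affine algebraic groups\<close>

text \<open>
  An affine algebraic group over the algebraically closed field \<open>'k\<close> is a pair consisting of a
  group \<open>G\<close> (its group of \<open>'k\<close>-points) and its coordinate algebra \<open>A\<close>, a finitely generated
  algebra of \<open>'k\<close>-valued functions on \<open>G\<close>. Reductive groups are reduced, so nothing is lost by
  working with honest functions.

  Functions on \<open>carrier G\<close> are represented by functions on the whole type that vanish outside
  \<open>carrier G\<close>, so that vector space operations and products are the pointwise ones. The unit of
  the coordinate algebra is therefore the indicator function of \<open>carrier G\<close>.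
\<close>

definition fscale :: "'k::field \<Rightarrow> ('x \<Rightarrow> 'k) \<Rightarrow> ('x \<Rightarrow> 'k)" where
  "fscale c f = (\<lambda>x. c * f x)"

lemma vector_space_fscale: "vector_space (fscale :: 'k::field \<Rightarrow> ('x \<Rightarrow> 'k) \<Rightarrow> _)"
  by unfold_locales (auto simp: fscale_def fun_eq_iff algebra_simps)

definition function_algebra :: "'x set \<Rightarrow> ('x \<Rightarrow> 'k::field) set \<Rightarrow> bool" where
  "function_algebra X A \<longleftrightarrow>
     (\<forall>f\<in>A. \<forall>x. x \<notin> X \<longrightarrow> f x = 0) \<and> indicator X \<in> A \<and>
     (\<forall>f\<in>A. \<forall>g\<in>A. f + g \<in> A \<and> f * g \<in> A) \<and> (\<forall>c. \<forall>f\<in>A. fscale c f \<in> A)"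

definition algebra_character :: "'x set \<Rightarrow> ('x \<Rightarrow> 'k::field) set \<Rightarrow> (('x \<Rightarrow> 'k) \<Rightarrow> 'k) \<Rightarrow> bool" where
  "algebra_character X A \<phi> \<longleftrightarrow>
     \<phi> (indicator X) = 1 \<and>
     (\<forall>f\<in>A. \<forall>g\<in>A. \<phi> (f + g) = \<phi> f + \<phi> g \<and> \<phi> (f * g) = \<phi> f * \<phi> g) \<and>
     (\<forall>c. \<forall>f\<in>A. \<phi> (fscale c f) = c * \<phi> f)"

text \<open>
  The comultiplication sends \<open>f\<close> to the function \<open>(x, y) \<mapsto> f (x y)\<close> on \<open>G \<times> G\<close>. The following
  says that it maps \<open>B\<close> into the image of \<open>B \<otimes> B\<close>.
\<close>

definition comult_closed :: "('g, 'm) monoid_scheme \<Rightarrow> ('g \<Rightarrow> 'k::field) set \<Rightarrow> bool" where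
  "comult_closed G B \<longleftrightarrow>
     (\<forall>f\<in>B. \<exists>(n::nat) a b. (\<forall>i<n. a i \<in> B \<and> b i \<in> B) \<and>
        (\<forall>x\<in>carrier G. \<forall>y\<in>carrier G. f (x \<otimes>\<^bsub>G\<^esub> y) = (\<Sum>i<n. a i x * b i y)))"

definition antipode_closed :: "('g, 'm) monoid_scheme \<Rightarrow> ('g \<Rightarrow> 'k::field) set \<Rightarrow> bool" where
  "antipode_closed G B \<longleftrightarrow>
     (\<forall>f\<in>B. (\<lambda>x. if x \<in> carrier G then f (inv\<^bsub>G\<^esub> x) else 0) \<in> B)"

locale affine_algebraic_group = group G
  for G :: "('g, 'm) monoid_scheme" (structure) +
  fixes A :: "('g \<Rightarrow> 'k::alg_closed_field) set"
  assumes function_algebra: "function_algebra (carrier G) A"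
    and finitely_generated:
      "\<exists>S. finite S \<and> S \<subseteq> A \<and> (\<forall>B. function_algebra (carrier G) B \<and> S \<subseteq> B \<longrightarrow> A \<subseteq> B)"
    and points: "\<And>\<phi>. algebra_character (carrier G) A \<phi> \<Longrightarrow> \<exists>!x\<in>carrier G. \<forall>f\<in>A. \<phi> f = f x"
    and comult: "comult_closed G A"
    and antipode: "antipode_closed G A"


section \<open>Reductive groups\<close>

definition zariski_closed :: "('g, 'm) monoid_scheme \<Rightarrow> ('g \<Rightarrow> 'k::field) set \<Rightarrow> 'g set \<Rightarrow> bool" where
  "zariski_closed G A Z \<longleftrightarrow> (\<exists>S\<subseteq>A. Z = {x \<in> carrier G. \<forall>f\<in>S. f x = 0})"

definition zariski_connected :: "('g, 'm) monoid_scheme \<Rightarrow> ('g \<Rightarrow> 'k::field) set \<Rightarrow> 'g set \<Rightarrow> bool" where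
  "zariski_connected G A H \<longleftrightarrow>
     \<not> (\<exists>Y Z. zariski_closed G A Y \<and> zariski_closed G A Z \<and> H \<subseteq> Y \<union> Z \<and>
              Y \<inter> Z \<inter> H = {} \<and> Y \<inter> H \<noteq> {} \<and> Z \<inter> H \<noteq> {})"

definition closed_subgroup :: "('g, 'm) monoid_scheme \<Rightarrow> ('g \<Rightarrow> 'k::field) set \<Rightarrow> 'g set \<Rightarrow> bool" where
  "closed_subgroup G A H \<longleftrightarrow> subgroup H G \<and> zariski_closed G A H"

definition right_translation ::
    "('g, 'm) monoid_scheme \<Rightarrow> 'g \<Rightarrow> ('g \<Rightarrow> 'k::field) \<Rightarrow> ('g \<Rightarrow> 'k)" where
  "right_translation G g f = (\<lambda>x. if x \<in> carrier G then f (x \<otimes>\<^bsub>G\<^esub> g) else 0)"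

text \<open>An element is unipotent if right translation by it is a locally unipotent operator.\<close>

definition unipotent_element :: "('g, 'm) monoid_scheme \<Rightarrow> ('g \<Rightarrow> 'k::field) set \<Rightarrow> 'g \<Rightarrow> bool" where
  "unipotent_element G A g \<longleftrightarrow>
     g \<in> carrier G \<and> (\<forall>f\<in>A. \<exists>n::nat. ((\<lambda>h. right_translation G g h - h) ^^ n) f = 0)"

text \<open>
  Among the closed connected normal unipotent subgroups there is a largest one, which is hence
  their union.
\<close>

definition unipotent_radical :: "('g, 'm) monoid_scheme \<Rightarrow> ('g \<Rightarrow> 'k::field) set \<Rightarrow> 'g set" where
  "unipotent_radical G A =
     \<Union>{H. closed_subgroup G A H \<and> H \<lhd> G \<and> zariski_connected G A H \<and>
           (\<forall>h\<in>H. unipotent_element G A h)}"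

definition reductive_group ::
    "('g, 'm) monoid_scheme \<Rightarrow> ('g \<Rightarrow> 'k::alg_closed_field) set \<Rightarrow> bool" where
  "reductive_group G A \<longleftrightarrow> affine_algebraic_group G A \<and> unipotent_radical G A = {\<one>\<^bsub>G\<^esub>}"


section \<open>Split forms over the prime field\<close>

definition prime_subfield :: "'k::field set" where
  "prime_subfield = range (of_nat :: nat \<Rightarrow> 'k)"
  \<comment> \<open>a subfield (with \<open>CHAR('k)\<close> elements) because \<open>'k\<close> will have positive characteristic\<close>

definition Fp_span :: "('x \<Rightarrow> 'k::field) set \<Rightarrow> ('x \<Rightarrow> 'k) set" where
  "Fp_span B = {\<Sum>b\<in>t. fscale (c b) b | t c. finite t \<and> t \<subseteq> B \<and> (\<forall>b\<in>t. c b \<in> prime_subfield)}"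

text \<open>
  \<open>A0\<close> is (the coordinate ring of) a form of \<open>G\<close> over the prime field: a Hopf subalgebra over
  the prime field such that the canonical map \<open>A0 \<otimes> 'k \<rightarrow> A\<close> is bijective, i.e.\ some
  basis of \<open>A0\<close> over the prime field is a basis of \<open>A\<close> over \<open>'k\<close>.
\<close>

definition Fp_form ::
    "('g, 'm) monoid_scheme \<Rightarrow> ('g \<Rightarrow> 'k::field) set \<Rightarrow> ('g \<Rightarrow> 'k) set \<Rightarrow> bool" where
  "Fp_form G A A0 \<longleftrightarrow>
     (\<exists>B. \<not> module.dependent fscale B \<and> module.span fscale B = A \<and> Fp_span B = A0) \<and>
     indicator (carrier G) \<in> A0 \<and> (\<forall>f\<in>A0. \<forall>g\<in>A0. f * g \<in> A0) \<and>
     comult_closed G A0 \<and> antipode_closed G A0 \<and> (\<forall>f\<in>A0. f \<one>\<^bsub>G\<^esub> \<in> prime_subfield)"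

definition laurent_monomials ::
    "('g, 'm) monoid_scheme \<Rightarrow> nat \<Rightarrow> (nat \<Rightarrow> 'g \<Rightarrow> 'k::field) \<Rightarrow> ('g \<Rightarrow> 'k) set" where
  "laurent_monomials G n \<chi> =
     {\<lambda>x. indicator (carrier G) x * (\<Prod>i<n. \<chi> i x powi m i) | m :: nat \<Rightarrow> int. True}"

text \<open>
  \<open>(\<chi>\<^sub>0, \<dots>, \<chi>\<^sub>n\<^sub>-\<^sub>1)\<close> is an isomorphism of algebraic groups from \<open>G\<close> to the \<open>n\<close>-dimensional torus:
  a bijective homomorphism, along which the Laurent polynomials pull back onto \<open>A\<close>.
\<close>

definition torus_isomorphism ::
    "('g, 'm) monoid_scheme \<Rightarrow> ('g \<Rightarrow> 'k::field) set \<Rightarrow> nat \<Rightarrow> (nat \<Rightarrow> 'g \<Rightarrow> 'k) \<Rightarrow> bool" where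
  "torus_isomorphism G A n \<chi> \<longleftrightarrow>
     (\<forall>i<n. \<chi> i \<in> A) \<and>
     (\<forall>i<n. \<forall>x\<in>carrier G. \<forall>y\<in>carrier G. \<chi> i (x \<otimes>\<^bsub>G\<^esub> y) = \<chi> i x * \<chi> i y) \<and>
     bij_betw (\<lambda>x. \<lambda>i\<in>{..<n}. \<chi> i x) (carrier G) ({..<n} \<rightarrow>\<^sub>E UNIV - {0}) \<and>
     module.span fscale (laurent_monomials G n \<chi>) = A"

definition torus :: "('g, 'm) monoid_scheme \<Rightarrow> ('g \<Rightarrow> 'k::field) set \<Rightarrow> bool" where
  "torus G A \<longleftrightarrow> (\<exists>n \<chi>. torus_isomorphism G A n \<chi>)"

text \<open>The isomorphism can be chosen over the prime field.\<close>

definition split_torus ::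
    "('g, 'm) monoid_scheme \<Rightarrow> ('g \<Rightarrow> 'k::field) set \<Rightarrow> ('g \<Rightarrow> 'k) set \<Rightarrow> bool" where
  "split_torus G A A0 \<longleftrightarrow>
     Fp_form G A A0 \<and>
     (\<exists>n \<chi>. torus_isomorphism G A n \<chi> \<and> Fp_span (laurent_monomials G n \<chi>) = A0)"

definition restrict_functions :: "'x set \<Rightarrow> ('x \<Rightarrow> 'k::field) set \<Rightarrow> ('x \<Rightarrow> 'k) set" where
  "restrict_functions T B = (\<lambda>f. f * indicator T) ` B"

definition subtorus :: "('g, 'm) monoid_scheme \<Rightarrow> ('g \<Rightarrow> 'k::field) set \<Rightarrow> 'g set \<Rightarrow> bool" where
  "subtorus G A T \<longleftrightarrow>
     closed_subgroup G A T \<and> torus (G\<lparr>carrier := T\<rparr>) (restrict_functions T A)"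

definition maximal_torus :: "('g, 'm) monoid_scheme \<Rightarrow> ('g \<Rightarrow> 'k::field) set \<Rightarrow> 'g set \<Rightarrow> bool" where
  "maximal_torus G A T \<longleftrightarrow>
     subtorus G A T \<and> (\<forall>T'. subtorus G A T' \<and> T \<subseteq> T' \<longrightarrow> T' = T)"

text \<open>
  A form is split if some maximal torus is defined over the prime field (the restrictions of \<open>A0\<close>
  to it are a form of it) and split over it.
\<close>

definition split_Fp_form ::
    "('g, 'm) monoid_scheme \<Rightarrow> ('g \<Rightarrow> 'k::field) set \<Rightarrow> ('g \<Rightarrow> 'k) set \<Rightarrow> bool" where
  "split_Fp_form G A A0 \<longleftrightarrow>
     Fp_form G A A0 \<and>
     (\<exists>T. maximal_torus G A T \<and>
        split_torus (G\<lparr>carrier := T\<rparr>) (restrict_functions T A) (restrict_functions T A0))"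


section \<open>Distributions\<close>

text \<open>Linear forms on a space \<open>W\<close> of functions are represented by their extension by zero.\<close>

definition linear_forms :: "('x \<Rightarrow> 'k::field) set \<Rightarrow> (('x \<Rightarrow> 'k) \<Rightarrow> 'k) set" where
  "linear_forms W =
     {\<mu>. (\<forall>f\<in>W. \<forall>g\<in>W. \<mu> (f + g) = \<mu> f + \<mu> g) \<and> (\<forall>c. \<forall>f\<in>W. \<mu> (fscale c f) = c * \<mu> f) \<and>
         (\<forall>f. f \<notin> W \<longrightarrow> \<mu> f = 0)}"

definition augmentation_ideal ::
    "('g, 'm) monoid_scheme \<Rightarrow> ('g \<Rightarrow> 'k::field) set \<Rightarrow> ('g \<Rightarrow> 'k) set" where
  "augmentation_ideal G A = {f \<in> A. f \<one>\<^bsub>G\<^esub> = 0}"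

primrec augmentation_power ::
    "('g, 'm) monoid_scheme \<Rightarrow> ('g \<Rightarrow> 'k::field) set \<Rightarrow> nat \<Rightarrow> ('g \<Rightarrow> 'k) set" where
  "augmentation_power G A 0 = A"
| "augmentation_power G A (Suc n) =
     module.span fscale {f * g | f g. f \<in> augmentation_ideal G A \<and> g \<in> augmentation_power G A n}"

definition dist ::
    "('g, 'm) monoid_scheme \<Rightarrow> ('g \<Rightarrow> 'k::field) set \<Rightarrow> nat \<Rightarrow> (('g \<Rightarrow> 'k) \<Rightarrow> 'k) set" where
  "dist G A k = {\<mu> \<in> linear_forms A. \<forall>f\<in>augmentation_power G A (k + 1). \<mu> f = 0}"

definition dist_plus ::
    "('g, 'm) monoid_scheme \<Rightarrow> ('g \<Rightarrow> 'k::field) set \<Rightarrow> nat \<Rightarrow> (('g \<Rightarrow> 'k) \<Rightarrow> 'k) set" where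
  "dist_plus G A k = {\<mu> \<in> dist G A k. \<mu> (indicator (carrier G)) = 0}"

text \<open>
  \<open>(\<mu> \<otimes> \<rho>) \<circ> \<Delta>\<close>: the value of \<open>\<mu> \<otimes> \<rho>\<close> on an element of \<open>A \<otimes> A\<close>, viewed as a function of
  two variables, is obtained by applying \<open>\<rho>\<close> in the second variable and then \<open>\<mu>\<close> in the first.
  See \<open>dist_mult_eq\<close> below for the formula in terms of a tensor decomposition.
\<close>

definition dist_mult ::
    "('g, 'm) monoid_scheme \<Rightarrow> ('g \<Rightarrow> 'k::field) set \<Rightarrow>
     (('g \<Rightarrow> 'k) \<Rightarrow> 'k) \<Rightarrow> (('g \<Rightarrow> 'k) \<Rightarrow> 'k) \<Rightarrow> (('g \<Rightarrow> 'k) \<Rightarrow> 'k)" where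
  "dist_mult G A \<mu> \<rho> = (\<lambda>f. if f \<in> A then
     \<mu> (\<lambda>x. if x \<in> carrier G then
          \<rho> (\<lambda>y. if y \<in> carrier G then f (x \<otimes>\<^bsub>G\<^esub> y) else 0) else 0) else 0)"

lemma linear_forms_sum:
  fixes A :: "('x \<Rightarrow> 'k::field) set"
  assumes "function_algebra X A" "\<mu> \<in> linear_forms A" "\<And>i. i < (n::nat) \<Longrightarrow> a i \<in> A"
  shows "(\<Sum>i<n. fscale (c i) (a i)) \<in> A"
    and "\<mu> (\<Sum>i<n. fscale (c i) (a i)) = (\<Sum>i<n. c i * \<mu> (a i))"
proof -
  have "(indicator X :: 'x \<Rightarrow> 'k) \<in> A" using assms(1) by (simp add: function_algebra_def)
  then have 0: "fscale 0 (indicator X :: 'x \<Rightarrow> 'k) \<in> A"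
    using assms(1) by (simp add: function_algebra_def)
  have z: "fscale 0 (indicator X) = (0 :: 'x \<Rightarrow> 'k)" by (auto simp: fscale_def)
  have zA: "0 \<in> A" using 0 z by simp
  have "\<mu> (fscale 0 (indicator X)) = 0 * \<mu> (indicator X)"
    using assms(1,2) by (simp add: linear_forms_def function_algebra_def)
  then have z\<mu>: "\<mu> 0 = 0" by (simp add: z)
  have "(\<Sum>i<n. fscale (c i) (a i)) \<in> A \<and>
        \<mu> (\<Sum>i<n. fscale (c i) (a i)) = (\<Sum>i<n. c i * \<mu> (a i))"
    using assms(3)
  proof (induction n)
    case 0
    show ?case using zA z\<mu> by (simp add: zero_fun_def)
  next
    case (Suc n)
    have aA: "fscale (c n) (a n) \<in> A" "\<mu> (fscale (c n) (a n)) = c n * \<mu> (a n)"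
      using Suc.prems[of n] assms(1,2) by (auto simp: function_algebra_def linear_forms_def)
    have IH: "(\<Sum>i<n. fscale (c i) (a i)) \<in> A"
      "\<mu> (\<Sum>i<n. fscale (c i) (a i)) = (\<Sum>i<n. c i * \<mu> (a i))"
      using Suc by auto
    have "u + v \<in> A" "\<mu> (u + v) = \<mu> u + \<mu> v" if "u \<in> A" "v \<in> A" for u v
      using that assms(1,2) unfolding function_algebra_def linear_forms_def by blast+
    from this[OF IH(1) aA(1)] show ?case unfolding sum.lessThan_Suc IH(2) aA(2) ..
  qed
  then show "(\<Sum>i<n. fscale (c i) (a i)) \<in> A"
    and "\<mu> (\<Sum>i<n. fscale (c i) (a i)) = (\<Sum>i<n. c i * \<mu> (a i))" by auto
qed

lemma sum_fun_apply: "(\<Sum>i\<in>I. F i) x = (\<Sum>i\<in>I. F i x)"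
  for F :: "'i \<Rightarrow> 'x \<Rightarrow> 'k::comm_monoid_add"
  by (induction I rule: infinite_finite_induct) auto

lemma dist_mult_eq:
  fixes A :: "('g \<Rightarrow> 'k::field) set" and n :: nat
  assumes alg: "function_algebra (carrier G) A"
    and \<mu>: "\<mu> \<in> linear_forms A" and \<rho>: "\<rho> \<in> linear_forms A" and f: "f \<in> A"
    and ab: "\<And>i. i < n \<Longrightarrow> a i \<in> A \<and> b i \<in> A"
    and comult: "\<And>x y. x \<in> carrier G \<Longrightarrow> y \<in> carrier G \<Longrightarrow> f (x \<otimes>\<^bsub>G\<^esub> y) = (\<Sum>i<n. a i x * b i y)"
  shows "dist_mult G A \<mu> \<rho> f = (\<Sum>i<n. \<mu> (a i) * \<rho> (b i))"
proof -
  have supp: "h x = 0" if "h \<in> A" "x \<notin> carrier G" for h x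
    using alg that by (auto simp: function_algebra_def)
  have inner: "\<rho> (\<lambda>y. if y \<in> carrier G then f (x \<otimes>\<^bsub>G\<^esub> y) else 0) = (\<Sum>i<n. a i x * \<rho> (b i))"
    if x: "x \<in> carrier G" for x
  proof -
    have "(\<lambda>y. if y \<in> carrier G then f (x \<otimes>\<^bsub>G\<^esub> y) else 0) = (\<Sum>i<n. fscale (a i x) (b i))"
    proof
      fix y
      show "(if y \<in> carrier G then f (x \<otimes>\<^bsub>G\<^esub> y) else 0) = (\<Sum>i<n. fscale (a i x) (b i)) y"
      proof (cases "y \<in> carrier G")
        case True
        then show ?thesis using comult[OF x] by (simp add: sum_fun_apply fscale_def)
      next
        case False
        then have "b i y = 0" if "i < n" for i using ab[OF that] supp by blast
        then show ?thesis using False by (simp add: sum_fun_apply fscale_def)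
      qed
    qed
    then show ?thesis using linear_forms_sum(2)[OF alg \<rho>, of n b "\<lambda>i. a i x"] ab by simp
  qed
  have "(\<lambda>x. if x \<in> carrier G then
          \<rho> (\<lambda>y. if y \<in> carrier G then f (x \<otimes>\<^bsub>G\<^esub> y) else 0) else 0)
        = (\<Sum>i<n. fscale (\<rho> (b i)) (a i))" (is "?l = ?r")
  proof
    fix x
    show "?l x = ?r x"
    proof (cases "x \<in> carrier G")
      case True
      then show ?thesis by (simp add: inner sum_fun_apply fscale_def mult.commute)
    next
      case False
      then have "a i x = 0" if "i < n" for i using ab[OF that] supp by blast
      then show ?thesis using False by (simp add: sum_fun_apply fscale_def)
    qed
  qed
  then show ?thesis
    using linear_forms_sum(2)[OF alg \<mu>, of n a "\<lambda>i. \<rho> (b i)"] ab f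
    by (simp add: dist_mult_def mult.commute)
qed

primrec dist_power ::
    "('g, 'm) monoid_scheme \<Rightarrow> ('g \<Rightarrow> 'k::field) set \<Rightarrow>
     (('g \<Rightarrow> 'k) \<Rightarrow> 'k) \<Rightarrow> nat \<Rightarrow> (('g \<Rightarrow> 'k) \<Rightarrow> 'k)" where
  "dist_power G A \<delta> 0 = (\<lambda>f. if f \<in> A then f \<one>\<^bsub>G\<^esub> else 0)"
| "dist_power G A \<delta> (Suc n) = dist_mult G A \<delta> (dist_power G A \<delta> n)"

text \<open>
  The linear form on \<open>A = A0 \<otimes> 'k\<close> given by \<open>f \<otimes> a \<mapsto> \<delta> (f ^ p ^ r \<otimes> a)\<close>, where \<open>p\<close> is the
  characteristic.
\<close>

definition dist_frobenius ::
    "('g \<Rightarrow> 'k::field) set \<Rightarrow> ('g \<Rightarrow> 'k) set \<Rightarrow> nat \<Rightarrow> (('g \<Rightarrow> 'k) \<Rightarrow> 'k) \<Rightarrow> (('g \<Rightarrow> 'k) \<Rightarrow> 'k)" where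
  "dist_frobenius A A0 r \<delta> =
     (THE \<mu>. \<mu> \<in> linear_forms A \<and>
        (\<forall>f\<in>A0. \<forall>a. \<mu> (fscale a f) = \<delta> (fscale a (\<lambda>x. f x ^ (CHAR('k) ^ r)))))"


section \<open>Tensor algebras\<close>

text \<open>
  The free associative algebra on a set \<open>V\<close> is the monoid algebra over \<open>'k\<close> of the free monoid
  on \<open>V\<close>. Concatenation of words is written additively in order to use the convolution product
  of finitely supported functions.
\<close>

datatype 'v mon = Mon (letters: "'v list")

instantiation mon :: (type) monoid_add
begin

definition "0 = Mon []"
definition "u + v = Mon (letters u @ letters v)"

instance
  by standard (simp_all add: zero_mon_def plus_mon_def)

end

definition free_algebra :: "'v set \<Rightarrow> ('v mon \<Rightarrow>\<^sub>0 'k::field) ring" where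
  "free_algebra V =
     \<lparr>carrier = {x. \<forall>w\<in>Poly_Mapping.keys x. set (letters w) \<subseteq> V},
      monoid.mult = (*), one = 1, zero = 0, add = (+)\<rparr>"

definition free_generator :: "'v \<Rightarrow> ('v mon \<Rightarrow>\<^sub>0 'k::field)" where
  "free_generator v = Poly_Mapping.single (Mon [v]) 1"

definition free_scalar :: "'k::field \<Rightarrow> ('v mon \<Rightarrow>\<^sub>0 'k)" where
  "free_scalar c = Poly_Mapping.single 0 c"

lemma ring_free_algebra: "ring (free_algebra V :: ('v mon \<Rightarrow>\<^sub>0 'k::field) ring)"
proof -
  let ?C = "{x :: 'v mon \<Rightarrow>\<^sub>0 'k. \<forall>w\<in>Poly_Mapping.keys x. set (letters w) \<subseteq> V}"
  have add: "x + y \<in> ?C" if "x \<in> ?C" "y \<in> ?C" for x y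
    using that Poly_Mapping.keys_add[of x y] by blast
  have mult: "x * y \<in> ?C" if xy: "x \<in> ?C" "y \<in> ?C" for x y
  proof (clarify)
    fix w v assume "w \<in> Poly_Mapping.keys (x * y)" and v: "v \<in> set (letters w)"
    then obtain a b where ab: "a \<in> Poly_Mapping.keys x" "b \<in> Poly_Mapping.keys y" "w = a + b"
      using keys_mult[of x y] by blast
    have "set (letters w) = set (letters a) \<union> set (letters b)"
      unfolding ab(3) plus_mon_def by simp
    then show "v \<in> V" using v xy ab(1,2) by blast
  qed
  have neg: "\<exists>y\<in>?C. y + x = 0" if "x \<in> ?C" for x
    using that by (intro bexI[of _ "- x"]) simp_all
  have one: "1 \<in> ?C" and zero: "0 \<in> ?C" by (simp_all add: zero_mon_def)
  define C where "C = ?C"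
  have F: "free_algebra V = \<lparr>carrier = C, monoid.mult = (*), one = 1, zero = 0, add = (+)\<rparr>"
    by (simp add: free_algebra_def C_def)
  have abel: "abelian_group (free_algebra V :: ('v mon \<Rightarrow>\<^sub>0 'k) ring)"
    unfolding F using add neg zero
    by (intro abelian_groupI) (simp_all only: C_def[symmetric] partial_object.select_convs
          ring.select_convs ac_simps add_0_left add_0_right)
  have mon: "Group.monoid (free_algebra V :: ('v mon \<Rightarrow>\<^sub>0 'k) ring)"
    unfolding F using mult one
    by (intro monoidI) (simp_all only: C_def[symmetric] partial_object.select_convs
          monoid.select_convs mult.assoc mult_1_left mult_1_right)
  show ?thesis
    using abel mon by (intro ringI) (simp_all add: F distrib_left distrib_right)
qed

text \<open>
  The tensor algebra of a space \<open>V\<close> of functions is the free algebra on the set \<open>V\<close> modulo the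
  linear relations of \<open>V\<close>.
\<close>

definition linear_relations ::
    "('x \<Rightarrow> 'k::field) set \<Rightarrow> (('x \<Rightarrow> 'k) mon \<Rightarrow>\<^sub>0 'k) set" where
  "linear_relations V =
     {free_generator (v + w) - free_generator v - free_generator w | v w. v \<in> V \<and> w \<in> V} \<union>
     {free_generator (fscale c v) - free_scalar c * free_generator v | c v. v \<in> V}"

definition linear_ideal ::
    "('x \<Rightarrow> 'k::field) set \<Rightarrow> (('x \<Rightarrow> 'k) mon \<Rightarrow>\<^sub>0 'k) set" where
  "linear_ideal V = Idl\<^bsub>free_algebra V\<^esub> (linear_relations V)"

definition tensor_algebra ::
    "('x \<Rightarrow> 'k::field) set \<Rightarrow> (('x \<Rightarrow> 'k) mon \<Rightarrow>\<^sub>0 'k) set ring" where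
  "tensor_algebra V = free_algebra V Quot linear_ideal V"

definition tensor_generator ::
    "('x \<Rightarrow> 'k::field) set \<Rightarrow> ('x \<Rightarrow> 'k) \<Rightarrow> (('x \<Rightarrow> 'k) mon \<Rightarrow>\<^sub>0 'k) set" where
  "tensor_generator V v = linear_ideal V +>\<^bsub>free_algebra V\<^esub> free_generator v"

definition tensor_scalar ::
    "('x \<Rightarrow> 'k::field) set \<Rightarrow> 'k \<Rightarrow> (('x \<Rightarrow> 'k) mon \<Rightarrow>\<^sub>0 'k) set" where
  "tensor_scalar V c = linear_ideal V +>\<^bsub>free_algebra V\<^esub> free_scalar c"


section \<open>Higher universal enveloping algebras\<close>

type_synonym ('g, 'k) tensor = "((('g \<Rightarrow> 'k) \<Rightarrow> 'k) mon \<Rightarrow>\<^sub>0 'k) set"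

definition env_generators ::
    "('g, 'm) monoid_scheme \<Rightarrow> ('g \<Rightarrow> 'k::field) set \<Rightarrow> nat \<Rightarrow> (('g \<Rightarrow> 'k) \<Rightarrow> 'k) set" where
  "env_generators G A r = dist_plus G A (CHAR('k) ^ (r + 1) - 1)"

text \<open>
  In the commutator relations, \<open>i + j \<le> p ^ (r + 1)\<close> allows one of \<open>i\<close>, \<open>j\<close> to be \<open>p ^ (r + 1)\<close>
  and the other to be \<open>0\<close>. As \<open>dist_plus G A 0\<close> is zero, this case is void, but one of the
  factors could lie outside the space of generators, hence the positivity of \<open>i\<close> and \<open>j\<close>.
\<close>

definition env_relations ::
    "('g, 'm) monoid_scheme \<Rightarrow> ('g \<Rightarrow> 'k::field) set \<Rightarrow> nat \<Rightarrow> ('g, 'k) tensor set" where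
  "env_relations G A r =
     (let V = env_generators G A r; T = tensor_algebra V; \<iota> = tensor_generator V in
       {\<iota> x \<otimes>\<^bsub>T\<^esub> \<iota> y \<ominus>\<^bsub>T\<^esub> \<iota> (dist_mult G A x y) | x y i j.
          x \<in> dist_plus G A i \<and> y \<in> dist_plus G A j \<and> i + j < CHAR('k) ^ (r + 1)} \<union>
       {(\<iota> x \<otimes>\<^bsub>T\<^esub> \<iota> y \<ominus>\<^bsub>T\<^esub> \<iota> y \<otimes>\<^bsub>T\<^esub> \<iota> x) \<ominus>\<^bsub>T\<^esub> \<iota> (dist_mult G A x y - dist_mult G A y x) | x y i j.
          x \<in> dist_plus G A i \<and> y \<in> dist_plus G A j \<and> 0 < i \<and> 0 < j \<and> i + j \<le> CHAR('k) ^ (r + 1)})"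

definition env_ideal ::
    "('g, 'm) monoid_scheme \<Rightarrow> ('g \<Rightarrow> 'k::field) set \<Rightarrow> nat \<Rightarrow> ('g, 'k) tensor set" where
  "env_ideal G A r = Idl\<^bsub>tensor_algebra (env_generators G A r)\<^esub> (env_relations G A r)"

definition env ::
    "('g, 'm) monoid_scheme \<Rightarrow> ('g \<Rightarrow> 'k::field) set \<Rightarrow> nat \<Rightarrow> ('g, 'k) tensor set ring" where
  "env G A r = tensor_algebra (env_generators G A r) Quot env_ideal G A r"

definition env_generator ::
    "('g, 'm) monoid_scheme \<Rightarrow> ('g \<Rightarrow> 'k::field) set \<Rightarrow> nat \<Rightarrow>
     (('g \<Rightarrow> 'k) \<Rightarrow> 'k) \<Rightarrow> ('g, 'k) tensor set" where
  "env_generator G A r \<delta> =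
     (let V = env_generators G A r in
       env_ideal G A r +>\<^bsub>tensor_algebra V\<^esub> tensor_generator V \<delta>)"

definition env_scalar ::
    "('g, 'm) monoid_scheme \<Rightarrow> ('g \<Rightarrow> 'k::field) set \<Rightarrow> nat \<Rightarrow> 'k \<Rightarrow> ('g, 'k) tensor set" where
  "env_scalar G A r c =
     (let V = env_generators G A r in
       env_ideal G A r +>\<^bsub>tensor_algebra V\<^esub> tensor_scalar V c)"

definition env_xi ::
    "('g, 'm) monoid_scheme \<Rightarrow> ('g \<Rightarrow> 'k::field) set \<Rightarrow> nat \<Rightarrow>
     (('g \<Rightarrow> 'k) \<Rightarrow> 'k) \<Rightarrow> ('g, 'k) tensor set" where
  "env_xi G A r \<delta> =
     env_generator G A r \<delta> [^]\<^bsub>env G A r\<^esub> CHAR('k)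
       \<ominus>\<^bsub>env G A r\<^esub> env_generator G A r (dist_power G A \<delta> CHAR('k))"

text \<open>The Lie algebra of \<open>G\<close> is \<open>dist_plus G A 1\<close>, and \<open>\<chi>\<close> is a linear form on it.\<close>

definition reduced_env_ideal ::
    "('g, 'm) monoid_scheme \<Rightarrow> ('g \<Rightarrow> 'k::field) set \<Rightarrow> ('g \<Rightarrow> 'k) set \<Rightarrow> nat \<Rightarrow>
     ((('g \<Rightarrow> 'k) \<Rightarrow> 'k) \<Rightarrow> 'k) \<Rightarrow> ('g, 'k) tensor set set" where
  "reduced_env_ideal G A A0 r \<chi> =
     Idl\<^bsub>env G A r\<^esub>
       {env_xi G A r \<delta> \<ominus>\<^bsub>env G A r\<^esub> env_scalar G A r (\<chi> (dist_frobenius A A0 r \<delta>) ^ CHAR('k)) | \<delta>.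
          \<delta> \<in> dist_plus G A (CHAR('k) ^ r)}"

definition reduced_env ::
    "('g, 'm) monoid_scheme \<Rightarrow> ('g \<Rightarrow> 'k::field) set \<Rightarrow> ('g \<Rightarrow> 'k) set \<Rightarrow> nat \<Rightarrow>
     ((('g \<Rightarrow> 'k) \<Rightarrow> 'k) \<Rightarrow> 'k) \<Rightarrow> ('g, 'k) tensor set set ring" where
  "reduced_env G A A0 r \<chi> = env G A r Quot reduced_env_ideal G A A0 r \<chi>"


section \<open>Modules over noncommutative rings\<close>

text \<open>
  Modules over the algebras above are modules over the underlying rings; the field \<open>'k\<close> acts
  through the structure map of the algebra.
\<close>

locale left_module = R: ring R + M: abelian_group M
  for R :: "('a, 'm) ring_scheme" and M :: "('v, 'n) ring_scheme" +
  fixes act :: "'a \<Rightarrow> 'v \<Rightarrow> 'v"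
  assumes act_closed: "a \<in> carrier R \<Longrightarrow> x \<in> carrier M \<Longrightarrow> act a x \<in> carrier M"
    and act_add_left: "a \<in> carrier R \<Longrightarrow> b \<in> carrier R \<Longrightarrow> x \<in> carrier M \<Longrightarrow>
          act (a \<oplus>\<^bsub>R\<^esub> b) x = act a x \<oplus>\<^bsub>M\<^esub> act b x"
    and act_add_right: "a \<in> carrier R \<Longrightarrow> x \<in> carrier M \<Longrightarrow> y \<in> carrier M \<Longrightarrow>
          act a (x \<oplus>\<^bsub>M\<^esub> y) = act a x \<oplus>\<^bsub>M\<^esub> act a y"
    and act_mult: "a \<in> carrier R \<Longrightarrow> b \<in> carrier R \<Longrightarrow> x \<in> carrier M \<Longrightarrow>
          act (a \<otimes>\<^bsub>R\<^esub> b) x = act a (act b x)"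
    and act_one: "x \<in> carrier M \<Longrightarrow> act \<one>\<^bsub>R\<^esub> x = x"

definition submodule_of ::
    "('a, 'm) ring_scheme \<Rightarrow> ('v, 'n) ring_scheme \<Rightarrow> ('a \<Rightarrow> 'v \<Rightarrow> 'v) \<Rightarrow> 'v set \<Rightarrow> bool" where
  "submodule_of R M act N \<longleftrightarrow>
     additive_subgroup N M \<and> (\<forall>a\<in>carrier R. \<forall>x\<in>N. act a x \<in> N)"

definition irreducible_module ::
    "('a, 'm) ring_scheme \<Rightarrow> ('v, 'n) ring_scheme \<Rightarrow> ('a \<Rightarrow> 'v \<Rightarrow> 'v) \<Rightarrow> bool" where
  "irreducible_module R M act \<longleftrightarrow>
     left_module R M act \<and> carrier M \<noteq> {\<zero>\<^bsub>M\<^esub>} \<and>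
     (\<forall>N. submodule_of R M act N \<longrightarrow> N = {\<zero>\<^bsub>M\<^esub>} \<or> N = carrier M)"

end

theory Submission
  imports Defs "HOL-Computational_Algebra.Primes" "HOL-Library.Multiset"
begin

text \<open>
  Write \<open>q = p\<^sup>r\<close> and \<open>N = p\<^sup>r\<^sup>+\<^sup>1\<close>, let \<open>U\<close> be the algebra \<open>U\<^sup>[\<^sup>r\<^sup>]\<close>, and for a distribution
  \<open>\<delta>\<close> of order at most \<open>q\<close> without constant term let \<open>\<xi> \<delta> = \<delta>\<^sup>\<otimes>\<^sup>p - \<delta>\<^sup>p\<close> in \<open>U\<close>. The claim is that on a simple
  module every \<open>\<xi> \<delta>\<close> acts by the scalar \<open>\<chi> (\<Xi> \<delta>)\<^sup>p\<close>, for one linear form \<open>\<chi>\<close> on the Lie algebra. It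
  follows from three properties of \<open>\<xi>\<close>.

  First, \<open>\<xi>\<close> is additive and \<open>p\<close>-semilinear, and \<open>\<xi> \<delta>\<close> vanishes when \<open>\<delta>\<close> kills all \<open>q\<close>-th powers. In
  degrees below \<open>N\<close> the algebra \<open>U\<close> agrees with the algebra of distributions, and commutators drop the
  degree by one. The difference of the two sides of each identity is therefore visibly of degree below
  \<open>N\<close>, and there it may be computed with distributions, where it is zero. The vanishing statement needs
  in addition that a distribution of order \<open>n\<close> is a sum of products of distributions of smaller order
  unless \<open>n\<close> is a power of \<open>p\<close> and the distribution is nonzero on some \<open>n\<close>-th power (\<open>indecomposables\<close>).
  Dually: a primitive element of the associated graded ring of the coordinate algebra is an iterated
  \<open>p\<close>-th power. Consequently \<open>\<xi> \<delta>\<close> only depends on the numbers \<open>\<delta> (h\<^sup>q)\<close>, and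
  \<open>\<xi> \<delta> = (\<Sum>h\<in>H. \<delta> (h\<^sup>q)\<^sup>p \<xi> (d h))\<close> for a finite set \<open>H\<close> of functions (\<open>xi_expand\<close>).

  Second, \<open>\<xi> \<delta>\<close> is central (\<open>xi_central\<close>). The group acts on \<open>U\<close> by conjugation. If
  \<open>Ad g u = (\<Sum>j. c\<^sub>j(g) u\<^sub>j)\<close> with regular functions \<open>c\<^sub>j\<close>, then \<open>y u = (\<Sum>j. u\<^sub>j (c\<^sub>j \<cdot> y))\<close> for every distribution
  \<open>y\<close> of order at most \<open>q\<close>, where \<open>c \<cdot> y\<close> is the form \<open>f \<mapsto> y (c f)\<close>. For \<open>u = \<xi> \<delta>\<close> the coefficient functions
  are \<open>N\<close>-th powers by the expansion above, and multiplication by an \<open>N\<close>-th power acts on distributions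
  of order less than \<open>N\<close> as the scalar given by its value at the identity. Hence \<open>y\<close> commutes with
  \<open>\<xi> \<delta>\<close>, and such \<open>y\<close> generate \<open>U\<close>.

  Third, \<open>U\<close> is finitely generated as a module over its subring generated by the scalars and the
  elements \<open>\<xi> (d h)\<close>. In a long word over a finite spanning alphabet some letter occurs \<open>p\<close> times; modulo
  shorter words the copies can be collected, and the \<open>p\<close>-th power of a letter is a value of \<open>\<xi>\<close> plus a
  distribution of smaller degree.

  For a simple module the annihilator of a nonzero vector is a maximal left ideal. By the third
  property, Nakayama's lemma and the Nullstellensatz, the central elements \<open>\<xi> (d h)\<close> act on the module
  by scalars (\<open>central_character\<close>), which are \<open>p\<close>-th powers \<open>(c h)\<^sup>p\<close> since the field is algebraically closed.
  So \<open>\<xi> \<delta>\<close> acts by \<open>(\<Sum>h\<in>H. \<delta> (h\<^sup>q) c h)\<^sup>p\<close>. The set \<open>H\<close> can be chosen inside the form of the coordinate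
  algebra over the prime field, where \<open>(\<Xi> \<delta>) h = \<delta> (h\<^sup>q)\<close>, and \<open>\<chi> \<eta> = (\<Sum>h\<in>H. \<eta> h c h)\<close> is the required
  linear form.

  All computations in \<open>U\<close> take place in the free algebra on all forms, modulo an inductively defined
  two-sided ideal \<open>J\<close>. The congruence \<open>u \<approx> v\<close> means \<open>u - v \<in> J\<close>. Only at the end is this transferred to
  the iterated quotient that defines \<open>U\<close>.
\<close>

section \<open>Spaces of functions\<close>

global_interpretation fs: vector_space "fscale :: 'k::field \<Rightarrow> ('x \<Rightarrow> 'k) \<Rightarrow> 'x \<Rightarrow> 'k"
  by (rule vector_space_fscale)

lemma fscale_apply: "fscale c f x = c * f x"
  by (simp add: fscale_def)

declare plus_fun_apply [simp del] times_fun_apply [simp del] zero_fun_apply [simp del]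
  minus_apply [simp del] uminus_apply [simp del] one_fun_apply [simp del] of_nat_fun_apply [simp del]

text \<open>
  Functionals are functions whose arguments are functions, so evaluating sums and products
  pointwise must be requested explicitly; applied everywhere it would also rewrite inside arguments.
\<close>

lemmas pointwise = plus_fun_apply times_fun_apply zero_fun_apply minus_apply uminus_apply
  one_fun_apply fscale_apply sum_fun_apply

text \<open>
  A finite set of functions separates a space of functionals only up to a finite-dimensional
  quotient. This selects coordinates on that quotient from the set itself, so that a special choice of
  the set (generators of the algebra, or elements of a form) is inherited by the coordinates. Adding one
  function \<open>e\<close> to the set either changes nothing or enlarges the dual family by one functional that
  is normalized at \<open>e\<close>.
\<close>

lemma dual_basis:
  fixes W :: "('y \<Rightarrow> 'k::field) set"
  assumes "finite E" "fs.subspace W"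
  shows "\<exists>H d. H \<subseteq> E \<and> (\<forall>h\<in>H. d h \<in> W) \<and> (\<forall>h\<in>H. \<forall>h'\<in>H. d h h' = (if h = h' then 1 else 0)) \<and>
           (\<forall>\<mu>\<in>W. \<forall>e\<in>E. \<mu> e = (\<Sum>h\<in>H. \<mu> h * d h e))"
  using assms
proof (induction E arbitrary: W rule: finite_induct)
  case empty
  show ?case by (rule exI[of _ "{}"]) simp
next
  case (insert e E)
  define W' where "W' = {\<mu>\<in>W. \<mu> e = 0}"
  have W': "fs.subspace W'"
    using insert.prems unfolding W'_def fs.subspace_def by (auto simp: pointwise)
  obtain H d where H: "H \<subseteq> E" "\<forall>h\<in>H. d h \<in> W'" "\<forall>h\<in>H. \<forall>h'\<in>H. d h h' = (if h = h' then 1 else 0)"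
     "\<forall>\<mu>\<in>W'. \<forall>e\<in>E. \<mu> e = (\<Sum>h\<in>H. \<mu> h * d h e)"
    using insert.IH[OF W'] by blast
  have finH: "finite H" using H(1) insert.hyps(1) finite_subset by blast
  show ?case
  proof (cases "\<forall>\<mu>\<in>W. \<mu> e = 0")
    case True
    then have "W' = W" by (auto simp: W'_def)
    show ?thesis
    proof (rule exI[of _ H], rule exI[of _ d], intro conjI ballI)
      show "H \<subseteq> insert e E" using H(1) by blast
      show "d h \<in> W" if "h \<in> H" for h using H(2) that \<open>W' = W\<close> by blast
      show "d h h' = (if h = h' then 1 else 0)" if "h \<in> H" "h' \<in> H" for h h'
        using H(3) that by blast
      show "\<mu> x = (\<Sum>h\<in>H. \<mu> h * d h x)" if \<mu>: "\<mu> \<in> W" "x \<in> insert e E" for \<mu> x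
      proof (cases "x = e")
        case False
        then show ?thesis using \<mu> H(4) \<open>W' = W\<close> by blast
      next
        case x: True
        have z: "\<rho> e = 0" if "\<rho> \<in> W" for \<rho> using True that by blast
        have "d h e = 0" if "h \<in> H" for h using z H(2) that \<open>W' = W\<close> by blast
        then show ?thesis using x z[OF \<mu>(1)] by simp
      qed
    qed
  next
    case False
    then obtain \<nu> where \<nu>: "\<nu> \<in> W" "\<nu> e \<noteq> 0" by blast
    define \<nu>1 where "\<nu>1 = fscale (1 / \<nu> e) \<nu>"
    have \<nu>1: "\<nu>1 \<in> W" "\<nu>1 e = 1"
      using \<nu> insert.prems by (simp_all add: \<nu>1_def fs.subspace_scale fscale_apply[of _ _ e])
    (* the functional dual to e: corrected so that it vanishes on the old coordinates *)
    define \<nu>2 where "\<nu>2 = \<nu>1 - (\<Sum>h\<in>H. fscale (\<nu>1 h) (d h))"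
    have dW: "d h \<in> W" "d h e = 0" if "h \<in> H" for h using bspec[OF H(2) that] by (simp_all add: W'_def)
    have \<nu>2: "\<nu>2 \<in> W" unfolding \<nu>2_def
      using insert.prems \<nu>1 dW by (intro fs.subspace_diff fs.subspace_sum fs.subspace_scale) auto
    have \<nu>2a: "\<nu>2 x = \<nu>1 x - (\<Sum>h\<in>H. \<nu>1 h * d h x)" for x
      by (simp add: \<nu>2_def pointwise)
    have \<nu>2e: "\<nu>2 e = 1" using dW by (simp add: \<nu>2a \<nu>1)
    have \<nu>2H: "\<nu>2 h = 0" if "h \<in> H" for h
    proof -
      have "(\<Sum>h'\<in>H. \<nu>1 h' * d h' h) = (\<Sum>h'\<in>H. if h' = h then \<nu>1 h' else 0)"
      proof (rule sum.cong)
        fix h' assume "h' \<in> H"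
        then have "d h' h = (if h' = h then 1 else 0)" using H(3) that by blast
        then show "\<nu>1 h' * d h' h = (if h' = h then \<nu>1 h' else 0)" by simp
      qed simp
      then show ?thesis using that finH by (simp add: \<nu>2a)
    qed
    have eH: "e \<notin> H" using H(1) insert.hyps by blast
    let ?d = "d(e := \<nu>2)"
    have "\<mu> x = (\<Sum>h\<in>insert e H. \<mu> h * ?d h x)" if \<mu>: "\<mu> \<in> W" and x: "x \<in> insert e E" for \<mu> x
    proof -
      define \<mu>' where "\<mu>' = \<mu> - fscale (\<mu> e) \<nu>2"
      have \<mu>': "\<mu>' \<in> W'"
        unfolding W'_def \<mu>'_def using \<mu> \<nu>2 \<nu>2e insert.prems
        by (simp add: fs.subspace_diff fs.subspace_scale minus_apply[of _ _ e] fscale_apply[of _ _ e])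
      have a: "\<mu>' h = \<mu> h" if "h \<in> H" for h using \<nu>2H[OF that] by (simp add: \<mu>'_def pointwise)
      have "\<mu>' x = (\<Sum>h\<in>H. \<mu> h * d h x)"
      proof (cases "x = e")
        case True
        then show ?thesis using \<mu>' dW(2) by (simp add: W'_def)
      next
        case False
        then have "\<mu>' x = (\<Sum>h\<in>H. \<mu>' h * d h x)" using H(4) \<mu>' x by blast
        then show ?thesis using a by simp
      qed
      moreover have "\<mu> x = \<mu>' x + \<mu> e * \<nu>2 x" by (simp add: \<mu>'_def pointwise)
      moreover have "(\<Sum>h\<in>insert e H. \<mu> h * ?d h x) = \<mu> e * \<nu>2 x + (\<Sum>h\<in>H. \<mu> h * d h x)"
        using eH finH by (subst sum.insert) (auto intro!: sum.cong)
      ultimately show ?thesis by simp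
    qed
    note expand = this
    show ?thesis
    proof (rule exI[of _ "insert e H"], rule exI[of _ ?d], intro conjI ballI)
      show "insert e H \<subseteq> insert e E" using H(1) by blast
      show "?d h \<in> W" if "h \<in> insert e H" for h using dW(1)[of h] that \<nu>2 by (cases "h = e") simp_all
      show "?d h h' = (if h = h' then 1 else 0)" if "h \<in> insert e H" "h' \<in> insert e H" for h h'
      proof (cases "h = e \<or> h' = e")
        case True
        then show ?thesis using that eH \<nu>2e \<nu>2H[of h'] dW(2)[of h] by (cases "h = e"; cases "h' = e") auto
      next
        case False
        then have "d h h' = (if h = h' then 1 else 0)" using H(3) that by blast
        then show ?thesis using False by simp
      qed
      show "\<mu> x = (\<Sum>h\<in>insert e H. \<mu> h * ?d h x)" if "\<mu> \<in> W" "x \<in> insert e E" for \<mu> x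
        using expand[OF that] .
    qed
  qed
qed

text \<open>
  The quotient by a subspace has enough linear functionals.
\<close>

lemma functional_separates:
  fixes S :: "('y \<Rightarrow> 'k::field) set"
  assumes S: "fs.subspace S" and f: "f \<notin> S"
  obtains \<phi> where "\<And>u v. \<phi> (u + v) = \<phi> u + \<phi> v" "\<And>c u. \<phi> (fscale c u) = c * \<phi> u"
    "\<And>u. u \<in> S \<Longrightarrow> \<phi> u = 0" "\<phi> f = (1::'k)"
proof -
  interpret vs: vector_space "(*) :: 'k \<Rightarrow> 'k \<Rightarrow> 'k" by unfold_locales (auto simp: algebra_simps)
  interpret pr: vector_space_pair "fscale :: 'k \<Rightarrow> ('y \<Rightarrow> 'k) \<Rightarrow> _" "(*) :: 'k \<Rightarrow> 'k \<Rightarrow> 'k" ..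
  obtain B where B: "B \<subseteq> S" "fs.independent B" "S \<subseteq> fs.span B"
    using fs.maximal_independent_subset by blast
  have SB: "S = fs.span B" using B S by (metis fs.span_minimal subset_antisym)
  then have fB: "f \<notin> fs.span B" using f by simp
  have ind: "fs.independent (insert f B)" using B fB by (rule_tac fs.independent_insertI) auto
  obtain \<phi> where \<phi>: "Vector_Spaces.linear fscale (*) \<phi>"
      "\<forall>x\<in>insert f B. \<phi> x = (if x = f then 1 else 0)"
    using pr.linear_independent_extend[OF ind, of "\<lambda>x. if x = f then 1 else 0"] by blast
  interpret L: Vector_Spaces.linear fscale "(*)" \<phi> by (rule \<phi>)
  have "\<phi> u = 0" if "u \<in> S" for u
  proof -
    have "u \<in> fs.span B" using that SB by simp
    then show ?thesis
    proof (induction rule: fs.span_induct_alt)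
      case base show ?case by (rule L.zero)
    next
      case (step c x y)
      then have "x \<noteq> f" using fB fs.span_base by blast
      then show ?case using step \<phi>(2) by (simp add: L.add L.scale)
    qed
  qed
  then show ?thesis using that[of \<phi>] \<phi>(2) L.add L.scale by auto
qed

section \<open>Extending characters of commutative rings\<close>

text \<open>
  If the field were finite, one plus the product of all \<open>X - a\<close> would have no root.
\<close>

lemma infinite_alg_closed: "infinite (UNIV :: 'k::alg_closed_field set)"
proof
  assume fin: "finite (UNIV :: 'k set)"
  let ?f = "(\<Prod>a\<in>(UNIV :: 'k set). [:- a, 1:]) + 1"
  have ev: "poly ?f x = 1" for x
  proof -
    have "(\<Prod>a\<in>UNIV. x - a) = 0" using fin by (intro prod_zero) auto
    then show ?thesis by (simp add: poly_prod)
  qed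
  have "degree (\<Prod>a\<in>(UNIV :: 'k set). [:- a, 1:]) = card (UNIV :: 'k set)"
    by (simp add: degree_prod_eq_sum_degree)
  moreover have "card (UNIV :: 'k set) > 0" using fin by (simp add: card_gt_0_iff)
  ultimately have "degree ?f > 0" using degree_add_eq_left[of 1 "\<Prod>a\<in>(UNIV :: 'k set). [:- a, 1:]"] by simp
  then obtain x where "poly ?f x = 0" using alg_closed_imp_poly_has_root by blast
  then show False using ev by simp
qed

text \<open>
  The quotient of the ambient ring by \<open>Q\<close> is a domain, but everything is phrased with
  congruences modulo \<open>Q\<close>. Characters of a subring are then honest functions on the ambient ring, and
  adjoining one element stays inside one type.
\<close>

locale prime_ideal_set =
  fixes Q :: "'r::comm_ring_1 set"
  assumes Q_0: "0 \<in> Q" and Q_add: "a \<in> Q \<Longrightarrow> b \<in> Q \<Longrightarrow> a + b \<in> Q"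
    and Q_mult: "a \<in> Q \<Longrightarrow> c * a \<in> Q" and Q_1: "1 \<notin> Q"
    and Q_prime: "a * b \<in> Q \<Longrightarrow> a \<in> Q \<or> b \<in> Q"
begin

lemma Q_uminus: "a \<in> Q \<Longrightarrow> - a \<in> Q" using Q_mult[of a "-1"] by simp
lemma Q_diff: "a \<in> Q \<Longrightarrow> b \<in> Q \<Longrightarrow> a - b \<in> Q" using Q_add[of a "- b"] Q_uminus by simp
lemma Q_sum: "(\<And>i. i \<in> S \<Longrightarrow> f i \<in> Q) \<Longrightarrow> sum f S \<in> Q"
  by (induction S rule: infinite_finite_induct) (auto intro: Q_0 Q_add)
lemma Q_power: "a ^ n \<in> Q \<Longrightarrow> a \<in> Q"
  by (induction n) (use Q_1 Q_prime in auto)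

definition QP :: "'r poly set" where "QP = {h. \<forall>i. coeff h i \<in> Q}"

lemma QP_add: "g \<in> QP \<Longrightarrow> h \<in> QP \<Longrightarrow> g + h \<in> QP" by (simp add: QP_def Q_add)
lemma QP_mult: "g \<in> QP \<Longrightarrow> h * g \<in> QP"
  by (auto simp: QP_def coeff_mult intro!: Q_sum Q_mult)
lemma QP_poly: "h \<in> QP \<Longrightarrow> poly h x \<in> Q"
  unfolding poly_altdef
  by (intro Q_sum) (use Q_mult[of "coeff h i" "x ^ i" for i] in \<open>auto simp: QP_def mult.commute\<close>)

definition Pol :: "'r set \<Rightarrow> 'r poly set" where "Pol B = {h. \<forall>i. coeff h i \<in> B}"

definition subring_set :: "'r set \<Rightarrow> bool" where
  "subring_set B \<longleftrightarrow> 0 \<in> B \<and> 1 \<in> B \<and> (\<forall>a\<in>B. \<forall>b\<in>B. a + b \<in> B \<and> a - b \<in> B \<and> a * b \<in> B)"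

definition adjoin :: "'r set \<Rightarrow> 'r \<Rightarrow> 'r set" where "adjoin B x = (\<lambda>h. poly h x) ` Pol B"

definition character :: "'r set \<Rightarrow> ('r \<Rightarrow> 'k::field) \<Rightarrow> bool" where
  "character B \<phi> \<longleftrightarrow> \<phi> 1 = 1 \<and> (\<forall>a\<in>B. \<forall>b\<in>B. \<phi> (a + b) = \<phi> a + \<phi> b \<and> \<phi> (a * b) = \<phi> a * \<phi> b) \<and>
     (\<forall>a\<in>B \<inter> Q. \<phi> a = 0)"

context
  fixes B assumes B: "subring_set B"
begin

lemma B_simps: "0 \<in> B" "1 \<in> B" "a \<in> B \<Longrightarrow> b \<in> B \<Longrightarrow> a + b \<in> B"
  "a \<in> B \<Longrightarrow> b \<in> B \<Longrightarrow> a - b \<in> B" "a \<in> B \<Longrightarrow> b \<in> B \<Longrightarrow> a * b \<in> B"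
  using B by (auto simp: subring_set_def)

lemma B_sum: "(\<And>i. i \<in> S \<Longrightarrow> f i \<in> B) \<Longrightarrow> sum f S \<in> B"
  by (induction S rule: infinite_finite_induct) (auto intro: B_simps)
lemma B_power: "a \<in> B \<Longrightarrow> a ^ n \<in> B" by (induction n) (auto intro: B_simps)

lemma Pol_simps: "0 \<in> Pol B" "1 \<in> Pol B" "g \<in> Pol B \<Longrightarrow> h \<in> Pol B \<Longrightarrow> g + h \<in> Pol B"
  "g \<in> Pol B \<Longrightarrow> h \<in> Pol B \<Longrightarrow> g - h \<in> Pol B" "g \<in> Pol B \<Longrightarrow> h \<in> Pol B \<Longrightarrow> g * h \<in> Pol B"
  "c \<in> B \<Longrightarrow> g \<in> Pol B \<Longrightarrow> smult c g \<in> Pol B" "c \<in> B \<Longrightarrow> monom c n \<in> Pol B" "c \<in> B \<Longrightarrow> [:c:] \<in> Pol B"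
  by (auto simp: Pol_def coeff_mult coeff_pCons intro: B_simps B_sum split: nat.splits)

lemma adjoin_subring: "subring_set (adjoin B x)"
  unfolding subring_set_def adjoin_def
proof (intro conjI ballI)
  show "0 \<in> (\<lambda>h. poly h x) ` Pol B" by (rule image_eqI[of _ _ 0]) (auto simp: Pol_simps)
  show "1 \<in> (\<lambda>h. poly h x) ` Pol B" by (rule image_eqI[of _ _ 1]) (auto simp: Pol_simps)
  fix a b assume "a \<in> (\<lambda>h. poly h x) ` Pol B" "b \<in> (\<lambda>h. poly h x) ` Pol B"
  then obtain g h where gh: "g \<in> Pol B" "h \<in> Pol B" "a = poly g x" "b = poly h x" by blast
  show "a + b \<in> (\<lambda>h. poly h x) ` Pol B" by (rule image_eqI[of _ _ "g + h"]) (auto simp: Pol_simps gh)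
  show "a - b \<in> (\<lambda>h. poly h x) ` Pol B" by (rule image_eqI[of _ _ "g - h"]) (auto simp: Pol_simps gh)
  show "a * b \<in> (\<lambda>h. poly h x) ` Pol B" by (rule image_eqI[of _ _ "g * h"]) (auto simp: Pol_simps gh)
qed

lemma adjoin_base: "B \<subseteq> adjoin B x"
  unfolding adjoin_def by (auto intro!: image_eqI[of _ _ "[:c:]" for c] Pol_simps)

lemma adjoin_gen: "x \<in> adjoin B x"
  unfolding adjoin_def by (rule image_eqI[of _ _ "monom 1 1"]) (auto simp: poly_monom intro: Pol_simps B_simps)

text \<open>
  Dropping leading terms whose coefficients lie in \<open>Q\<close> gives a polynomial whose leading coefficient is
  nonzero modulo \<open>Q\<close>.
\<close>

lemma strip_lead_coeff:
  assumes "h \<in> Pol B" "h \<notin> QP"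
  shows "\<exists>h'\<in>Pol B. degree h' \<le> degree h \<and> lead_coeff h' \<notin> Q \<and> h - h' \<in> QP"
proof -
  let ?S = "{i. coeff h i \<notin> Q}"
  have "?S \<subseteq> {..degree h}" using Q_0 by (auto simp: not_le[symmetric] coeff_eq_0 intro: le_degree)
  then have fin: "finite ?S" using finite_subset by blast
  have ne: "?S \<noteq> {}" using assms by (auto simp: QP_def)
  define d where "d = Max ?S"
  have d: "coeff h d \<notin> Q" using Max_in[OF fin ne] by (simp add: d_def)
  have gt: "coeff h i \<in> Q" if "i > d" for i using Max_ge[OF fin, of i] that by (force simp: d_def)
  define h' where "h' = poly_cutoff (Suc d) h"
  have ch: "coeff h' i = (if i \<le> d then coeff h i else 0)" for i by (simp add: h'_def coeff_poly_cutoff less_Suc_eq_le)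
  have "degree h' = d"
  proof (rule antisym)
    show "degree h' \<le> d" by (rule degree_le) (simp add: ch)
    have "coeff h' d \<noteq> 0" using d Q_0 by (auto simp: ch)
    then show "d \<le> degree h'" by (rule le_degree)
  qed
  moreover have "d \<le> degree h" using d Q_0 by (intro le_degree) auto
  moreover have "h' \<in> Pol B" using assms(1) B_simps(1) by (auto simp: Pol_def ch)
  moreover have "h - h' \<in> QP" using gt Q_0 by (auto simp: QP_def ch)
  ultimately show ?thesis using d by (intro bexI[of _ h']) (auto simp: ch)
qed

text \<open>
  Division with remainder works after multiplying by powers of the leading coefficient, which need
  not be a unit.
\<close>

lemma pseudo_division:
  assumes f: "f \<in> Pol B" "degree f > 0"
  shows "g \<in> Pol B \<Longrightarrow> \<exists>N u w. u \<in> Pol B \<and> w \<in> Pol B \<and> degree w < degree f \<and> smult (lead_coeff f ^ N) g = u * f + w"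
proof (induction "degree g" arbitrary: g rule: less_induct)
  case less
  show ?case
  proof (cases "degree g < degree f")
    case True
    then show ?thesis using less.prems by (intro exI[of _ 0] exI[of _ 0] exI[of _ g]) (auto intro: Pol_simps)
  next
    case False
    let ?c = "lead_coeff f" and ?m = "monom (lead_coeff g) (degree g - degree f)"
    have cB: "?c \<in> B" "lead_coeff g \<in> B" using f less.prems by (auto simp: Pol_def)
    define g' where "g' = smult ?c g - ?m * f"
    have g'P: "g' \<in> Pol B" unfolding g'_def using cB f less.prems by (intro Pol_simps)
    have g0: "degree g > 0" using False f by simp
    have "degree g' \<le> degree g"
    proof -
      have "degree (?m * f) \<le> degree g - degree f + degree f"
        using degree_mult_le[of ?m f] degree_monom_le[of "lead_coeff g" "degree g - degree f"] by linarith
      then show ?thesis unfolding g'_def using False degree_smult_le[of ?c g] by (intro degree_diff_le) auto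
    qed
    moreover have "coeff g' (degree g) = 0"
    proof -
      have "coeff (?m * f) (degree g) = lead_coeff g * coeff f (degree g - (degree g - degree f))"
        by (simp add: coeff_monom_mult)
      moreover have "degree g - (degree g - degree f) = degree f" using False by simp
      ultimately show ?thesis by (simp add: g'_def mult.commute)
    qed
    ultimately have "degree g' < degree g"
      using g0 by (metis le_neq_implies_less leading_coeff_0_iff degree_0)
    then obtain N u w where w: "u \<in> Pol B" "w \<in> Pol B" "degree w < degree f" "smult (?c ^ N) g' = u * f + w"
      using less.hyps[OF _ g'P] by blast
    have "smult (?c ^ Suc N) g = smult (?c ^ N) g' + smult (?c ^ N) (?m * f)"
      by (simp add: g'_def smult_diff_right mult.commute)
    also have "\<dots> = (u + smult (?c ^ N) ?m) * f + w" by (simp add: w distrib_right)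
    finally have "smult (?c ^ Suc N) g = (u + smult (?c ^ N) ?m) * f + w" .
    moreover have "u + smult (?c ^ N) ?m \<in> Pol B" using w cB by (intro Pol_simps B_power)
    ultimately show ?thesis using w by blast
  qed
qed

context
  fixes \<phi> :: "'r \<Rightarrow> 'k::alg_closed_field"
  assumes \<phi>: "character B \<phi>"
begin

lemma \<phi>_simps: "\<phi> 1 = 1" "a \<in> B \<Longrightarrow> b \<in> B \<Longrightarrow> \<phi> (a + b) = \<phi> a + \<phi> b"
  "a \<in> B \<Longrightarrow> b \<in> B \<Longrightarrow> \<phi> (a * b) = \<phi> a * \<phi> b" "a \<in> B \<Longrightarrow> a \<in> Q \<Longrightarrow> \<phi> a = 0"
  using \<phi> by (auto simp: character_def)

lemma \<phi>_0: "\<phi> 0 = 0" using \<phi>_simps(4) B_simps(1) Q_0 by blast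

lemma \<phi>_diff: "a \<in> B \<Longrightarrow> b \<in> B \<Longrightarrow> \<phi> (a - b) = \<phi> a - \<phi> b"
  using \<phi>_simps(2)[of "a - b" b] B_simps(4) by simp

lemma \<phi>_sum: "(\<And>i. i \<in> S \<Longrightarrow> f i \<in> B) \<Longrightarrow> \<phi> (sum f S) = (\<Sum>i\<in>S. \<phi> (f i))"
  by (induction S rule: infinite_finite_induct) (auto simp: \<phi>_0 \<phi>_simps B_sum)

lemma \<phi>_power: "a \<in> B \<Longrightarrow> \<phi> (a ^ n) = \<phi> a ^ n"
  by (induction n) (auto simp: \<phi>_simps B_power)

lemma map_simps:
  assumes "g \<in> Pol B" "h \<in> Pol B"
  shows "map_poly \<phi> (g + h) = map_poly \<phi> g + map_poly \<phi> h"
    "map_poly \<phi> (g - h) = map_poly \<phi> g - map_poly \<phi> h"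
    "map_poly \<phi> (g * h) = map_poly \<phi> g * map_poly \<phi> h"
    "c \<in> B \<Longrightarrow> map_poly \<phi> (smult c g) = smult (\<phi> c) (map_poly \<phi> g)"
  using assms
  by (auto intro!: poly_eqI simp: coeff_map_poly \<phi>_0 \<phi>_simps \<phi>_diff coeff_mult Pol_def \<phi>_sum B_simps)

lemma map_QP: "g \<in> Pol B \<Longrightarrow> g \<in> QP \<Longrightarrow> map_poly \<phi> g = 0"
  by (auto intro!: poly_eqI simp: coeff_map_poly \<phi>_0 \<phi>_simps Pol_def QP_def)

text \<open>
  A character extends to the ring with \<open>x\<close> adjoined by sending \<open>x\<close> to \<open>\<xi>\<close>, provided that \<open>\<xi>\<close> satisfies
  all relations of \<open>x\<close>.
\<close>

lemma extend_by_point: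
  assumes kill: "\<And>g. g \<in> Pol B \<Longrightarrow> poly g x \<in> Q \<Longrightarrow> poly (map_poly \<phi> g) \<xi> = 0"
  shows "\<exists>\<psi>. character (adjoin B x) \<psi> \<and> (\<forall>g\<in>Pol B. \<psi> (poly g x) = poly (map_poly \<phi> g) \<xi>) \<and> (\<forall>a\<in>B. \<psi> a = \<phi> a)"
proof -
  define \<psi> where "\<psi> a = poly (map_poly \<phi> (SOME g. g \<in> Pol B \<and> poly g x = a)) \<xi>" for a
  have \<psi>: "\<psi> (poly g x) = poly (map_poly \<phi> g) \<xi>" if g: "g \<in> Pol B" for g
  proof -
    define g' where "g' = (SOME h. h \<in> Pol B \<and> poly h x = poly g x)"
    have g': "g' \<in> Pol B" "poly g' x = poly g x"
      using someI[of "\<lambda>h. h \<in> Pol B \<and> poly h x = poly g x" g] g by (auto simp: g'_def)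
    have "poly (map_poly \<phi> (g' - g)) \<xi> = 0" using g g' Q_0 by (intro kill) (auto intro: Pol_simps)
    then show ?thesis using map_simps(2)[OF g'(1) g] by (simp add: \<psi>_def g'_def[symmetric])
  qed
  have \<psi>B: "\<psi> a = \<phi> a" if "a \<in> B" for a
    using \<psi>[of "[:a:]"] that Pol_simps(8)[OF that] by (simp add: map_poly_pCons \<phi>_0)
  have "character (adjoin B x) \<psi>"
    unfolding character_def
  proof (intro conjI ballI)
    show "\<psi> 1 = 1" using \<psi>B[OF B_simps(2)] \<phi>_simps by simp
    show "\<psi> a = 0" if a: "a \<in> adjoin B x \<inter> Q" for a
    proof -
      obtain g where g: "g \<in> Pol B" "a = poly g x" using a by (auto simp: adjoin_def)
      then show ?thesis using \<psi> kill a by simp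
    qed
    fix a b assume "a \<in> adjoin B x" "b \<in> adjoin B x"
    then obtain g h where gh: "g \<in> Pol B" "h \<in> Pol B" "a = poly g x" "b = poly h x"
      by (auto simp: adjoin_def)
    show "\<psi> (a + b) = \<psi> a + \<psi> b"
      using \<psi>[OF Pol_simps(3)[OF gh(1,2)]] \<psi>[OF gh(1)] \<psi>[OF gh(2)] map_simps(1)[OF gh(1,2)] by (simp add: gh)
    show "\<psi> (a * b) = \<psi> a * \<psi> b"
      using \<psi>[OF Pol_simps(5)[OF gh(1,2)]] \<psi>[OF gh(1)] \<psi>[OF gh(2)] map_simps(3)[OF gh(1,2)] by (simp add: gh)
  qed
  then show ?thesis using \<psi> \<psi>B by blast
qed

end

text \<open>
  One step of the Nullstellensatz: characters that avoid a suitable \<open>a\<close> extend to characters that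
  avoid \<open>b\<close>. If \<open>x\<close> is transcendental modulo \<open>Q\<close>, one sends it to any point at which the nonzero polynomial
  representing \<open>b\<close> does not vanish. If \<open>x\<close> is algebraic, let \<open>f\<close> be a relation of least degree; \<open>a\<close> is the
  product of its leading coefficient with an element of the smaller ring that modulo \<open>Q\<close> is a nonzero
  multiple of \<open>b\<close>, and \<open>x\<close> is sent to a root of \<open>f\<close>.
\<close>

lemma extend_character:
  assumes b: "b \<in> adjoin B x" "b \<notin> Q"
  shows "\<exists>a\<in>B. a \<notin> Q \<and> (\<forall>\<phi> :: 'r \<Rightarrow> 'k::alg_closed_field. character B \<phi> \<and> \<phi> a \<noteq> 0 \<longrightarrow>
     (\<exists>\<psi>. character (adjoin B x) \<psi> \<and> \<psi> b \<noteq> 0 \<and> (\<forall>z\<in>B. \<psi> z = \<phi> z)))"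
proof -
  obtain h where h: "h \<in> Pol B" "b = poly h x" using b by (auto simp: adjoin_def)
  let ?Z = "{f \<in> Pol B. poly f x \<in> Q \<and> lead_coeff f \<notin> Q}"
  have hQ: "h \<notin> QP" using QP_poly b h by blast
  show ?thesis
  proof (cases "?Z = {}")
    case True
    (* x is transcendental: a relation with a nonzero leading coefficient modulo Q would lie in ?Z *)
    have all: "g \<in> QP" if g: "g \<in> Pol B" "poly g x \<in> Q" for g
    proof (rule ccontr)
      assume "g \<notin> QP"
      then obtain g' where g': "g' \<in> Pol B" "lead_coeff g' \<notin> Q" "g - g' \<in> QP" using strip_lead_coeff[OF g(1)] by blast
      have "poly g x - poly (g - g') x \<in> Q" using g(2) QP_poly[OF g'(3)] by (rule Q_diff)
      then have "poly g' x \<in> Q" by simp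
      then show False using True g' by blast
    qed
    obtain j where j: "coeff h j \<notin> Q" using hQ by (auto simp: QP_def)
    have jB: "coeff h j \<in> B" using h by (auto simp: Pol_def)
    have "\<exists>\<psi>. character (adjoin B x) \<psi> \<and> \<psi> b \<noteq> 0 \<and> (\<forall>z\<in>B. \<psi> z = \<phi> z)"
      if \<phi>: "character B \<phi>" "\<phi> (coeff h j) \<noteq> 0" for \<phi> :: "'r \<Rightarrow> 'k"
    proof -
      have "coeff (map_poly \<phi> h) j \<noteq> 0" using \<phi> \<phi>_0[OF \<phi>(1)] by (simp add: coeff_map_poly)
      then have "map_poly \<phi> h \<noteq> 0" by auto
      then have "finite {\<xi>. poly (map_poly \<phi> h) \<xi> = 0}" by (rule poly_roots_finite)
      then obtain \<xi> where \<xi>: "poly (map_poly \<phi> h) \<xi> \<noteq> 0"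
        using ex_new_if_finite[OF infinite_alg_closed] by blast
      have "poly (map_poly \<phi> g) \<xi> = 0" if "g \<in> Pol B" "poly g x \<in> Q" for g
        using map_QP[OF \<phi>(1) that(1) all[OF that]] by simp
      then obtain \<psi> where "character (adjoin B x) \<psi>" "\<forall>g\<in>Pol B. \<psi> (poly g x) = poly (map_poly \<phi> g) \<xi>" "\<forall>a\<in>B. \<psi> a = \<phi> a"
        using extend_by_point[OF \<phi>(1)] by blast
      then show ?thesis using \<xi> h by (intro exI[of _ \<psi>]) auto
    qed
    then show ?thesis using j jB by blast
  next
    case False
    then obtain f0 where "f0 \<in> ?Z" by blast
    (* x is algebraic: f plays the role of its minimal polynomial *)
    define f where "f = (ARG_MIN degree f. f \<in> ?Z)"
    have f: "f \<in> Pol B" "poly f x \<in> Q" "lead_coeff f \<notin> Q" and min: "\<And>g. g \<in> ?Z \<Longrightarrow> degree f \<le> degree g"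
      using arg_min_natI[of "\<lambda>f. f \<in> ?Z" f0 degree] arg_min_nat_le[of "\<lambda>f. f \<in> ?Z" _ degree] \<open>f0 \<in> ?Z\<close>
      unfolding f_def by auto
    have fdeg: "degree f > 0"
    proof (rule ccontr)
      assume "\<not> degree f > 0"
      then obtain c where "f = [:c:]" using degree_eq_zeroE[of f] by auto
      then show False using f by simp
    qed
    have small: "w \<in> QP" if w: "w \<in> Pol B" "poly w x \<in> Q" "degree w < degree f" for w
    proof (rule ccontr)
      assume "w \<notin> QP"
      then obtain w' where w': "w' \<in> Pol B" "degree w' \<le> degree w" "lead_coeff w' \<notin> Q" "w - w' \<in> QP"
        using strip_lead_coeff[OF w(1)] by blast
      have "poly w x - poly (w - w') x \<in> Q" using w(2) QP_poly[OF w'(4)] by (rule Q_diff)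
      then have "w' \<in> ?Z" using w' by simp
      then show False using min[of w'] w' w(3) by simp
    qed
    (* multiples of b modulo Q; an element of least degree turns out to be constant, i.e. to lie in B *)
    let ?T = "{e \<in> Pol B. lead_coeff e \<notin> Q \<and> (\<exists>v\<in>Pol B. poly e x - poly v x * b \<in> Q)}"
    have inT: "\<exists>e\<in>?T. degree e \<le> degree w" if w: "w \<in> Pol B" "w \<notin> QP" "v \<in> Pol B" "poly w x - poly v x * b \<in> Q" for w v
    proof -
      obtain w' where w': "w' \<in> Pol B" "degree w' \<le> degree w" "lead_coeff w' \<notin> Q" "w - w' \<in> QP"
        using strip_lead_coeff[OF w(1,2)] by blast
      have "(poly w x - poly v x * b) - poly (w - w') x \<in> Q" using w(4) QP_poly[OF w'(4)] by (rule Q_diff)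
      then have "poly w' x - poly v x * b \<in> Q" by (simp add: algebra_simps)
      then show ?thesis using w' w(3) by blast
    qed
    have "\<exists>e\<in>?T. degree e < degree f"
    proof -
      obtain N u w where w: "u \<in> Pol B" "w \<in> Pol B" "degree w < degree f" "smult (lead_coeff f ^ N) h = u * f + w"
        using pseudo_division[OF f(1) fdeg h(1)] by blast
      have "lead_coeff f ^ N * b = poly u x * poly f x + poly w x"
        using arg_cong[OF w(4), of "\<lambda>g. poly g x"] by (simp add: h)
      then have e: "poly w x - poly [:lead_coeff f ^ N:] x * b = - (poly u x * poly f x)" by (simp add: algebra_simps)
      then have "poly w x - poly [:lead_coeff f ^ N:] x * b \<in> Q" using f(2) Q_mult Q_uminus by simp
      moreover have "w \<notin> QP"
      proof
        assume "w \<in> QP"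
        then have "poly w x + poly u x * poly f x \<in> Q" using f(2) QP_poly by (intro Q_add Q_mult)
        then have "lead_coeff f ^ N * b \<in> Q" using e by (simp add: algebra_simps)
        then show False using Q_prime Q_power f(3) b(2) by blast
      qed
      moreover have "[:lead_coeff f ^ N:] \<in> Pol B" using f(1) by (intro Pol_simps B_power) (simp add: Pol_def)
      ultimately obtain e where "e \<in> ?T" "degree e \<le> degree w" using inT[OF w(2)] by blast
      then show ?thesis using w(3) by (intro bexI[of _ e]) auto
    qed
    then obtain e0 where e0: "e0 \<in> ?T" "degree e0 < degree f" by blast
    define e where "e = (ARG_MIN degree e. e \<in> ?T)"
    have eT: "e \<in> ?T" and emin: "\<And>g. g \<in> ?T \<Longrightarrow> degree e \<le> degree g"
      using arg_min_natI[of "\<lambda>f. f \<in> ?T" e0 degree] arg_min_nat_le[of "\<lambda>f. f \<in> ?T" _ degree] e0(1)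
      unfolding e_def by auto
    then obtain v where e: "e \<in> Pol B" "lead_coeff e \<notin> Q" "v \<in> Pol B" "poly e x - poly v x * b \<in> Q" by blast
    have elt: "degree e < degree f" using emin[OF e0(1)] e0(2) by simp
    have e_deg: "degree e = 0"
    proof (rule ccontr)
      assume "degree e \<noteq> 0"
      then have ed: "degree e > 0" by simp
      obtain N u w where w: "u \<in> Pol B" "w \<in> Pol B" "degree w < degree e" "smult (lead_coeff e ^ N) f = u * e + w"
        using pseudo_division[OF e(1) ed f(1)] by blast
      have ev: "lead_coeff e ^ N * poly f x = poly u x * poly e x + poly w x"
        using arg_cong[OF w(4), of "\<lambda>g. poly g x"] by simp
      have "poly w x - poly (- (u * v)) x * b = lead_coeff e ^ N * poly f x - poly u x * (poly e x - poly v x * b)"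
        using ev by (simp add: algebra_simps)
      also have "\<dots> \<in> Q" by (rule Q_diff[OF Q_mult[OF f(2)] Q_mult[OF e(4)]])
      finally have "poly w x - poly (- (u * v)) x * b \<in> Q" .
      moreover have "- (u * v) \<in> Pol B" using Pol_simps(4)[OF Pol_simps(1) Pol_simps(5)[OF w(1) e(3)]] by simp
      ultimately have wQ: "w \<in> QP" using inT[OF w(2)] emin w(3) by fastforce
      have "poly u x * poly e x = lead_coeff e ^ N * poly f x - poly w x" using ev by simp
      also have "\<dots> \<in> Q" using f(2) QP_poly[OF wQ] by (intro Q_diff Q_mult)
      finally have "poly u x \<in> Q \<or> poly e x \<in> Q" by (rule Q_prime)
      moreover have "poly e x \<notin> Q" using min[of e] e elt by auto
      ultimately have ux: "poly u x \<in> Q" by blast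
      have le: "coeff (u * e) k \<in> Q" if "k > degree f" for k
      proof -
        have "coeff (u * e) k = lead_coeff e ^ N * coeff f k - coeff w k"
          using arg_cong[OF w(4), of "\<lambda>g. coeff g k"] by simp
        then show ?thesis using that wQ by (auto simp: coeff_eq_0 QP_def intro: Q_uminus)
      qed
      have "u \<notin> QP"
      proof
        assume "u \<in> QP"
        then have "e * u + w \<in> QP" using wQ by (intro QP_add QP_mult)
        then have "coeff (smult (lead_coeff e ^ N) f) (degree f) \<in> Q" unfolding w(4) by (simp add: QP_def mult.commute)
        then have "lead_coeff e ^ N * lead_coeff f \<in> Q" by simp
        then show False using Q_prime Q_power e(2) f(3) by blast
      qed
      then obtain u' where u': "u' \<in> Pol B" "lead_coeff u' \<notin> Q" "u - u' \<in> QP" using strip_lead_coeff[OF w(1)] by blast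
      have "poly u x - poly (u - u') x \<in> Q" using ux QP_poly[OF u'(3)] by (rule Q_diff)
      then have "degree f \<le> degree u'" using min[of u'] u' by simp
      then have "coeff (u * e) (degree u' + degree e) \<in> Q" using ed by (intro le) simp
      moreover have "coeff (e * (u - u')) (degree u' + degree e) \<in> Q"
        using QP_mult[OF u'(3), of e] unfolding QP_def by blast
      ultimately have "coeff (u * e) (degree u' + degree e) - coeff (e * (u - u')) (degree u' + degree e) \<in> Q"
        by (rule Q_diff)
      then have "coeff (u' * e) (degree u' + degree e) \<in> Q" by (simp add: algebra_simps)
      then have "lead_coeff u' * lead_coeff e \<in> Q" by (simp add: coeff_mult_degree_sum)
      then show False using Q_prime u' e by blast
    qed
    then obtain c where c: "e = [:c:]" using degree_eq_zeroE by blast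
    have cB: "c \<in> B" "c \<notin> Q" "c - poly v x * b \<in> Q" using e c by (auto simp: Pol_def coeff_pCons dest: spec[of _ 0])
    have fB: "lead_coeff f \<in> B" using f(1) by (simp add: Pol_def)
    have "\<exists>\<psi>. character (adjoin B x) \<psi> \<and> \<psi> b \<noteq> 0 \<and> (\<forall>z\<in>B. \<psi> z = \<phi> z)"
      if \<phi>: "character B \<phi>" "\<phi> (lead_coeff f * c) \<noteq> 0" for \<phi> :: "'r \<Rightarrow> 'k"
    proof -
      have nz: "\<phi> (lead_coeff f) \<noteq> 0" "\<phi> c \<noteq> 0" using \<phi>(2) \<phi>_simps(3)[OF \<phi>(1) fB cB(1)] by auto
      have "degree (map_poly \<phi> f) = degree f"
        by (rule map_poly_degree_eq) (rule nz(1))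
      then obtain \<xi> where \<xi>: "poly (map_poly \<phi> f) \<xi> = 0" using alg_closed_imp_poly_has_root fdeg by metis
      have kill: "poly (map_poly \<phi> g) \<xi> = 0" if g: "g \<in> Pol B" "poly g x \<in> Q" for g
      proof -
        obtain N u w where w: "u \<in> Pol B" "w \<in> Pol B" "degree w < degree f" "smult (lead_coeff f ^ N) g = u * f + w"
          using pseudo_division[OF f(1) fdeg g(1)] by blast
        have "poly w x = lead_coeff f ^ N * poly g x - poly u x * poly f x"
          using arg_cong[OF w(4), of "\<lambda>g. poly g x"] by (simp add: algebra_simps)
        also have "\<dots> \<in> Q" using g f(2) by (intro Q_diff Q_mult)
        finally have "w \<in> QP" using small w by blast
        then have mw: "map_poly \<phi> w = 0" using map_QP[OF \<phi>(1) w(2)] by blast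
        have "smult (\<phi> (lead_coeff f) ^ N) (map_poly \<phi> g) = map_poly \<phi> u * map_poly \<phi> f + map_poly \<phi> w"
          using arg_cong[OF w(4), of "map_poly \<phi>"]
          by (simp add: map_simps[OF \<phi>(1) Pol_simps(5)[OF w(1) f(1)] w(2)] map_simps(3)[OF \<phi>(1) w(1) f(1)]
             map_simps(4)[OF \<phi>(1) g(1) g(1) B_power[OF fB]] \<phi>_power[OF \<phi>(1) fB])
        then have "poly (smult (\<phi> (lead_coeff f) ^ N) (map_poly \<phi> g)) \<xi> = poly (map_poly \<phi> u * map_poly \<phi> f + map_poly \<phi> w) \<xi>"
          by (simp only:)
        then have "\<phi> (lead_coeff f) ^ N * poly (map_poly \<phi> g) \<xi> = 0" using \<xi> mw by simp
        then show ?thesis using nz by simp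
      qed
      then obtain \<psi> where \<psi>: "character (adjoin B x) \<psi>" "\<forall>a\<in>B. \<psi> a = \<phi> a"
        using extend_by_point[OF \<phi>(1)] by blast
      note sub = adjoin_subring[of x]
      have vx: "poly v x \<in> adjoin B x" using e(3) by (auto simp: adjoin_def)
      have cx: "c \<in> adjoin B x" using cB adjoin_base by blast
      have vb: "poly v x * b \<in> adjoin B x" "c - poly v x * b \<in> adjoin B x"
        using sub vx b(1) cx unfolding subring_set_def by auto
      have "\<psi> c = \<psi> (c - poly v x * b) + \<psi> (poly v x * b)"
        using \<psi>(1) vb unfolding character_def by (metis diff_add_cancel)
      also have "\<psi> (c - poly v x * b) = 0" using \<psi>(1) vb cB(3) unfolding character_def by blast
      also have "\<psi> (poly v x * b) = \<psi> (poly v x) * \<psi> b" using \<psi>(1) vx b(1) unfolding character_def by blast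
      finally have "\<psi> b \<noteq> 0" using \<psi>(2) cB(1) nz(2) by auto
      then show ?thesis using \<psi> by blast
    qed
    moreover have "lead_coeff f * c \<in> B" using fB cB(1) by (rule B_simps)
    moreover have "lead_coeff f * c \<notin> Q" using Q_prime f(3) cB(2) by blast
    ultimately show ?thesis by blast
  qed
qed

end

end

section \<open>Central elements modulo a maximal left ideal\<close>

lemma poly_mapping_sum_induct [case_names single add]:
  assumes s: "\<And>c a. P (Poly_Mapping.single a c)" and add: "\<And>x y. P x \<Longrightarrow> P y \<Longrightarrow> P (x + y)"
  shows "P u"
proof (induction u rule: update_induct)
  case const
  show ?case using s[of undefined 0] by simp
next
  case (update f a b)
  have "Poly_Mapping.update a b f = Poly_Mapping.single a b + f"
    using update(1) by (intro poly_mapping_eqI) (auto simp: lookup_update lookup_add lookup_single in_keys_iff when_def)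
  then show ?case using s add update(3) by simp
qed

text \<open>
  The situation of a simple module in terms of the annihilator \<open>M\<close> of a vector. The elements \<open>\<zeta> i\<close> are
  only assumed to be central up to elements that annihilate the whole module.
\<close>

locale maximal_left_ideal =
  fixes \<sigma> :: "'k::alg_closed_field \<Rightarrow> 'f::ring_1" and M :: "'f set" and n :: nat and \<zeta> :: "nat \<Rightarrow> 'f"
  assumes \<sigma>_add: "\<sigma> (s + t) = \<sigma> s + \<sigma> t" and \<sigma>_mult: "\<sigma> (s * t) = \<sigma> s * \<sigma> t" and \<sigma>_1: "\<sigma> 1 = 1"
    and \<sigma>_central: "\<sigma> s * u = u * \<sigma> s"
    and M_add: "u \<in> M \<Longrightarrow> v \<in> M \<Longrightarrow> u + v \<in> M" and M_mult: "u \<in> M \<Longrightarrow> a * u \<in> M" and M_1: "1 \<notin> M"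
    and M_max: "u \<notin> M \<Longrightarrow> \<exists>a. a * u - 1 \<in> M"
    and \<zeta>_central: "i < n \<Longrightarrow> (\<zeta> i * u - u * \<zeta> i) * v \<in> M"
begin

text \<open>
  The annihilator of the module generated by the vector.
\<close>

definition P :: "'f set" where "P = {u. \<forall>v. u * v \<in> M}"

lemma M_0: "0 \<in> M"
proof -
  obtain u where "u \<in> M" using M_1 M_max by (metis diff_self mult.left_neutral mult_zero_left)
  then show ?thesis using M_mult[of u 0] by simp
qed
lemma M_uminus: "u \<in> M \<Longrightarrow> - u \<in> M" using M_mult[of u "-1"] by simp
lemma M_diff: "u \<in> M \<Longrightarrow> v \<in> M \<Longrightarrow> u - v \<in> M" using M_add[of u "- v"] M_uminus by simp
lemma M_sum: "(\<And>i. i \<in> S \<Longrightarrow> f i \<in> M) \<Longrightarrow> sum f S \<in> M"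
  by (induction S rule: infinite_finite_induct) (auto intro: M_0 M_add)

lemma P_0: "0 \<in> P" by (simp add: P_def M_0)
lemma P_add: "u \<in> P \<Longrightarrow> v \<in> P \<Longrightarrow> u + v \<in> P" by (simp add: P_def distrib_right M_add)
lemma P_diff: "u \<in> P \<Longrightarrow> v \<in> P \<Longrightarrow> u - v \<in> P" by (simp add: P_def left_diff_distrib M_diff)
lemma P_left: "u \<in> P \<Longrightarrow> a * u \<in> P" by (simp add: P_def mult.assoc M_mult)
lemma P_right: "u \<in> P \<Longrightarrow> u * a \<in> P" by (simp add: P_def mult.assoc)
lemma P_M: "u \<in> P \<Longrightarrow> u \<in> M" unfolding P_def by (metis mem_Collect_eq mult.right_neutral)

definition eqP (infix "\<doteq>" 50) where "u \<doteq> v \<longleftrightarrow> u - v \<in> P"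

lemma eqP_refl [simp, intro]: "u \<doteq> u" by (simp add: eqP_def P_0)
lemma eqP_sym: "u \<doteq> v \<Longrightarrow> v \<doteq> u" unfolding eqP_def using P_diff[OF P_0, of "u - v"] by simp
lemma eqP_trans [trans]: "u \<doteq> v \<Longrightarrow> v \<doteq> w \<Longrightarrow> u \<doteq> w" unfolding eqP_def using P_add[of "u - v" "v - w"] by simp
lemma eqP_add: "u \<doteq> v \<Longrightarrow> u' \<doteq> v' \<Longrightarrow> u + u' \<doteq> v + v'"
  unfolding eqP_def using P_add[of "u - v" "u' - v'"] by (simp add: algebra_simps)
lemma eqP_mult: "u \<doteq> v \<Longrightarrow> u' \<doteq> v' \<Longrightarrow> u * u' \<doteq> v * v'"
  unfolding eqP_def using P_add[OF P_right[of "u - v" u'] P_left[of "u' - v'" v]] by (simp add: algebra_simps)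
lemma eqP_P: "u \<doteq> v \<Longrightarrow> v \<in> P \<Longrightarrow> u \<in> P" unfolding eqP_def using P_add[of "u - v" v] by simp
lemma eqP_M: "u \<doteq> v \<Longrightarrow> v \<in> M \<Longrightarrow> u \<in> M" unfolding eqP_def using M_add[OF P_M, of "u - v" v] by simp

lemma \<sigma>_0: "\<sigma> 0 = 0" using \<sigma>_add[of 0 0] by simp

definition power_word :: "(nat \<Rightarrow>\<^sub>0 nat) \<Rightarrow> nat \<Rightarrow> 'f" where
  "power_word \<alpha> m = prod_list (map (\<lambda>i. \<zeta> i ^ Poly_Mapping.lookup \<alpha> i) [0..<m])"

lemma \<zeta>_comm: "i < n \<Longrightarrow> u * \<zeta> i \<doteq> \<zeta> i * u"
  by (rule eqP_sym) (simp add: eqP_def P_def \<zeta>_central)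

lemma \<zeta>_power_comm: "i < n \<Longrightarrow> u * \<zeta> i ^ k \<doteq> \<zeta> i ^ k * u"
proof (induction k)
  case (Suc k)
  have "(u * \<zeta> i) * \<zeta> i ^ k \<doteq> (\<zeta> i * u) * \<zeta> i ^ k" using Suc.prems by (intro eqP_mult \<zeta>_comm) auto
  moreover have "\<zeta> i * (u * \<zeta> i ^ k) \<doteq> \<zeta> i * (\<zeta> i ^ k * u)" using Suc by (intro eqP_mult[OF eqP_refl]) auto
  ultimately show ?case using eqP_trans by (simp add: mult.assoc)
qed simp

lemma power_word_comm: "m \<le> n \<Longrightarrow> u * power_word \<alpha> m \<doteq> power_word \<alpha> m * u"
proof (induction m)
  case 0 then show ?case by (simp add: power_word_def)
next
  case (Suc m)
  let ?z = "\<zeta> m ^ Poly_Mapping.lookup \<alpha> m"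
  have e: "power_word \<alpha> (Suc m) = power_word \<alpha> m * ?z" by (simp add: power_word_def)
  have "(u * power_word \<alpha> m) * ?z \<doteq> (power_word \<alpha> m * u) * ?z" using Suc by (intro eqP_mult[OF _ eqP_refl]) auto
  moreover have "power_word \<alpha> m * (u * ?z) \<doteq> power_word \<alpha> m * (?z * u)"
    using Suc.prems by (intro eqP_mult \<zeta>_power_comm) auto
  ultimately show ?case using eqP_trans by (simp add: e mult.assoc)
qed

lemma power_word_mult: "m \<le> n \<Longrightarrow> power_word (\<alpha> + \<beta>) m \<doteq> power_word \<alpha> m * power_word \<beta> m"
proof (induction m)
  case 0 then show ?case by (simp add: power_word_def)
next
  case (Suc m)
  let ?z = "\<zeta> m ^ Poly_Mapping.lookup \<alpha> m" and ?w = "\<zeta> m ^ Poly_Mapping.lookup \<beta> m"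
  have e: "power_word \<alpha> (Suc m) = power_word \<alpha> m * \<zeta> m ^ Poly_Mapping.lookup \<alpha> m" for \<alpha>
    by (simp add: power_word_def)
  have "power_word (\<alpha> + \<beta>) m * (?z * ?w) \<doteq> (power_word \<alpha> m * power_word \<beta> m) * (?z * ?w)"
    using Suc by (intro eqP_mult) auto
  moreover have "power_word \<alpha> m * (power_word \<beta> m * ?z) * ?w \<doteq> power_word \<alpha> m * (?z * power_word \<beta> m) * ?w"
    using Suc.prems by (intro eqP_mult \<zeta>_power_comm) auto
  ultimately show ?case using eqP_trans by (simp add: e mult.assoc lookup_add power_add)
qed

text \<open>
  Substitution of the elements \<open>\<zeta> i\<close> for the variables of a polynomial. It is multiplicative only modulo \<open>P\<close>.
\<close>

definition subst_zeta :: "((nat \<Rightarrow>\<^sub>0 nat) \<Rightarrow>\<^sub>0 'k) \<Rightarrow> 'f" where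
  "subst_zeta f = (\<Sum>\<alpha>\<in>Poly_Mapping.keys f. \<sigma> (Poly_Mapping.lookup f \<alpha>) * power_word \<alpha> n)"

lemma subst_zeta_add: "subst_zeta (f + g) = subst_zeta f + subst_zeta g"
proof -
  let ?K = "Poly_Mapping.keys f \<union> Poly_Mapping.keys g"
  have ext: "subst_zeta x = (\<Sum>w\<in>?K. \<sigma> (Poly_Mapping.lookup x w) * power_word w n)"
    if "Poly_Mapping.keys x \<subseteq> ?K" for x
    unfolding subst_zeta_def using that
    by (intro sum.mono_neutral_left) (auto simp: in_keys_iff \<sigma>_0)
  show ?thesis
    using keys_add[of f g] by (simp add: ext lookup_add \<sigma>_add distrib_right sum.distrib)
qed

lemma subst_zeta_single: "subst_zeta (Poly_Mapping.single \<alpha> c) = \<sigma> c * power_word \<alpha> n"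
  by (simp add: subst_zeta_def \<sigma>_0)

lemma subst_zeta_diff: "subst_zeta (f - g) = subst_zeta f - subst_zeta g"
  using subst_zeta_add[of "f - g" g] by simp

lemma subst_zeta_mult: "subst_zeta (f * g) \<doteq> subst_zeta f * subst_zeta g"
proof (induction f rule: poly_mapping_sum_induct)
  case f: (single c \<alpha>)
  show ?case
  proof (induction g rule: poly_mapping_sum_induct)
    case (single d \<beta>)
    have "\<sigma> c * \<sigma> d * (x * y) = (\<sigma> c * x) * (\<sigma> d * y)" for x y by (metis \<sigma>_central mult.assoc)
    moreover have "\<sigma> c * \<sigma> d * power_word (\<alpha> + \<beta>) n \<doteq> \<sigma> c * \<sigma> d * (power_word \<alpha> n * power_word \<beta> n)"
      by (intro eqP_mult power_word_mult) auto
    ultimately show ?case by (simp add: mult_single subst_zeta_single \<sigma>_mult)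
  qed (simp add: distrib_left subst_zeta_add eqP_add)
qed (simp add: distrib_right subst_zeta_add eqP_add)

lemma subst_zeta_comm: "u * subst_zeta f \<doteq> subst_zeta f * u"
proof (induction f rule: poly_mapping_sum_induct)
  case (single c \<alpha>)
  have "\<sigma> c * (u * power_word \<alpha> n) \<doteq> \<sigma> c * (power_word \<alpha> n * u)" by (intro eqP_mult power_word_comm) auto
  moreover have "u * (\<sigma> c * x) = \<sigma> c * (u * x)" for x by (metis \<sigma>_central mult.assoc)
  ultimately show ?case by (simp add: subst_zeta_single mult.assoc)
qed (simp add: distrib_left distrib_right subst_zeta_add eqP_add)

abbreviation "const c \<equiv> Poly_Mapping.single (0 :: nat \<Rightarrow>\<^sub>0 nat) (c :: 'k)"
abbreviation "var i \<equiv> Poly_Mapping.single (Poly_Mapping.single i 1 :: nat \<Rightarrow>\<^sub>0 nat) (1 :: 'k)"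

lemma subst_zeta_const: "subst_zeta (const c) = \<sigma> c"
proof -
  have "power_word 0 m = 1" for m by (induction m) (simp_all add: power_word_def)
  then show ?thesis by (simp add: subst_zeta_single)
qed

lemma subst_zeta_var: assumes "i < n" shows "subst_zeta (var i) = \<zeta> i"
proof -
  have "power_word (Poly_Mapping.single i 1) m = (if i < m then \<zeta> i else 1)" for m
    by (induction m) (auto simp: power_word_def lookup_single when_def less_Suc_eq)
  then show ?thesis using assms by (simp add: subst_zeta_single \<sigma>_1)
qed

text \<open>
  By Schur's lemma a central element that does not kill the module acts invertibly, hence
  the polynomial relations between the \<open>\<zeta> i\<close> on the module form a prime ideal.
\<close>

definition Q :: "((nat \<Rightarrow>\<^sub>0 nat) \<Rightarrow>\<^sub>0 'k) set" where "Q = {f. subst_zeta f \<in> P}"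

lemma central_M_P: "subst_zeta f \<in> M \<Longrightarrow> subst_zeta f \<in> P"
proof -
  assume f: "subst_zeta f \<in> M"
  have "subst_zeta f * v \<in> M" for v
    by (rule eqP_M[OF eqP_sym[OF subst_zeta_comm]]) (rule M_mult[OF f])
  then show ?thesis by (simp add: P_def)
qed

sublocale Q: prime_ideal_set Q
proof
  show "0 \<in> Q" using subst_zeta_const[of 0] by (simp add: Q_def \<sigma>_0 P_0)
  fix a b c :: "(nat \<Rightarrow>\<^sub>0 nat) \<Rightarrow>\<^sub>0 'k"
  show "a + b \<in> Q" if "a \<in> Q" "b \<in> Q" using that by (simp add: Q_def subst_zeta_add P_add)
  show "c * a \<in> Q" if "a \<in> Q" using that eqP_P[OF subst_zeta_mult P_left] by (simp add: Q_def)
  have "subst_zeta 1 = 1" using subst_zeta_const[of 1] by (simp add: \<sigma>_1)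
  then show "1 \<notin> Q" using P_M M_1 by (auto simp: Q_def)
  show "a \<in> Q \<or> b \<in> Q" if ab: "a * b \<in> Q"
  proof (rule ccontr)
    assume no: "\<not> (a \<in> Q \<or> b \<in> Q)"
    let ?a = "subst_zeta a" and ?b = "subst_zeta b"
    have "?a \<notin> M" using no central_M_P by (auto simp: Q_def)
    then obtain x where x: "x * ?a - 1 \<in> M" using M_max by blast
    have "?a * ?b \<in> P" using ab eqP_P[OF eqP_sym[OF subst_zeta_mult]] by (simp add: Q_def)
    then have "x * (?a * ?b) \<in> P" by (rule P_left)
    moreover have "?b * (x * ?a) \<doteq> (x * ?a) * ?b" by (rule eqP_sym[OF subst_zeta_comm])
    ultimately have "?b * (x * ?a) \<in> M" using eqP_P P_M by (simp add: mult.assoc)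
    then have "?b * (x * ?a) - ?b * (x * ?a - 1) \<in> M" using M_mult[OF x] by (rule M_diff)
    then have "?b \<in> M" by (simp add: algebra_simps)
    then show False using no central_M_P by (auto simp: Q_def)
  qed
qed

text \<open>
  The polynomials in the first \<open>i\<close> variables, built up by adjoining one variable at a time so
  that \<open>extend_character\<close> applies.
\<close>

primrec adjoin_vars :: "nat \<Rightarrow> ((nat \<Rightarrow>\<^sub>0 nat) \<Rightarrow>\<^sub>0 'k) set" where
  "adjoin_vars 0 = range const"
| "adjoin_vars (Suc i) = Q.adjoin (adjoin_vars i) (var i)"

lemma subring_vars: "Q.subring_set (adjoin_vars i)"
proof (induction i)
  case 0
  show ?case unfolding Q.subring_set_def
  proof (intro conjI ballI)
    show "0 \<in> adjoin_vars 0" by (auto intro: image_eqI[of _ _ 0])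
    show "1 \<in> adjoin_vars 0" by (auto intro!: image_eqI[of _ _ 1])
    fix a b assume "a \<in> adjoin_vars 0" "b \<in> adjoin_vars 0"
    then obtain c d where cd: "a = const c" "b = const d" by auto
    show "a + b \<in> adjoin_vars 0" by (auto simp: cd simp flip: single_add)
    show "a - b \<in> adjoin_vars 0" by (auto simp: cd simp flip: single_diff)
    show "a * b \<in> adjoin_vars 0" by (auto simp: cd mult_single)
  qed
next
  case (Suc i)
  then show ?case by (simp add: Q.adjoin_subring)
qed

lemma vars_mono: "i \<le> j \<Longrightarrow> adjoin_vars i \<subseteq> adjoin_vars j"
  by (rule lift_Suc_mono_le[of adjoin_vars]) (auto dest: Q.adjoin_base[OF subring_vars, THEN subsetD])

lemma const_vars: "const c \<in> adjoin_vars i" using vars_mono[of 0 i] by auto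

lemma var_vars: "i < j \<Longrightarrow> var i \<in> adjoin_vars j"
  using vars_mono[of "Suc i" j] Q.adjoin_gen[OF subring_vars, of "var i" i] by auto

text \<open>
  The Nullstellensatz, by induction on the number of variables.
\<close>

lemma character_exists:
  "b \<in> adjoin_vars i \<Longrightarrow> b \<notin> Q \<Longrightarrow>
    \<exists>\<phi> :: _ \<Rightarrow> 'k. Q.character (adjoin_vars i) \<phi> \<and> \<phi> b \<noteq> 0 \<and> (\<forall>c. \<phi> (const c) = c)"
proof (induction i arbitrary: b)
  case 0
  define \<phi> where "\<phi> f = Poly_Mapping.lookup f 0" for f :: "(nat \<Rightarrow>\<^sub>0 nat) \<Rightarrow>\<^sub>0 'k"
  have c: "\<phi> (const c) = c" for c by (simp add: \<phi>_def)
  have z: "c = 0" if "const c \<in> Q" for c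
  proof (rule ccontr)
    assume "c \<noteq> 0"
    then have "const (1 / c) * const c = 1" by (simp add: mult_single)
    then show False using Q.Q_mult[OF that] Q.Q_1 by metis
  qed
  have "Q.character (adjoin_vars 0) \<phi>"
    unfolding Q.character_def
  proof (intro conjI ballI)
    show "\<phi> 1 = 1" using c[of 1] by simp
    show "\<phi> a = 0" if "a \<in> adjoin_vars 0 \<inter> Q" for a using that z c by auto
    fix a b assume "a \<in> adjoin_vars 0" "b \<in> adjoin_vars 0"
    then obtain s t where st: "a = const s" "b = const t" by auto
    show "\<phi> (a + b) = \<phi> a + \<phi> b" by (simp add: st c flip: single_add)
    show "\<phi> (a * b) = \<phi> a * \<phi> b" by (simp add: st c mult_single)
  qed
  moreover have "\<phi> b \<noteq> 0" using 0 c Q.Q_0 by auto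
  ultimately show ?case using c by blast
next
  case (Suc i)
  have "b \<in> Q.adjoin (adjoin_vars i) (var i)" using Suc.prems by simp
  from Q.extend_character[OF subring_vars this Suc.prems(2), where ?'k = 'k]
  obtain a where a: "a \<in> adjoin_vars i" "a \<notin> Q" "\<And>\<phi> :: _ \<Rightarrow> 'k. Q.character (adjoin_vars i) \<phi> \<Longrightarrow> \<phi> a \<noteq> 0 \<Longrightarrow>
     (\<exists>\<psi>. Q.character (Q.adjoin (adjoin_vars i) (var i)) \<psi> \<and> \<psi> b \<noteq> 0 \<and> (\<forall>z\<in>adjoin_vars i. \<psi> z = \<phi> z))"
    by blast
  obtain \<phi> :: "_ \<Rightarrow> 'k" where \<phi>: "Q.character (adjoin_vars i) \<phi>" "\<phi> a \<noteq> 0" "\<forall>c. \<phi> (const c) = c"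
    using Suc.IH[OF a(1,2)] by blast
  obtain \<psi> where "Q.character (Q.adjoin (adjoin_vars i) (var i)) \<psi>" "\<psi> b \<noteq> 0" "\<forall>z\<in>adjoin_vars i. \<psi> z = \<phi> z"
    using a(3)[OF \<phi>(1,2)] by blast
  then show ?case using \<phi>(3) const_vars by (intro exI[of _ \<psi>]) auto
qed

text \<open>
  The denominator \<open>d\<close> appears when Nakayama's argument inverts polynomials at which a character does not
  vanish.
\<close>

definition spans :: "'f set \<Rightarrow> ((nat \<Rightarrow>\<^sub>0 nat) \<Rightarrow>\<^sub>0 'k) \<Rightarrow> bool" where
  "spans T d \<longleftrightarrow> (\<forall>u. \<exists>c. (\<forall>t. c t \<in> adjoin_vars n) \<and> subst_zeta d * u - (\<Sum>t\<in>T. subst_zeta (c t) * t) \<in> M)"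

text \<open>
  Choose a character \<open>\<phi>\<close> of the polynomial ring that respects all relations of the \<open>\<zeta> i\<close> on the module. If
  some \<open>m\<close> with \<open>\<phi> m = 0\<close> did not kill the module, it would act invertibly on it by simplicity, and
  Nakayama's argument would produce a polynomial \<open>d\<close> with \<open>\<phi> d \<noteq> 0\<close> that kills the module. So \<open>\<zeta> i - \<phi> (\<zeta> i)\<close>
  acts as zero.
\<close>

theorem central_character:
  assumes T: "finite T" and span: "spans T 1"
  shows "\<exists>c. \<forall>i<n. \<zeta> i - \<sigma> (c i) \<in> P"
proof -
  let ?B = "adjoin_vars n" and ?e = "subst_zeta"
  have B: "a \<in> ?B \<Longrightarrow> b \<in> ?B \<Longrightarrow> a + b \<in> ?B \<and> a - b \<in> ?B \<and> a * b \<in> ?B" "0 \<in> ?B" "1 \<in> ?B" for a b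
    using subring_vars[of n] by (auto simp: Q.subring_set_def)
  obtain \<phi> :: "_ \<Rightarrow> 'k" where \<phi>: "Q.character ?B \<phi>" "\<And>c. \<phi> (const c) = c"
    using character_exists[OF B(3) Q.Q_1] by blast
  have ph: "\<phi> 1 = 1" "a \<in> ?B \<Longrightarrow> b \<in> ?B \<Longrightarrow> \<phi> (a + b) = \<phi> a + \<phi> b" "a \<in> ?B \<Longrightarrow> b \<in> ?B \<Longrightarrow> \<phi> (a * b) = \<phi> a * \<phi> b"
    "a \<in> ?B \<Longrightarrow> a \<in> Q \<Longrightarrow> \<phi> a = 0" for a b using \<phi>(1) by (auto simp: Q.character_def)
  have phd: "\<phi> (a - b) = \<phi> a - \<phi> b" if "a \<in> ?B" "b \<in> ?B" for a b
    using ph(2)[of "a - b" b] B(1)[OF that] that by simp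
  have ker: "?e m * u \<in> M" if m: "m \<in> ?B" "\<phi> m = 0" for m u
  proof (rule ccontr)
    assume "?e m * u \<notin> M"
    then obtain a where a: "a * (?e m * u) - 1 \<in> M" using M_max by blast
    (* by centrality, w is an inverse of m on the module *)
    define w where "w = a * u"
    have w: "x - ?e m * (x * w) \<in> M" for x
    proof -
      have "x * (a * ?e m) * u \<doteq> x * (?e m * a) * u" by (intro eqP_mult subst_zeta_comm) auto
      moreover have "(x * ?e m) * w \<doteq> (?e m * x) * w" by (intro eqP_mult subst_zeta_comm) auto
      ultimately have "x * (a * (?e m * u)) \<doteq> ?e m * (x * w)" using eqP_trans by (simp add: w_def mult.assoc)
      then have "x * (a * (?e m * u)) - ?e m * (x * w) \<in> M" unfolding eqP_def by (rule P_M)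
      from M_diff[OF this M_mult[OF a, of x]] show ?thesis by (simp add: algebra_simps)
    qed
    (* remove the elements of T one by one from the spanning set, at the cost of a larger denominator d *)
    have "\<exists>d\<in>?B. \<phi> d \<noteq> 0 \<and> spans T' d" if "finite T0" "T' \<union> T0 = T" "T' \<inter> T0 = {}" for T0 T'
      using that
    proof (induction T0 arbitrary: T' rule: finite_induct)
      case empty
      then show ?case using span B(3) ph(1) by (intro bexI[of _ 1]) auto
    next
      case (insert s T0)
      have "insert s T' \<union> T0 = T" "insert s T' \<inter> T0 = {}" and sT: "s \<notin> T'" using insert by auto
      then obtain d where d: "d \<in> ?B" "\<phi> d \<noteq> 0" "spans (insert s T') d" using insert.IH by blast
      have finT': "finite T'" using T insert.prems(1) by (metis finite_Un)
      obtain c where c: "\<And>t. c t \<in> ?B" "?e d * (s * w) - (\<Sum>t\<in>insert s T'. ?e (c t) * t) \<in> M"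
        using d(3) unfolding spans_def by blast
      (* d s = m (d s w) is m c_s s plus a combination of the remaining elements; the coefficient k is nonzero under \<phi> *)
      define k where "k = d - m * c s"
      have kB: "k \<in> ?B" using B(1) d(1) m(1) c(1) by (simp add: k_def)
      have ks: "?e k * s - (\<Sum>t\<in>T'. ?e (m * c t) * t) \<in> M"
      proof -
        have "?e d * (s - ?e m * (s * w)) \<in> M" by (rule M_mult[OF w])
        moreover have "?e m * (?e d * (s * w) - (\<Sum>t\<in>insert s T'. ?e (c t) * t)) \<in> M" by (rule M_mult[OF c(2)])
        ultimately have "?e d * (s - ?e m * (s * w)) + ?e m * (?e d * (s * w) - (\<Sum>t\<in>insert s T'. ?e (c t) * t)) \<in> M"
          by (rule M_add)
        moreover have "?e d * ?e m * (s * w) \<doteq> ?e m * ?e d * (s * w)" by (intro eqP_mult subst_zeta_comm) auto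
        then have "?e d * ?e m * (s * w) - ?e m * ?e d * (s * w) \<in> M" unfolding eqP_def by (rule P_M)
        ultimately have "?e d * (s - ?e m * (s * w)) + ?e m * (?e d * (s * w) - (\<Sum>t\<in>insert s T'. ?e (c t) * t))
           + (?e d * ?e m * (s * w) - ?e m * ?e d * (s * w)) \<in> M" by (rule M_add)
        then have 1: "?e d * s - (\<Sum>t\<in>insert s T'. ?e m * ?e (c t) * t) \<in> M"
          by (simp add: algebra_simps sum_distrib_left)
        have "(\<Sum>t\<in>insert s T'. ?e m * ?e (c t) * t) - (\<Sum>t\<in>insert s T'. ?e (m * c t) * t) \<in> M"
        proof -
          have "?e m * ?e (c t) * t - ?e (m * c t) * t \<in> M" for t
          proof -
            have "?e m * ?e (c t) * t \<doteq> ?e (m * c t) * t" by (intro eqP_mult eqP_sym[OF subst_zeta_mult]) auto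
            then show ?thesis unfolding eqP_def by (rule P_M)
          qed
          then show ?thesis by (simp only: sum_subtractf[symmetric]) (rule M_sum)
        qed
        from M_add[OF 1 this] have "?e d * s - (\<Sum>t\<in>insert s T'. ?e (m * c t) * t) \<in> M" by simp
        then show ?thesis using sT finT' by (simp add: k_def subst_zeta_diff algebra_simps)
      qed
      have "spans T' (k * d)"
        unfolding spans_def
      proof
        fix u
        obtain b where b: "\<And>t. b t \<in> ?B" "?e d * u - (\<Sum>t\<in>insert s T'. ?e (b t) * t) \<in> M"
          using d(3) unfolding spans_def by blast
        define a where "a t = k * b t + b s * (m * c t)" for t
        have "?e (k * d) * u \<doteq> ?e k * ?e d * u" by (intro eqP_mult subst_zeta_mult) auto
        then have 1: "?e (k * d) * u - ?e k * ?e d * u \<in> M" unfolding eqP_def by (rule P_M)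
        have 2: "?e k * (?e d * u - (\<Sum>t\<in>insert s T'. ?e (b t) * t)) \<in> M" by (rule M_mult[OF b(2)])
        have "?e k * ?e (b s) * s \<doteq> ?e (b s) * ?e k * s" by (intro eqP_mult subst_zeta_comm) auto
        then have 3: "?e k * ?e (b s) * s - ?e (b s) * ?e k * s \<in> M" unfolding eqP_def by (rule P_M)
        have 4: "?e (b s) * (?e k * s - (\<Sum>t\<in>T'. ?e (m * c t) * t)) \<in> M" by (rule M_mult[OF ks])
        have 5: "(\<Sum>t\<in>T'. ?e k * ?e (b t) * t + ?e (b s) * ?e (m * c t) * t) - (\<Sum>t\<in>T'. ?e (a t) * t) \<in> M"
        proof -
          have "?e k * ?e (b t) * t + ?e (b s) * ?e (m * c t) * t - ?e (a t) * t \<in> M" for t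
          proof -
            have "?e k * ?e (b t) * t + ?e (b s) * ?e (m * c t) * t \<doteq> ?e (k * b t) * t + ?e (b s * (m * c t)) * t"
              by (intro eqP_add eqP_mult eqP_sym[OF subst_zeta_mult]) auto
            then show ?thesis unfolding eqP_def a_def subst_zeta_add distrib_right by (rule P_M)
          qed
          then show ?thesis by (simp only: sum_subtractf[symmetric]) (rule M_sum)
        qed
        have "?e (k * d) * u - (\<Sum>t\<in>T'. ?e (a t) * t) =
          (?e (k * d) * u - ?e k * ?e d * u) + ?e k * (?e d * u - (\<Sum>t\<in>insert s T'. ?e (b t) * t))
          + (?e k * ?e (b s) * s - ?e (b s) * ?e k * s) + ?e (b s) * (?e k * s - (\<Sum>t\<in>T'. ?e (m * c t) * t))
          + ((\<Sum>t\<in>T'. ?e k * ?e (b t) * t + ?e (b s) * ?e (m * c t) * t) - (\<Sum>t\<in>T'. ?e (a t) * t))"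
          using sT finT' by (simp add: algebra_simps sum_distrib_left sum.distrib)
        also have "\<dots> \<in> M" by (intro M_add 1 2 3 4 5)
        finally have "?e (k * d) * u - (\<Sum>t\<in>T'. ?e (a t) * t) \<in> M" .
        moreover have "a t \<in> ?B" for t using B(1) kB b(1) c(1) m(1) by (simp add: a_def)
        ultimately show "\<exists>c. (\<forall>t. c t \<in> ?B) \<and> ?e (k * d) * u - (\<Sum>t\<in>T'. ?e (c t) * t) \<in> M" by blast
      qed
      moreover have "\<phi> k = \<phi> d" using d(1) m c(1) B(1) by (simp add: k_def phd ph)
      then have "\<phi> (k * d) \<noteq> 0" using d ph(3)[OF kB d(1)] by simp
      ultimately show ?case using B(1)[OF kB d(1)] by blast
    qed
    from this[OF T, of "{}"] obtain d where d: "d \<in> ?B" "\<phi> d \<noteq> 0" "spans {} d" by auto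
    have "?e d * 1 \<in> M" using d(3)[unfolded spans_def, THEN spec, of 1] by simp
    then have "d \<in> Q" using central_M_P by (simp add: Q_def)
    then show False using ph(4) d by blast
  qed
  have "\<zeta> i - \<sigma> (\<phi> (var i)) \<in> P" if i: "i < n" for i
  proof -
    let ?m = "var i - const (\<phi> (var i))"
    have "?m \<in> ?B" using var_vars[OF i] const_vars B(1) by blast
    moreover have "\<phi> ?m = 0" using var_vars[OF i] const_vars by (simp add: phd \<phi>(2))
    ultimately have "?e ?m \<in> P" using ker by (simp add: P_def)
    then show ?thesis by (simp only: subst_zeta_diff subst_zeta_var[OF i] subst_zeta_const)
  qed
  then show ?thesis by (intro exI[of _ "\<lambda>i. \<phi> (var i)"] allI impI)
qed

end

section \<open>The coordinate algebra and its augmentation ideal\<close>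

lemma span_mult_mem:
  fixes S T V :: "('x \<Rightarrow> 'k::field) set"
  assumes "f \<in> fs.span S" "g \<in> fs.span T" "fs.subspace V" "\<And>s t. s \<in> S \<Longrightarrow> t \<in> T \<Longrightarrow> s * t \<in> V"
  shows "f * g \<in> V"
proof -
  have sc: "fscale c x * y = fscale c (x * y)" "x * fscale c y = fscale c (x * y)" for c and x y :: "'x \<Rightarrow> 'k"
    by (auto simp: fun_eq_iff pointwise)
  have 1: "s * g \<in> V" if "s \<in> S" for s
    using assms(2)
  proof (induction rule: fs.span_induct_alt)
    case base
    show ?case using assms(3) by (simp add: fs.subspace_0)
  next
    case (step c x y)
    then show ?case using assms(3,4) that
      by (simp add: distrib_left sc fs.subspace_add fs.subspace_scale)
  qed
  show ?thesis
    using assms(1)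
  proof (induction rule: fs.span_induct_alt)
    case base
    show ?case using assms(3) by (simp add: fs.subspace_0)
  next
    case (step c x y)
    then show ?case using assms(3) 1
      by (simp add: distrib_right sc fs.subspace_add fs.subspace_scale)
  qed
qed

lemma fscale_mult: "fscale c f * g = fscale c (f * g)" "f * fscale c g = fscale c (f * g)"
  by (auto simp: fun_eq_iff pointwise)

lemma power_fun_apply: "(f ^ n) x = f x ^ n" for f :: "'x \<Rightarrow> 'k::comm_ring_1"
  by (induction n) (simp_all add: pointwise)

lemma fscale_power: "fscale c f ^ n = fscale (c ^ n) (f ^ n)"
  by (auto simp: fun_eq_iff pointwise power_fun_apply power_mult_distrib)

lemma CHAR_fun: "CHAR('x \<Rightarrow> 'k::field) = CHAR('k)"
proof (rule dvd_antisym)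
  have "of_nat CHAR('k) = (0 :: 'x \<Rightarrow> 'k)" by (simp add: of_nat_fun zero_fun_def)
  then show "CHAR('x \<Rightarrow> 'k) dvd CHAR('k)" by (simp add: of_nat_eq_0_iff_char_dvd)
  have "of_nat CHAR('x \<Rightarrow> 'k) = (0 :: 'x \<Rightarrow> 'k)" by simp
  then have "of_nat CHAR('x \<Rightarrow> 'k) = (0 :: 'k)" by (simp add: of_nat_fun zero_fun_def fun_eq_iff)
  then show "CHAR('k) dvd CHAR('x \<Rightarrow> 'k)" by (simp add: of_nat_eq_0_iff_char_dvd)
qed

text \<open>
  The characteristic gets a name of its own, so that it can occur in exponents without the type
  of the field.
\<close>

locale char_p_group = affine_algebraic_group G A
  for G :: "('g, 'm) monoid_scheme" (structure) and A :: "('g \<Rightarrow> 'k::alg_closed_field) set" +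
  fixes p :: nat
  assumes p_CHAR: "p = CHAR('k)" and char_pos: "p > 0"
begin

abbreviation one_A :: "'g \<Rightarrow> 'k" where "one_A \<equiv> indicator (carrier G)"
abbreviation aug :: "('g \<Rightarrow> 'k) set" where "aug \<equiv> augmentation_ideal G A"
abbreviation I :: "nat \<Rightarrow> ('g \<Rightarrow> 'k) set" where "I n \<equiv> augmentation_power G A n"

lemma prime_p: "prime p"
  using char_pos prime_CHAR_semidom unfolding p_CHAR by blast

lemma p_gt_1: "p > 1"
  using prime_p prime_gt_1_nat by blast

declare char_pos [simp]

lemma frobenius_add: "(f + g) ^ (p ^ s) = f ^ (p ^ s) + g ^ (p ^ s)" for f g :: "'x \<Rightarrow> 'k"
  by (rule freshmans_dream') (use prime_p in \<open>simp_all add: CHAR_fun p_CHAR\<close>)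

lemma frobenius_sum: "(\<Sum>i\<in>J. f i) ^ (p ^ s) = (\<Sum>i\<in>J. f i ^ (p ^ s))" for f :: "'i \<Rightarrow> 'x \<Rightarrow> 'k"
  by (rule freshmans_dream_sum') (use prime_p in \<open>simp_all add: CHAR_fun p_CHAR\<close>)

lemma frobenius_add_field: "(a + b) ^ (p ^ s) = a ^ (p ^ s) + b ^ (p ^ s)" for a b :: 'k
  by (rule freshmans_dream') (use prime_p in \<open>simp_all add: p_CHAR\<close>)

lemma frobenius_sum_field: "(\<Sum>i\<in>J. f i) ^ (p ^ s) = (\<Sum>i\<in>J. f i ^ (p ^ s))" for f :: "'i \<Rightarrow> 'k"
  by (rule freshmans_dream_sum') (use prime_p in \<open>simp_all add: p_CHAR\<close>)

lemma frobenius_root: obtains d :: 'k where "d ^ (p ^ s) = c"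
proof -
  have "0 < p ^ s" by simp
  then obtain y where "y ^ (p ^ s) = c" using nth_root_exists[of "p ^ s" c] by blast
  then show ?thesis by (rule that)
qed

lemma frobenius_diff_field: "(a - b) ^ (p ^ s) = a ^ (p ^ s) - b ^ (p ^ s)" for a b :: 'k
  using frobenius_add_field[of "a - b" b s] by (simp add: algebra_simps)

lemma A_mult [intro]: "f \<in> A \<Longrightarrow> g \<in> A \<Longrightarrow> f * g \<in> A"
  and A_one [intro, simp]: "one_A \<in> A"
  using function_algebra unfolding function_algebra_def by blast+

lemma A_supp: "f \<in> A \<Longrightarrow> x \<notin> carrier G \<Longrightarrow> f x = 0"
  using function_algebra unfolding function_algebra_def by blast

lemma A_subspace: "fs.subspace A"
proof (rule fs.subspaceI)
  have "fscale 0 one_A \<in> A" using function_algebra unfolding function_algebra_def by blast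
  then show "0 \<in> A" by (metis fs.scale_zero_left)
qed (use function_algebra in \<open>unfold function_algebra_def, blast+\<close>)

lemmas A_add [intro] = fs.subspace_add[OF A_subspace]
  and A_diff [intro] = fs.subspace_diff[OF A_subspace]
  and A_scale [intro] = fs.subspace_scale[OF A_subspace]
  and A_zero [intro, simp] = fs.subspace_0[OF A_subspace]
  and A_sum = fs.subspace_sum[OF A_subspace]

lemma A_eqI: "f \<in> A \<Longrightarrow> g \<in> A \<Longrightarrow> (\<And>x. x \<in> carrier G \<Longrightarrow> f x = g x) \<Longrightarrow> f = g"
  using A_supp by (metis ext)

lemma one_A_mult [simp]: "f \<in> A \<Longrightarrow> one_A * f = f" "f \<in> A \<Longrightarrow> f * one_A = f"
  using A_supp by (auto simp: fun_eq_iff pointwise indicator_def)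

lemma one_A_power: "n > 0 \<Longrightarrow> one_A ^ n = one_A"
  by (auto simp: fun_eq_iff power_fun_apply indicator_def)

lemma A_power: "f \<in> A \<Longrightarrow> n > 0 \<Longrightarrow> f ^ n \<in> A"
proof (induction n)
  case (Suc n)
  then show ?case by (cases "n = 0") auto
qed simp

lemma aug_iff: "f \<in> aug \<longleftrightarrow> f \<in> A \<and> f \<one> = 0"
  by (simp add: augmentation_ideal_def)

lemma aug_A: "f \<in> aug \<Longrightarrow> f \<in> A" by (simp add: aug_iff)

lemma aug_subspace: "fs.subspace aug"
  by (rule fs.subspaceI) (auto simp: aug_iff pointwise)

lemma aug_normalize: "f \<in> A \<Longrightarrow> f - fscale (f \<one>) one_A \<in> aug"
  by (auto simp: aug_iff pointwise)

lemma I_subspace: "fs.subspace (I n)"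
  by (cases n) (simp_all add: A_subspace fs.subspace_span)

lemmas I_add = fs.subspace_add[OF I_subspace]
  and I_diff = fs.subspace_diff[OF I_subspace]
  and I_scale = fs.subspace_scale[OF I_subspace]
  and I_zero [simp] = fs.subspace_0[OF I_subspace]
  and I_sum = fs.subspace_sum[OF I_subspace]

lemma I_Suc_gen: "f \<in> aug \<Longrightarrow> g \<in> I n \<Longrightarrow> f * g \<in> I (Suc n)"
  by (auto intro!: fs.span_base)

lemma I_Suc_induct: 
  assumes "f \<in> I (Suc n)" "fs.subspace V" "\<And>a g. a \<in> aug \<Longrightarrow> g \<in> I n \<Longrightarrow> a * g \<in> V"
  shows "f \<in> V"
proof -
  have "f \<in> fs.span {f * g | f g. f \<in> aug \<and> g \<in> I n}" using assms(1) by simp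
  then show ?thesis by (rule fs.span_minimal[THEN subsetD, rotated 2]) (use assms in auto)
qed

lemma I_A_mult: "f \<in> A \<Longrightarrow> g \<in> I n \<Longrightarrow> f * g \<in> I n"
proof (induction n arbitrary: g)
  case 0 then show ?case by auto
next
  case (Suc n)
  have "fs.subspace {g. f * g \<in> I (Suc n)}"
    by (rule fs.subspaceI) (auto simp: distrib_left fscale_mult simp del: augmentation_power.simps intro: I_add I_scale)
  from Suc.prems(2) this show ?case
  proof (rule I_Suc_induct[where V = "{g. f * g \<in> I (Suc n)}", THEN CollectD])
    fix a g assume "a \<in> aug" "g \<in> I n"
    then have "a * (f * g) \<in> I (Suc n)" using Suc by (intro I_Suc_gen) auto
    then show "a * g \<in> {g. f * g \<in> I (Suc n)}" by (simp add: mult_ac del: augmentation_power.simps)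
  qed
qed

lemma I_Suc_subset: "I (Suc n) \<subseteq> I n"
proof
  fix f assume "f \<in> I (Suc n)"
  then show "f \<in> I n"
    by (rule I_Suc_induct) (auto simp: I_subspace intro: I_A_mult aug_A)
qed

lemma I_antimono: "m \<le> n \<Longrightarrow> I n \<subseteq> I m"
  by (rule lift_Suc_antimono_le[of I]) (use I_Suc_subset in auto)

lemma I_subset_A: "I n \<subseteq> A"
  using I_antimono[of 0 n] by simp

lemma I_1: "I (Suc 0) = aug"
proof
  show "I (Suc 0) \<subseteq> aug"
  proof
    fix f assume "f \<in> I (Suc 0)"
    then show "f \<in> aug"
      by (rule I_Suc_induct[OF _ aug_subspace]) (auto simp: aug_iff pointwise)
  qed
  show "aug \<subseteq> I (Suc 0)"
  proof
    fix f assume f: "f \<in> aug"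
    then have "f * one_A \<in> I (Suc 0)" by (intro I_Suc_gen) auto
    then show "f \<in> I (Suc 0)" using f by (simp add: aug_iff del: augmentation_power.simps)
  qed
qed

declare augmentation_power.simps(2) [simp del]

lemma I_mult: "f \<in> I m \<Longrightarrow> g \<in> I n \<Longrightarrow> f * g \<in> I (m + n)"
proof (induction m arbitrary: f)
  case 0 then show ?case by (auto intro: I_A_mult)
next
  case (Suc m)
  have "fs.subspace {f. f * g \<in> I (Suc m + n)}"
    by (rule fs.subspaceI) (auto simp: distrib_right fscale_mult intro: I_add I_scale)
  from Suc.prems(1) this show ?case
  proof (rule I_Suc_induct[where V = "{f. f * g \<in> I (Suc m + n)}", THEN CollectD])
    fix a h assume "a \<in> aug" "h \<in> I m"
    then have "a * (h * g) \<in> I (Suc (m + n))" using Suc by (intro I_Suc_gen) auto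
    then show "a * h \<in> {f. f * g \<in> I (Suc m + n)}" by (simp add: mult_ac)
  qed
qed

lemma I_power: "f \<in> I m \<Longrightarrow> k > 0 \<Longrightarrow> f ^ k \<in> I (k * m)"
proof (induction k)
  case (Suc k)
  then show ?case using I_mult[of f m "f ^ k" "k * m"] by (cases "k = 0") auto
qed simp

lemma aug_power: "f \<in> aug \<Longrightarrow> k > 0 \<Longrightarrow> f ^ k \<in> I k"
  using I_power[of f 1 k] by (simp add: I_1)

definition generates :: "('g \<Rightarrow> 'k) set \<Rightarrow> bool" where
  "generates S \<longleftrightarrow> finite S \<and> S \<subseteq> A \<and> (\<forall>B. function_algebra (carrier G) B \<and> S \<subseteq> B \<longrightarrow> A \<subseteq> B)"

lemma generates_ex: "\<exists>S. generates S"
  using finitely_generated unfolding generates_def by blast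

text \<open>
  Functions are moved into the augmentation ideal by subtracting their value at the identity.
\<close>

abbreviation normalized :: "('g \<Rightarrow> 'k) \<Rightarrow> 'g \<Rightarrow> 'k" where
  "normalized s \<equiv> s - fscale (s \<one>) one_A"

text \<open>
  The right-hand side is closed under products: a product of normalized functions lies in the square
  of the augmentation ideal.
\<close>

lemma A_subset_span:
  assumes "generates S"
  shows "A \<subseteq> fs.span (insert one_A (normalized ` S \<union> I 2))"
proof -
  let ?B = "insert one_A (normalized ` S \<union> I 2)"
  have S: "S \<subseteq> A" using assms by (simp add: generates_def)
  have BA: "?B \<subseteq> A" using S I_subset_A by auto
  then have spA: "fs.span ?B \<subseteq> A" using A_subspace by (rule fs.span_minimal)
  have mul: "s * t \<in> fs.span ?B" if st: "s \<in> ?B" "t \<in> ?B" for s t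
  proof -
    consider "s = one_A" | "t = one_A" | "s \<in> normalized ` S \<union> I 2" "t \<in> normalized ` S \<union> I 2"
      using st by blast
    then show ?thesis
    proof cases
      case 1
      then have "s * t = t" using st BA by auto
      then show ?thesis using st by (simp only: fs.span_base)
    next
      case 2
      then have "s * t = s" using st BA by auto
      then show ?thesis using st by (simp only: fs.span_base)
    next
      case 3
      have "normalized ` S \<union> I 2 \<subseteq> I 1"
        using S I_antimono[of 1 2] by (auto simp: I_1 intro: aug_normalize)
      then have "s * t \<in> I (1 + 1)" using 3 by (intro I_mult) auto
      then have "s * t \<in> ?B" by (simp add: numeral_2_eq_2)
      then show ?thesis by (rule fs.span_base)
    qed
  qed
  have "function_algebra (carrier G) (fs.span ?B)"
    unfolding function_algebra_def
  proof (intro conjI ballI allI impI)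
    fix f g assume fg: "f \<in> fs.span ?B" "g \<in> fs.span ?B"
    show "f * g \<in> fs.span ?B" by (rule span_mult_mem[OF fg fs.subspace_span mul])
  qed (use spA A_supp in \<open>auto intro: fs.span_add fs.span_scale fs.span_base\<close>)
  moreover have "S \<subseteq> fs.span ?B"
  proof
    fix s assume "s \<in> S"
    then have "normalized s + fscale (s \<one>) one_A \<in> fs.span ?B"
      by (intro fs.span_add fs.span_scale fs.span_base) auto
    then show "s \<in> fs.span ?B" by simp
  qed
  ultimately show ?thesis using assms by (auto simp: generates_def)
qed

lemma aug_subset_span:
  assumes "generates S"
  shows "aug \<subseteq> fs.span (normalized ` S \<union> I 2)"
proof
  fix f assume f: "f \<in> aug"
  then have "f \<in> fs.span (insert one_A (normalized ` S \<union> I 2))"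
    using A_subset_span[OF assms] aug_A by blast
  then obtain k where k: "f - fscale k one_A \<in> fs.span (normalized ` S \<union> I 2)"
    using fs.span_breakdown_eq by blast
  have "normalized ` S \<union> I 2 \<subseteq> aug"
    using assms I_antimono[of 1 2] by (auto simp: I_1 generates_def intro!: aug_normalize)
  then have "fs.span (normalized ` S \<union> I 2) \<subseteq> aug" using aug_subspace by (rule fs.span_minimal)
  then have "f - fscale k one_A \<in> aug" using k by blast
  then have "k = 0" using f by (simp add: aug_iff pointwise)
  then show "f \<in> fs.span (normalized ` S \<union> I 2)" using k by simp
qed

text \<open>
  Each quotient of successive powers of the augmentation ideal is finite-dimensional.
\<close>

lemma I_finite_span: "\<exists>E. finite E \<and> E \<subseteq> I n \<and> I n \<subseteq> fs.span (E \<union> I (Suc n))"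
proof (induction n)
  case 0
  have "A \<subseteq> fs.span ({one_A} \<union> aug)"
  proof
    fix f assume f: "f \<in> A"
    then have "normalized f + fscale (f \<one>) one_A \<in> fs.span ({one_A} \<union> aug)"
      by (intro fs.span_add fs.span_scale fs.span_base) (auto intro: aug_normalize)
    then show "f \<in> fs.span ({one_A} \<union> aug)" by simp
  qed
  then show ?case by (intro exI[of _ "{one_A}"]) (auto simp: I_1)
next
  case (Suc n)
  then obtain E where E: "finite E" "E \<subseteq> I n" "I n \<subseteq> fs.span (E \<union> I (Suc n))" by blast
  obtain S where S: "generates S" using generates_ex by blast
  let ?E = "(\<lambda>(s, e). s * e) ` (normalized ` S \<times> E)"
  have nS: "normalized ` S \<subseteq> I 1" using S by (auto simp: I_1 generates_def intro!: aug_normalize)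
  have sub: "s * t \<in> fs.span (?E \<union> I (Suc (Suc n)))"
    if st: "s \<in> normalized ` S \<union> I 2" "t \<in> E \<union> I (Suc n)" for s t
  proof (cases "s \<in> I 2")
    case True
    have "t \<in> I n" using st E I_Suc_subset by blast
    then have "s * t \<in> I (2 + n)" using True by (rule_tac I_mult)
    then show ?thesis by (auto intro: fs.span_base)
  next
    case False
    then have s: "s \<in> normalized ` S" using st by blast
    show ?thesis
    proof (cases "t \<in> E")
      case True
      then show ?thesis using s by (intro fs.span_base) auto
    next
      case False
      then have "s * t \<in> I (1 + Suc n)" using s st nS by (intro I_mult) auto
      then show ?thesis by (intro fs.span_base) auto
    qed
  qed
  have "I (Suc n) \<subseteq> fs.span (?E \<union> I (Suc (Suc n)))"
  proof
    fix f assume "f \<in> I (Suc n)"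
    then show "f \<in> fs.span (?E \<union> I (Suc (Suc n)))"
    proof (rule I_Suc_induct)
      fix a g assume "a \<in> aug" "g \<in> I n"
      then have "a \<in> fs.span (normalized ` S \<union> I 2)" "g \<in> fs.span (E \<union> I (Suc n))"
        using aug_subset_span[OF S] E by auto
      then show "a * g \<in> fs.span (?E \<union> I (Suc (Suc n)))"
        by (rule span_mult_mem[OF _ _ fs.subspace_span sub])
    qed (rule fs.subspace_span)
  qed
  moreover have "?E \<subseteq> I (Suc n)"
  proof -
    have "s * e \<in> I (Suc n)" if "s \<in> normalized ` S" "e \<in> E" for s e
    proof -
      have "s * e \<in> I (1 + n)" using E nS that by (intro I_mult) auto
      then show ?thesis by simp
    qed
    then show ?thesis by (simp only: image_subset_iff split_paired_Ball_Sigma prod.case) simp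
  qed
  moreover have "finite ?E" using E S by (auto simp: generates_def)
  ultimately show ?case by blast
qed

lemma A_finite_span: "\<exists>E. finite E \<and> E \<subseteq> A \<and> A \<subseteq> fs.span (E \<union> I n)"
proof (induction n)
  case 0
  show ?case by (rule exI[of _ "{}"]) (auto intro: fs.span_base)
next
  case (Suc n)
  then obtain E where E: "finite E" "E \<subseteq> A" "A \<subseteq> fs.span (E \<union> I n)" by blast
  obtain E' where E': "finite E'" "E' \<subseteq> I n" "I n \<subseteq> fs.span (E' \<union> I (Suc n))"
    using I_finite_span by blast
  have "E \<union> I n \<subseteq> fs.span ((E \<union> E') \<union> I (Suc n))"
    using E'(3) fs.span_mono[of "E' \<union> I (Suc n)" "(E \<union> E') \<union> I (Suc n)"]
    by (auto intro: fs.span_base)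
  then have "fs.span (E \<union> I n) \<subseteq> fs.span ((E \<union> E') \<union> I (Suc n))"
    by (rule fs.span_minimal) (rule fs.subspace_span)
  then have "A \<subseteq> fs.span ((E \<union> E') \<union> I (Suc n))" using E(3) by blast
  moreover have "E \<union> E' \<subseteq> A" using E E' I_subset_A by blast
  ultimately show ?case using E(1) E'(1) by blast
qed

end

section \<open>The filtered algebra of distributions\<close>

context char_p_group
begin

abbreviation LF :: "(('g \<Rightarrow> 'k) \<Rightarrow> 'k) set" where "LF \<equiv> linear_forms A"

lemma LF_add: "\<mu> \<in> LF \<Longrightarrow> f \<in> A \<Longrightarrow> g \<in> A \<Longrightarrow> \<mu> (f + g) = \<mu> f + \<mu> g"
  and LF_scale: "\<mu> \<in> LF \<Longrightarrow> f \<in> A \<Longrightarrow> \<mu> (fscale c f) = c * \<mu> f"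
  and LF_out: "\<mu> \<in> LF \<Longrightarrow> f \<notin> A \<Longrightarrow> \<mu> f = 0"
  by (simp_all add: linear_forms_def)

lemma LF_I:
  assumes "\<And>f g. f \<in> A \<Longrightarrow> g \<in> A \<Longrightarrow> \<mu> (f + g) = \<mu> f + \<mu> g"
    "\<And>f c. f \<in> A \<Longrightarrow> \<mu> (fscale c f) = c * \<mu> f" "\<And>f. f \<notin> A \<Longrightarrow> \<mu> f = 0"
  shows "\<mu> \<in> LF"
  using assms by (simp add: linear_forms_def)

lemma LF_0: "\<mu> \<in> LF \<Longrightarrow> \<mu> 0 = 0"
  using LF_scale[of \<mu> 0 0] by (simp add: A_zero)

lemma LF_diff: "\<mu> \<in> LF \<Longrightarrow> f \<in> A \<Longrightarrow> g \<in> A \<Longrightarrow> \<mu> (f - g) = \<mu> f - \<mu> g"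
  using LF_add[of \<mu> "f - g" g] A_diff by simp

lemma LF_sum: "\<mu> \<in> LF \<Longrightarrow> (\<And>i. i \<in> J \<Longrightarrow> f i \<in> A) \<Longrightarrow> \<mu> (\<Sum>i\<in>J. f i) = (\<Sum>i\<in>J. \<mu> (f i))"
  by (induction J rule: infinite_finite_induct) (simp_all add: LF_0 LF_add A_sum)

lemma LF_sum_scale:
  "\<mu> \<in> LF \<Longrightarrow> (\<And>i. i \<in> J \<Longrightarrow> f i \<in> A) \<Longrightarrow> \<mu> (\<Sum>i\<in>J. fscale (c i) (f i)) = (\<Sum>i\<in>J. c i * \<mu> (f i))"
  by (subst LF_sum) (auto simp: LF_scale)

lemma LF_eqI: "\<mu> \<in> LF \<Longrightarrow> \<nu> \<in> LF \<Longrightarrow> (\<And>f. f \<in> A \<Longrightarrow> \<mu> f = \<nu> f) \<Longrightarrow> \<mu> = \<nu>"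
  using LF_out by (metis ext)

lemma LF_subspace: "fs.subspace LF"
  by (rule fs.subspaceI)
    (auto intro!: LF_I simp: pointwise LF_add LF_scale LF_out algebra_simps)

lemmas LF_plus = fs.subspace_add[OF LF_subspace]
  and LF_minus = fs.subspace_diff[OF LF_subspace]
  and LF_fscale = fs.subspace_scale[OF LF_subspace]
  and LF_zero [simp] = fs.subspace_0[OF LF_subspace]
  and LF_setsum = fs.subspace_sum[OF LF_subspace]

text \<open>
  Shifted indexing: \<open>Dd n\<close> consists of the distributions of order less than \<open>n\<close>, so that \<open>Dd 0\<close> is zero and
  subtraction of natural numbers behaves well in degree estimates.
\<close>

definition Dd :: "nat \<Rightarrow> (('g \<Rightarrow> 'k) \<Rightarrow> 'k) set" where
  "Dd n = {\<mu> \<in> LF. \<forall>f\<in>I n. \<mu> f = 0}"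

lemma dist_eq_Dd: "dist G A n = Dd (Suc n)"
  by (simp add: dist_def Dd_def)

lemma Dd_LF: "\<mu> \<in> Dd n \<Longrightarrow> \<mu> \<in> LF" by (simp add: Dd_def)
lemma Dd_vanish: "\<mu> \<in> Dd n \<Longrightarrow> f \<in> I n \<Longrightarrow> \<mu> f = 0" by (simp add: Dd_def)

lemma Dd_subspace: "fs.subspace (Dd n)"
proof (rule fs.subspaceI)
  show "0 \<in> Dd n" by (simp add: Dd_def zero_fun_apply)
  fix \<mu> \<nu> c assume "\<mu> \<in> Dd n"
  then show "fscale c \<mu> \<in> Dd n" by (simp add: Dd_def LF_fscale fscale_apply)
  assume "\<nu> \<in> Dd n"
  with \<open>\<mu> \<in> Dd n\<close> show "\<mu> + \<nu> \<in> Dd n" by (simp add: Dd_def LF_plus plus_fun_apply)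
qed

lemmas Dd_plus = fs.subspace_add[OF Dd_subspace]
  and Dd_minus = fs.subspace_diff[OF Dd_subspace]
  and Dd_fscale = fs.subspace_scale[OF Dd_subspace]
  and Dd_zero [simp] = fs.subspace_0[OF Dd_subspace]
  and Dd_sum = fs.subspace_sum[OF Dd_subspace]

lemma Dd_mono: "m \<le> n \<Longrightarrow> \<mu> \<in> Dd m \<Longrightarrow> \<mu> \<in> Dd n"
  using I_antimono by (auto simp: Dd_def)

lemma Dd_0: "\<mu> \<in> Dd 0 \<longleftrightarrow> \<mu> = 0"
proof
  assume "\<mu> \<in> Dd 0"
  then show "\<mu> = 0" using LF_out[of \<mu>] by (intro ext) (auto simp: Dd_def zero_fun_apply)
qed simp

text \<open>
  Evaluation at the identity, the unit for the product of distributions.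
\<close>

definition eps :: "('g \<Rightarrow> 'k) \<Rightarrow> 'k" where
  "eps = (\<lambda>f. if f \<in> A then f \<one> else 0)"

lemma eps_apply: "f \<in> A \<Longrightarrow> eps f = f \<one>" by (simp add: eps_def)

lemma eps_LF: "eps \<in> LF"
  by (rule LF_I) (auto simp: eps_def pointwise A_add A_scale)

lemma eps_Dd: "eps \<in> Dd (Suc 0)"
  by (auto simp: Dd_def eps_LF I_1 aug_iff eps_apply)

lemma Dd_1: assumes "\<mu> \<in> Dd (Suc 0)" shows "\<mu> = fscale (\<mu> one_A) eps"
proof (rule LF_eqI)
  fix f assume f: "f \<in> A"
  have "\<mu> (normalized f) = 0" using assms aug_normalize[OF f] by (auto simp: Dd_def I_1)
  then show "\<mu> f = fscale (\<mu> one_A) eps f"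
    using f Dd_LF[OF assms] by (simp add: LF_diff LF_scale A_scale pointwise eps_apply)
qed (use assms Dd_LF eps_LF LF_fscale in auto)

definition translate :: "'g \<Rightarrow> ('g \<Rightarrow> 'k) \<Rightarrow> 'g \<Rightarrow> 'k" where
  "translate x f = (\<lambda>y. if y \<in> carrier G then f (x \<otimes> y) else 0)"

text \<open>
  The operator on functions for which \<open>\<mu> \<rho> = \<mu> \<circ> conv \<rho>\<close>. Estimates for products of distributions
  are obtained from its effect on powers of the augmentation ideal.
\<close>

definition conv :: "(('g \<Rightarrow> 'k) \<Rightarrow> 'k) \<Rightarrow> ('g \<Rightarrow> 'k) \<Rightarrow> 'g \<Rightarrow> 'k" where
  "conv \<rho> f = (\<lambda>x. if x \<in> carrier G then \<rho> (translate x f) else 0)"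

abbreviation dm (infixl "\<star>" 70) where "\<mu> \<star> \<rho> \<equiv> dist_mult G A \<mu> \<rho>"

lemma dm_eq: "\<mu> \<star> \<rho> = (\<lambda>f. if f \<in> A then \<mu> (conv \<rho> f) else 0)"
  unfolding dist_mult_def conv_def translate_def by (rule refl)

lemma conv_apply: "x \<in> carrier G \<Longrightarrow> conv \<rho> f x = \<rho> (translate x f)"
  and conv_out: "x \<notin> carrier G \<Longrightarrow> conv \<rho> f x = 0"
  by (simp_all add: conv_def)

lemma conv_cong_zero: "conv 0 f = 0"
  by (auto simp: conv_def fun_eq_iff zero_fun_apply)

lemma dm_apply: "f \<in> A \<Longrightarrow> (\<mu> \<star> \<rho>) f = \<mu> (conv \<rho> f)"
  by (simp add: dm_eq)

lemma comultE:
  assumes "f \<in> A"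
  obtains n :: nat and a b where "\<And>i. i < n \<Longrightarrow> a i \<in> A" "\<And>i. i < n \<Longrightarrow> b i \<in> A"
    "\<And>x y. x \<in> carrier G \<Longrightarrow> y \<in> carrier G \<Longrightarrow> f (x \<otimes> y) = (\<Sum>i<n. a i x * b i y)"
proof -
  obtain n :: nat and a b where ab: "\<forall>i<n. a i \<in> A \<and> b i \<in> A"
    "\<forall>x\<in>carrier G. \<forall>y\<in>carrier G. f (x \<otimes> y) = (\<Sum>i<n. a i x * b i y)"
    using comult assms unfolding comult_closed_def by blast
  show ?thesis by (rule that[of n a b]) (use ab in blast)+
qed

lemma translate_eq_sum:
  assumes "\<And>i. i < (n::nat) \<Longrightarrow> b i \<in> A"
    "\<And>x y. x \<in> carrier G \<Longrightarrow> y \<in> carrier G \<Longrightarrow> f (x \<otimes> y) = (\<Sum>i<n. a i x * b i y)" "x \<in> carrier G"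
  shows "translate x f = (\<Sum>i<n. fscale (a i x) (b i))"
proof
  fix y
  show "translate x f y = (\<Sum>i<n. fscale (a i x) (b i)) y"
    using assms(1,3) assms(2)[OF assms(3), of y] A_supp[of "b i" y for i]
    by (cases "y \<in> carrier G") (simp_all add: translate_def pointwise)
qed

lemma conv_eq_sum:
  assumes ab: "\<And>i. i < (n::nat) \<Longrightarrow> a i \<in> A" "\<And>i. i < (n::nat) \<Longrightarrow> b i \<in> A"
    "\<And>x y. x \<in> carrier G \<Longrightarrow> y \<in> carrier G \<Longrightarrow> f (x \<otimes> y) = (\<Sum>i<n. a i x * b i y)" and \<rho>: "\<rho> \<in> LF"
  shows "conv \<rho> f = (\<Sum>i<n. fscale (\<rho> (b i)) (a i))"
proof
  fix x
  show "conv \<rho> f x = (\<Sum>i<n. fscale (\<rho> (b i)) (a i)) x"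
  proof (cases "x \<in> carrier G")
    case True
    have "\<rho> (\<Sum>i<n. fscale (a i x) (b i)) = (\<Sum>i<n. a i x * \<rho> (b i))"
      by (rule LF_sum_scale[OF \<rho>]) (use ab in auto)
    moreover have "translate x f = (\<Sum>i<n. fscale (a i x) (b i))"
      by (rule translate_eq_sum[where f = f and a = a, OF ab(2,3) True])
    ultimately show ?thesis
      unfolding conv_apply[OF True] by (simp add: pointwise mult.commute)
  next
    case False
    then show ?thesis using ab(1) A_supp[of "a i" x for i] by (simp add: conv_def pointwise)
  qed
qed

lemma translate_A: assumes "f \<in> A" "x \<in> carrier G" shows "translate x f \<in> A"
proof -
  obtain n :: nat and a b where "\<And>i. i < n \<Longrightarrow> b i \<in> A"
    "\<And>x y. x \<in> carrier G \<Longrightarrow> y \<in> carrier G \<Longrightarrow> f (x \<otimes> y) = (\<Sum>i<n. a i x * b i y)"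
    using comultE[OF assms(1)] by metis
  then show ?thesis using translate_eq_sum[of n b f a x, OF _ _ assms(2)] by (auto intro!: A_sum A_scale)
qed

lemma conv_A: assumes "f \<in> A" "\<rho> \<in> LF" shows "conv \<rho> f \<in> A"
proof -
  obtain n :: nat and a b where "\<And>i. i < n \<Longrightarrow> a i \<in> A" "\<And>i. i < n \<Longrightarrow> b i \<in> A"
    "\<And>x y. x \<in> carrier G \<Longrightarrow> y \<in> carrier G \<Longrightarrow> f (x \<otimes> y) = (\<Sum>i<n. a i x * b i y)"
    using comultE[OF assms(1)] by metis
  then show ?thesis using conv_eq_sum[of n a b f \<rho>, OF _ _ _ assms(2)] by (auto intro!: A_sum A_scale)
qed

lemma translate_add: "translate x (f + g) = translate x f + translate x g"
  and translate_scale: "translate x (fscale c f) = fscale c (translate x f)"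
  and translate_mult: "translate x (f * g) = translate x f * translate x g"
  by (auto simp: translate_def fun_eq_iff pointwise)

lemma translate_power: "n > 0 \<Longrightarrow> translate x (f ^ n) = translate x f ^ n"
  by (auto simp: translate_def fun_eq_iff power_fun_apply)

lemma translate_one: "f \<in> A \<Longrightarrow> translate \<one> f = f"
  by (auto simp: translate_def fun_eq_iff A_supp)

lemma translate_at_one: "x \<in> carrier G \<Longrightarrow> translate x f \<one> = f x"
  by (simp add: translate_def)

lemma translate_translate:
  "x \<in> carrier G \<Longrightarrow> y \<in> carrier G \<Longrightarrow> translate y (translate x f) = translate (x \<otimes> y) f"
  by (auto simp: translate_def fun_eq_iff m_assoc)

lemma conv_translate: assumes "x \<in> carrier G" shows "conv \<rho> (translate x f) = translate x (conv \<rho> f)"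
proof
  fix y
  show "conv \<rho> (translate x f) y = translate x (conv \<rho> f) y"
    using assms by (cases "y \<in> carrier G")
      (simp_all add: conv_apply conv_out translate_translate translate_def[of x "conv \<rho> f"])
qed

lemma conv_add: "\<rho> \<in> LF \<Longrightarrow> f \<in> A \<Longrightarrow> g \<in> A \<Longrightarrow> conv \<rho> (f + g) = conv \<rho> f + conv \<rho> g"
  by (auto simp: conv_def fun_eq_iff translate_add LF_add translate_A plus_fun_apply)

lemma conv_scale: "\<rho> \<in> LF \<Longrightarrow> f \<in> A \<Longrightarrow> conv \<rho> (fscale c f) = fscale c (conv \<rho> f)"
  by (auto simp: conv_def fun_eq_iff translate_scale LF_scale translate_A fscale_apply)

lemma conv_eps: "f \<in> A \<Longrightarrow> conv eps f = f"
  by (rule A_eqI) (simp_all add: conv_A eps_LF conv_apply eps_apply translate_A translate_at_one)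

lemma conv_at_one: "f \<in> A \<Longrightarrow> conv \<rho> f \<one> = \<rho> f"
  by (simp add: conv_def translate_one)

lemma dm_LF: assumes "\<mu> \<in> LF" "\<rho> \<in> LF" shows "\<mu> \<star> \<rho> \<in> LF"
  by (rule LF_I) (auto simp: dm_eq assms LF_add LF_scale conv_add conv_scale conv_A A_add A_scale)

lemma conv_dm: "\<mu> \<in> LF \<Longrightarrow> \<rho> \<in> LF \<Longrightarrow> f \<in> A \<Longrightarrow> conv (\<mu> \<star> \<rho>) f = conv \<mu> (conv \<rho> f)"
  by (rule A_eqI) (simp_all add: conv_A dm_LF conv_apply[of _ \<mu>] conv_apply[of _ "\<mu> \<star> \<rho>"] dm_apply translate_A conv_translate)

lemma dm_assoc: "\<mu> \<in> LF \<Longrightarrow> \<rho> \<in> LF \<Longrightarrow> \<sigma> \<in> LF \<Longrightarrow> (\<mu> \<star> \<rho>) \<star> \<sigma> = \<mu> \<star> (\<rho> \<star> \<sigma>)"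
  by (rule LF_eqI) (auto simp: dm_LF dm_apply conv_dm conv_A)

lemma dm_eps: "\<mu> \<in> LF \<Longrightarrow> \<mu> \<star> eps = \<mu>" "\<mu> \<in> LF \<Longrightarrow> eps \<star> \<mu> = \<mu>"
  by (rule LF_eqI; auto simp: dm_LF dm_apply eps_LF conv_eps eps_apply conv_A conv_at_one)+

lemma conv_plus_left: "\<rho> \<in> LF \<Longrightarrow> \<sigma> \<in> LF \<Longrightarrow> conv (\<rho> + \<sigma>) f = conv \<rho> f + conv \<sigma> f"
  and conv_fscale_left: "conv (fscale c \<rho>) f = fscale c (conv \<rho> f)"
  by (auto simp: conv_def fun_eq_iff plus_fun_apply fscale_apply)

lemma dm_add_left: "(\<mu> + \<nu>) \<star> \<rho> = \<mu> \<star> \<rho> + \<nu> \<star> \<rho>"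
  by (auto simp: dm_eq fun_eq_iff plus_fun_apply)

lemma dm_diff_left: "(\<mu> - \<nu>) \<star> \<rho> = \<mu> \<star> \<rho> - \<nu> \<star> \<rho>"
  by (auto simp: dm_eq fun_eq_iff minus_apply)

lemma dm_scale_left: "fscale c \<mu> \<star> \<rho> = fscale c (\<mu> \<star> \<rho>)"
  by (auto simp: dm_eq fun_eq_iff fscale_apply)

lemma dm_zero_left: "0 \<star> \<rho> = 0"
  by (auto simp: dm_eq fun_eq_iff zero_fun_apply)

lemma dm_add_right: "\<mu> \<in> LF \<Longrightarrow> \<rho> \<in> LF \<Longrightarrow> \<sigma> \<in> LF \<Longrightarrow> \<mu> \<star> (\<rho> + \<sigma>) = \<mu> \<star> \<rho> + \<mu> \<star> \<sigma>"
  by (rule LF_eqI) (auto simp: dm_LF LF_plus dm_apply conv_plus_left LF_add conv_A plus_fun_apply[of "\<mu> \<star> \<rho>"])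

lemma dm_scale_right: "\<mu> \<in> LF \<Longrightarrow> \<rho> \<in> LF \<Longrightarrow> \<mu> \<star> (fscale c \<rho>) = fscale c (\<mu> \<star> \<rho>)"
  by (rule LF_eqI) (auto simp: dm_LF LF_fscale dm_apply conv_fscale_left LF_scale conv_A fscale_apply[of c "\<mu> \<star> \<rho>"])

lemma dm_diff_right: "\<mu> \<in> LF \<Longrightarrow> \<rho> \<in> LF \<Longrightarrow> \<sigma> \<in> LF \<Longrightarrow> \<mu> \<star> (\<rho> - \<sigma>) = \<mu> \<star> \<rho> - \<mu> \<star> \<sigma>"
  using dm_add_right[of \<mu> "\<rho> - \<sigma>" \<sigma>] LF_minus[of \<rho> \<sigma>] by (simp add: algebra_simps)

lemma dm_zero_right: "\<mu> \<in> LF \<Longrightarrow> \<mu> \<star> 0 = 0"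
  using dm_scale_right[of \<mu> 0 0] by simp

lemma dm_sum_left: "(\<Sum>i\<in>J. \<mu> i) \<star> \<rho> = (\<Sum>i\<in>J. \<mu> i \<star> \<rho>)"
  by (induction J rule: infinite_finite_induct) (simp_all add: dm_zero_left dm_add_left)

lemma translate_one_A: "x \<in> carrier G \<Longrightarrow> translate x one_A = one_A"
  by (auto simp: translate_def fun_eq_iff indicator_def)

lemma dm_one_A: assumes "\<mu> \<in> LF" shows "(\<mu> \<star> \<rho>) one_A = \<mu> one_A * \<rho> one_A"
proof -
  have "conv \<rho> one_A = fscale (\<rho> one_A) one_A"
    by (auto simp: conv_def fun_eq_iff translate_one_A fscale_apply)
  then show ?thesis using assms by (simp add: dm_apply LF_scale)
qed

text \<open>
  The module structure of the space of linear forms over the coordinate algebra. Multiplication by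
  an element of the augmentation ideal lowers the order, which allows inductions on the order.
\<close>

definition ctr :: "('g \<Rightarrow> 'k) \<Rightarrow> (('g \<Rightarrow> 'k) \<Rightarrow> 'k) \<Rightarrow> ('g \<Rightarrow> 'k) \<Rightarrow> 'k" where
  "ctr f \<mu> = (\<lambda>h. if h \<in> A then \<mu> (f * h) else 0)"

lemma ctr_apply: "h \<in> A \<Longrightarrow> ctr f \<mu> h = \<mu> (f * h)" by (simp add: ctr_def)

lemma ctr_LF: "f \<in> A \<Longrightarrow> \<mu> \<in> LF \<Longrightarrow> ctr f \<mu> \<in> LF"
  by (rule LF_I) (auto simp: ctr_def distrib_left LF_add LF_scale fscale_mult A_add A_scale A_mult)

lemma le_add_diff_inverse_ge: "n \<le> k + (n - k)" for n k :: nat by simp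

lemma ctr_Dd: assumes "f \<in> I k" "\<mu> \<in> Dd n" shows "ctr f \<mu> \<in> Dd (n - k)"
proof -
  have "\<mu> (f * h) = 0" if "h \<in> I (n - k)" for h
  proof -
    (* the subtraction may truncate, but then the exponent is even larger than n *)
    have "f * h \<in> I (k + (n - k))" using assms(1) that by (rule I_mult)
    then have "f * h \<in> I n" using I_antimono[of n "k + (n - k)", OF le_add_diff_inverse_ge] by blast
    then show ?thesis using assms by (auto simp: Dd_def)
  qed
  moreover have "f \<in> A" using assms I_subset_A by auto
  ultimately show ?thesis using assms(2) by (auto simp: Dd_def ctr_LF) (simp add: ctr_def)
qed

lemma ctr_aug_Dd: "f \<in> aug \<Longrightarrow> \<mu> \<in> Dd n \<Longrightarrow> ctr f \<mu> \<in> Dd (n - 1)"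
  using ctr_Dd[of f 1 \<mu> n] by (simp add: I_1)

text \<open>
  The converse of the order estimate for \<open>ctr\<close>: order can be tested after contraction with the
  augmentation ideal.
\<close>

lemma Dd_criterion:
  assumes "\<mu> \<in> LF" "\<And>f. f \<in> aug \<Longrightarrow> ctr f \<mu> \<in> Dd n"
  shows "\<mu> \<in> Dd (Suc n)"
proof -
  have "fs.subspace {f \<in> A. \<mu> f = 0}"
    by (rule fs.subspaceI) (auto simp: LF_0 LF_add LF_scale assms(1) A_add A_scale)
  then have "f \<in> {f \<in> A. \<mu> f = 0}" if "f \<in> I (Suc n)" for f
    using that
  proof (rule_tac I_Suc_induct)
    fix a g assume ag: "a \<in> aug" "g \<in> I n"
    then have "g \<in> A" using I_subset_A by auto
    have "ctr a \<mu> g = 0" using assms(2)[OF ag(1)] ag(2) by (rule Dd_vanish)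
    then show "a * g \<in> {f \<in> A. \<mu> f = 0}" using \<open>g \<in> A\<close> ag(1) by (auto simp: ctr_apply aug_A A_mult)
  qed
  then show ?thesis using assms(1) by (auto simp: Dd_def)
qed

lemma ctr_diff_right: "ctr f (\<mu> - \<nu>) = ctr f \<mu> - ctr f \<nu>"
  by (auto simp: ctr_def fun_eq_iff plus_fun_apply minus_apply)

lemma ctr_add_left: "\<mu> \<in> LF \<Longrightarrow> f \<in> A \<Longrightarrow> g \<in> A \<Longrightarrow> ctr (f + g) \<mu> = ctr f \<mu> + ctr g \<mu>"
  by (auto simp: ctr_def fun_eq_iff plus_fun_apply[of "ctr f \<mu>"] plus_fun_apply[of "\<lambda>h. if h \<in> A then \<mu> (f * h) else 0"]
      distrib_right LF_add A_mult)

lemma ctr_scale_left: "\<mu> \<in> LF \<Longrightarrow> f \<in> A \<Longrightarrow> ctr (fscale c f) \<mu> = fscale c (ctr f \<mu>)"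
  by (auto simp: ctr_def fun_eq_iff fscale_apply[of c "\<lambda>h. if h \<in> A then \<mu> (f * h) else 0"]
      fscale_mult LF_scale A_mult)

lemma ctr_ctr: "g \<in> A \<Longrightarrow> ctr f (ctr g \<mu>) = ctr (f * g) \<mu>" if "f \<in> A"
  using that by (auto simp: ctr_def fun_eq_iff A_mult mult_ac)

lemma ctr_one: "\<mu> \<in> LF \<Longrightarrow> ctr one_A \<mu> = \<mu>"
  by (auto simp: ctr_def fun_eq_iff LF_out)

text \<open>
  The reduced comultiplication of an element of the augmentation ideal.
\<close>

definition aug_decomp :: "('g \<Rightarrow> 'k) \<Rightarrow> nat \<Rightarrow> (nat \<Rightarrow> 'g \<Rightarrow> 'k) \<Rightarrow> (nat \<Rightarrow> 'g \<Rightarrow> 'k) \<Rightarrow> bool" where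
  "aug_decomp f n a b \<longleftrightarrow> (\<forall>i<n. a i \<in> aug \<and> b i \<in> aug) \<and>
     (\<forall>x\<in>carrier G. \<forall>y\<in>carrier G. f (x \<otimes> y) = f x + f y + (\<Sum>i<n. a i x * b i y))"

lemma aug_decompD:
  assumes "aug_decomp f n a b"
  shows "i < n \<Longrightarrow> a i \<in> aug" "i < n \<Longrightarrow> b i \<in> aug"
    "x \<in> carrier G \<Longrightarrow> y \<in> carrier G \<Longrightarrow> f (x \<otimes> y) = f x + f y + (\<Sum>i<n. a i x * b i y)"
  using assms by (simp_all add: aug_decomp_def)

lemma aug_decomp_ex:
  assumes f: "f \<in> aug"
  shows "\<exists>n a b. aug_decomp f n a b"
proof -
  obtain n :: nat and a b where ab: "\<And>i. i < n \<Longrightarrow> a i \<in> A" "\<And>i. i < n \<Longrightarrow> b i \<in> A"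
    "\<And>x y. x \<in> carrier G \<Longrightarrow> y \<in> carrier G \<Longrightarrow> f (x \<otimes> y) = (\<Sum>i<n. a i x * b i y)"
    using comultE[OF aug_A[OF f]] by metis
  have fx: "f x = (\<Sum>i<n. a i x * b i \<one>)" "f x = (\<Sum>i<n. a i \<one> * b i x)" if "x \<in> carrier G" for x
    using ab(3)[of x \<one>] ab(3)[of \<one> x] that by simp_all
  have f1: "(\<Sum>i<n. a i \<one> * b i \<one>) = 0" using fx(1)[of \<one>] f by (simp add: aug_iff)
  have "aug_decomp f n (\<lambda>i. normalized (a i)) (\<lambda>i. normalized (b i))"
    unfolding aug_decomp_def
  proof (intro conjI allI impI ballI)
    fix x y assume xy: "x \<in> carrier G" "y \<in> carrier G"
    have "(\<Sum>i<n. normalized (a i) x * normalized (b i) y) =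
      (\<Sum>i<n. a i x * b i y) - (\<Sum>i<n. a i x * b i \<one>) - (\<Sum>i<n. a i \<one> * b i y) + (\<Sum>i<n. a i \<one> * b i \<one>)"
      using xy by (simp add: pointwise algebra_simps sum.distrib sum_subtractf)
    then show "f (x \<otimes> y) = f x + f y + (\<Sum>i<n. normalized (a i) x * normalized (b i) y)"
      using ab(3)[OF xy] fx(1)[OF xy(1)] fx(2)[OF xy(2)] f1 by simp
  qed (use ab(1,2) aug_normalize in auto)
  then show ?thesis by blast
qed

text \<open>
  A twisted product rule: the comultiplication is multiplicative, and \<open>f (x y)\<close> is \<open>f x + f y\<close> up to the
  reduced comultiplication.
\<close>

lemma conv_mult:
  assumes "f \<in> aug" "g \<in> A" "\<rho> \<in> LF"
    and dec: "aug_decomp f n a b"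
  shows "conv \<rho> (f * g) = f * conv \<rho> g + conv (ctr f \<rho>) g + (\<Sum>i<n. a i * conv (ctr (b i) \<rho>) g)"
proof (rule A_eqI)
  have fA: "f \<in> A" and abA: "\<And>i. i < n \<Longrightarrow> a i \<in> A" "\<And>i. i < n \<Longrightarrow> b i \<in> A"
    using assms(1) aug_A aug_decompD(1,2)[OF dec] by auto
  note ab = aug_decompD[OF dec]
  show "conv \<rho> (f * g) \<in> A" using assms fA by (simp add: conv_A A_mult)
  show "f * conv \<rho> g + conv (ctr f \<rho>) g + (\<Sum>i<n. a i * conv (ctr (b i) \<rho>) g) \<in> A"
    using assms fA abA by (auto intro!: A_add A_mult A_sum conv_A ctr_LF)
  fix x assume x: "x \<in> carrier G"
  have tg: "translate x g \<in> A" using assms x by (simp add: translate_A)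
  have "translate x f = fscale (f x) one_A + f + (\<Sum>i<n. fscale (a i x) (b i))"
  proof
    fix y
    show "translate x f y = (fscale (f x) one_A + f + (\<Sum>i<n. fscale (a i x) (b i))) y"
      using ab(3)[OF x, of y] A_supp[OF fA, of y] A_supp[OF abA(2), of _ y]
      by (cases "y \<in> carrier G") (simp_all add: translate_def pointwise)
  qed
  then have "translate x (f * g) = fscale (f x) (translate x g) + f * translate x g
      + (\<Sum>i<n. fscale (a i x) (b i * translate x g))"
    using tg by (simp add: translate_mult distrib_right fscale_mult sum_distrib_right)
  moreover have "fscale (f x) (translate x g) \<in> A" "f * translate x g \<in> A"
    "\<And>i. i < n \<Longrightarrow> b i * translate x g \<in> A"
    using tg fA abA by (auto intro: A_scale A_mult)
  moreover from this(3) have "(\<Sum>i<n. fscale (a i x) (b i * translate x g)) \<in> A"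
    by (auto intro!: A_sum A_scale)
  ultimately have "\<rho> (translate x (f * g)) = f x * \<rho> (translate x g) + \<rho> (f * translate x g)
     + (\<Sum>i<n. a i x * \<rho> (b i * translate x g))"
    using LF_sum_scale[OF assms(3), of "{..<n}" "\<lambda>i. b i * translate x g" "\<lambda>i. a i x"] tg
    by (simp add: LF_add[OF assms(3)] LF_scale[OF assms(3)] A_add)
  then show "conv \<rho> (f * g) x = (f * conv \<rho> g + conv (ctr f \<rho>) g + (\<Sum>i<n. a i * conv (ctr (b i) \<rho>) g)) x"
    using x tg by (simp add: pointwise conv_apply ctr_apply)
qed

text \<open>
  By the product rule, every factor from the augmentation ideal either survives or lowers the order of
  the distribution.
\<close>

lemma conv_I: "\<rho> \<in> Dd m \<Longrightarrow> g \<in> I n \<Longrightarrow> conv \<rho> g \<in> I (n + 1 - m)"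
proof (induction n arbitrary: m \<rho> g)
  case 0
  then show ?case
    by (cases "m = 0") (auto simp: Dd_0 Dd_LF conv_cong_zero intro!: conv_A)
next
  case (Suc n)
  show ?case
  proof (cases "m = 0")
    case True
    then show ?thesis using Suc.prems by (simp add: Dd_0 conv_cong_zero)
  next
    case False
    have \<rho>: "\<rho> \<in> LF" using Suc.prems Dd_LF by auto
    have "fs.subspace {g \<in> A. conv \<rho> g \<in> I (Suc n + 1 - m)}"
      by (rule fs.subspaceI)
        (auto simp: conv_add conv_scale \<rho> A_add A_scale I_add I_scale conv_scale[OF \<rho> A_zero, of 0, simplified])
    with Suc.prems(2) have "g \<in> {g \<in> A. conv \<rho> g \<in> I (Suc n + 1 - m)}"
    proof (rule I_Suc_induct)
      fix f g assume fg: "f \<in> aug" "g \<in> I n"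
      then have gA: "g \<in> A" using I_subset_A by blast
      obtain l a b where dec: "aug_decomp f l a b" using aug_decomp_ex[OF fg(1)] by blast
      note ab = aug_decompD[OF dec]
      have le: "Suc n + 1 - m \<le> n + 1 - (m - 1)" "Suc n + 1 - m \<le> Suc (n + 1 - m)" using False by auto
      have c: "conv (ctr h \<rho>) g \<in> I (Suc n + 1 - m)" if "h \<in> aug" for h
        using Suc.IH[OF ctr_aug_Dd[OF that Suc.prems(1)] fg(2)] I_antimono[OF le(1)] by auto
      have "f * conv \<rho> g \<in> I (Suc (n + 1 - m))"
        using fg Suc.IH[OF Suc.prems(1)] by (intro I_Suc_gen) auto
      then have "f * conv \<rho> g \<in> I (Suc n + 1 - m)" using I_antimono[OF le(2)] by auto
      moreover have "(\<Sum>i<l. a i * conv (ctr (b i) \<rho>) g) \<in> I (Suc n + 1 - m)"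
        using c ab(1,2) by (intro I_sum I_A_mult) (auto simp: aug_A)
      ultimately have "conv \<rho> (f * g) \<in> I (Suc n + 1 - m)"
        unfolding conv_mult[OF fg(1) gA \<rho> dec] using c[OF fg(1)] by (intro I_add)
      then show "f * g \<in> {g \<in> A. conv \<rho> g \<in> I (Suc n + 1 - m)}" using fg gA by (auto simp: aug_A A_mult)
    qed
    then show ?thesis by simp
  qed
qed

lemma dm_Dd: assumes "\<mu> \<in> Dd m" "\<rho> \<in> Dd n" shows "\<mu> \<star> \<rho> \<in> Dd (m + n - 1)"
proof (cases "n = 0")
  case True
  then show ?thesis using assms by (simp add: Dd_0 dm_zero_right Dd_LF)
next
  case False
  have "(\<mu> \<star> \<rho>) f = 0" if f: "f \<in> I (m + n - 1)" for f
  proof -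
    have "conv \<rho> f \<in> I (m + n - 1 + 1 - n)" using assms f by (intro conv_I)
    then have "conv \<rho> f \<in> I m" using False by simp
    then have "\<mu> (conv \<rho> f) = 0" using assms(1) by (intro Dd_vanish)
    moreover have "f \<in> A" using f I_subset_A by blast
    ultimately show ?thesis by (simp add: dm_apply)
  qed
  then show ?thesis using assms by (simp add: Dd_def dm_LF)
qed

text \<open>
  The dual form of the product rule for \<open>conv\<close>.
\<close>

lemma ctr_dm:
  assumes "f \<in> aug" "\<mu> \<in> LF" "\<rho> \<in> LF"
    and dec: "aug_decomp f n a b"
  shows "ctr f (\<mu> \<star> \<rho>) = ctr f \<mu> \<star> \<rho> + \<mu> \<star> ctr f \<rho> + (\<Sum>i<n. ctr (a i) \<mu> \<star> ctr (b i) \<rho>)"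
proof (rule LF_eqI)
  have fA: "f \<in> A" and abA: "\<And>i. i < n \<Longrightarrow> a i \<in> A" "\<And>i. i < n \<Longrightarrow> b i \<in> A"
    using assms(1) aug_A aug_decompD(1,2)[OF dec] by auto
  note ab = aug_decompD[OF dec]
  show "ctr f (\<mu> \<star> \<rho>) \<in> LF" using assms fA by (simp add: ctr_LF dm_LF)
  show "ctr f \<mu> \<star> \<rho> + \<mu> \<star> ctr f \<rho> + (\<Sum>i<n. ctr (a i) \<mu> \<star> ctr (b i) \<rho>) \<in> LF"
    using assms fA abA by (auto intro!: LF_plus LF_setsum dm_LF ctr_LF)
  fix g assume g: "g \<in> A"
  have "\<mu> (conv \<rho> (f * g)) = \<mu> (f * conv \<rho> g) + \<mu> (conv (ctr f \<rho>) g) + (\<Sum>i<n. \<mu> (a i * conv (ctr (b i) \<rho>) g))"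
  proof -
    have 1: "f * conv \<rho> g \<in> A" "conv (ctr f \<rho>) g \<in> A" "\<And>i. i < n \<Longrightarrow> a i * conv (ctr (b i) \<rho>) g \<in> A"
      using g fA abA assms(3) by (auto intro!: A_mult conv_A ctr_LF)
    then have "(\<Sum>i<n. a i * conv (ctr (b i) \<rho>) g) \<in> A" by (auto intro!: A_sum)
    then show ?thesis
      unfolding conv_mult[OF assms(1) g assms(3) dec]
      using 1 LF_sum[OF assms(2), of "{..<n}" "\<lambda>i. a i * conv (ctr (b i) \<rho>) g"]
      by (simp add: LF_add[OF assms(2)] A_add)
  qed
  then show "ctr f (\<mu> \<star> \<rho>) g = (ctr f \<mu> \<star> \<rho> + \<mu> \<star> ctr f \<rho> + (\<Sum>i<n. ctr (a i) \<mu> \<star> ctr (b i) \<rho>)) g"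
    using g fA abA assms(2,3)
    by (simp add: plus_fun_apply sum_fun_apply) (simp add: ctr_apply dm_apply A_mult conv_A ctr_LF)
qed

text \<open>
  Commutators drop the order by one. Contracting with a function of the augmentation ideal reproduces
  commutators of smaller total order, plus terms from the reduced comultiplication, which have the
  required order individually.
\<close>

lemma dm_commutator_aux:
  "N = m + n \<Longrightarrow> \<mu> \<in> Dd (Suc m) \<Longrightarrow> \<rho> \<in> Dd (Suc n) \<Longrightarrow> \<mu> \<star> \<rho> - \<rho> \<star> \<mu> \<in> Dd N"
proof (induction N arbitrary: m n \<mu> \<rho>)
  case 0
  then have "\<mu> = fscale (\<mu> one_A) eps" using Dd_1 by simp
  then have "\<mu> \<star> \<rho> = \<rho> \<star> \<mu>"
    using 0 Dd_LF by (metis dm_scale_left dm_scale_right dm_eps eps_LF)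
  then show ?case by simp
next
  case (Suc N)
  note LF = Dd_LF[OF Suc.prems(2)] Dd_LF[OF Suc.prems(3)]
  consider "m = 0" | "n = 0" | "m > 0" "n > 0" by auto
  then show ?case
  proof cases
    case 1
    then have "\<mu> = fscale (\<mu> one_A) eps" using Dd_1 Suc.prems by simp
    then have "\<mu> \<star> \<rho> = \<rho> \<star> \<mu>"
      using LF by (metis dm_scale_left dm_scale_right dm_eps eps_LF)
    then show ?thesis by simp
  next
    case 2
    then have "\<rho> = fscale (\<rho> one_A) eps" using Dd_1 Suc.prems by simp
    then have "\<mu> \<star> \<rho> = \<rho> \<star> \<mu>"
      using LF by (metis dm_scale_left dm_scale_right dm_eps eps_LF)
    then show ?thesis by simp
  next
    case 3
    show ?thesis
    proof (rule Dd_criterion)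
      show "\<mu> \<star> \<rho> - \<rho> \<star> \<mu> \<in> LF" using LF by (simp add: LF_minus dm_LF)
      fix f assume f: "f \<in> aug"
      obtain l a b where dec: "aug_decomp f l a b" using aug_decomp_ex[OF f] by blast
      note ab = aug_decompD[OF dec]
      have \<mu>: "ctr h \<mu> \<in> Dd (Suc (m - 1))" if "h \<in> aug" for h
        using ctr_aug_Dd[OF that Suc.prems(2)] 3 by simp
      have \<rho>: "ctr h \<rho> \<in> Dd (Suc (n - 1))" if "h \<in> aug" for h
        using ctr_aug_Dd[OF that Suc.prems(3)] 3 by simp
      have 1: "ctr f \<mu> \<star> \<rho> - \<rho> \<star> ctr f \<mu> \<in> Dd N"
        by (rule Suc.IH[OF _ \<mu>[OF f] Suc.prems(3)]) (use Suc.prems(1) 3 in simp)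
      have 2: "\<mu> \<star> ctr f \<rho> - ctr f \<rho> \<star> \<mu> \<in> Dd N"
        by (rule Suc.IH[OF _ Suc.prems(2) \<rho>[OF f]]) (use Suc.prems(1) 3 in simp)
      have N: "Suc (m - 1) + Suc (n - 1) - 1 = N" "Suc (n - 1) + Suc (m - 1) - 1 = N"
        using Suc.prems(1) 3 by auto
      have 3: "(\<Sum>i<l. ctr (a i) \<mu> \<star> ctr (b i) \<rho>) - (\<Sum>i<l. ctr (a i) \<rho> \<star> ctr (b i) \<mu>) \<in> Dd N"
        using dm_Dd[OF \<mu> \<rho>, unfolded N] dm_Dd[OF \<rho> \<mu>, unfolded N] ab(1,2)
        by (intro Dd_minus Dd_sum) auto
      have "ctr f (\<mu> \<star> \<rho> - \<rho> \<star> \<mu>) = (ctr f \<mu> \<star> \<rho> - \<rho> \<star> ctr f \<mu>) + (\<mu> \<star> ctr f \<rho> - ctr f \<rho> \<star> \<mu>)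
         + ((\<Sum>i<l. ctr (a i) \<mu> \<star> ctr (b i) \<rho>) - (\<Sum>i<l. ctr (a i) \<rho> \<star> ctr (b i) \<mu>))"
        unfolding ctr_diff_right ctr_dm[OF f LF dec] ctr_dm[OF f LF(2,1) dec] by simp
      then show "ctr f (\<mu> \<star> \<rho> - \<rho> \<star> \<mu>) \<in> Dd N" using 1 2 3 by (simp add: Dd_plus)
    qed
  qed
qed

lemma dm_commutator: "\<mu> \<in> Dd (Suc m) \<Longrightarrow> \<rho> \<in> Dd (Suc n) \<Longrightarrow> \<mu> \<star> \<rho> - \<rho> \<star> \<mu> \<in> Dd (m + n)"
  using dm_commutator_aux by blast

abbreviation pow where "pow \<equiv> dist_power G A"

lemma pow_0: "pow \<delta> 0 = eps" by (simp add: eps_def)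

declare dist_power.simps(1) [simp del]

lemma pow_LF: "\<delta> \<in> LF \<Longrightarrow> pow \<delta> k \<in> LF"
  by (induction k) (simp_all add: pow_0 eps_LF dm_LF)

lemma pow_1: "\<delta> \<in> LF \<Longrightarrow> pow \<delta> (Suc 0) = \<delta>"
  by (simp add: pow_0 dm_eps)

lemma pow_Dd: "\<delta> \<in> Dd (Suc n) \<Longrightarrow> pow \<delta> k \<in> Dd (Suc (k * n))"
proof (induction k)
  case 0 then show ?case by (simp add: pow_0 eps_Dd)
next
  case (Suc k)
  then show ?case using dm_Dd[of \<delta> "Suc n" "pow \<delta> k" "Suc (k * n)"] by simp
qed

lemma pow_scale: "\<delta> \<in> LF \<Longrightarrow> pow (fscale c \<delta>) k = fscale (c ^ k) (pow \<delta> k)"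
  by (induction k) (simp_all add: pow_0 dm_scale_left dm_scale_right pow_LF)

text \<open>
  Contraction acts on powers like a derivation up to lower order, because commutators have lower order.
\<close>

lemma ctr_pow:
  assumes \<delta>: "\<delta> \<in> Dd (Suc n)" and n: "n > 0" and f: "f \<in> aug"
  shows "ctr f (pow \<delta> (Suc k)) - fscale (of_nat (Suc k)) (pow \<delta> k \<star> ctr f \<delta>) \<in> Dd (Suc k * n - 1)"
proof (induction k)
  case 0
  then show ?case using Dd_LF[OF \<delta>] f by (simp add: pow_1 pow_0 dm_eps ctr_LF aug_A)
next
  case (Suc k)
  note L = Dd_LF[OF \<delta>]
  define P where "P = pow \<delta> (Suc k)"
  have PL: "P \<in> LF" using pow_LF[OF L] by (simp only: P_def)
  have PD: "P \<in> Dd (Suc (Suc k * n))" using pow_Dd[OF \<delta>] by (simp only: P_def)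
  have Pe: "P = \<delta> \<star> pow \<delta> k" by (simp add: P_def)
  obtain l a b where dec: "aug_decomp f l a b" using aug_decomp_ex[OF f] by blast
      note ab = aug_decompD[OF dec]
  have cn: "ctr h \<delta> \<in> Dd n" if "h \<in> aug" for h using ctr_aug_Dd[OF that \<delta>] by simp
  have cP: "ctr h P \<in> Dd (Suc k * n)" if "h \<in> aug" for h using ctr_aug_Dd[OF that PD] by simp
  have cL: "ctr f \<delta> \<in> LF" "ctr f P \<in> LF" using cn cP f Dd_LF by blast+
  have 1: "(\<Sum>i<l. ctr (a i) \<delta> \<star> ctr (b i) P) \<in> Dd (Suc (Suc k) * n - 1)"
    using dm_Dd[OF cn cP] ab(1,2) by (intro Dd_sum) (auto simp: algebra_simps)
  have 2: "ctr f \<delta> \<star> P - P \<star> ctr f \<delta> \<in> Dd (Suc (Suc k) * n - 1)"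
  proof -
    have "ctr f \<delta> \<in> Dd (Suc (n - 1))" using cn[OF f] n by simp
    from dm_commutator[OF this PD] show ?thesis using n by (simp add: algebra_simps)
  qed
  define R where "R = ctr f P - fscale (of_nat (Suc k)) (pow \<delta> k \<star> ctr f \<delta>)"
  have "R \<in> Dd (Suc k * n - 1)" using Suc by (simp only: R_def P_def)
  then have "\<delta> \<star> R \<in> Dd (Suc n + (Suc k * n - 1) - 1)" by (rule dm_Dd[OF \<delta>])
  then have 3: "\<delta> \<star> R \<in> Dd (Suc (Suc k) * n - 1)" using n by (simp add: algebra_simps)
  have "\<delta> \<star> R = \<delta> \<star> ctr f P - fscale (of_nat (Suc k)) (P \<star> ctr f \<delta>)"
    unfolding R_def Pe using L cL(1) cL(2)[unfolded Pe] pow_LF[OF L]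
    by (simp add: dm_diff_right LF_fscale dm_LF dm_scale_right dm_assoc)
  moreover have "ctr f (\<delta> \<star> P) = ctr f \<delta> \<star> P + \<delta> \<star> ctr f P + (\<Sum>i<l. ctr (a i) \<delta> \<star> ctr (b i) P)"
    by (rule ctr_dm[OF f L PL dec])
  moreover have "fscale (of_nat (Suc (Suc k))) (P \<star> ctr f \<delta>)
      = P \<star> ctr f \<delta> + fscale (of_nat (Suc k)) (P \<star> ctr f \<delta>)"
    by (subst of_nat_Suc) (simp only: fs.scale_left_distrib fs.scale_one)
  ultimately have "ctr f (\<delta> \<star> P) - fscale (of_nat (Suc (Suc k))) (P \<star> ctr f \<delta>)
     = (ctr f \<delta> \<star> P - P \<star> ctr f \<delta>) + \<delta> \<star> R + (\<Sum>i<l. ctr (a i) \<delta> \<star> ctr (b i) P)"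
    by (simp del: of_nat_Suc)
  moreover have "\<dots> \<in> Dd (Suc (Suc k) * n - 1)" using 1 2 3 by (intro Dd_plus)
  ultimately have "ctr f (\<delta> \<star> P) - fscale (of_nat (Suc (Suc k))) (P \<star> ctr f \<delta>) \<in> Dd (Suc (Suc k) * n - 1)"
    by (simp only:)
  moreover have "pow \<delta> (Suc (Suc k)) = \<delta> \<star> P" unfolding P_def by simp
  ultimately show ?case unfolding P_def by (simp only:)
qed

text \<open>
  In characteristic \<open>p\<close> the leading term of the contraction of \<open>\<delta>\<^sup>p\<close> has coefficient \<open>p\<close>, so the order of
  \<open>\<delta>\<^sup>p\<close> is smaller by one than that of a general product of \<open>p\<close> factors.
\<close>

lemma pow_p_Dd: assumes \<delta>: "\<delta> \<in> Dd (Suc n)" and n: "n > 0" shows "pow \<delta> p \<in> Dd (p * n)"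
proof -
  obtain k where k: "p = Suc k" using p_gt_1 by (cases p) auto
  have z: "of_nat p = (0 :: 'k)" unfolding p_CHAR by simp
  have "pow \<delta> p \<in> Dd (Suc (p * n - 1))"
  proof (rule Dd_criterion)
    show "pow \<delta> p \<in> LF" using pow_LF Dd_LF \<delta> by blast
    fix f assume "f \<in> aug"
    from ctr_pow[OF \<delta> n this, of k] show "ctr f (pow \<delta> p) \<in> Dd (p * n - 1)"
      unfolding k[symmetric] z by simp
  qed
  then show ?thesis using n by simp
qed

end

section \<open>Distributions on Frobenius powers\<close>

context char_p_group
begin

text \<open>
  Powers of the augmentation ideal are recovered from the distributions that kill them.
\<close>

lemma Dd_separates:
  assumes "f \<in> A" "\<And>\<mu>. \<mu> \<in> Dd n \<Longrightarrow> \<mu> f = 0"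
  shows "f \<in> I n"
proof (rule ccontr)
  assume "f \<notin> I n"
  then obtain \<phi> where \<phi>: "\<And>u v. \<phi> (u + v) = \<phi> u + \<phi> v" "\<And>c u. \<phi> (fscale c u) = c * \<phi> u"
    "\<And>u. u \<in> I n \<Longrightarrow> \<phi> u = 0" "\<phi> f = 1"
    using functional_separates[OF I_subspace] by metis
  define \<mu> where "\<mu> = (\<lambda>g. if g \<in> A then \<phi> g else 0)"
  have "\<mu> \<in> LF" by (rule LF_I) (auto simp: \<mu>_def \<phi> A_add A_scale)
  then have "\<mu> \<in> Dd n" using \<phi>(3) I_subset_A by (auto simp: Dd_def \<mu>_def)
  then show False using assms \<phi>(4) by (force simp: \<mu>_def)
qed

abbreviation Dp :: "nat \<Rightarrow> (('g \<Rightarrow> 'k) \<Rightarrow> 'k) set" where "Dp n \<equiv> dist_plus G A n"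

lemma Dp_iff: "\<mu> \<in> Dp n \<longleftrightarrow> \<mu> \<in> Dd (Suc n) \<and> \<mu> one_A = 0"
  by (simp add: dist_plus_def dist_eq_Dd)

lemma Dp_Dd: "\<mu> \<in> Dp n \<Longrightarrow> \<mu> \<in> Dd (Suc n)"
  and Dp_one: "\<mu> \<in> Dp n \<Longrightarrow> \<mu> one_A = 0"
  and Dp_LF: "\<mu> \<in> Dp n \<Longrightarrow> \<mu> \<in> LF"
  by (auto simp: Dp_iff Dd_LF)

lemma Dp_subspace: "fs.subspace (Dp n)"
  by (rule fs.subspaceI) (auto simp: Dp_iff Dd_plus Dd_fscale zero_fun_apply plus_fun_apply[of _ _ one_A] fscale_apply[of _ _ one_A])

lemmas Dp_plus = fs.subspace_add[OF Dp_subspace]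
  and Dp_minus = fs.subspace_diff[OF Dp_subspace]
  and Dp_fscale = fs.subspace_scale[OF Dp_subspace]
  and Dp_zero [simp] = fs.subspace_0[OF Dp_subspace]
  and Dp_sum = fs.subspace_sum[OF Dp_subspace]

lemma Dp_mono: "m \<le> n \<Longrightarrow> \<mu> \<in> Dp m \<Longrightarrow> \<mu> \<in> Dp n"
  by (auto simp: Dp_iff intro: Dd_mono[of "Suc m" "Suc n"])

lemma Dp_0: "\<mu> \<in> Dp 0 \<longleftrightarrow> \<mu> = 0"
  using Dd_1[of \<mu>] by (auto simp: Dp_iff zero_fun_apply)

text \<open>
  The projection to distributions without constant term, along evaluation at the identity.
\<close>

definition plus_part :: "(('g \<Rightarrow> 'k) \<Rightarrow> 'k) \<Rightarrow> ('g \<Rightarrow> 'k) \<Rightarrow> 'k" where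
  "plus_part \<mu> = \<mu> - fscale (\<mu> one_A) eps"

lemma one_A_at_one [simp]: "one_A \<one> = 1" by simp

lemma eps_one_A: "eps one_A = 1" by (simp add: eps_apply)

lemma plus_part_Dp: assumes "\<mu> \<in> Dd (Suc n)" shows "plus_part \<mu> \<in> Dp n"
proof -
  have "eps \<in> Dd (Suc n)" using eps_Dd Dd_mono[of "Suc 0" "Suc n"] by auto
  then show ?thesis
    using assms unfolding plus_part_def
    by (simp add: Dp_iff Dd_minus Dd_fscale minus_apply[of _ _ one_A] fscale_apply[of _ _ one_A] eps_one_A)
qed

lemma plus_part_eq: "\<mu> = plus_part \<mu> + fscale (\<mu> one_A) eps"
  by (simp add: plus_part_def)

lemma plus_part_aug: "f \<in> aug \<Longrightarrow> plus_part \<mu> f = \<mu> f"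
  by (simp add: plus_part_def minus_apply[of _ _ f] fscale_apply[of _ _ f] eps_apply aug_iff)

lemma plus_part_id: "\<mu> \<in> Dp n \<Longrightarrow> plus_part \<mu> = \<mu>"
  by (simp add: plus_part_def Dp_one)

lemma Dp_separates:
  assumes "f \<in> aug" "\<And>\<mu>. \<mu> \<in> Dp n \<Longrightarrow> \<mu> f = 0"
  shows "f \<in> I (Suc n)"
  using Dd_separates[of f "Suc n"] assms plus_part_Dp plus_part_aug aug_A by metis

lemma Dp_normalized: "\<mu> \<in> Dp n \<Longrightarrow> f \<in> A \<Longrightarrow> \<mu> (normalized f) = \<mu> f"
  using Dp_LF[of \<mu> n] Dp_one[of \<mu> n] by (simp add: LF_diff LF_scale A_scale)

lemma Dp_vanish: "\<mu> \<in> Dp n \<Longrightarrow> f \<in> I (Suc n) \<Longrightarrow> \<mu> f = 0"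
  using Dp_Dd Dd_vanish by blast

lemma dm_Dp: assumes "\<mu> \<in> Dp m" "\<rho> \<in> Dp n" shows "\<mu> \<star> \<rho> \<in> Dp (m + n)"
  using dm_Dd[OF assms[THEN Dp_Dd]] dm_one_A[OF Dp_LF[OF assms(1)], of \<rho>] Dp_one[OF assms(1)]
  by (simp add: Dp_iff)

lemma dm_commutator_Dp:
  assumes "\<mu> \<in> Dp m" "\<rho> \<in> Dp n" "m + n > 0" shows "\<mu> \<star> \<rho> - \<rho> \<star> \<mu> \<in> Dp (m + n - 1)"
  using assms(3) dm_commutator[OF assms(1,2)[THEN Dp_Dd]] Dp_one[OF assms(1)] Dp_one[OF assms(2)]
    dm_one_A[OF Dp_LF[OF assms(1)], of \<rho>] dm_one_A[OF Dp_LF[OF assms(2)], of \<mu>]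
  by (simp add: Dp_iff minus_apply[of _ _ one_A])

lemma pow_p_Dp: assumes "\<delta> \<in> Dp n" "n > 0" shows "pow \<delta> p \<in> Dp (p * n - 1)"
proof -
  have "pow \<delta> p \<in> Dd (p * n)" using assms pow_p_Dd Dp_Dd by blast
  moreover have "pow \<delta> (Suc k) one_A = 0" for k
    using assms dm_one_A[OF Dp_LF[OF assms(1)]] Dp_one[OF assms(1)] by simp
  then have "pow \<delta> p one_A = 0" using char_pos by (cases p) auto
  ultimately show ?thesis using assms by (simp add: Dp_iff)
qed

lemma conv_one_A: "conv \<rho> one_A = fscale (\<rho> one_A) one_A"
  by (rule ext) (auto simp: conv_def translate_one_A fscale_apply)

lemma I_le: "f \<in> I m \<Longrightarrow> n \<le> m \<Longrightarrow> f \<in> I n" using I_antimono by blast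

lemma p_nz [simp]: "p \<noteq> 0" using char_pos by (simp del: char_pos)

text \<open>
  On \<open>q\<close>-th powers a distribution of order at most \<open>q\<close> behaves like a tangent vector: the product of
  two \<open>q\<close>-th powers from the augmentation ideal lies in its power with exponent \<open>2 q > q\<close>.
\<close>

lemma Dp_frobenius_derivation:
  assumes \<rho>: "\<rho> \<in> Dp (p ^ s)" and f: "f \<in> A" and g: "g \<in> A"
  shows "\<rho> (f ^ (p ^ s) * g ^ (p ^ s)) = \<rho> (f ^ (p ^ s)) * g \<one> ^ (p ^ s) + f \<one> ^ (p ^ s) * \<rho> (g ^ (p ^ s))"
proof -
  let ?q = "p ^ s"
  define f' g' where "f' = normalized f" and "g' = normalized g"
  have f': "f' \<in> aug" and g': "g' \<in> aug" using f g aug_normalize by (auto simp: f'_def g'_def)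
  have q: "?q > 0" by simp
  have fq: "h ^ ?q = normalized h ^ ?q + fscale (h \<one> ^ ?q) one_A" for h
    using frobenius_add[of "normalized h" "fscale (h \<one>) one_A" s] q
    by (simp add: fscale_power one_A_power)
  have fA: "f' ^ ?q \<in> A" "g' ^ ?q \<in> A" using f' g' q by (auto intro: A_power aug_A)
  have L: "\<rho> \<in> LF" using \<rho> Dp_LF by blast
  have "f' ^ ?q * g' ^ ?q \<in> I (?q + ?q)" using f' g' q by (intro I_mult aug_power)
  then have z: "\<rho> (f' ^ ?q * g' ^ ?q) = 0" using \<rho> Dp_vanish I_le[of _ "?q + ?q" "Suc ?q"] q by simp
  have "f ^ ?q * g ^ ?q = f' ^ ?q * g' ^ ?q + fscale (g \<one> ^ ?q) (f' ^ ?q) + fscale (f \<one> ^ ?q) (g' ^ ?q)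
      + fscale (f \<one> ^ ?q * g \<one> ^ ?q) one_A"
    unfolding fq[of f] fq[of g] f'_def[symmetric] g'_def[symmetric] using fA
    by (simp add: algebra_simps fscale_mult)
  then have 1: "\<rho> (f ^ ?q * g ^ ?q) = g \<one> ^ ?q * \<rho> (f' ^ ?q) + f \<one> ^ ?q * \<rho> (g' ^ ?q)"
    using fA z Dp_one[OF \<rho>] by (simp add: LF_add[OF L] LF_scale[OF L] A_add A_mult A_scale)
  have 2: "\<rho> (h ^ ?q) = \<rho> (normalized h ^ ?q)" if "h \<in> A" for h
  proof -
    have "normalized h ^ ?q \<in> A" using A_power[OF aug_A[OF aug_normalize[OF that]]] q by blast
    then show ?thesis unfolding fq[of h] using Dp_one[OF \<rho>] by (simp add: LF_add[OF L] LF_scale[OF L] A_scale)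
  qed
  show ?thesis unfolding 1 2[OF f] 2[OF g] f'_def g'_def by simp
qed

lemma conv_frobenius_derivation:
  assumes \<rho>: "\<rho> \<in> Dp (p ^ s)" and f: "f \<in> A" and g: "g \<in> A"
  shows "conv \<rho> ((f * g) ^ (p ^ s)) = conv \<rho> (f ^ (p ^ s)) * g ^ (p ^ s) + f ^ (p ^ s) * conv \<rho> (g ^ (p ^ s))"
proof
  let ?q = "p ^ s"
  fix x
  show "conv \<rho> ((f * g) ^ ?q) x = (conv \<rho> (f ^ ?q) * g ^ ?q + f ^ ?q * conv \<rho> (g ^ ?q)) x"
  proof (cases "x \<in> carrier G")
    case True
    then have "\<rho> (translate x f ^ ?q * translate x g ^ ?q) =
       \<rho> (translate x f ^ ?q) * g x ^ ?q + f x ^ ?q * \<rho> (translate x g ^ ?q)"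
      using Dp_frobenius_derivation[OF \<rho>, of "translate x f" "translate x g"] f g
      by (simp add: translate_A translate_at_one)
    then show ?thesis
      using True by (simp add: pointwise conv_apply translate_power translate_mult power_mult_distrib power_fun_apply)
  next
    case False
    then show ?thesis by (simp add: conv_out pointwise)
  qed
qed

lemma Dp_frobenius_normalized:
  assumes "\<mu> \<in> Dp n" "f \<in> A" shows "\<mu> (normalized f ^ (p ^ s)) = \<mu> (f ^ (p ^ s))"
proof -
  have "f ^ (p ^ s) = normalized f ^ (p ^ s) + fscale (f \<one> ^ (p ^ s)) one_A"
    using frobenius_add[of "normalized f" "fscale (f \<one>) one_A" s]
    by (simp add: fscale_power one_A_power)
  moreover have "normalized f ^ (p ^ s) \<in> A" using A_power[OF aug_A[OF aug_normalize[OF assms(2)]]] by simp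
  ultimately show ?thesis using assms Dp_one[OF assms(1)]
    by (simp add: LF_add[OF Dp_LF[OF assms(1)]] LF_scale[OF Dp_LF[OF assms(1)]] A_scale)
qed

lemma Dp_frobenius_add:
  assumes "\<mu> \<in> LF" "f \<in> A" "g \<in> A"
  shows "\<mu> ((f + g) ^ (p ^ s)) = \<mu> (f ^ (p ^ s)) + \<mu> (g ^ (p ^ s))"
  using assms by (simp add: frobenius_add LF_add A_power)

text \<open>
  As for tangent vectors, the values on \<open>q\<close>-th powers are determined by generators of the algebra.
\<close>

lemma frobenius_vanish_span:
  assumes S: "generates S" and \<mu>: "\<mu> \<in> Dp (p ^ s)" and z: "\<And>h. h \<in> S \<Longrightarrow> \<mu> (h ^ (p ^ s)) = 0" and f: "f \<in> A"
  shows "\<mu> (f ^ (p ^ s)) = 0"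
proof -
  let ?q = "p ^ s"
  let ?V = "{f \<in> A. \<mu> (f ^ ?q) = 0}"
  have L: "\<mu> \<in> LF" using \<mu> Dp_LF by blast
  have sub: "fs.subspace ?V"
    by (rule fs.subspaceI)
      (auto simp: A_add A_scale Dp_frobenius_add[OF L] fscale_power LF_scale[OF L] A_power power_0_left LF_0[OF L])
  have "normalized ` S \<union> I 2 \<subseteq> ?V"
  proof
    fix g assume "g \<in> normalized ` S \<union> I 2"
    then show "g \<in> ?V"
    proof
      assume "g \<in> normalized ` S"
      then obtain h where h: "h \<in> S" "g = normalized h" by blast
      then have "h \<in> A" using S by (auto simp: generates_def)
      then show ?thesis using h z Dp_frobenius_normalized[OF \<mu>] aug_normalize aug_A by auto
    next
      assume g: "g \<in> I 2"
      then have "g ^ ?q \<in> I (?q * 2)" by (intro I_power) auto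
      then have "g ^ ?q \<in> I (Suc ?q)"
        by (rule I_le) (use char_pos in \<open>simp add: Suc_le_eq\<close>)
      then show ?thesis using g \<mu> Dp_vanish I_subset_A by blast
    qed
  qed
  then have "fs.span (normalized ` S \<union> I 2) \<subseteq> ?V" using sub by (rule fs.span_minimal)
  then have "normalized f \<in> ?V" using aug_subset_span[OF S] aug_normalize[OF f] by blast
  then show ?thesis using Dp_frobenius_normalized[OF \<mu> f] by simp
qed

text \<open>
  This is \<open>dual_basis\<close> for the restrictions of the distributions to \<open>q\<close>-th powers of generators; from there
  the expansion extends to all functions by \<open>frobenius_vanish_span\<close>.
\<close>

lemma frobenius_dual:
  assumes S: "generates S"
  shows "\<exists>H d. H \<subseteq> S \<and> (\<forall>h\<in>H. d h \<in> Dp (p ^ s)) \<and>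
    (\<forall>h\<in>H. \<forall>h'\<in>H. d h (h' ^ (p ^ s)) = (if h = h' then 1 else 0)) \<and>
    (\<forall>\<mu>\<in>Dp (p ^ s). \<forall>f\<in>A. \<mu> (f ^ (p ^ s)) = (\<Sum>h\<in>H. \<mu> (h ^ (p ^ s)) * d h (f ^ (p ^ s))))"
proof -
  let ?q = "p ^ s"
  let ?v = "\<lambda>\<mu> h. \<mu> (h ^ ?q)"
  let ?W = "?v ` Dp ?q"
  have finS: "finite S" and SA: "S \<subseteq> A" using S by (auto simp: generates_def)
  have sub: "fs.subspace ?W"
  proof (rule fs.subspaceI)
    show "0 \<in> ?W" by (rule image_eqI[of _ _ 0]) (auto simp: fun_eq_iff zero_fun_apply)
    fix x y c assume x: "x \<in> ?W"
    then obtain \<mu> where \<mu>: "\<mu> \<in> Dp ?q" "x = ?v \<mu>" by blast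
    show "fscale c x \<in> ?W"
      by (rule image_eqI[of _ _ "fscale c \<mu>"]) (use \<mu> in \<open>auto simp: fun_eq_iff fscale_apply Dp_fscale\<close>)
    assume "y \<in> ?W"
    then obtain \<nu> where \<nu>: "\<nu> \<in> Dp ?q" "y = ?v \<nu>" by blast
    show "x + y \<in> ?W"
      by (rule image_eqI[of _ _ "\<mu> + \<nu>"]) (use \<mu> \<nu> in \<open>auto simp: fun_eq_iff plus_fun_apply Dp_plus\<close>)
  qed
  obtain H d where H: "H \<subseteq> S" "\<forall>h\<in>H. d h \<in> ?W" "\<forall>h\<in>H. \<forall>h'\<in>H. d h h' = (if h = h' then 1 else 0)"
    "\<forall>\<mu>\<in>?W. \<forall>e\<in>S. \<mu> e = (\<Sum>h\<in>H. \<mu> h * d h e)"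
    using dual_basis[OF finS sub] by blast
  have "\<forall>h\<in>H. \<exists>\<mu>. \<mu> \<in> Dp ?q \<and> d h = ?v \<mu>" using H(2) by blast
  then obtain \<delta> where \<delta>: "\<And>h. h \<in> H \<Longrightarrow> \<delta> h \<in> Dp ?q" "\<And>h. h \<in> H \<Longrightarrow> d h = ?v (\<delta> h)"
    by metis
  have ex: "\<mu> (f ^ ?q) = (\<Sum>h\<in>H. \<mu> (h ^ ?q) * \<delta> h (f ^ ?q))" if \<mu>: "\<mu> \<in> Dp ?q" and f: "f \<in> A" for \<mu> f
  proof -
    define \<nu> where "\<nu> = \<mu> - (\<Sum>h\<in>H. fscale (\<mu> (h ^ ?q)) (\<delta> h))"
    have \<nu>: "\<nu> \<in> Dp ?q" unfolding \<nu>_def using \<mu> \<delta>(1) by (auto intro!: Dp_minus Dp_sum Dp_fscale)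
    have \<nu>a: "\<nu> g = \<mu> g - (\<Sum>h\<in>H. \<mu> (h ^ ?q) * \<delta> h g)" for g
      by (simp add: \<nu>_def pointwise)
    have "\<nu> (g ^ ?q) = 0" if "g \<in> S" for g
    proof -
      have "?v \<mu> g = (\<Sum>h\<in>H. ?v \<mu> h * d h g)" using bspec[OF bspec[OF H(4) imageI[OF \<mu>]] that] .
      also have "\<dots> = (\<Sum>h\<in>H. ?v \<mu> h * \<delta> h (g ^ ?q))" using \<delta>(2) by (intro sum.cong) auto
      finally show ?thesis by (simp add: \<nu>a)
    qed
    then have "\<nu> (f ^ ?q) = 0" by (rule frobenius_vanish_span[OF S \<nu> _ f])
    then show ?thesis by (simp add: \<nu>a)
  qed
  have du: "\<delta> h (h' ^ ?q) = (if h = h' then 1 else 0)" if "h \<in> H" "h' \<in> H" for h h'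
    using bspec[OF bspec[OF H(3) that(1)] that(2)] \<delta>(2)[OF that(1)] by simp
  show ?thesis
    by (rule exI[of _ H], rule exI[of _ \<delta>], intro conjI ballI) (fact H(1) \<delta>(1) du ex)+
qed

end

section \<open>Distributions that are sums of products\<close>

context char_p_group
begin

text \<open>
  The factor \<open>one_A\<close> makes the empty monomial the unit of the coordinate algebra, which vanishes outside the group,
  instead of the constant function.
\<close>

definition monomial :: "('g \<Rightarrow> 'k) multiset \<Rightarrow> 'g \<Rightarrow> 'k" where
  "monomial M = (\<Prod>h\<in>#M. normalized h) * one_A"

lemma monomial_empty: "monomial {#} = one_A" by (simp add: monomial_def)
lemma monomial_add: "monomial (add_mset h M) = normalized h * monomial M" by (simp add: monomial_def mult.assoc)

lemma monomial_I: "set_mset M \<subseteq> A \<Longrightarrow> monomial M \<in> I (size M)"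
proof (induction M)
  case (add h M)
  then show ?case by (auto simp: monomial_add intro!: I_Suc_gen aug_normalize)
qed (simp add: monomial_empty)

lemma monomial_A: "set_mset M \<subseteq> A \<Longrightarrow> monomial M \<in> A"
  using monomial_I I_subset_A by blast

lemma I_span:
  assumes "f \<in> fs.span S" "S \<subseteq> I n" shows "f \<in> I n"
  using fs.span_minimal[OF assms(2) I_subspace] assms(1) by blast

text \<open>
  Modulo the next power of the augmentation ideal, the \<open>q\<close>-th power of an element is a polynomial in
  the \<open>q\<close>-th powers of the dual functions \<open>H\<close>: the difference is not seen by distributions of order at
  most \<open>q\<close>, and these detect the leading term.
\<close>

lemma frobenius_expand:
  assumes HA: "H \<subseteq> A" and d: "\<And>h. h \<in> H \<Longrightarrow> d h \<in> Dp (p ^ s)"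
    and ex: "\<And>\<mu> f. \<mu> \<in> Dp (p ^ s) \<Longrightarrow> f \<in> A \<Longrightarrow>
        \<mu> (f ^ (p ^ s)) = (\<Sum>h\<in>H. \<mu> (h ^ (p ^ s)) * d h (f ^ (p ^ s)))"
  shows "h \<in> I m \<Longrightarrow> h ^ (p ^ s) \<in> fs.span ({monomial M ^ (p ^ s) | M. set_mset M \<subseteq> H \<and> size M = m} \<union> I (p ^ s * m + 1))"
proof (induction m arbitrary: h)
  let ?q = "p ^ s"
  case 0
  have "h ^ ?q = normalized h ^ ?q + fscale (h \<one> ^ ?q) (monomial {#} ^ ?q)"
    using frobenius_add[of "normalized h" "fscale (h \<one>) one_A" s]
    by (simp add: fscale_power monomial_empty)
  moreover have "normalized h ^ ?q \<in> I ?q" using 0 by (intro aug_power aug_normalize) auto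
  then have "normalized h ^ ?q \<in> I 1" by (rule I_le) (simp add: Suc_le_eq)
  ultimately show ?case
    by (auto intro!: fs.span_add fs.span_scale intro: fs.span_base)
next
  let ?q = "p ^ s"
  let ?X = "\<lambda>m. {monomial M ^ ?q | M. set_mset M \<subseteq> H \<and> size M = m}"
  let ?Y = "\<lambda>m. ?X m \<union> I (?q * m + 1)"
  case (Suc m)
  let ?V = "{h \<in> A. h ^ ?q \<in> fs.span (?Y (Suc m))}"
  have sub: "fs.subspace ?V"
    by (rule fs.subspaceI)
      (auto simp: A_add A_scale frobenius_add fscale_power power_0_left fs.span_add fs.span_scale fs.span_zero)
  have "h \<in> ?V"
  proof (rule I_Suc_induct[OF Suc.prems sub])
    fix f g assume f: "f \<in> aug" and g: "g \<in> I m"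
    have gA: "g \<in> A" using g I_subset_A by blast
    let ?F = "f ^ ?q - (\<Sum>h\<in>H. fscale (d h (f ^ ?q)) (normalized h ^ ?q))"
    have fI: "f ^ ?q \<in> I ?q" using f by (intro aug_power) auto
    have nI: "normalized h ^ ?q \<in> I ?q" if "h \<in> H" for h using that HA by (intro aug_power aug_normalize) auto
    have F: "?F \<in> I ?q" using fI nI by (intro I_diff I_sum I_scale) auto
    then have Faug: "?F \<in> aug" using I_le[of ?F ?q 1] by (simp add: I_1 Suc_le_eq)
    have FS: "?F \<in> I (Suc ?q)"
    proof (rule Dp_separates[OF Faug])
      fix \<mu> assume \<mu>: "\<mu> \<in> Dp ?q"
      note L = Dp_LF[OF \<mu>]
      have nA: "normalized h ^ ?q \<in> A" if "h \<in> H" for h using nI[OF that] I_subset_A by blast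
      have "\<mu> (\<Sum>h\<in>H. fscale (d h (f ^ ?q)) (normalized h ^ ?q)) = (\<Sum>h\<in>H. d h (f ^ ?q) * \<mu> (normalized h ^ ?q))"
        by (rule LF_sum_scale[OF L nA])
      also have "\<dots> = (\<Sum>h\<in>H. \<mu> (h ^ ?q) * d h (f ^ ?q))"
        using HA Dp_frobenius_normalized[OF \<mu>] by (intro sum.cong) (auto simp: mult.commute)
      also have "\<dots> = \<mu> (f ^ ?q)" using ex[OF \<mu> aug_A[OF f]] by simp
      finally show "\<mu> ?F = 0"
        using nA fI I_subset_A by (subst LF_diff[OF L]) (auto intro!: A_sum A_scale)
    qed
    have fs: "f ^ ?q \<in> fs.span ((\<lambda>h. normalized h ^ ?q) ` H \<union> I (Suc ?q))"
    proof -
      have "?F + (\<Sum>h\<in>H. fscale (d h (f ^ ?q)) (normalized h ^ ?q)) \<in> fs.span ((\<lambda>h. normalized h ^ ?q) ` H \<union> I (Suc ?q))"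
        using FS by (intro fs.span_add fs.span_sum fs.span_scale) (auto intro: fs.span_base)
      then show ?thesis by simp
    qed
    have "f ^ ?q * g ^ ?q \<in> fs.span (?Y (Suc m))"
    proof (rule span_mult_mem[OF fs Suc.IH[OF g] fs.subspace_span])
      fix a b assume a: "a \<in> (\<lambda>h. normalized h ^ ?q) ` H \<union> I (Suc ?q)" and b: "b \<in> ?Y m"
      have bI: "b \<in> I (?q * m)"
      proof (cases "b \<in> I (?q * m + 1)")
        case True then show ?thesis by (rule I_le) simp
      next
        case False
        then obtain M where M: "b = monomial M ^ ?q" "set_mset M \<subseteq> H" "size M = m" using b by blast
        then have "monomial M \<in> I m" using HA monomial_I by blast
        then show ?thesis using M I_power[of "monomial M" m ?q] by simp
      qed
      show "a * b \<in> fs.span (?Y (Suc m))"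
      proof (cases "a \<in> I (Suc ?q)")
        case True
        then have "a * b \<in> I (Suc ?q + ?q * m)" using bI by (rule I_mult)
        then show ?thesis by (intro fs.span_base) auto
      next
        case False
        then obtain h where h: "h \<in> H" "a = normalized h ^ ?q" using a by blast
        show ?thesis
        proof (cases "b \<in> I (?q * m + 1)")
          case True
          then have "a * b \<in> I (?q + (?q * m + 1))" using h nI I_mult by blast
          then show ?thesis by (intro fs.span_base) (auto simp: algebra_simps)
        next
          case False
          then obtain M where M: "b = monomial M ^ ?q" "set_mset M \<subseteq> H" "size M = m" using b by blast
          have "a * b = monomial (add_mset h M) ^ ?q" by (simp add: h M monomial_add power_mult_distrib)
          moreover have "monomial (add_mset h M) ^ ?q \<in> ?X (Suc m)"
            using M h by (intro CollectI exI[of _ "add_mset h M"]) auto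
          ultimately show ?thesis by (intro fs.span_base) auto
        qed
      qed
    qed
    then show "f * g \<in> ?V" using gA f by (auto simp: power_mult_distrib aug_A A_mult)
  qed
  then show ?case by simp
qed

text \<open>
  The analogue of the Euler operator \<open>x\<^sub>j \<partial>/\<partial>x\<^sub>j\<close> for the variable \<open>x\<^sub>j = j\<^sup>q\<close>.
\<close>

definition euler :: "nat \<Rightarrow> (('g \<Rightarrow> 'k) \<Rightarrow> 'k) \<Rightarrow> ('g \<Rightarrow> 'k) \<Rightarrow> ('g \<Rightarrow> 'k) \<Rightarrow> ('g \<Rightarrow> 'k)" where
  "euler q \<rho> j f = normalized j ^ q * conv \<rho> f"

lemma euler_A: "\<rho> \<in> LF \<Longrightarrow> j \<in> A \<Longrightarrow> f \<in> A \<Longrightarrow> q > 0 \<Longrightarrow> euler q \<rho> j f \<in> A"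
  unfolding euler_def by (intro A_mult A_power conv_A aug_A[OF aug_normalize])

lemma euler_add: "\<rho> \<in> LF \<Longrightarrow> f \<in> A \<Longrightarrow> g \<in> A \<Longrightarrow> euler q \<rho> j (f + g) = euler q \<rho> j f + euler q \<rho> j g"
  by (simp add: euler_def conv_add distrib_left)

lemma euler_scale: "\<rho> \<in> LF \<Longrightarrow> f \<in> A \<Longrightarrow> euler q \<rho> j (fscale c f) = fscale c (euler q \<rho> j f)"
  by (simp add: euler_def conv_scale fscale_mult)

lemma euler_I: assumes "\<rho> \<in> Dp q" "j \<in> A" "q > 0" "f \<in> I n" shows "euler q \<rho> j f \<in> I n"
proof -
  have "conv \<rho> f \<in> I (n + 1 - Suc q)" using assms Dp_Dd by (intro conv_I)
  moreover have "normalized j ^ q \<in> I q" using assms by (intro aug_power aug_normalize)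
  ultimately have "normalized j ^ q * conv \<rho> f \<in> I (q + (n + 1 - Suc q))" by (rule_tac I_mult)
  then show ?thesis unfolding euler_def by (rule I_le) simp
qed

text \<open>
  By the product rule for \<open>q\<close>-th powers, the dual functional of a variable counts its occurrences in a monomial.
\<close>

lemma euler_mon:
  assumes HA: "H \<subseteq> A" and d: "\<And>h. h \<in> H \<Longrightarrow> d h \<in> Dp (p ^ s)"
    and du: "\<And>h h'. h \<in> H \<Longrightarrow> h' \<in> H \<Longrightarrow> d h (h' ^ (p ^ s)) = (if h = h' then 1 else 0)"
    and j: "j \<in> H"
  shows "set_mset M \<subseteq> H \<Longrightarrow>
    euler (p ^ s) (d j) j (monomial M ^ (p ^ s)) - fscale (of_nat (count M j)) (monomial M ^ (p ^ s)) \<in> I (p ^ s * size M + 1)"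
proof (induction M)
  let ?q = "p ^ s"
  case empty
  show ?case using Dp_one[OF d[OF j]] by (simp add: monomial_empty one_A_power euler_def conv_one_A)
next
  let ?q = "p ^ s" and ?E = "euler (p ^ s) (d j) j"
  case (add h M)
  have hA: "h \<in> A" "h \<in> H" and jA: "j \<in> A" and MA: "set_mset M \<subseteq> A" using add.prems HA j by auto
  note dj = d[OF j]
  let ?n = "normalized h" and ?c = "if h = j then 1 else (0::'k)"
  have nA: "?n \<in> A" and nj: "normalized j \<in> A" using aug_normalize aug_A hA jA by blast+
  have nI: "?n ^ ?q \<in> I ?q" "normalized j ^ ?q \<in> I ?q" using hA jA by (auto intro!: aug_power aug_normalize)
  have MI: "monomial M ^ ?q \<in> I (?q * size M)" using I_power[OF monomial_I[OF MA]] by simp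
  let ?K = "conv (d j) (?n ^ ?q) - fscale ?c one_A"
  have nqA: "?n ^ ?q \<in> A" using nA by (intro A_power) auto
  have K: "?K \<in> aug"
    unfolding aug_iff
  proof
    show "?K \<in> A" using nqA Dp_LF[OF dj] by (auto intro!: A_diff conv_A A_scale)
    have "d j (?n ^ ?q) = ?c" using Dp_frobenius_normalized[OF dj hA(1)] du[OF j hA(2)] by auto
    then show "?K \<one> = 0" using nqA
      by (simp add: minus_apply[of _ _ "\<one>"] fscale_apply[of _ _ "\<one>"] conv_at_one)
  qed
  have "conv (d j) (monomial (add_mset h M) ^ ?q) =
      conv (d j) (?n ^ ?q) * monomial M ^ ?q + ?n ^ ?q * conv (d j) (monomial M ^ ?q)"
    using conv_frobenius_derivation[OF dj nA monomial_A[OF MA]] by (simp add: monomial_add)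
  moreover define u v w where "u = ?n ^ ?q" and "v = normalized j ^ ?q" and "w = monomial M ^ ?q"
  moreover have "monomial (add_mset h M) ^ ?q = u * w" by (simp add: monomial_add power_mult_distrib u_def w_def)
  moreover have "fscale (of_nat (count (add_mset h M) j)) (u * w) = fscale (of_nat (count M j)) (u * w) + fscale ?c (u * w)"
    by (simp add: fs.scale_left_distrib)
  ultimately have "?E (monomial (add_mset h M) ^ ?q) - fscale (of_nat (count (add_mset h M) j)) (monomial (add_mset h M) ^ ?q)
     = v * ((conv (d j) u - fscale ?c one_A) * w)
       + u * (?E w - fscale (of_nat (count M j)) w)
       + (v * (fscale ?c one_A * w) - fscale ?c (u * w))"
    unfolding euler_def by (simp only: v_def[symmetric] algebra_simps fscale_mult)
  then have "?E (monomial (add_mset h M) ^ ?q) - fscale (of_nat (count (add_mset h M) j)) (monomial (add_mset h M) ^ ?q)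
     = normalized j ^ ?q * (?K * monomial M ^ ?q)
       + ?n ^ ?q * (?E (monomial M ^ ?q) - fscale (of_nat (count M j)) (monomial M ^ ?q))
       + (normalized j ^ ?q * (fscale ?c one_A * monomial M ^ ?q) - fscale ?c (?n ^ ?q * monomial M ^ ?q))"
    unfolding u_def v_def w_def .
  also have "normalized j ^ ?q * (fscale ?c one_A * monomial M ^ ?q) - fscale ?c (?n ^ ?q * monomial M ^ ?q) = 0"
    using A_power[OF monomial_A[OF MA], of ?q] by (simp add: fscale_mult)
  also have "normalized j ^ ?q * (?K * monomial M ^ ?q)
       + ?n ^ ?q * (?E (monomial M ^ ?q) - fscale (of_nat (count M j)) (monomial M ^ ?q)) + 0 \<in> I (?q * size (add_mset h M) + 1)"
  proof -
    have "normalized j ^ ?q * (?K * monomial M ^ ?q) \<in> I (?q + Suc (?q * size M))"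
      using nI(2) I_Suc_gen[OF K MI] by (rule I_mult)
    moreover have "?n ^ ?q * (?E (monomial M ^ ?q) - fscale (of_nat (count M j)) (monomial M ^ ?q)) \<in> I (?q + (?q * size M + 1))"
      by (rule I_mult[OF nI(1)]) (use add in auto)
    ultimately show ?thesis by (simp add: I_add)
  qed
  finally show ?case .
qed

lemma of_nat_pow_p: "(of_nat n :: 'k) ^ p = of_nat n"
proof (induction n)
  case (Suc n)
  then show ?case using frobenius_add_field[of 1 "of_nat n" 1] by simp
qed simp

text \<open>
  Fermat's little theorem inside the field.
\<close>

lemma of_nat_pow_p_minus_1: "(of_nat n :: 'k) ^ (p - 1) = (if p dvd n then 0 else 1)"
proof (cases "p dvd n")
  case True
  then have "of_nat n = (0::'k)" unfolding p_CHAR by (simp add: of_nat_eq_0_iff_char_dvd)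
  then show ?thesis using True p_gt_1 by simp
next
  case False
  then have nz: "of_nat n \<noteq> (0::'k)" unfolding p_CHAR by (simp add: of_nat_eq_0_iff_char_dvd)
  have "(of_nat n :: 'k) ^ (p - 1) * of_nat n = of_nat n"
    using of_nat_pow_p[of n] p_gt_1 by (cases p) (auto simp: mult.commute)
  then show ?thesis using nz False by simp
qed

lemma monomial_p_power:
  assumes "set_mset M \<subseteq> H" "\<And>j. j \<in> H \<Longrightarrow> p dvd count M j"
  shows "\<exists>M'. set_mset M' \<subseteq> H \<and> monomial M = monomial M' ^ p \<and> size M = p * size M'"
  using assms
proof (induction "size M" arbitrary: M rule: less_induct)
  case less
  show ?case
  proof (cases "M = {#}")
    case True
    then show ?thesis by (intro exI[of _ "{#}"]) (simp add: monomial_empty one_A_power)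
  next
    case False
    then obtain h where h: "h \<in># M" by blast
    then have "p dvd count M h" "count M h > 0" using less.prems by auto
    then have "p \<le> count M h" by (rule dvd_imp_le)
    then have sub: "replicate_mset p h \<subseteq># M" by (simp add: count_le_replicate_mset_subset_eq[symmetric])
    define M2 where "M2 = M - replicate_mset p h"
    have M: "M = M2 + replicate_mset p h" using sub by (simp add: M2_def)
    have sz: "size M = size M2 + p" by (simp add: M)
    have "size M2 < size M" using sz by simp
    moreover have "set_mset M2 \<subseteq> H" using less.prems(1) M by auto
    moreover have "p dvd count M2 j" if "j \<in> H" for j
      using less.prems(2)[OF that] by (auto simp: M2_def)
    ultimately obtain M' where M': "set_mset M' \<subseteq> H" "monomial M2 = monomial M' ^ p" "size M2 = p * size M'"
      using less.hyps by blast
    have "monomial (M2 + replicate_mset k h) = normalized h ^ k * monomial M2" for k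
      by (induction k) (simp_all add: monomial_add mult.assoc)
    then have "monomial M = monomial (add_mset h M') ^ p" by (simp add: M M'(2) monomial_add power_mult_distrib)
    then show ?thesis using M' h less.prems(1) sz by (intro exI[of _ "add_mset h M'"]) auto
  qed
qed

text \<open>
  Over a perfect field sums and multiples of \<open>q\<close>-th powers are \<open>q\<close>-th powers.
\<close>

lemma span_frobenius_powers:
  assumes "f \<in> fs.span ({h ^ (p ^ s) | h. h \<in> I m} \<union> I n)"
  shows "\<exists>h\<in>I m. f - h ^ (p ^ s) \<in> I n"
  using assms
proof (induction rule: fs.span_induct_alt)
  case base
  show ?case by (rule bexI[of _ 0]) (simp_all add: power_0_left)
next
  case (step c x y)
  then obtain h where h: "h \<in> I m" "y - h ^ (p ^ s) \<in> I n" by blast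
  show ?case
  proof (cases "x \<in> I n")
    case True
    have "fscale c x + (y - h ^ (p ^ s)) \<in> I n" using True h by (intro I_add I_scale)
    then show ?thesis using h by (intro bexI[of _ h]) (simp_all add: algebra_simps)
  next
    case False
    then obtain g where g: "g \<in> I m" "x = g ^ (p ^ s)" using step by blast
    obtain a where a: "a ^ (p ^ s) = c" by (rule frobenius_root)
    have "fscale c x + y - (fscale a g + h) ^ (p ^ s) = y - h ^ (p ^ s)"
      by (simp add: frobenius_add fscale_power a g)
    then have "fscale c x + y - (fscale a g + h) ^ (p ^ s) \<in> I n" using h(2) by (simp only:)
    then show ?thesis using g h by (intro bexI[of _ "fscale a g + h"]) (simp_all only: I_add I_scale)
  qed
qed

text \<open>
  If the leading form of \<open>F\<close> is a polynomial in \<open>q\<close>-th powers and is killed by all derivations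
  \<open>conv \<rho>\<close>, then only monomials whose exponents are all divisible by \<open>p\<close> occur: the operator
  \<open>1 - E\<^sub>j\<^sup>p\<^sup>-\<^sup>1\<close>, for an Euler operator \<open>E\<^sub>j\<close>, fixes \<open>F\<close> to leading order and kills every monomial whose exponent of \<open>j\<close> is
  prime to \<open>p\<close>. So the leading form is already a polynomial in \<open>p q\<close>-th powers, or zero.
\<close>

lemma primitive_step:
  assumes F: "F \<in> A" and n: "n = p ^ s * m" and h: "h \<in> I m" "F - h ^ (p ^ s) \<in> I (n + 1)"
    and pr: "\<And>\<rho>. \<rho> \<in> Dp (p ^ s) \<Longrightarrow> conv \<rho> F \<in> I (n - p ^ s + 1)" and m: "m \<ge> 1"
  shows "\<exists>m' h'. (m = p * m' \<and> h' \<in> I m' \<and> F - h' ^ (p ^ (s + 1)) \<in> I (n + 1)) \<or> F \<in> I (n + 1)"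
proof -
  let ?q = "p ^ s"
  obtain S where S: "generates S" using generates_ex by blast
  obtain H d where H: "H \<subseteq> S" and d0: "\<forall>h\<in>H. d h \<in> Dp ?q"
    and du0: "\<forall>h\<in>H. \<forall>h'\<in>H. d h (h' ^ ?q) = (if h = h' then 1 else 0)"
    and ex0: "\<forall>\<mu>\<in>Dp ?q. \<forall>f\<in>A. \<mu> (f ^ ?q) = (\<Sum>h\<in>H. \<mu> (h ^ ?q) * d h (f ^ ?q))"
    using frobenius_dual[OF S, of s] by blast
  have HA: "H \<subseteq> A" and finH: "finite H" using H S finite_subset by (auto simp: generates_def)
  have d: "\<And>h. h \<in> H \<Longrightarrow> d h \<in> Dp ?q" using d0 by blast
  have du: "\<And>h h'. h \<in> H \<Longrightarrow> h' \<in> H \<Longrightarrow> d h (h' ^ ?q) = (if h = h' then 1 else 0)"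
    using du0 by blast
  have ex: "\<And>\<mu> f. \<mu> \<in> Dp ?q \<Longrightarrow> f \<in> A \<Longrightarrow> \<mu> (f ^ ?q) = (\<Sum>h\<in>H. \<mu> (h ^ ?q) * d h (f ^ ?q))"
    using ex0 by blast
  (* the spaces in which F is located successively: exponents of the variables in J are divisible by p *)
  define Y where "Y J = {monomial M ^ ?q | M. set_mset M \<subseteq> H \<and> size M = m \<and> (\<forall>j\<in>J. p dvd count M j)} \<union> I (n + 1)" for J
  have Y_cases: "\<exists>M. x = monomial M ^ ?q \<and> set_mset M \<subseteq> H \<and> size M = m \<and> (\<forall>j\<in>J. p dvd count M j)"
    if "x \<in> Y J" "x \<notin> I (n + 1)" for x J
    using that unfolding Y_def by simp
  have YA: "Y J \<subseteq> A" for J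
  proof -
    have "monomial M ^ ?q \<in> A" if "set_mset M \<subseteq> H" for M
      using A_power[OF monomial_A, of M ?q] that HA by auto
    then show ?thesis using I_subset_A unfolding Y_def by blast
  qed
  have start: "F \<in> fs.span (Y {})"
  proof -
    have "h ^ ?q \<in> fs.span (Y {})"
      using frobenius_expand[OF HA d ex h(1)] unfolding Y_def n by simp
    moreover have "F - h ^ ?q \<in> fs.span (Y {})" using h(2) by (intro fs.span_base) (simp add: Y_def)
    ultimately have "h ^ ?q + (F - h ^ ?q) \<in> fs.span (Y {})" by (rule fs.span_add)
    then show ?thesis by simp
  qed
  have step: "F \<in> fs.span (Y (insert j J))" if FJ: "F \<in> fs.span (Y J)" and j: "j \<in> H" for j J
  proof -
    let ?E = "euler ?q (d j) j"
    have jA: "j \<in> A" using j HA by blast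
    note dj = d[OF j] and dL = Dp_LF[OF d[OF j]]
    have EA: "f \<in> A \<Longrightarrow> (?E ^^ k) f \<in> A" for k f
      by (induction k) (auto intro!: euler_A dL jA)
    have EI: "f \<in> I l \<Longrightarrow> (?E ^^ k) f \<in> I l" for k f l
      by (induction k) (auto intro!: euler_I dj jA)
    have Eadd: "f \<in> A \<Longrightarrow> g \<in> A \<Longrightarrow> (?E ^^ k) (f + g) = (?E ^^ k) f + (?E ^^ k) g" for k f g
      by (induction k) (auto simp: euler_add[OF dL] EA)
    have Esc: "f \<in> A \<Longrightarrow> (?E ^^ k) (fscale c f) = fscale c ((?E ^^ k) f)" for k f c
      by (induction k) (auto simp: euler_scale[OF dL] EA)
    (* to leading order the projection to the monomials whose exponent of j is divisible by p *)
    define Q where "Q f = f - (?E ^^ (p - 1)) f" for f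
    have Q0: "Q 0 = 0" using Esc[of 0 "p - 1" 0] by (simp add: Q_def)
    have "Q f \<in> fs.span (Y (insert j J))" if "f \<in> fs.span (Y J)" for f
    proof -
      have "f \<in> A \<and> Q f \<in> fs.span (Y (insert j J))"
        using that
      proof (induction rule: fs.span_induct_alt)
        case base
        show ?case by (simp add: Q0 fs.span_zero)
      next
        case (step c x y)
        have xA: "x \<in> A" using step(1) YA by blast
        have "Q x \<in> fs.span (Y (insert j J))"
        proof (cases "x \<in> I (n + 1)")
          case True
          then have "Q x \<in> I (n + 1)" unfolding Q_def by (intro I_diff EI)
          then show ?thesis by (intro fs.span_base) (simp add: Y_def)
        next
          case False
          obtain M where M0: "x = monomial M ^ ?q \<and> set_mset M \<subseteq> H \<and> size M = m \<and> (\<forall>j\<in>J. p dvd count M j)"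
            using Y_cases[OF step(1) False] by (rule exE)
          have M: "x = monomial M ^ ?q" "set_mset M \<subseteq> H" "size M = m" "\<forall>j\<in>J. p dvd count M j"
            using M0 by blast+
          let ?c = "of_nat (count M j) :: 'k"
          have E1: "?E x - fscale ?c x \<in> I (n + 1)"
            using euler_mon[OF HA d du j M(2)] unfolding M(1,3) n .
          have Ek: "(?E ^^ k) x - fscale (?c ^ k) x \<in> I (n + 1)" for k
          proof (induction k)
            case (Suc k)
            have "?E ((?E ^^ k) x - fscale (?c ^ k) x) \<in> I (n + 1)"
              using Suc by (intro euler_I dj jA) auto
            moreover have "?E ((?E ^^ k) x - fscale (?c ^ k) x) + fscale (?c ^ k) (?E x) = ?E ((?E ^^ k) x)"
              using euler_add[OF dL, of "(?E ^^ k) x - fscale (?c ^ k) x" "fscale (?c ^ k) x" ?q j]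
                EA[OF xA, of k] xA by (simp add: A_diff A_scale euler_scale[OF dL xA])
            moreover have "fscale (?c ^ k) (?E x - fscale ?c x) \<in> I (n + 1)" using E1 by (rule I_scale)
            ultimately have "?E ((?E ^^ k) x) - fscale (?c ^ k) (?E x) + fscale (?c ^ k) (?E x - fscale ?c x) \<in> I (n + 1)"
              by (metis I_add add_diff_cancel_right')
            then show ?case by (simp add: fs.scale_right_diff_distrib mult.commute)
          qed simp
          (* 1 - c ^ (p - 1) is 1 or 0 according to whether p divides the exponent of j *)
          have Qx: "Q x - fscale (1 - ?c ^ (p - 1)) x \<in> I (n + 1)"
          proof -
            have "Q x - fscale (1 - ?c ^ (p - 1)) x = - ((?E ^^ (p - 1)) x - fscale (?c ^ (p - 1)) x)"
              by (simp add: Q_def fs.scale_left_diff_distrib)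
            then show ?thesis using fs.subspace_neg[OF I_subspace Ek[of "p - 1"]] by (simp only:)
          qed
          have "fscale (1 - ?c ^ (p - 1)) x \<in> fs.span (Y (insert j J))"
          proof (cases "p dvd count M j")
            case True
            then have "x \<in> Y (insert j J)" using M unfolding Y_def by blast
            then show ?thesis by (intro fs.span_scale fs.span_base)
          next
            case False
            then have "?c ^ (p - 1) = 1" by (simp only: of_nat_pow_p_minus_1 if_False)
            then show ?thesis by (simp only: diff_self fs.scale_zero_left fs.span_zero)
          qed
          moreover have "Q x - fscale (1 - ?c ^ (p - 1)) x \<in> fs.span (Y (insert j J))"
            using Qx by (intro fs.span_base) (simp add: Y_def)
          ultimately have "fscale (1 - ?c ^ (p - 1)) x + (Q x - fscale (1 - ?c ^ (p - 1)) x) \<in> fs.span (Y (insert j J))"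
            by (rule fs.span_add)
          then show ?thesis by simp
        qed
        moreover have "Q (fscale c x + y) = fscale c (Q x) + Q y"
          using step xA by (simp add: Q_def Eadd Esc A_scale fs.scale_right_diff_distrib)
        ultimately show ?case using step xA by (simp add: A_add A_scale fs.span_add fs.span_scale)
      qed
      then show ?thesis by blast
    qed
    then have "Q F \<in> fs.span (Y (insert j J))" using FJ by blast
    moreover have "(?E ^^ (p - 1)) F \<in> fs.span (Y (insert j J))"
    proof -
      obtain k where k: "p - 1 = Suc k" using p_gt_1 by (cases "p - 1") auto
      (* primitivity of F enters here: the Euler operators kill its leading form *)
      have "normalized j ^ ?q * conv (d j) F \<in> I (?q + (n - ?q + 1))"
        using pr[OF dj] jA by (intro I_mult aug_power aug_normalize) auto
      then have "?E F \<in> I (n + 1)" unfolding euler_def by (rule I_le) simp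
      then have "(?E ^^ k) (?E F) \<in> I (n + 1)" by (rule EI)
      then have "(?E ^^ (p - 1)) F \<in> I (n + 1)" unfolding k by (simp add: funpow_Suc_right del: funpow.simps)
      then show ?thesis by (intro fs.span_base) (simp add: Y_def)
    qed
    ultimately have "Q F + (?E ^^ (p - 1)) F \<in> fs.span (Y (insert j J))" by (rule fs.span_add)
    then show ?thesis by (simp add: Q_def)
  qed
  have "finite J \<Longrightarrow> J \<subseteq> H \<Longrightarrow> F \<in> fs.span (Y J)" for J
    by (induction J rule: finite_induct) (use start step in auto)
  then have FH: "F \<in> fs.span (Y H)" using finH by blast
  show ?thesis
  proof (cases "p dvd m")
    case False
    have "Y H \<subseteq> I (n + 1)"
    proof
      fix x assume x: "x \<in> Y H"
      have False if M: "set_mset M \<subseteq> H" "size M = m" "\<forall>j\<in>H. p dvd count M j" for M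
      proof -
        have "\<exists>M'. set_mset M' \<subseteq> H \<and> monomial M = monomial M' ^ p \<and> size M = p * size M'"
          by (rule monomial_p_power[of M H]) (use M in blast)+
        then obtain M' :: "('g \<Rightarrow> 'k) multiset" where "size M = p * size M'" by blast
        then show False using False M(2) by auto
      qed
      then show "x \<in> I (n + 1)" using Y_cases[OF x] by blast
    qed
    then have "F \<in> I (n + 1)" using FH I_span by blast
    then show ?thesis by blast
  next
    case True
    then obtain m' where m': "m = p * m'" by auto
    have "Y H \<subseteq> {h ^ (p ^ (s + 1)) | h. h \<in> I m'} \<union> I (n + 1)"
    proof
      fix x assume x: "x \<in> Y H"
      show "x \<in> {h ^ (p ^ (s + 1)) | h. h \<in> I m'} \<union> I (n + 1)"
      proof (cases "x \<in> I (n + 1)")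
        case False
        obtain M where M0: "x = monomial M ^ ?q \<and> set_mset M \<subseteq> H \<and> size M = m \<and> (\<forall>j\<in>H. p dvd count M j)"
            using Y_cases[OF x False] by (rule exE)
          have M: "x = monomial M ^ ?q" "set_mset M \<subseteq> H" "size M = m" "\<forall>j\<in>H. p dvd count M j"
            using M0 by blast+
        obtain M' where M': "set_mset M' \<subseteq> H" "monomial M = monomial M' ^ p" "size M = p * size M'"
        proof -
          have "\<exists>M'. set_mset M' \<subseteq> H \<and> monomial M = monomial M' ^ p \<and> size M = p * size M'"
            by (rule monomial_p_power[of M H]) (use M(2,4) in blast)+
          then show thesis using that by blast
        qed
        have "size M' = m'" using M M' m' by simp
        then have "monomial M' \<in> I m'" using monomial_I[of M'] M' HA by blast
        moreover have "x = monomial M' ^ (p ^ (s + 1))" by (simp add: M M' power_mult[symmetric])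
        ultimately show ?thesis by blast
      qed blast
    qed
    then have "F \<in> fs.span ({h ^ (p ^ (s + 1)) | h. h \<in> I m'} \<union> I (n + 1))"
      using FH fs.span_mono by blast
    then obtain h' where "h' \<in> I m'" "F - h' ^ (p ^ (s + 1)) \<in> I (n + 1)"
      using span_frobenius_powers by blast
    then show ?thesis using m' by blast
  qed
qed

text \<open>
  Iterating \<open>primitive_step\<close> turns the leading form into \<open>p\<^sup>s\<close>-th powers for growing \<open>s\<close> until it is linear in them
  or vanishes.
\<close>

lemma primitive_is_frobenius_power:
  assumes F: "F \<in> I n" "n \<ge> 1"
    and pr: "\<And>q \<rho>. 1 \<le> q \<Longrightarrow> q < n \<Longrightarrow> \<rho> \<in> Dp q \<Longrightarrow> conv \<rho> F \<in> I (n - q + 1)"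
  shows "F \<in> I (n + 1) \<or> (\<exists>s h. n = p ^ s \<and> h \<in> A \<and> F - h ^ (p ^ s) \<in> I (n + 1))"
proof -
  have "n = p ^ s * m \<Longrightarrow> h \<in> I m \<Longrightarrow> F - h ^ (p ^ s) \<in> I (n + 1) \<Longrightarrow> ?thesis" for m s h
  proof (induction m arbitrary: s h rule: less_induct)
    case (less m)
    have FA: "F \<in> A" using F I_subset_A by blast
    have hA: "h \<in> A" using less I_subset_A by blast
    have m0: "m \<noteq> 0" using less.prems(1) F(2) by auto
    show ?case
    proof (cases "m = 1")
      case True
      then show ?thesis using less.prems hA by auto
    next
      case False
      then have "m \<ge> 2" using m0 by simp
      then have q: "1 \<le> p ^ s" "p ^ s < n" using less.prems(1) by (auto simp: Suc_le_eq)
      have "\<exists>m' h'. (m = p * m' \<and> h' \<in> I m' \<and> F - h' ^ (p ^ (s + 1)) \<in> I (n + 1)) \<or> F \<in> I (n + 1)"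
        using m0 by (intro primitive_step[OF FA less.prems pr[OF q]]) auto
      then consider "F \<in> I (n + 1)" | m' h' where "m = p * m'" "h' \<in> I m'" "F - h' ^ (p ^ (s + 1)) \<in> I (n + 1)"
        by blast
      then show ?thesis
      proof cases
        case 2
        have "m' < m" using 2(1) m0 p_gt_1 by simp
        moreover have "n = p ^ (s + 1) * m'" using less.prems(1) 2(1) by simp
        ultimately show ?thesis using less.IH[of m' "s + 1" h'] 2 by blast
      qed blast
    qed
  qed
  (* start with the trivial description of F as a first power *)
  from this[of 0 n F] show ?thesis using F by simp
qed

text \<open>
  The part of the distributions of order at most \<open>n\<close> that comes from smaller order.
\<close>

definition decomposables :: "nat \<Rightarrow> (('g \<Rightarrow> 'k) \<Rightarrow> 'k) set" where
  "decomposables n = fs.span ({x \<star> y | x y i j. x \<in> Dp i \<and> y \<in> Dp j \<and> 0 < i \<and> 0 < j \<and> i + j = n} \<union> Dp (n - 1))"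

lemma decomposables_subset: "decomposables n \<subseteq> Dp n"
  unfolding decomposables_def
  by (rule fs.span_minimal[OF _ Dp_subspace]) (auto intro: dm_Dp Dp_mono[of "n - 1" n])

text \<open>
  Otherwise some function \<open>F\<close> is killed by all decomposable distributions but not by \<open>\<delta>\<close>. Being killed by the products
  says that the leading form of \<open>F\<close> is primitive, so \<open>F\<close> agrees with a \<open>p\<^sup>s\<close>-th power up to terms invisible to
  \<open>\<delta>\<close>, which contradicts the hypothesis on \<open>\<delta>\<close>.
\<close>

lemma indecomposables:
  assumes \<delta>: "\<delta> \<in> Dp n" and n: "n \<ge> 1"
    and van: "\<And>s h. n = p ^ s \<Longrightarrow> h \<in> A \<Longrightarrow> \<delta> (h ^ n) = 0"
  shows "\<delta> \<in> decomposables n"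
proof (rule ccontr)
  assume no: "\<delta> \<notin> decomposables n"
  obtain E where E: "finite E" "E \<subseteq> A" "A \<subseteq> fs.span (E \<union> I (Suc n))" using A_finite_span by blast
  have sub: "fs.subspace (decomposables n)" by (simp add: decomposables_def fs.subspace_span)
  obtain H d where H: "H \<subseteq> E" "\<forall>h\<in>H. d h \<in> decomposables n"
     "\<forall>\<mu>\<in>decomposables n. \<forall>e\<in>E. \<mu> e = (\<Sum>h\<in>H. \<mu> h * d h e)"
    using dual_basis[OF E(1) sub] by blast
  (* the part of \<delta> that is not explained by decomposables, and a function that detects it *)
  define \<delta>' where "\<delta>' = \<delta> - (\<Sum>h\<in>H. fscale (\<delta> h) (d h))"
  have sD: "(\<Sum>h\<in>H. fscale (\<delta> h) (d h)) \<in> decomposables n"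
    using H(2) by (intro fs.subspace_sum[OF sub] fs.subspace_scale[OF sub]) auto
  have \<delta>'D: "\<delta>' \<in> Dp n" unfolding \<delta>'_def using \<delta> sD decomposables_subset by (intro Dp_minus) auto
  have nz: "\<delta>' \<noteq> 0" using no sD by (auto simp: \<delta>'_def)
  have "\<exists>e\<in>E. \<delta>' e \<noteq> 0"
  proof (rule ccontr)
    assume "\<not> ?thesis"
    then have zE: "\<And>e. e \<in> E \<Longrightarrow> \<delta>' e = 0" by blast
    note L = Dp_LF[OF \<delta>'D]
    have "fs.subspace {f \<in> A. \<delta>' f = 0}"
      by (rule fs.subspaceI) (auto simp: A_add A_scale LF_add[OF L] LF_scale[OF L] LF_0[OF L])
    moreover have "E \<union> I (Suc n) \<subseteq> {f \<in> A. \<delta>' f = 0}" using zE E(2) Dp_vanish[OF \<delta>'D] I_subset_A by blast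
    ultimately have "A \<subseteq> {f \<in> A. \<delta>' f = 0}" using E(3) fs.span_minimal by blast
    then have "\<delta>' = 0" by (intro LF_eqI[OF L LF_zero]) (auto simp: zero_fun_apply)
    then show False using nz by blast
  qed
  then obtain e where e: "e \<in> E" "\<delta>' e \<noteq> 0" by blast
  (* adjust e so that all decomposables vanish on it *)
  define f where "f = e - (\<Sum>h\<in>H. fscale (d h e) h)"
  have HA: "H \<subseteq> A" and eA: "e \<in> A" using H(1) E(2) e by auto
  have sA: "(\<Sum>h\<in>H. fscale (d h e) h) \<in> A" using HA by (intro A_sum A_scale) auto
  have fA: "f \<in> A" using eA sA by (simp add: f_def A_diff)
  have ev: "\<mu> f = \<mu> e - (\<Sum>h\<in>H. d h e * \<mu> h)" if "\<mu> \<in> LF" for \<mu>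
    unfolding f_def LF_diff[OF that eA sA] using HA by (subst LF_sum_scale[OF that]) auto
  define F where "F = normalized f"
  have Faug: "F \<in> aug" using fA aug_normalize by (simp add: F_def)
  have evF: "\<mu> F = \<mu> f" if "\<mu> \<in> Dp k" for \<mu> k using Dp_normalized[OF that fA] by (simp add: F_def)
  have kill: "\<mu> F = 0" if "\<mu> \<in> decomposables n" for \<mu>
  proof -
    have \<mu>: "\<mu> \<in> Dp n" using that decomposables_subset by blast
    have "\<mu> e = (\<Sum>h\<in>H. \<mu> h * d h e)" using bspec[OF bspec[OF H(3) that] e(1)] .
    then show ?thesis using evF[OF \<mu>] ev[OF Dp_LF[OF \<mu>]] by (simp add: mult.commute)
  qed
  have keep: "\<delta> F \<noteq> 0"
  proof -
    have "\<delta>' e = \<delta> e - (\<Sum>h\<in>H. \<delta> h * d h e)" by (simp add: \<delta>'_def pointwise)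
    then show ?thesis using e(2) evF[OF \<delta>] ev[OF Dp_LF[OF \<delta>]] by (simp add: mult.commute)
  qed
  have kill1: "\<mu> F = 0" if "\<mu> \<in> Dp (n - 1)" for \<mu>
    by (rule kill) (use that in \<open>auto simp: decomposables_def intro: fs.span_base\<close>)
  have FI: "F \<in> I n" using Dp_separates[of F "n - 1", OF Faug] kill1 n by simp
  have pr: "conv \<rho> F \<in> I (n - q + 1)" if q: "1 \<le> q" "q < n" and \<rho>: "\<rho> \<in> Dp q" for q \<rho>
  proof (rule Dd_separates)
    have FA: "F \<in> A" using Faug aug_A by blast
    show "conv \<rho> F \<in> A" using FA Dp_LF[OF \<rho>] by (rule conv_A)
    fix \<mu> assume \<mu>: "\<mu> \<in> Dd (n - q + 1)"
    then have pp: "plus_part \<mu> \<in> Dp (n - q)" using plus_part_Dp by simp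
    have "(plus_part \<mu> \<star> \<rho>) F = 0"
    proof (rule kill)
      have "plus_part \<mu> \<star> \<rho> \<in> {x \<star> y | x y i j. x \<in> Dp i \<and> y \<in> Dp j \<and> 0 < i \<and> 0 < j \<and> i + j = n}"
        using pp \<rho> q by (intro CollectI exI[of _ "plus_part \<mu>"] exI[of _ \<rho>] exI[of _ "n - q"] exI[of _ q]) auto
      then show "plus_part \<mu> \<star> \<rho> \<in> decomposables n"
        unfolding decomposables_def by (intro fs.span_base) blast
    qed
    moreover have "\<rho> F = 0" using kill1 Dp_mono[of q "n - 1"] \<rho> q by simp
    moreover have "(\<mu> \<star> \<rho>) F = (plus_part \<mu> \<star> \<rho>) F + \<mu> one_A * \<rho> F"
      by (subst plus_part_eq) (simp add: dm_add_left dm_scale_left dm_eps Dp_LF[OF \<rho>] plus_fun_apply[of _ _ F] fscale_apply[of _ _ F])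
    ultimately show "\<mu> (conv \<rho> F) = 0" using FA by (simp add: dm_apply)
  qed
  from primitive_is_frobenius_power[OF FI n pr]
  show False
  proof
    assume "F \<in> I (n + 1)"
    then show False using Dp_vanish[OF \<delta>] keep by simp
  next
    assume "\<exists>s h. n = p ^ s \<and> h \<in> A \<and> F - h ^ (p ^ s) \<in> I (n + 1)"
    then obtain s h where sh: "n = p ^ s" "h \<in> A" "F - h ^ n \<in> I (n + 1)" by blast
    have "\<delta> (F - h ^ n) = 0" using Dp_vanish[OF \<delta>] sh by simp
    moreover have "\<delta> (F - h ^ n) = \<delta> F - \<delta> (h ^ n)"
      using Faug sh n by (intro LF_diff[OF Dp_LF[OF \<delta>]] A_power) (auto simp: aug_A)
    ultimately show False using van[OF sh(1,2)] keep by simp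
  qed
qed

end

section \<open>The relations of the higher enveloping algebra\<close>

abbreviation gen :: "'v \<Rightarrow> 'v mon \<Rightarrow>\<^sub>0 'k::field" where "gen \<equiv> free_generator"
abbreviation sc :: "'k::field \<Rightarrow> 'v mon \<Rightarrow>\<^sub>0 'k" where "sc \<equiv> free_scalar"

lemma mon_plus [simp]: "Mon a + Mon b = Mon (a @ b)" by (simp add: plus_mon_def)

lemma sc_add: "sc (a + b) = sc a + sc b"
  and sc_mult: "sc (a * b) = sc a * sc b"
  and sc_0 [simp]: "sc 0 = 0"
  and sc_1 [simp]: "sc 1 = 1"
  by (simp_all add: free_scalar_def single_add mult_single)

lemma sc_diff: "sc (a - b) = sc a - sc b"
  by (simp add: eq_diff_eq flip: sc_add)

lemma sc_power: "sc (a ^ n) = sc a ^ n"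
  by (induction n) (simp_all add: sc_mult)

lemma sc_of_nat: "sc (of_nat n) = of_nat n"
  by (induction n) (simp_all add: sc_add)

lemma single_word: "Poly_Mapping.single (Mon w) c = sc c * prod_list (map gen w)"
proof (induction w arbitrary: c)
  case Nil
  then show ?case by (simp add: free_scalar_def zero_mon_def)
next
  case (Cons v w)
  have "Poly_Mapping.single (Mon (v # w)) c = Poly_Mapping.single 0 c * (gen v * Poly_Mapping.single (Mon w) 1)"
    by (simp add: free_generator_def mult_single zero_mon_def)
  then show ?case using Cons[of 1] by (simp add: free_scalar_def)
qed

text \<open>
  Every element of the free algebra is a sum of multiples of words.
\<close>

lemma free_induct [case_names word add]:
  assumes w: "\<And>c w. P (sc c * prod_list (map gen w))" and add: "\<And>x y. P x \<Longrightarrow> P y \<Longrightarrow> P (x + y)"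
  shows "P u"
proof (induction u rule: update_induct)
  case const
  show ?case using w[of 0 "[]"] by simp
next
  case (update f a b)
  have "Poly_Mapping.update a b f = Poly_Mapping.single a b + f"
    using update(1) by (intro poly_mapping_eqI) (auto simp: lookup_update lookup_add lookup_single in_keys_iff when_def)
  moreover have "P (Poly_Mapping.single a b)"
    using w[of b "letters a"] single_word[of "letters a" b] by simp
  ultimately show ?case using add update(3) by simp
qed

lemma sc_central: "sc c * u = u * sc c"
proof (induction u rule: free_induct)
  case (word d w)
  have "sc c * Poly_Mapping.single (Mon w) d = Poly_Mapping.single (Mon w) d * sc c"
    by (simp add: free_scalar_def mult_single zero_mon_def mult.commute)
  then show ?case by (simp add: single_word)
qed (simp add: distrib_left distrib_right)

text \<open>
  The scalar multiplication \<open>s\<close> of the target is a parameter because the targets are both free algebras and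
  spaces of linear forms.
\<close>

definition lin_ext :: "('k::field \<Rightarrow> 'r \<Rightarrow> 'r::ab_group_add) \<Rightarrow> ('v list \<Rightarrow> 'r) \<Rightarrow> ('v mon \<Rightarrow>\<^sub>0 'k) \<Rightarrow> 'r" where
  "lin_ext s \<psi> u = (\<Sum>w\<in>Poly_Mapping.keys u. s (Poly_Mapping.lookup u w) (\<psi> (letters w)))"

lemma (in vector_space) lin_ext_add: "lin_ext scale \<psi> (u + v) = lin_ext scale \<psi> u + lin_ext scale \<psi> v"
proof -
  let ?K = "Poly_Mapping.keys u \<union> Poly_Mapping.keys v"
  have ext: "lin_ext scale \<psi> x = (\<Sum>w\<in>?K. scale (Poly_Mapping.lookup x w) (\<psi> (letters w)))"
    if "Poly_Mapping.keys x \<subseteq> ?K" for x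
    unfolding lin_ext_def using that
    by (intro sum.mono_neutral_left) (auto simp: in_keys_iff)
  show ?thesis
    using keys_add[of u v] by (simp add: ext lookup_add scale_left_distrib sum.distrib)
qed

lemma (in vector_space) lin_ext_word: "lin_ext scale \<psi> (sc c * prod_list (map gen w)) = scale c (\<psi> w)"
  by (simp add: lin_ext_def flip: single_word)

lemma vector_space_sc: "vector_space (\<lambda>c (x :: 'v mon \<Rightarrow>\<^sub>0 'k::field). sc c * x)"
  by unfold_locales (simp_all add: distrib_left distrib_right sc_add sc_mult mult.assoc)

definition subst :: "('v \<Rightarrow> 'w mon \<Rightarrow>\<^sub>0 'k::field) \<Rightarrow> ('v mon \<Rightarrow>\<^sub>0 'k) \<Rightarrow> 'w mon \<Rightarrow>\<^sub>0 'k" where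
  "subst \<theta> = lin_ext (\<lambda>c x. sc c * x) (\<lambda>w. prod_list (map \<theta> w))"

lemma subst_add: "subst \<theta> (u + v) = subst \<theta> u + subst \<theta> v"
  unfolding subst_def by (rule vector_space.lin_ext_add[OF vector_space_sc])

lemma subst_word: "subst \<theta> (sc c * prod_list (map gen w)) = sc c * prod_list (map \<theta> w)"
  unfolding subst_def by (rule vector_space.lin_ext_word[OF vector_space_sc])

lemma word_mult: "(sc c * prod_list (map gen a)) * (sc d * prod_list (map gen b)) = sc (c * d) * prod_list (map gen (a @ b))"
  by (metis (no_types, lifting) sc_central sc_mult mult.assoc map_append prod_list.append)

lemma subst_mult: "subst \<theta> (u * v) = subst \<theta> u * subst \<theta> v"
proof (induction u rule: free_induct)
  case u: (word c a)
  show ?case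
  proof (induction v rule: free_induct)
    case (word d b)
    have "sc (c * d) * (x * y) = (sc c * x) * (sc d * y)" for x y :: "'y mon \<Rightarrow>\<^sub>0 'z::field" and c d
      by (metis sc_central sc_mult mult.assoc)
    then show ?case unfolding word_mult subst_word by simp
  qed (simp add: distrib_left subst_add)
qed (simp add: distrib_right subst_add)

lemma subst_gen: "subst \<theta> (gen v) = \<theta> v"
  using subst_word[of \<theta> 1 "[v]"] by simp

lemma subst_sc: "subst \<theta> (sc c) = sc c"
  using subst_word[of \<theta> c "[]"] by simp

lemma subst_diff: "subst \<theta> (u - v) = subst \<theta> u - subst \<theta> v"
  using subst_add[of \<theta> "u - v" v] by simp

lemma subst_1: "subst \<theta> 1 = 1"
  using subst_sc[of \<theta> 1] by simp

lemma subst_power: "subst \<theta> (u ^ n) = subst \<theta> u ^ n"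
  by (induction n) (simp_all add: subst_1 subst_mult)

locale higher_env = char_p_group G A p
  for G :: "('g, 'm) monoid_scheme" (structure) and A :: "('g \<Rightarrow> 'k::alg_closed_field) set" and p +
  fixes r :: nat
begin

definition q :: nat where "q = p ^ r"
definition N :: nat where "N = p * q"

lemma q_pos [simp]: "q > 0" by (simp add: q_def)
lemma N_eq: "N = p ^ (r + 1)" by (simp add: N_def q_def)
lemma N_pos [simp]: "N > 0" by (simp add: N_def)
lemma q_less_N: "q < N" using p_gt_1 by (simp add: N_def)
lemma two_q_le: "q + q \<le> N" 
proof -
  have "2 * q \<le> p * q" by (rule mult_le_mono1) (use p_gt_1 in simp)
  then show ?thesis by (simp only: N_def mult_2)
qed

definition V :: "(('g \<Rightarrow> 'k) \<Rightarrow> 'k) set" where "V = Dp (N - 1)"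

lemma V_subspace: "fs.subspace V" unfolding V_def by (rule Dp_subspace)

lemmas V_plus = fs.subspace_add[OF V_subspace]
  and V_minus = fs.subspace_diff[OF V_subspace]
  and V_fscale = fs.subspace_scale[OF V_subspace]
  and V_zero [simp] = fs.subspace_0[OF V_subspace]
  and V_sum = fs.subspace_sum[OF V_subspace]

lemma V_LF: "v \<in> V \<Longrightarrow> v \<in> LF" unfolding V_def by (rule Dp_LF)

text \<open>
  The two-sided ideal whose quotient is the higher enveloping algebra, on the free algebra over the
  whole type of linear forms. Letters that are not generators are set to zero, and therefore no carrier
  sets are needed in computations.
\<close>

inductive_set J :: "((('g \<Rightarrow> 'k) \<Rightarrow> 'k) mon \<Rightarrow>\<^sub>0 'k) set" where
  J_add_rel: "v \<in> V \<Longrightarrow> w \<in> V \<Longrightarrow> gen (v + w) - gen v - gen w \<in> J"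
| J_scale_rel: "v \<in> V \<Longrightarrow> gen (fscale c v) - sc c * gen v \<in> J"
| J_mult_rel: "x \<in> Dp i \<Longrightarrow> y \<in> Dp j \<Longrightarrow> i + j < N \<Longrightarrow> gen x * gen y - gen (x \<star> y) \<in> J"
| J_comm_rel: "x \<in> Dp i \<Longrightarrow> y \<in> Dp j \<Longrightarrow> 0 < i \<Longrightarrow> 0 < j \<Longrightarrow> i + j \<le> N \<Longrightarrow>
     gen x * gen y - gen y * gen x - gen (x \<star> y - y \<star> x) \<in> J"
| J_out: "v \<notin> V \<Longrightarrow> gen v \<in> J"
| J_plus: "u \<in> J \<Longrightarrow> v \<in> J \<Longrightarrow> u + v \<in> J"
| J_left: "u \<in> J \<Longrightarrow> a * u \<in> J"
| J_right: "u \<in> J \<Longrightarrow> u * a \<in> J"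

lemma J_0 [simp]: "0 \<in> J"
proof -
  have "0 * (gen (0 + 0) - gen 0 - gen 0) \<in> J" by (intro J_left J_add_rel) simp_all
  then show ?thesis by simp
qed

lemma J_uminus: "u \<in> J \<Longrightarrow> - u \<in> J"
  using J_left[of u "-1"] by simp

lemma J_minus: "u \<in> J \<Longrightarrow> v \<in> J \<Longrightarrow> u - v \<in> J"
  using J_plus[of u "- v"] J_uminus by simp

definition eqJ :: "((('g \<Rightarrow> 'k) \<Rightarrow> 'k) mon \<Rightarrow>\<^sub>0 'k) \<Rightarrow> _ \<Rightarrow> bool" (infix "\<approx>" 50) where
  "u \<approx> v \<longleftrightarrow> u - v \<in> J"

lemma eqJ_refl [simp, intro]: "u \<approx> u" by (simp add: eqJ_def)
lemma eqJ_sym: "u \<approx> v \<Longrightarrow> v \<approx> u" unfolding eqJ_def using J_uminus by fastforce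
lemma eqJ_trans [trans]: "u \<approx> v \<Longrightarrow> v \<approx> w \<Longrightarrow> u \<approx> w"
  unfolding eqJ_def using J_plus by fastforce
lemma eqJ_add: "u \<approx> v \<Longrightarrow> u' \<approx> v' \<Longrightarrow> u + u' \<approx> v + v'"
  unfolding eqJ_def using J_plus[of "u - v" "u' - v'"] by (simp add: algebra_simps)
lemma eqJ_diff: "u \<approx> v \<Longrightarrow> u' \<approx> v' \<Longrightarrow> u - u' \<approx> v - v'"
  unfolding eqJ_def using J_minus[of "u - v" "u' - v'"] by (simp add: algebra_simps)
lemma eqJ_mult: "u \<approx> v \<Longrightarrow> u' \<approx> v' \<Longrightarrow> u * u' \<approx> v * v'"
  unfolding eqJ_def using J_plus[OF J_right[of "u - v" u'] J_left[of "u' - v'" v]] by (simp add: algebra_simps)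
lemma eqJ_power: "u \<approx> v \<Longrightarrow> u ^ n \<approx> v ^ n"
  by (induction n) (auto intro: eqJ_mult)
lemma eqJ_sum: "(\<And>i. i \<in> S \<Longrightarrow> f i \<approx> g i) \<Longrightarrow> sum f S \<approx> sum g S"
  by (induction S rule: infinite_finite_induct) (auto intro: eqJ_add)
lemma eqJ_0: "u \<approx> 0 \<longleftrightarrow> u \<in> J" by (simp add: eqJ_def)
lemma eqJ_diff_0: "u - v \<approx> 0 \<longleftrightarrow> u \<approx> v" by (simp add: eqJ_def)

lemma gen_add: "v \<in> V \<Longrightarrow> w \<in> V \<Longrightarrow> gen (v + w) \<approx> gen v + gen w"
  unfolding eqJ_def using J_add_rel[of v w] by (simp add: algebra_simps)
lemma gen_scale: "v \<in> V \<Longrightarrow> gen (fscale c v) \<approx> sc c * gen v"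
  unfolding eqJ_def by (rule J_scale_rel)
lemma gen_0: "gen 0 \<approx> 0" using gen_scale[of 0 0] by simp
lemma gen_diff: "v \<in> V \<Longrightarrow> w \<in> V \<Longrightarrow> gen (v - w) \<approx> gen v - gen w"
  using eqJ_diff[OF gen_add[of "v - w" w] eqJ_refl[of "gen w"]] V_minus[of v w]
  by (simp add: eqJ_sym)
lemma gen_sum: "(\<And>i. i \<in> S \<Longrightarrow> v i \<in> V) \<Longrightarrow> gen (sum v S) \<approx> (\<Sum>i\<in>S. gen (v i))"
proof (induction S rule: infinite_finite_induct)
  case (insert x S)
  have "gen (v x + sum v S) \<approx> gen (v x) + gen (sum v S)"
    using insert.prems by (intro gen_add V_sum) auto
  also have "\<dots> \<approx> gen (v x) + (\<Sum>i\<in>S. gen (v i))" using insert by (intro eqJ_add) auto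
  finally show ?case using insert by simp
qed (auto simp: gen_0)

lemma Dp_V: "x \<in> Dp i \<Longrightarrow> i < N \<Longrightarrow> x \<in> V"
  unfolding V_def using Dp_mono[of i "N - 1" x] by simp

definition word_dist :: "(('g \<Rightarrow> 'k) \<Rightarrow> 'k) list \<Rightarrow> ('g \<Rightarrow> 'k) \<Rightarrow> 'k" where
  "word_dist w = foldr (\<lambda>v x. (if v \<in> V then v else 0) \<star> x) w eps"

text \<open>
  The canonical map to the algebra of distributions. It is the tool that identifies elements of small
  degree.
\<close>

definition ev :: "((('g \<Rightarrow> 'k) \<Rightarrow> 'k) mon \<Rightarrow>\<^sub>0 'k) \<Rightarrow> ('g \<Rightarrow> 'k) \<Rightarrow> 'k" where
  "ev = lin_ext fscale word_dist"

lemma word_dist_LF: "word_dist w \<in> LF"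
  by (induction w) (auto simp: word_dist_def eps_LF V_LF intro!: dm_LF)

lemma word_dist_append: "word_dist (a @ b) = word_dist a \<star> word_dist b"
proof (induction a)
  case Nil
  then show ?case using word_dist_LF[of b] by (simp add: word_dist_def dm_eps)
next
  case (Cons v a)
  have "word_dist (v # x) = (if v \<in> V then v else 0) \<star> word_dist x" for x by (simp add: word_dist_def)
  moreover have "(if v \<in> V then v else 0) \<in> LF" by (auto intro: V_LF)
  ultimately show ?case using Cons word_dist_LF by (simp add: dm_assoc)
qed

lemma ev_add: "ev (u + v) = ev u + ev v"
  unfolding ev_def by (rule fs.lin_ext_add)
lemma ev_word: "ev (sc c * prod_list (map gen w)) = fscale c (word_dist w)"
  unfolding ev_def by (rule fs.lin_ext_word)

lemma ev_LF: "ev u \<in> LF"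
  by (induction u rule: free_induct) (auto simp: ev_add ev_word intro: LF_plus LF_fscale word_dist_LF)

lemma ev_mult: "ev (u * v) = ev u \<star> ev v"
proof (induction u rule: free_induct)
  case u: (word c a)
  show ?case
  proof (induction v rule: free_induct)
    case (word d b)
    show ?case unfolding word_mult ev_word word_dist_append
      by (simp add: dm_scale_left dm_scale_right word_dist_LF LF_fscale dm_LF)
  next
    case (add x y)
    then show ?case by (simp add: distrib_left ev_add dm_add_right ev_LF)
  qed
qed (simp add: distrib_right ev_add dm_add_left)

lemma ev_diff: "ev (u - v) = ev u - ev v"
  using ev_add[of "u - v" v] by simp

lemma ev_sc: "ev (sc c) = fscale c eps"
  using ev_word[of c "[]"] by (simp add: word_dist_def)

lemma ev_gen: "v \<in> V \<Longrightarrow> ev (gen v) = v"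
  using ev_word[of 1 "[v]"] by (simp add: word_dist_def dm_eps V_LF)

lemma ev_gen_out: "v \<notin> V \<Longrightarrow> ev (gen v) = 0"
  using ev_word[of 1 "[v]"] by (simp add: word_dist_def dm_zero_left)

lemma ev_power: "v \<in> V \<Longrightarrow> ev (gen v ^ k) = pow v k"
  by (induction k) (use ev_sc[of 1] in \<open>simp_all add: pow_0 ev_mult ev_gen\<close>)

text \<open>
  The defining relations hold in the algebra of distributions.
\<close>

lemma ev_J: "u \<in> J \<Longrightarrow> ev u = 0"
proof (induction rule: J.induct)
  case (J_add_rel v w)
  then show ?case by (simp add: ev_diff ev_gen V_plus)
next
  case (J_scale_rel v c)
  then show ?case by (simp add: ev_diff ev_mult ev_sc ev_gen V_fscale dm_scale_left dm_eps V_LF)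
next
  case (J_mult_rel x i y j)
  then have "x \<in> V" "y \<in> V" "x \<star> y \<in> V" using dm_Dp[of x i y j] by (auto intro: Dp_V)
  then show ?case by (simp add: ev_diff ev_mult ev_gen)
next
  case (J_comm_rel x i y j)
  then have "x \<star> y - y \<star> x \<in> Dp (i + j - 1)" by (intro dm_commutator_Dp) auto
  then have "x \<in> V" "y \<in> V" "x \<star> y - y \<star> x \<in> V" using J_comm_rel by (auto intro: Dp_V)
  then show ?case by (simp add: ev_diff ev_mult ev_gen)
next
  case (J_out v)
  then show ?case by (rule ev_gen_out)
qed (simp_all add: ev_add ev_mult dm_zero_left dm_zero_right ev_LF)

lemma ev_eqJ: "u \<approx> v \<Longrightarrow> ev u = ev v"
  using ev_J[of "u - v"] by (simp add: eqJ_def ev_diff)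

text \<open>
  The class of a distribution that may have a constant term: the constant term becomes a scalar.
\<close>

definition br :: "(('g \<Rightarrow> 'k) \<Rightarrow> 'k) \<Rightarrow> (('g \<Rightarrow> 'k) \<Rightarrow> 'k) mon \<Rightarrow>\<^sub>0 'k" where
  "br z = sc (z one_A) + gen (plus_part z)"

lemma br_Dp: "z \<in> Dp n \<Longrightarrow> br z = gen z"
  by (simp add: br_def plus_part_id Dp_one)

lemma plus_part_V: "z \<in> Dd N \<Longrightarrow> plus_part z \<in> V"
  unfolding V_def using plus_part_Dp[of z "N - 1"] by simp

lemma plus_part_add: "plus_part (z + y) = plus_part z + plus_part y"
  and plus_part_scale: "plus_part (fscale c z) = fscale c (plus_part z)"
  by (simp_all add: plus_part_def plus_fun_apply[of z y one_A] fscale_apply[of c z one_A]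
      fs.scale_left_distrib fs.scale_right_diff_distrib)

lemma br_add: "z \<in> Dd N \<Longrightarrow> y \<in> Dd N \<Longrightarrow> br (z + y) \<approx> br z + br y"
proof -
  assume "z \<in> Dd N" "y \<in> Dd N"
  then have "sc (z one_A) + sc (y one_A) + gen (plus_part z + plus_part y)
      \<approx> sc (z one_A) + sc (y one_A) + (gen (plus_part z) + gen (plus_part y))"
    by (intro eqJ_add gen_add plus_part_V) auto
  then show ?thesis by (simp add: br_def plus_part_add plus_fun_apply[of z y one_A] plus_fun_apply[of y z one_A] sc_add algebra_simps)
qed

lemma br_scale: "z \<in> Dd N \<Longrightarrow> br (fscale c z) \<approx> sc c * br z"
proof -
  assume "z \<in> Dd N"
  then have "sc (c * z one_A) + gen (fscale c (plus_part z)) \<approx> sc (c * z one_A) + sc c * gen (plus_part z)"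
    by (intro eqJ_add gen_scale plus_part_V) auto
  then show ?thesis by (simp add: br_def plus_part_scale fscale_apply[of c z one_A] sc_mult algebra_simps)
qed

lemma br_0: "br 0 \<approx> 0"
  using br_scale[of 0 0] by simp

lemma br_eps: "br eps \<approx> 1"
  using eqJ_add[OF eqJ_refl[of 1] gen_0] by (simp add: br_def plus_part_def eps_one_A)

lemma ev_br: "z \<in> Dd N \<Longrightarrow> ev (br z) = z"
proof -
  assume "z \<in> Dd N"
  then have "ev (br z) = plus_part z + fscale (z one_A) eps"
    by (simp add: br_def ev_add ev_sc ev_gen plus_part_V add.commute)
  then show ?thesis by (simp only: plus_part_eq[symmetric])
qed

lemma plus_part_dm:
  assumes "x \<in> LF" "y \<in> LF"
  shows "plus_part (x \<star> y) = plus_part x \<star> plus_part y + fscale (y one_A) (plus_part x) + fscale (x one_A) (plus_part y)"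
proof -
  have "plus_part x \<in> LF" "plus_part y \<in> LF" using assms eps_LF by (auto simp: plus_part_def intro!: LF_minus LF_fscale)
  then show ?thesis
    using assms eps_LF unfolding plus_part_def
    by (simp add: dm_one_A dm_diff_left dm_diff_right dm_scale_left dm_scale_right dm_eps LF_fscale LF_minus
        fs.scale_right_diff_distrib algebra_simps)
qed

lemma gen_comb3:
  assumes "a \<in> V" "b \<in> V" "c \<in> V"
  shows "gen ((a + fscale s b) + fscale t c) \<approx> (gen a + sc s * gen b) + sc t * gen c"
proof -
  have V: "fscale s b \<in> V" "fscale t c \<in> V" "a + fscale s b \<in> V" using assms by (simp_all add: V_fscale V_plus)
  have "gen ((a + fscale s b) + fscale t c) \<approx> gen (a + fscale s b) + gen (fscale t c)"
    by (rule gen_add[OF V(3,2)])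
  also have "\<dots> \<approx> (gen a + gen (fscale s b)) + gen (fscale t c)"
    by (rule eqJ_add[OF gen_add[OF assms(1) V(1)] eqJ_refl])
  also have "\<dots> \<approx> (gen a + sc s * gen b) + sc t * gen c"
    by (rule eqJ_add[OF eqJ_add[OF eqJ_refl gen_scale[OF assms(2)]] gen_scale[OF assms(3)]])
  finally show ?thesis .
qed

text \<open>
  The product relation, extended to distributions with constant term.
\<close>

lemma br_mult:
  assumes x: "x \<in> Dd (Suc i)" and y: "y \<in> Dd (Suc j)" and ij: "i + j < N"
  shows "br x * br y \<approx> br (x \<star> y)"
proof -
  let ?x = "plus_part x" and ?y = "plus_part y"
  have xp: "?x \<in> Dp i" "?y \<in> Dp j" using x y plus_part_Dp by auto
  have xV: "?x \<in> V" "?y \<in> V" "?x \<star> ?y \<in> V" using xp dm_Dp[OF xp] ij by (auto intro: Dp_V)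
  have pe: "plus_part (x \<star> y) = (?x \<star> ?y + fscale (y one_A) ?x) + fscale (x one_A) ?y"
    using x y by (simp add: plus_part_dm Dd_LF)
  have "gen (plus_part (x \<star> y)) \<approx> (gen (?x \<star> ?y) + sc (y one_A) * gen ?x) + sc (x one_A) * gen ?y"
    unfolding pe by (rule gen_comb3[OF xV(3,1,2)])
  also have "\<dots> \<approx> (gen ?x * gen ?y + sc (y one_A) * gen ?x) + sc (x one_A) * gen ?y"
  proof (rule eqJ_add[OF eqJ_add[OF eqJ_sym eqJ_refl] eqJ_refl])
    show "gen ?x * gen ?y \<approx> gen (?x \<star> ?y)"
      using J_mult_rel[OF xp ij] by (simp add: eqJ_def)
  qed
  finally have "sc (x one_A * y one_A) + gen (plus_part (x \<star> y)) \<approx>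
     sc (x one_A * y one_A) + ((gen ?x * gen ?y + sc (y one_A) * gen ?x) + sc (x one_A) * gen ?y)"
    by (rule eqJ_add[OF eqJ_refl])
  moreover have "br x * br y = sc (x one_A * y one_A) + ((gen ?x * gen ?y + sc (y one_A) * gen ?x) + sc (x one_A) * gen ?y)"
    by (simp add: br_def algebra_simps sc_mult sc_central[of "y one_A" "gen ?x"])
  moreover have "(x \<star> y) one_A = x one_A * y one_A" using dm_one_A[OF Dd_LF[OF x]] .
  ultimately show ?thesis unfolding br_def[of "x \<star> y"] by (simp add: eqJ_sym)
qed

lemma br_comm:
  assumes x: "x \<in> Dd (Suc i)" and y: "y \<in> Dd (Suc j)" and ij: "i + j \<le> N" "0 < i" "0 < j"
  shows "br x * br y - br y * br x \<approx> br (x \<star> y - y \<star> x)"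
proof -
  let ?x = "plus_part x" and ?y = "plus_part y"
  have xp: "?x \<in> Dp i" "?y \<in> Dp j" using x y plus_part_Dp by auto
  have "x \<star> y - y \<star> x = ?x \<star> ?y - ?y \<star> ?x"
    using x y eps_LF unfolding plus_part_def
    by (simp add: dm_diff_left dm_diff_right dm_scale_left dm_scale_right dm_eps LF_fscale LF_minus Dd_LF
        fs.scale_right_diff_distrib algebra_simps)
  moreover have "?x \<star> ?y - ?y \<star> ?x \<in> Dp (i + j - 1)" using xp ij by (intro dm_commutator_Dp) auto
  ultimately have "br (x \<star> y - y \<star> x) = gen (?x \<star> ?y - ?y \<star> ?x)" using br_Dp by simp
  moreover have "br x * br y - br y * br x = gen ?x * gen ?y - gen ?y * gen ?x"
    by (simp add: br_def algebra_simps sc_central[of "x one_A" "sc (y one_A)"]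
      sc_central[of "y one_A" "gen ?x"] sc_central[of "x one_A" "gen ?y"])
  moreover have "gen ?x * gen ?y - gen ?y * gen ?x \<approx> gen (?x \<star> ?y - ?y \<star> ?x)"
    using J_comm_rel[OF xp] ij by (simp add: eqJ_def)
  ultimately show ?thesis by simp
qed

end

section \<open>Additivity and kernel of the p-th power map\<close>

context higher_env
begin

text \<open>
  The elements of degree at most \<open>n\<close>: those that are represented by one distribution of that order. For \<open>n < N\<close> the
  representing distribution is the value of \<open>ev\<close>.
\<close>

definition Gd :: "nat \<Rightarrow> ((('g \<Rightarrow> 'k) \<Rightarrow> 'k) mon \<Rightarrow>\<^sub>0 'k) set" where
  "Gd n = {u. \<exists>z\<in>Dd (Suc n). u \<approx> br z}"

lemma Gd_I: "z \<in> Dd (Suc n) \<Longrightarrow> u \<approx> br z \<Longrightarrow> u \<in> Gd n"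
  by (auto simp: Gd_def)

lemma Gd_E:
  assumes "u \<in> Gd n" obtains z where "z \<in> Dd (Suc n)" "u \<approx> br z"
  using assms by (auto simp: Gd_def)

lemma Dd_N: "z \<in> Dd (Suc n) \<Longrightarrow> n < N \<Longrightarrow> z \<in> Dd N"
  by (rule Dd_mono[of "Suc n"]) auto

lemma Gd_eqJ: "u \<in> Gd n \<Longrightarrow> v \<approx> u \<Longrightarrow> v \<in> Gd n"
  by (auto simp: Gd_def intro: eqJ_trans)

lemma Gd_mono: "m \<le> n \<Longrightarrow> u \<in> Gd m \<Longrightarrow> u \<in> Gd n"
  by (auto simp: Gd_def intro: Dd_mono[of "Suc m" "Suc n"])

lemma Gd_add: assumes "u \<in> Gd n" "v \<in> Gd n" "n < N" shows "u + v \<in> Gd n"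
proof -
  obtain z y where z: "z \<in> Dd (Suc n)" "u \<approx> br z" and y: "y \<in> Dd (Suc n)" "v \<approx> br y"
    using assms by (auto simp: Gd_def)
  have "u + v \<approx> br z + br y" using z y by (intro eqJ_add)
  also have "\<dots> \<approx> br (z + y)" using br_add z y assms(3) Dd_N by (intro eqJ_sym[OF br_add]) auto
  finally show ?thesis using z y by (intro Gd_I[of "z + y"] Dd_plus)
qed

lemma Gd_0: "0 \<in> Gd n" by (rule Gd_I[of 0]) (auto intro: eqJ_sym br_0)

lemma Gd_1: "1 \<in> Gd n"
  by (rule Gd_I[of eps]) (auto intro: eqJ_sym br_eps Dd_mono[OF _ eps_Dd])

lemma Gd_mult: assumes "u \<in> Gd i" "v \<in> Gd j" "i + j < N" shows "u * v \<in> Gd (i + j)"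
proof -
  obtain z where z: "z \<in> Dd (Suc i)" "u \<approx> br z" by (rule Gd_E[OF assms(1)])
  obtain y where y: "y \<in> Dd (Suc j)" "v \<approx> br y" by (rule Gd_E[OF assms(2)])
  have "u * v \<approx> br z * br y" by (rule eqJ_mult[OF z(2) y(2)])
  also have "\<dots> \<approx> br (z \<star> y)" by (rule br_mult[OF z(1) y(1) assms(3)])
  finally show ?thesis using dm_Dd[OF z(1) y(1)] by (intro Gd_I[of "z \<star> y"]) auto
qed

lemma Gd_comm: assumes "u \<in> Gd i" "v \<in> Gd j" "i + j \<le> N" "0 < i" "0 < j" shows "u * v - v * u \<in> Gd (i + j - 1)"
proof -
  obtain z where z: "z \<in> Dd (Suc i)" "u \<approx> br z" by (rule Gd_E[OF assms(1)])
  obtain y where y: "y \<in> Dd (Suc j)" "v \<approx> br y" by (rule Gd_E[OF assms(2)])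
  have "u * v - v * u \<approx> br z * br y - br y * br z" using z y by (intro eqJ_diff eqJ_mult)
  also have "\<dots> \<approx> br (z \<star> y - y \<star> z)" by (rule br_comm[OF z(1) y(1) assms(3-5)])
  finally show ?thesis using dm_commutator[OF z(1) y(1)] assms by (intro Gd_I[of "z \<star> y - y \<star> z"]) auto
qed

lemma Gd_power: "u \<in> Gd i \<Longrightarrow> k * i < N \<Longrightarrow> u ^ k \<in> Gd (k * i)"
proof (induction k)
  case 0 then show ?case by (simp add: Gd_1)
next
  case (Suc k)
  then have "u * u ^ k \<in> Gd (i + k * i)" by (intro Gd_mult) auto
  then show ?case by simp
qed

lemma Gd_gen: "x \<in> Dp n \<Longrightarrow> gen x \<in> Gd n"
  using br_Dp[of x n] by (intro Gd_I[of x]) (auto simp: Dp_Dd)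

text \<open>
  In degrees below \<open>N\<close> nothing is lost by passing to distributions.
\<close>

lemma Gd_ev: assumes "u \<in> Gd n" "n < N" shows "u \<approx> br (ev u)" "ev u \<in> Dd (Suc n)"
proof -
  obtain z where z: "z \<in> Dd (Suc n)" "u \<approx> br z" by (rule Gd_E[OF assms(1)])
  then have "ev u = z" using ev_eqJ[OF z(2)] ev_br Dd_N assms by simp
  then show "u \<approx> br (ev u)" "ev u \<in> Dd (Suc n)" using z by auto
qed

text \<open>ordered binomial\<close>

text \<open>
  The binomial formula with all \<open>x\<close> moved to the left, written recursively for the comparison
  with powers of a sum of noncommuting elements.
\<close>

primrec ordered_binomial :: "'r::ring_1 \<Rightarrow> 'r \<Rightarrow> nat \<Rightarrow> 'r" where
  "ordered_binomial x y 0 = 1"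
| "ordered_binomial x y (Suc k) = x * ordered_binomial x y k + ordered_binomial x y k * y"

lemma ordered_binomial_eq:
  "ordered_binomial x y k = (\<Sum>l\<le>k. of_nat (k choose l) * (x ^ l * y ^ (k - l)))"
proof (induction k)
  case (Suc k)
  let ?t = "\<lambda>l. x ^ l * y ^ (Suc k - l)"
  have 1: "x * (\<Sum>l\<le>k. of_nat (k choose l) * (x ^ l * y ^ (k - l)))
      = (\<Sum>l\<le>Suc k. (if l = 0 then 0 else of_nat (k choose (l - 1))) * ?t l)"
    unfolding sum.atMost_Suc_shift
    by (simp add: sum_distrib_left mult.assoc) (intro sum.cong refl, metis mult.assoc mult_of_nat_commute)
  have "(\<Sum>l\<le>k. of_nat (k choose l) * (x ^ l * y ^ (k - l))) * y = (\<Sum>l\<le>k. of_nat (k choose l) * ?t l)"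
    unfolding sum_distrib_right
    by (intro sum.cong) (auto simp: mult.assoc Suc_diff_le power_Suc2 simp del: power_Suc)
  then have 2: "(\<Sum>l\<le>k. of_nat (k choose l) * (x ^ l * y ^ (k - l))) * y = (\<Sum>l\<le>Suc k. of_nat (k choose l) * ?t l)"
    by (simp add: binomial_eq_0)
  have "of_nat (Suc k choose l) = (if l = 0 then 0 else of_nat (k choose (l - 1)) :: 'a) + of_nat (k choose l)" for l
    by (cases l) auto
  then show ?case unfolding ordered_binomial.simps Suc 1 2 by (simp only: sum.distrib[symmetric] distrib_right)
qed simp

lemma of_nat_free_p: "of_nat (p * n) = (0 :: 'v mon \<Rightarrow>\<^sub>0 'k)"
proof -
  have "sc (of_nat p :: 'k) = (0 :: 'v mon \<Rightarrow>\<^sub>0 'k)" unfolding p_CHAR by simp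
  then show ?thesis by (simp add: sc_of_nat)
qed

lemma ordered_binomial_p: "ordered_binomial x y p = x ^ p + y ^ p" for x y :: "'v mon \<Rightarrow>\<^sub>0 'k"
proof -
  have z: "of_nat (p choose l) * (x ^ l * y ^ (p - l)) = 0" if "0 < l" "l < p" for l
  proof -
    have "p dvd (p choose l)" using that prime_p by (intro dvd_choose_prime) auto
    then obtain n where "p choose l = p * n" by auto
    then show ?thesis by (simp only: of_nat_free_p mult_zero_left)
  qed
  obtain k where k: "p = Suc k" using p_gt_1 by (cases p) auto
  have "(\<Sum>l\<le>Suc k. of_nat (p choose l) * (x ^ l * y ^ (p - l)))
     = (\<Sum>l\<le>k. of_nat (p choose l) * (x ^ l * y ^ (p - l))) + x ^ p" by (simp add: k)
  also have "(\<Sum>l\<le>k. of_nat (p choose l) * (x ^ l * y ^ (p - l))) = (\<Sum>l\<in>{0}. of_nat (p choose l) * (x ^ l * y ^ (p - l)))"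
    using z k by (intro sum.mono_neutral_right) auto
  finally show ?thesis unfolding ordered_binomial_eq by (simp add: k add.commute)
qed

text \<open>
  Reordering the factors costs commutators, each of which lowers the degree by one; the top degree \<open>k d = N\<close> is
  admissible because commutator relations are available up to degree \<open>N\<close>.
\<close>

lemma binomial_Gd:
  assumes "X \<in> Gd d" "Y \<in> Gd d" "d > 0" "k \<ge> 1" "k * d \<le> N"
  shows "(X + Y) ^ k - ordered_binomial X Y k \<in> Gd (k * d - 1)"
proof -
  have U: "ordered_binomial X Y k \<in> Gd (k * d)" if "k * d < N" for k
    using that
  proof (induction k)
    case (Suc k)
    then have "X * ordered_binomial X Y k \<in> Gd (d + k * d)" "ordered_binomial X Y k * Y \<in> Gd (k * d + d)"
      using assms by (intro Gd_mult; simp)+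
    then have "X * ordered_binomial X Y k + ordered_binomial X Y k * Y \<in> Gd (d + k * d)"
      using Suc.prems by (intro Gd_add) (simp_all add: add.commute)
    then show ?case by simp
  qed (simp add: Gd_1)
  from \<open>k \<ge> 1\<close> \<open>k * d \<le> N\<close> show ?thesis
  proof (induction k rule: dec_induct)
    case base
    show ?case by (simp add: Gd_0)
  next
    case (step k)
    have kd: "k * d < N" "k * d > 0" using step assms by auto
    have "d < N" using step(4) kd(2) by (simp only: mult_Suc)
    then have XY: "X + Y \<in> Gd d" using assms by (intro Gd_add)
    have "(X + Y) * ((X + Y) ^ k - ordered_binomial X Y k) \<in> Gd (d + (k * d - 1))"
      using XY step kd assms by (intro Gd_mult) auto
    moreover have "Y * ordered_binomial X Y k - ordered_binomial X Y k * Y \<in> Gd (d + k * d - 1)"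
      using assms step kd by (intro Gd_comm U) auto
    moreover have "d + (k * d - 1) = Suc k * d - 1" "d + k * d - 1 = Suc k * d - 1" "Suc k * d - 1 < N"
      using kd step by auto
    ultimately have "(X + Y) * ((X + Y) ^ k - ordered_binomial X Y k) +
       (Y * ordered_binomial X Y k - ordered_binomial X Y k * Y) \<in> Gd (Suc k * d - 1)"
      by (metis Gd_add)
    then show ?case by (simp add: algebra_simps)
  qed
qed

text \<open>
  The same estimate for reordering \<open>(X Y)\<^sup>k\<close>.
\<close>

lemma power_mult_Gd:
  assumes "X \<in> Gd i" "Y \<in> Gd j" "i > 0" "j > 0" "k \<ge> 1" "k * (i + j) \<le> N"
  shows "(X * Y) ^ k - X ^ k * Y ^ k \<in> Gd (k * (i + j) - 1)"
  using assms(5,6)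
proof (induction k rule: dec_induct)
  case base
  show ?case by (simp add: Gd_0)
next
  case (step k)
  let ?K = "Suc k * (i + j)"
  have kd: "k * (i + j) < N" "k * i > 0" "k * (i + j) > 0" using step assms by auto
  have ki: "k * i < N" "k * j < N" using kd by (auto simp: algebra_simps)
  have "?K > 0" using kd(3) by simp
  then have K: "?K - 1 < N" using step(4) by (meson diff_less less_le_trans zero_less_one)
  have i1: "i + j < N" 
    using step assms(3,4) le_less_trans[of "i + j" "k * (i + j)" N] kd by (cases k) auto
  have "X * Y \<in> Gd (i + j)" using assms i1 by (intro Gd_mult) auto
  moreover have "(i + j) + (k * (i + j) - 1) = ?K - 1" using kd by simp
  ultimately have 1: "(X * Y) * ((X * Y) ^ k - X ^ k * Y ^ k) \<in> Gd (?K - 1)"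
    using Gd_mult[of "X * Y" "i + j" "(X * Y) ^ k - X ^ k * Y ^ k" "k * (i + j) - 1"] step kd K by simp
  have "Y * X ^ k - X ^ k * Y \<in> Gd (j + k * i - 1)"
    using assms kd ki step by (intro Gd_comm Gd_power) (auto simp: algebra_simps)
  note c = this
  have deg: "i + (j + k * i - 1) + k * j = ?K - 1" using assms by (simp add: algebra_simps)
  have b: "i + (j + k * i - 1) + k * j < N" unfolding deg by (rule K)
  then have b1: "i + (j + k * i - 1) < N" by (rule le_less_trans[OF le_add1])
  have "X * (Y * X ^ k - X ^ k * Y) * Y ^ k \<in> Gd (i + (j + k * i - 1) + k * j)"
    by (rule Gd_mult[OF Gd_mult[OF assms(1) c b1] Gd_power[OF assms(2) ki(2)] b])
  moreover have "i + (j + k * i - 1) + k * j = ?K - 1" using assms by (simp add: algebra_simps)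
  ultimately have 2: "X * (Y * X ^ k - X ^ k * Y) * Y ^ k \<in> Gd (?K - 1)" by simp
  have "(X * Y) ^ Suc k - X ^ Suc k * Y ^ Suc k =
      (X * Y) * ((X * Y) ^ k - X ^ k * Y ^ k) + X * (Y * X ^ k - X ^ k * Y) * Y ^ k"
    by (simp add: algebra_simps)
  then show ?case using Gd_add[OF 1 2 K] by simp
qed

definition xi :: "(('g \<Rightarrow> 'k) \<Rightarrow> 'k) \<Rightarrow> (('g \<Rightarrow> 'k) \<Rightarrow> 'k) mon \<Rightarrow>\<^sub>0 'k" where
  "xi \<delta> = gen \<delta> ^ p - gen (pow \<delta> p)"

lemma Dq_V: "\<delta> \<in> Dp q \<Longrightarrow> \<delta> \<in> V"
  using Dp_V q_less_N by blast

lemma pow_p_V: "\<delta> \<in> Dp q \<Longrightarrow> pow \<delta> p \<in> V"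
  using pow_p_Dp[of \<delta> q] Dp_V[of "pow \<delta> p" "p * q - 1"] by (simp add: N_def)

lemma br_V: "z \<in> V \<Longrightarrow> br z = gen z"
  using br_Dp unfolding V_def by blast

lemma Gd_gen_ev: 
  assumes "u \<in> Gd n" "n < N" "ev u \<in> V" shows "u \<approx> gen (ev u)"
  using Gd_ev(1)[OF assms(1,2)] br_V[OF assms(3)] by simp

text \<open>
  The binomial coefficients vanish in characteristic \<open>p\<close>, so \<open>(X + Y)\<^sup>p - X\<^sup>p - Y\<^sup>p\<close> has degree below \<open>N\<close>, and there it equals
  the corresponding expression for distributions.
\<close>

lemma xi_add: assumes d: "\<delta> \<in> Dp q" "\<eta> \<in> Dp q" shows "xi (\<delta> + \<eta>) \<approx> xi \<delta> + xi \<eta>"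
proof -
  let ?X = "gen \<delta>" and ?Y = "gen \<eta>"
  have V: "\<delta> \<in> V" "\<eta> \<in> V" "\<delta> + \<eta> \<in> V" using d Dq_V V_plus by auto
  let ?R = "gen (\<delta> + \<eta>) ^ p - (?X ^ p + ?Y ^ p)"
  have e: "?R \<approx> (?X + ?Y) ^ p - (?X ^ p + ?Y ^ p)"
    using V by (intro eqJ_diff eqJ_power gen_add eqJ_refl)
  have "(?X + ?Y) ^ p - ordered_binomial ?X ?Y p \<in> Gd (p * q - 1)"
    using d p_gt_1 by (intro binomial_Gd Gd_gen) (auto simp: N_def)
  then have "(?X + ?Y) ^ p - (?X ^ p + ?Y ^ p) \<in> Gd (N - 1)"
    by (simp only: ordered_binomial_p N_def)
  then have R: "?R \<in> Gd (N - 1)" using e by (rule Gd_eqJ)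
  have evR: "ev ?R = pow (\<delta> + \<eta>) p - (pow \<delta> p + pow \<eta> p)"
    using V by (simp add: ev_diff ev_add ev_power)
  have pV: "pow \<delta> p \<in> V" "pow \<eta> p \<in> V" "pow (\<delta> + \<eta>) p \<in> V" using d pow_p_V Dp_plus by auto
  have "?R \<approx> gen (ev ?R)"
    by (rule Gd_gen_ev[OF R]) (use evR pV in \<open>auto intro!: V_minus V_plus\<close>)
  then have "?R \<approx> gen (pow (\<delta> + \<eta>) p - (pow \<delta> p + pow \<eta> p))" by (simp only: evR)
  also have "\<dots> \<approx> gen (pow (\<delta> + \<eta>) p) - gen (pow \<delta> p + pow \<eta> p)"
    using pV by (intro gen_diff V_plus)
  also have "\<dots> \<approx> gen (pow (\<delta> + \<eta>) p) - (gen (pow \<delta> p) + gen (pow \<eta> p))"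
    using pV by (intro eqJ_diff eqJ_refl gen_add)
  finally show ?thesis unfolding xi_def eqJ_def by (simp add: algebra_simps)
qed

lemma xi_scale: assumes d: "\<delta> \<in> Dp q" shows "xi (fscale c \<delta>) \<approx> sc (c ^ p) * xi \<delta>"
proof -
  have V: "\<delta> \<in> V" "pow \<delta> p \<in> V" using d Dq_V pow_p_V by auto
  have cp: "(sc c * u) ^ k = sc c ^ k * u ^ k" for u :: "'v mon \<Rightarrow>\<^sub>0 'k" and k
    by (induction k) (auto simp: mult.assoc, metis sc_central sc_power mult.assoc)
  have "gen (fscale c \<delta>) ^ p \<approx> (sc c * gen \<delta>) ^ p" using V by (intro eqJ_power gen_scale)
  moreover have "gen (pow (fscale c \<delta>) p) \<approx> sc (c ^ p) * gen (pow \<delta> p)"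
    unfolding pow_scale[OF V_LF[OF V(1)]] using V(2) by (rule gen_scale)
  ultimately have "xi (fscale c \<delta>) \<approx> (sc c * gen \<delta>) ^ p - sc (c ^ p) * gen (pow \<delta> p)"
    unfolding xi_def by (rule eqJ_diff)
  then show ?thesis by (simp add: cp xi_def sc_power algebra_simps)
qed

lemma xi_zero: "xi 0 \<approx> 0"
  using xi_scale[of 0 0] char_pos by (simp add: power_0_left)

text \<open>
  If the \<open>p\<close>-th power in the enveloping algebra has degree below \<open>N\<close>, it is determined by its image in
  the algebra of distributions.
\<close>

lemma xi_Gd: assumes d: "\<delta> \<in> Dp q" and "gen \<delta> ^ p \<in> Gd n" "n < N" shows "xi \<delta> \<approx> 0"
proof -
  have "ev (gen \<delta> ^ p) = pow \<delta> p" using d Dq_V ev_power by blast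
  then have "gen \<delta> ^ p \<approx> gen (pow \<delta> p)"
    using Gd_gen_ev[OF assms(2,3)] pow_p_V[OF d] by simp
  then show ?thesis unfolding xi_def eqJ_diff_0 .
qed

text \<open>
  For \<open>\<delta> = x y\<close> one has \<open>\<delta>\<^sup>p = x\<^sup>p y\<^sup>p\<close> up to degree below \<open>N\<close>, and the \<open>p\<close>-th powers of \<open>x\<close> and \<open>y\<close>, which have
  smaller order, drop degree by \<open>pow_p_Dd\<close>.
\<close>

lemma xi_decomposables: assumes "\<delta> \<in> decomposables q" shows "xi \<delta> \<approx> 0"
proof -
  let ?W = "{\<delta> \<in> Dp q. xi \<delta> \<approx> 0}"
  have sub: "fs.subspace ?W"
  proof (rule fs.subspaceI)
    show "0 \<in> ?W" using xi_zero by simp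
    fix x y c assume x: "x \<in> ?W"
    have "xi (fscale c x) \<approx> sc (c ^ p) * xi x" using x xi_scale by blast
    also have "\<dots> \<approx> sc (c ^ p) * 0" using x by (intro eqJ_mult) auto
    finally show "fscale c x \<in> ?W" using x Dp_fscale by simp
    assume y: "y \<in> ?W"
    have "xi (x + y) \<approx> xi x + xi y" using x y xi_add by blast
    also have "\<dots> \<approx> 0 + 0" using x y by (intro eqJ_add) auto
    finally show "x + y \<in> ?W" using x y Dp_plus by simp
  qed
  have "z \<in> ?W" if z: "z \<in> {x \<star> y | x y i j. x \<in> Dp i \<and> y \<in> Dp j \<and> 0 < i \<and> 0 < j \<and> i + j = q} \<union> Dp (q - 1)" for z
  proof (cases "z \<in> Dp (q - 1)")
    case True
    then have zq: "z \<in> Dp q" by (rule Dp_mono[rotated]) simp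
    have lt: "p * (q - 1) < N" using p_gt_1 by (simp add: N_def)
    have "gen z ^ p \<in> Gd (p * (q - 1))" by (rule Gd_power[OF Gd_gen[OF True] lt])
    then show ?thesis using xi_Gd[OF zq _ lt] zq by simp
  next
    case False
    then obtain x y i j where xy: "z = x \<star> y" "x \<in> Dp i" "y \<in> Dp j" "0 < i" "0 < j" "i + j = q"
      using z by blast
    have zq: "z \<in> Dp q" using dm_Dp[OF xy(2,3)] xy by simp
    let ?X = "gen x" and ?Y = "gen y"
    have ij: "i + j < N" using xy q_less_N by simp
    have V: "x \<in> V" "y \<in> V" using xy ij Dp_V by auto
    have "gen z \<approx> ?X * ?Y" using J_mult_rel[OF xy(2,3) ij] xy(1) by (simp add: eqJ_def eqJ_sym[unfolded eqJ_def])
    then have e: "gen z ^ p \<approx> (?X * ?Y) ^ p" by (rule eqJ_power)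
    (* the p-th powers of both factors drop degree, hence so does their product *)
    have pij: "p * i + p * j = N" using xy(6) by (simp add: N_def distrib_left[symmetric])
    have pos: "p * i > 0" "p * j > 0" using xy by simp_all
    then have pl: "p * i < N" "p * j < N" using pij by linarith+
    have X: "?X ^ p \<in> Gd (p * i - 1)"
    proof -
      have G: "?X ^ p \<in> Gd (p * i)" by (rule Gd_power[OF Gd_gen[OF xy(2)] pl(1)])
      have "ev (?X ^ p) \<in> Dp (p * i - 1)" using ev_power[OF V(1)] pow_p_Dp[OF xy(2,4)] by simp
      then show ?thesis using Gd_ev(1)[OF G pl(1)] Dp_Dd by (intro Gd_I) auto
    qed
    have Y: "?Y ^ p \<in> Gd (p * j - 1)"
    proof -
      have G: "?Y ^ p \<in> Gd (p * j)" by (rule Gd_power[OF Gd_gen[OF xy(3)] pl(2)])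
      have "ev (?Y ^ p) \<in> Dp (p * j - 1)" using ev_power[OF V(2)] pow_p_Dp[OF xy(3,5)] by simp
      then show ?thesis using Gd_ev(1)[OF G pl(2)] Dp_Dd by (intro Gd_I) auto
    qed
    have "?X ^ p * ?Y ^ p \<in> Gd ((p * i - 1) + (p * j - 1))" using X Y pij pl xy by (intro Gd_mult) auto
    then have 1: "?X ^ p * ?Y ^ p \<in> Gd (N - 1)" by (rule Gd_mono[rotated]) (use pij in auto)
    have "(?X * ?Y) ^ p - ?X ^ p * ?Y ^ p \<in> Gd (p * (i + j) - 1)"
      using xy p_gt_1 by (intro power_mult_Gd Gd_gen) (auto simp: N_def)
    then have "(?X * ?Y) ^ p - ?X ^ p * ?Y ^ p \<in> Gd (N - 1)" using xy(6) by (simp add: N_def)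
    from Gd_add[OF this 1] have "(?X * ?Y) ^ p \<in> Gd (N - 1)" by simp
    then have "gen z ^ p \<in> Gd (N - 1)" using e by (rule Gd_eqJ)
    then have "xi z \<approx> 0" by (rule xi_Gd[OF zq]) simp
    then show ?thesis using zq by simp
  qed
  then have "decomposables q \<subseteq> ?W" unfolding decomposables_def by (intro fs.span_minimal[OF _ sub]) blast
  then show ?thesis using assms by blast
qed

lemma xi_frobenius_kernel:
  assumes "\<delta> \<in> Dp q" "\<And>h. h \<in> A \<Longrightarrow> \<delta> (h ^ q) = 0" shows "xi \<delta> \<approx> 0"
  using assms by (intro xi_decomposables indecomposables) (auto simp: Suc_le_eq)

lemma xi_sum: "(\<And>i. i \<in> S \<Longrightarrow> d i \<in> Dp q) \<Longrightarrow> xi (sum d S) \<approx> (\<Sum>i\<in>S. xi (d i))"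
proof (induction S rule: infinite_finite_induct)
  case (insert x S)
  have "xi (d x + sum d S) \<approx> xi (d x) + xi (sum d S)"
    using insert.prems by (intro xi_add Dp_sum) auto
  also have "\<dots> \<approx> xi (d x) + (\<Sum>i\<in>S. xi (d i))" using insert by (intro eqJ_add) auto
  finally show ?case using insert by simp
qed (auto simp: xi_zero)

end

section \<open>The adjoint action on distributions\<close>

context char_p_group
begin

definition conj_fun :: "'g \<Rightarrow> ('g \<Rightarrow> 'k) \<Rightarrow> 'g \<Rightarrow> 'k" where
  "conj_fun g f = (\<lambda>x. if x \<in> carrier G then f (g \<otimes> x \<otimes> inv g) else 0)"

lemma conj_fun_apply: "x \<in> carrier G \<Longrightarrow> conj_fun g f x = f (g \<otimes> x \<otimes> inv g)"
  and conj_fun_out: "x \<notin> carrier G \<Longrightarrow> conj_fun g f x = 0"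
  by (simp_all add: conj_fun_def)

definition comult_decomp :: "('g \<Rightarrow> 'k) \<Rightarrow> nat \<Rightarrow> (nat \<Rightarrow> 'g \<Rightarrow> 'k) \<Rightarrow> (nat \<Rightarrow> 'g \<Rightarrow> 'k) \<Rightarrow> bool" where
  "comult_decomp f n a b \<longleftrightarrow> (\<forall>i<n. a i \<in> A \<and> b i \<in> A) \<and>
     (\<forall>x\<in>carrier G. \<forall>y\<in>carrier G. f (x \<otimes> y) = (\<Sum>i<n. a i x * b i y))"

lemma comult_decomp_ex: "f \<in> A \<Longrightarrow> \<exists>n a b. comult_decomp f n a b"
  using comult unfolding comult_closed_def comult_decomp_def by blast

text \<open>
  Conjugation is algebraic: apply the comultiplication twice, and the antipode.
\<close>

lemma conj_fun_coeffs:
  assumes f: "f \<in> A"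
  shows "\<exists>(K :: (nat \<times> nat) set) a b. finite K \<and> (\<forall>i\<in>K. a i \<in> A \<and> b i \<in> A) \<and>
     (\<forall>g\<in>carrier G. conj_fun g f = (\<Sum>i\<in>K. fscale (a i g) (b i)))"
proof -
  obtain n a b where dec: "comult_decomp f n a b" using comult_decomp_ex[OF f] by blast
  then have ab: "\<And>i. i < n \<Longrightarrow> a i \<in> A \<and> b i \<in> A"
    and fab: "\<And>x y. x \<in> carrier G \<Longrightarrow> y \<in> carrier G \<Longrightarrow> f (x \<otimes> y) = (\<Sum>i<n. a i x * b i y)"
    by (auto simp: comult_decomp_def)
  have "\<forall>i. \<exists>m c d. i < n \<longrightarrow> comult_decomp (b i) m c d"
    using comult_decomp_ex ab by blast
  then obtain m c d where dec2: "\<And>i. i < n \<Longrightarrow> comult_decomp (b i) (m i) (c i) (d i)" by metis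
  have cd: "i < n \<Longrightarrow> j < m i \<Longrightarrow> c i j \<in> A \<and> d i j \<in> A"
    and bcd: "i < n \<Longrightarrow> x \<in> carrier G \<Longrightarrow> y \<in> carrier G \<Longrightarrow> b i (x \<otimes> y) = (\<Sum>j<m i. c i j x * d i j y)" for i j x y
    using dec2 by (auto simp: comult_decomp_def)
  define S where "S f = (\<lambda>x. if x \<in> carrier G then f (inv x) else 0)" for f :: "'g \<Rightarrow> 'k"
  have S: "S f \<in> A" if "f \<in> A" for f
    using antipode that unfolding antipode_closed_def S_def by blast
  define K where "K = Sigma {..<n} (\<lambda>i. {..<m i})"
  define a' b' where "a' = (\<lambda>(i, j). a i * S (d i j))" and "b' = (\<lambda>(i, j). c i j)"
  have "finite K" by (simp add: K_def)
  moreover have mem: "a' i \<in> A \<and> b' i \<in> A" if "i \<in> K" for i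
    using that ab cd S by (auto simp: K_def a'_def b'_def intro!: A_mult)
  moreover have "conj_fun g f = (\<Sum>i\<in>K. fscale (a' i g) (b' i))" if g: "g \<in> carrier G" for g
  proof
    fix x
    show "conj_fun g f x = (\<Sum>i\<in>K. fscale (a' i g) (b' i)) x"
    proof (cases "x \<in> carrier G")
      case True
      have "f (g \<otimes> (x \<otimes> inv g)) = (\<Sum>i<n. a i g * b i (x \<otimes> inv g))" using fab g True by simp
      also have "\<dots> = (\<Sum>i<n. a i g * (\<Sum>j<m i. c i j x * d i j (inv g)))"
        using bcd g True by (intro sum.cong refl) simp
      also have "\<dots> = (\<Sum>i<n. \<Sum>j<m i. a i g * S (d i j) g * c i j x)"
        using g by (simp add: sum_distrib_left S_def mult_ac)
      also have "\<dots> = (\<Sum>(i, j)\<in>K. a i g * S (d i j) g * c i j x)"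
        unfolding K_def by (rule sum.Sigma) auto
      also have "\<dots> = (\<Sum>i\<in>K. fscale (a' i g) (b' i)) x"
        unfolding sum_fun_apply by (intro sum.cong) (auto simp: a'_def b'_def fscale_apply times_fun_apply)
      finally show ?thesis using True g by (simp add: conj_fun_apply m_assoc)
    next
      case False
      have "b' i x = 0" if "i \<in> K" for i using mem[OF that] A_supp False by blast
      then show ?thesis using False by (simp add: conj_fun_out sum_fun_apply fscale_apply)
    qed
  qed
  ultimately show ?thesis by blast
qed

lemma conj_fun_A: assumes "g \<in> carrier G" "f \<in> A" shows "conj_fun g f \<in> A"
proof -
  obtain K :: "(nat \<times> nat) set" and a b where K: "\<forall>i\<in>K. a i \<in> A \<and> b i \<in> A"
     "\<forall>g\<in>carrier G. conj_fun g f = (\<Sum>i\<in>K. fscale (a i g) (b i))"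
    using conj_fun_coeffs[OF assms(2)] by blast
  have "conj_fun g f = (\<Sum>i\<in>K. fscale (a i g) (b i))" using K(2) assms(1) by blast
  also have "\<dots> \<in> A" using K(1) by (intro A_sum A_scale) blast
  finally show ?thesis .
qed

lemma conj_fun_add: "conj_fun g (f + h) = conj_fun g f + conj_fun g h"
  and conj_fun_scale: "conj_fun g (fscale c f) = fscale c (conj_fun g f)"
  and conj_fun_mult: "conj_fun g (f * h) = conj_fun g f * conj_fun g h"
  by (auto simp: conj_fun_def fun_eq_iff pointwise)

lemma conj_fun_power: "n > 0 \<Longrightarrow> conj_fun g (f ^ n) = conj_fun g f ^ n"
  by (auto simp: conj_fun_def fun_eq_iff power_fun_apply)

lemma conj_fun_aug: assumes "g \<in> carrier G" "f \<in> aug" shows "conj_fun g f \<in> aug"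
  using assms by (simp add: aug_iff conj_fun_A conj_fun_apply)

lemma conj_fun_I: assumes g: "g \<in> carrier G" shows "f \<in> I n \<Longrightarrow> conj_fun g f \<in> I n"
proof (induction n arbitrary: f)
  case 0 then show ?case using conj_fun_A[OF g] by simp
next
  case (Suc n)
  have z: "conj_fun g 0 = 0" by (simp add: conj_fun_def fun_eq_iff zero_fun_apply)
  have "fs.subspace {f. conj_fun g f \<in> I (Suc n)}"
    by (rule fs.subspaceI) (auto simp: z conj_fun_add conj_fun_scale intro: I_add I_scale)
  with Suc.prems have "f \<in> {f. conj_fun g f \<in> I (Suc n)}"
    by (rule I_Suc_induct) (use Suc.IH g in \<open>simp add: conj_fun_mult I_Suc_gen conj_fun_aug\<close>)
  then show ?case by simp
qed

lemma conj_fun_one_A: "g \<in> carrier G \<Longrightarrow> conj_fun g one_A = one_A"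
  by (auto simp: conj_fun_def fun_eq_iff indicator_def)

text \<open>
  The adjoint action of a group element on linear forms.
\<close>

definition Adm :: "'g \<Rightarrow> (('g \<Rightarrow> 'k) \<Rightarrow> 'k) \<Rightarrow> ('g \<Rightarrow> 'k) \<Rightarrow> 'k" where
  "Adm g \<mu> = (\<lambda>f. if f \<in> A then \<mu> (conj_fun g f) else 0)"

lemma Adm_apply: "f \<in> A \<Longrightarrow> Adm g \<mu> f = \<mu> (conj_fun g f)" by (simp add: Adm_def)

context
  fixes g assumes g: "g \<in> carrier G"
begin

lemma Adm_LF: "\<mu> \<in> LF \<Longrightarrow> Adm g \<mu> \<in> LF"
  by (rule LF_I) (auto simp: Adm_def conj_fun_add conj_fun_scale LF_add LF_scale A_add A_scale conj_fun_A g)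

lemma Adm_Dd: "\<mu> \<in> Dd n \<Longrightarrow> Adm g \<mu> \<in> Dd n"
proof -
  assume \<mu>: "\<mu> \<in> Dd n"
  have "Adm g \<mu> f = 0" if "f \<in> I n" for f
    using Dd_vanish[OF \<mu> conj_fun_I[OF g that]] that I_subset_A Adm_apply[of f g \<mu>] by auto
  then show ?thesis using Adm_LF[OF Dd_LF[OF \<mu>]] by (simp add: Dd_def)
qed

lemma Adm_Dp: "\<mu> \<in> Dp n \<Longrightarrow> Adm g \<mu> \<in> Dp n"
  by (simp add: Dp_iff Adm_Dd Adm_apply conj_fun_one_A g)

lemma Adm_add: "Adm g (\<mu> + \<nu>) = Adm g \<mu> + Adm g \<nu>"
  and Adm_diff: "Adm g (\<mu> - \<nu>) = Adm g \<mu> - Adm g \<nu>"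
  and Adm_scale: "Adm g (fscale c \<mu>) = fscale c (Adm g \<mu>)"
  by (auto simp: Adm_def fun_eq_iff pointwise)

lemma Adm_eps: "Adm g eps = eps"
  by (rule LF_eqI) (auto simp: Adm_LF eps_LF Adm_apply eps_apply conj_fun_A g conj_fun_apply)

lemma Adm_dm: assumes \<mu>: "\<mu> \<in> LF" and \<rho>: "\<rho> \<in> LF" shows "Adm g (\<mu> \<star> \<rho>) = Adm g \<mu> \<star> Adm g \<rho>"
proof (rule LF_eqI)
  fix f assume f: "f \<in> A"
  have "conv \<rho> (conj_fun g f) = conj_fun g (conv (Adm g \<rho>) f)"
  proof
    fix x
    show "conv \<rho> (conj_fun g f) x = conj_fun g (conv (Adm g \<rho>) f) x"
    proof (cases "x \<in> carrier G")
      case True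
      let ?x = "g \<otimes> x \<otimes> inv g"
      have "translate x (conj_fun g f) = conj_fun g (translate ?x f)"
      proof
        fix y
        have "g \<otimes> (x \<otimes> y) \<otimes> inv g = ?x \<otimes> (g \<otimes> y \<otimes> inv g)" if "y \<in> carrier G"
          using g True that by (simp add: m_assoc inv_solve_left)
        then show "translate x (conj_fun g f) y = conj_fun g (translate ?x f) y"
          using g True by (auto simp: translate_def conj_fun_def)
      qed
      then show ?thesis using True g f by (simp add: conv_apply conj_fun_apply Adm_apply translate_A)
    qed (simp add: conv_out conj_fun_out)
  qed
  then show "Adm g (\<mu> \<star> \<rho>) f = (Adm g \<mu> \<star> Adm g \<rho>) f"
    using f \<rho> by (simp add: Adm_apply[OF f] dm_apply conj_fun_A g) (simp add: Adm_apply conv_A Adm_LF)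
qed (auto intro: Adm_LF dm_LF \<mu> \<rho>)

lemma Adm_pow: "\<delta> \<in> LF \<Longrightarrow> Adm g (pow \<delta> k) = pow (Adm g \<delta>) k"
  by (induction k) (simp_all add: pow_0 Adm_eps Adm_dm pow_LF)

end

lemma Adm_one: "\<mu> \<in> LF \<Longrightarrow> Adm \<one> \<mu> = \<mu>"
proof (rule LF_eqI)
  fix f assume f: "f \<in> A"
  have "conj_fun \<one> f = f" by (rule A_eqI) (auto simp: conj_fun_A f conj_fun_apply)
  then show "Adm \<one> \<mu> f = \<mu> f" using f by (simp add: Adm_apply)
qed (auto intro: Adm_LF)

text \<open>
  Coordinates on distributions of bounded order. Packaging them as a predicate keeps the
  quantified equation out of the way of the simplifier.
\<close>

definition dual_frame :: "nat \<Rightarrow> ('g \<Rightarrow> 'k) set \<Rightarrow> (('g \<Rightarrow> 'k) \<Rightarrow> ('g \<Rightarrow> 'k) \<Rightarrow> 'k) \<Rightarrow> bool" where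
  "dual_frame n H d \<longleftrightarrow> finite H \<and> H \<subseteq> A \<and> (\<forall>h\<in>H. d h \<in> Dp n) \<and>
     (\<forall>\<mu>\<in>Dp n. \<mu> = (\<Sum>h\<in>H. fscale (\<mu> h) (d h)))"

lemma dual_frameD:
  assumes "dual_frame n H d"
  shows "finite H" "h \<in> H \<Longrightarrow> h \<in> A" "h \<in> H \<Longrightarrow> d h \<in> Dp n"
    "\<mu> \<in> Dp n \<Longrightarrow> \<mu> = (\<Sum>h\<in>H. fscale (\<mu> h) (d h))"
  using assms unfolding dual_frame_def by blast+

lemma dual_frame_ex: "\<exists>H d. dual_frame n H d"
proof -
  obtain E where E: "finite E" "E \<subseteq> A" "A \<subseteq> fs.span (E \<union> I (Suc n))" using A_finite_span by blast
  obtain H d where H: "H \<subseteq> E" "\<forall>h\<in>H. d h \<in> Dp n"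
     "\<forall>\<mu>\<in>Dp n. \<forall>e\<in>E. \<mu> e = (\<Sum>h\<in>H. \<mu> h * d h e)"
    using dual_basis[OF E(1) Dp_subspace[of n]] by blast
  have "\<mu> = (\<Sum>h\<in>H. fscale (\<mu> h) (d h))" if \<mu>: "\<mu> \<in> Dp n" for \<mu>
  proof -
    define \<nu> where "\<nu> = \<mu> - (\<Sum>h\<in>H. fscale (\<mu> h) (d h))"
    have \<nu>: "\<nu> \<in> Dp n" unfolding \<nu>_def using \<mu> H(2) by (intro Dp_minus Dp_sum Dp_fscale) auto
    note L = Dp_LF[OF \<nu>]
    have "\<nu> e = 0" if "e \<in> E" for e
      using bspec[OF bspec[OF H(3) \<mu>] that] by (simp add: \<nu>_def pointwise)
    then have "E \<union> I (Suc n) \<subseteq> {f \<in> A. \<nu> f = 0}" using E(2) Dp_vanish[OF \<nu>] I_subset_A by blast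
    moreover have "fs.subspace {f \<in> A. \<nu> f = 0}"
      by (rule fs.subspaceI) (auto simp: A_add A_scale LF_add[OF L] LF_scale[OF L] LF_0[OF L])
    ultimately have "A \<subseteq> {f \<in> A. \<nu> f = 0}" using E(3) fs.span_minimal by blast
    then have "\<nu> = 0" by (intro LF_eqI[OF L LF_zero]) (auto simp: zero_fun_apply)
    then show ?thesis by (simp add: \<nu>_def)
  qed
  then have 1: "\<forall>\<mu>\<in>Dp n. \<mu> = (\<Sum>h\<in>H. fscale (\<mu> h) (d h))" by (rule ballI)
  have 2: "finite H" using finite_subset[OF H(1) E(1)] .
  have 3: "H \<subseteq> A" using H(1) E(2) by (rule subset_trans)
  have "dual_frame n H d" unfolding dual_frame_def by (rule conjI[OF 2 conjI[OF 3 conjI[OF H(2) 1]]])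
  then show ?thesis by blast
qed

text \<open>
  The adjoint orbit map of \<open>v\<close> has regular functions as coordinates.
\<close>

definition Adm_expansion :: "nat \<Rightarrow> (('g \<Rightarrow> 'k) \<Rightarrow> 'k) \<Rightarrow> ('g \<Rightarrow> 'k) set \<Rightarrow>
    (('g \<Rightarrow> 'k) \<Rightarrow> 'g \<Rightarrow> 'k) \<Rightarrow> (('g \<Rightarrow> 'k) \<Rightarrow> ('g \<Rightarrow> 'k) \<Rightarrow> 'k) \<Rightarrow> bool" where
  "Adm_expansion n v H c d \<longleftrightarrow> finite H \<and> (\<forall>h\<in>H. c h \<in> A) \<and> (\<forall>h\<in>H. d h \<in> Dp n) \<and>
    (\<forall>g\<in>carrier G. Adm g v = (\<Sum>h\<in>H. fscale (c h g) (d h)))"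

lemma Adm_expansionD:
  assumes "Adm_expansion n v H c d"
  shows "finite H" "h \<in> H \<Longrightarrow> c h \<in> A" "h \<in> H \<Longrightarrow> d h \<in> Dp n"
    "g \<in> carrier G \<Longrightarrow> Adm g v = (\<Sum>h\<in>H. fscale (c h g) (d h))"
  using assms unfolding Adm_expansion_def by blast+

lemma Adm_coeffs:
  assumes v: "v \<in> Dp n"
  shows "\<exists>H c d. Adm_expansion n v H c d"
proof -
  obtain H d where fr: "dual_frame n H d" using dual_frame_ex by blast
  note H = dual_frameD[OF fr]
  have "\<exists>c. h \<in> H \<longrightarrow> c \<in> A \<and> (\<forall>g\<in>carrier G. Adm g v h = c g)" for h
  proof (cases "h \<in> H")
    case True
    then have hA: "h \<in> A" by (rule H(2))
    obtain K :: "(nat \<times> nat) set" and a b where K: "\<forall>i\<in>K. a i \<in> A \<and> b i \<in> A"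
       "\<forall>g\<in>carrier G. conj_fun g h = (\<Sum>i\<in>K. fscale (a i g) (b i))"
      using conj_fun_coeffs[OF hA] by blast
    define c where "c = (\<Sum>i\<in>K. fscale (v (b i)) (a i))"
    have "c \<in> A" unfolding c_def using K(1) by (intro A_sum A_scale) blast
    moreover have "Adm g v h = c g" if g: "g \<in> carrier G" for g
    proof -
      have "Adm g v h = v (\<Sum>i\<in>K. fscale (a i g) (b i))" using K(2) g by (simp add: Adm_apply[OF hA])
      also have "\<dots> = (\<Sum>i\<in>K. a i g * v (b i))" using K(1) by (intro LF_sum_scale[OF Dp_LF[OF v]]) blast
      finally show ?thesis by (simp add: c_def pointwise mult.commute)
    qed
    ultimately show ?thesis by blast
  qed auto
  then obtain c where c: "\<And>h. h \<in> H \<Longrightarrow> c h \<in> A \<and> (\<forall>g\<in>carrier G. Adm g v h = c h g)" by metis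
  have "Adm g v = (\<Sum>h\<in>H. fscale (c h g) (d h))" if g: "g \<in> carrier G" for g
  proof -
    have "Adm g v = (\<Sum>h\<in>H. fscale (Adm g v h) (d h))" by (rule H(4)[OF Adm_Dp[OF g v]])
    moreover have "(\<Sum>h\<in>H. fscale (Adm g v h) (d h)) = (\<Sum>h\<in>H. fscale (c h g) (d h))"
      using c g by (intro sum.cong) auto
    ultimately show ?thesis by (rule trans)
  qed
  then have 1: "\<forall>g\<in>carrier G. Adm g v = (\<Sum>h\<in>H. fscale (c h g) (d h))" by (rule ballI)
  have 2: "\<forall>h\<in>H. c h \<in> A" using c by blast
  have 3: "\<forall>h\<in>H. d h \<in> Dp n" using H(3) by (rule ballI)
  have "Adm_expansion n v H c d" unfolding Adm_expansion_def by (rule conjI[OF H(1) conjI[OF 2 conjI[OF 3 1]]])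
  then show ?thesis by blast
qed

text \<open>
  At a point \<open>y = g\<close> this is \<open>g v = (Ad g v) g\<close>, and an identity between regular functions of \<open>g\<close> may be
  evaluated at any distribution \<open>y\<close>.
\<close>

lemma dm_swap:
  assumes y: "y \<in> LF" and v: "v \<in> LF" and e: "Adm_expansion n v H c d"
  shows "y \<star> v = (\<Sum>h\<in>H. d h \<star> ctr (c h) y)"
proof (rule LF_eqI)
  note Ad = Adm_expansionD(4)[OF e]
  have cd: "\<And>h. h \<in> H \<Longrightarrow> c h \<in> A" "\<And>h. h \<in> H \<Longrightarrow> d h \<in> LF"
    using Adm_expansionD(2,3)[OF e] Dp_LF by blast+
  show "y \<star> v \<in> LF" "(\<Sum>h\<in>H. d h \<star> ctr (c h) y) \<in> LF"
    using y v cd by (auto intro!: dm_LF LF_setsum ctr_LF)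
  fix f assume f: "f \<in> A"
  obtain n a b where dec: "comult_decomp f n a b" using comult_decomp_ex[OF f] by blast
  then have ab: "\<And>i. i < n \<Longrightarrow> a i \<in> A" "\<And>i. i < n \<Longrightarrow> b i \<in> A"
    "\<And>x y. x \<in> carrier G \<Longrightarrow> y \<in> carrier G \<Longrightarrow> f (x \<otimes> y) = (\<Sum>i<n. a i x * b i y)"
    by (auto simp: comult_decomp_def)
  define R where "R x = (\<Sum>i<n. fscale (b i x) (a i))" for x
  define M where "M h = (\<Sum>i<n. fscale (d h (a i)) (b i))" for h
  have MA: "M h \<in> A" for h unfolding M_def using ab(2) by (auto intro!: A_sum A_scale)
  have RA: "R x \<in> A" for x unfolding R_def using ab(1) by (auto intro!: A_sum A_scale)
  have Rx: "R x z = f (z \<otimes> x)" if "x \<in> carrier G" "z \<in> carrier G" for x z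
    using ab(3)[OF that(2,1)] by (simp add: R_def pointwise mult.commute)
  have dR: "d h (R x) = M h x" if "h \<in> H" for h x
    unfolding R_def using LF_sum_scale[OF cd(2)[OF that], of "{..<n}" a "\<lambda>i. b i x"] ab(1)
    by (simp add: M_def pointwise mult.commute)
  have cM: "(\<Sum>h\<in>H. c h * M h) \<in> A" using cd MA by (auto intro!: A_sum A_mult)
  have "conv v f = (\<Sum>h\<in>H. c h * M h)"
  proof (rule A_eqI[OF conv_A[OF f v] cM])
    fix x assume x: "x \<in> carrier G"
    have "translate x f = conj_fun x (R x)"
    proof (rule A_eqI)
      fix z assume z: "z \<in> carrier G"
      have "x \<otimes> z \<otimes> inv x \<otimes> x = x \<otimes> z" using x z by (simp add: m_assoc)
      then show "translate x f z = conj_fun x (R x) z"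
        using x z Rx[OF x, of "x \<otimes> z \<otimes> inv x"] by (simp add: translate_def conj_fun_apply)
    qed (use x f RA in \<open>simp_all add: translate_A conj_fun_A\<close>)
    then have "conv v f x = Adm x v (R x)" using x RA by (simp add: conv_apply Adm_apply)
    also have "\<dots> = (\<Sum>h\<in>H. c h x * d h (R x))" unfolding Ad[OF x] by (simp add: pointwise)
    also have "\<dots> = (\<Sum>h\<in>H. c h * M h) x" using dR by (simp add: pointwise)
    finally show "conv v f x = (\<Sum>h\<in>H. c h * M h) x" .
  qed
  then have "(y \<star> v) f = (\<Sum>h\<in>H. y (c h * M h))"
    using f cd MA by (simp add: dm_apply) (subst LF_sum[OF y], auto intro: A_mult)
  also have "\<dots> = (\<Sum>h\<in>H. (d h \<star> ctr (c h) y) f)"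
  proof (rule sum.cong[OF refl])
    fix h assume h: "h \<in> H"
    let ?\<eta> = "ctr (c h) y"
    have \<eta>: "?\<eta> \<in> LF" using h cd y by (intro ctr_LF)
    have "conv ?\<eta> f = (\<Sum>i<n. fscale (?\<eta> (b i)) (a i))"
      by (rule conv_eq_sum[where f = f, OF ab \<eta>])
    then have "(d h \<star> ?\<eta>) f = (\<Sum>i<n. ?\<eta> (b i) * d h (a i))"
      using f LF_sum_scale[OF cd(2)[OF h], of "{..<n}" a "\<lambda>i. ?\<eta> (b i)"] ab(1) by (simp add: dm_apply)
    also have "\<dots> = ?\<eta> (M h)"
      unfolding M_def using LF_sum_scale[OF \<eta>, of "{..<n}" b "\<lambda>i. d h (a i)"] ab(2) by (simp add: mult.commute)
    finally show "y (c h * M h) = (d h \<star> ?\<eta>) f" using MA by (simp add: ctr_apply)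
  qed
  finally show "(y \<star> v) f = (\<Sum>h\<in>H. d h \<star> ctr (c h) y) f" by (simp add: sum_fun_apply)
qed

end

section \<open>Moving a distribution past an element\<close>

lemma sc_mult_mult: "sc (a * b) * (u * v) = (sc a * u) * (sc b * v)"
proof -
  have "sc b * (u * v) = u * (sc b * v)" by (simp only: mult.assoc[symmetric] sc_central[of b u])
  then show ?thesis by (simp only: sc_mult mult.assoc)
qed

context higher_env
begin

text \<open>
  The adjoint action on the free algebra.
\<close>

definition AdF :: "'g \<Rightarrow> ((('g \<Rightarrow> 'k) \<Rightarrow> 'k) mon \<Rightarrow>\<^sub>0 'k) \<Rightarrow> (('g \<Rightarrow> 'k) \<Rightarrow> 'k) mon \<Rightarrow>\<^sub>0 'k" where
  "AdF g = subst (\<lambda>v. if v \<in> V then gen (Adm g v) else 0)"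

lemma AdF_gen: "v \<in> V \<Longrightarrow> AdF g (gen v) = gen (Adm g v)"
  by (simp add: AdF_def subst_gen)

lemma AdF_add: "AdF g (u + v) = AdF g u + AdF g v"
  and AdF_mult: "AdF g (u * v) = AdF g u * AdF g v"
  and AdF_diff: "AdF g (u - v) = AdF g u - AdF g v"
  and AdF_power: "AdF g (u ^ n) = AdF g u ^ n"
  and AdF_sc: "AdF g (sc c) = sc c"
  by (simp_all only: AdF_def subst_add subst_mult subst_diff subst_power subst_sc)

lemmas AdF_hom = AdF_add AdF_mult AdF_diff AdF_power AdF_sc

lemma Adm_V: "g \<in> carrier G \<Longrightarrow> v \<in> V \<Longrightarrow> Adm g v \<in> V"
  unfolding V_def by (rule Adm_Dp)

lemma AdF_J: assumes g: "g \<in> carrier G" shows "u \<in> J \<Longrightarrow> AdF g u \<in> J"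
proof (induction rule: J.induct)
  case (J_add_rel v w)
  then show ?case using J.J_add_rel[OF Adm_V[OF g, of v] Adm_V[OF g, of w]]
    by (simp add: AdF_hom AdF_gen V_plus Adm_add[OF g])
next
  case (J_scale_rel v c)
  then show ?case using J.J_scale_rel[OF Adm_V[OF g, of v]]
    by (simp add: AdF_hom AdF_gen V_fscale Adm_scale[OF g])
next
  case (J_mult_rel x i y j)
  then have "x \<in> V" "y \<in> V" "x \<star> y \<in> V" using dm_Dp[of x i y j] by (auto intro: Dp_V)
  then show ?case using J.J_mult_rel[OF Adm_Dp[OF g J_mult_rel(1)] Adm_Dp[OF g J_mult_rel(2)] J_mult_rel(3)]
    by (simp add: AdF_hom AdF_gen Adm_dm[OF g V_LF V_LF])
next
  case (J_comm_rel x i y j)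
  then have "x \<star> y - y \<star> x \<in> Dp (i + j - 1)" by (intro dm_commutator_Dp) auto
  then have "x \<in> V" "y \<in> V" "x \<star> y - y \<star> x \<in> V" using J_comm_rel by (auto intro: Dp_V)
  then show ?case using J.J_comm_rel[OF Adm_Dp[OF g J_comm_rel(1)] Adm_Dp[OF g J_comm_rel(2)] J_comm_rel(3-5)]
    by (simp add: AdF_hom AdF_gen Adm_diff[OF g] Adm_dm[OF g V_LF V_LF])
next
  case (J_out v)
  then show ?case by (simp add: AdF_def subst_gen)
qed (simp_all add: AdF_hom J.intros)

lemma AdF_eqJ: "g \<in> carrier G \<Longrightarrow> u \<approx> v \<Longrightarrow> AdF g u \<approx> AdF g v"
  using AdF_J[of g "u - v"] by (simp add: eqJ_def AdF_hom)

text \<open>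
  A list of pairs \<open>(u, c)\<close> stands for the algebra-valued regular function \<open>g \<mapsto> (\<Sum> c g \<cdot> u)\<close>.
\<close>

definition at_point :: "(((('g \<Rightarrow> 'k) \<Rightarrow> 'k) mon \<Rightarrow>\<^sub>0 'k) \<times> ('g \<Rightarrow> 'k)) list \<Rightarrow> 'g \<Rightarrow> (('g \<Rightarrow> 'k) \<Rightarrow> 'k) mon \<Rightarrow>\<^sub>0 'k" where
  "at_point xs g = (\<Sum>(u, c)\<leftarrow>xs. sc (c g) * u)"

text \<open>
  The same function evaluated at a distribution, with the argument kept to the right of the values.
\<close>

definition at_dist :: "(((('g \<Rightarrow> 'k) \<Rightarrow> 'k) mon \<Rightarrow>\<^sub>0 'k) \<times> ('g \<Rightarrow> 'k)) list \<Rightarrow> (('g \<Rightarrow> 'k) \<Rightarrow> 'k) \<Rightarrow> (('g \<Rightarrow> 'k) \<Rightarrow> 'k) mon \<Rightarrow>\<^sub>0 'k" where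
  "at_dist xs y = (\<Sum>(u, c)\<leftarrow>xs. u * br (ctr c y))"

definition regular :: "(((('g \<Rightarrow> 'k) \<Rightarrow> 'k) mon \<Rightarrow>\<^sub>0 'k) \<times> ('g \<Rightarrow> 'k)) list \<Rightarrow> bool" where
  "regular xs \<longleftrightarrow> (\<forall>x\<in>set xs. snd x \<in> A)"

lemma at_point_simps [simp]:
  "at_point [] g = 0" "at_point (x # xs) g = sc (snd x g) * fst x + at_point xs g"
  "at_dist [] y = 0" "at_dist (x # xs) y = fst x * br (ctr (snd x) y) + at_dist xs y"
  "regular []" "regular (x # xs) \<longleftrightarrow> snd x \<in> A \<and> regular xs"
  by (auto simp: at_point_def at_dist_def regular_def case_prod_unfold)

lemma at_point_append: "at_point (xs @ ys) g = at_point xs g + at_point ys g"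
  and at_dist_append: "at_dist (xs @ ys) y = at_dist xs y + at_dist ys y"
  and regular_append: "regular (xs @ ys) \<longleftrightarrow> regular xs \<and> regular ys"
  by (induction xs) (simp_all add: add.assoc)

lemma J_left_iff: "u - v \<in> J \<Longrightarrow> v \<in> J \<Longrightarrow> u \<in> J"
  using J_plus[of "u - v" v] by simp

lemma ctr_Dd_A: "f \<in> A \<Longrightarrow> \<mu> \<in> Dd n \<Longrightarrow> ctr f \<mu> \<in> Dd n"
  using ctr_Dd[of f 0 \<mu> n] by simp

text \<open>
  Evaluation at distributions is well defined: it depends on the values at points only. By induction on
  the length, one coefficient function is eliminated from all others by a linear combination that makes
  them vanish at a point where it does not.
\<close>

lemma regular_zero_imp:
  assumes "regular xs" "\<And>g. g \<in> carrier G \<Longrightarrow> at_point xs g \<in> J" "y \<in> Dd N"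
  shows "at_dist xs y \<in> J"
  using assms(1,2)
proof (induction "length xs" arbitrary: xs)
  case 0
  then show ?case by simp
next
  case (Suc n)
  obtain u c ys where xs: "xs = (u, c) # ys" using Suc.hyps(2) by (cases xs) auto
  have cA: "c \<in> A" and ys: "regular ys" using Suc.prems(1) xs by auto
  show ?case
  proof (cases "\<forall>g\<in>carrier G. c g = 0")
    case True
    then have c0: "c = 0" using A_supp[OF cA] by (metis zero_fun_apply ext)
    have "at_point ys g \<in> J" if "g \<in> carrier G" for g
      using Suc.prems(2)[OF that] by (simp add: xs c0 zero_fun_apply)
    then have "at_dist ys y \<in> J" using Suc.hyps ys xs by simp
    moreover have "ctr c y = 0" using LF_0[OF Dd_LF[OF assms(3)]] by (simp add: ctr_def c0 fun_eq_iff zero_fun_apply)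
    then have "u * br (ctr c y) \<in> J" using br_0 by (simp add: eqJ_0 J_left)
    ultimately show ?thesis by (simp add: xs J_plus)
  next
    case False
    then obtain g0 where g0: "g0 \<in> carrier G" "c g0 \<noteq> 0" by blast
    (* the coefficient for which d - l d * c vanishes at g0 *)
    define l where "l d = d g0 / c g0" for d :: "'g \<Rightarrow> 'k"
    define zs where "zs = map (\<lambda>x. (fst x, snd x - fscale (l (snd x)) c)) ys"
    have rz: "regular zs" 
    proof -
      have "snd x - fscale (l (snd x)) c \<in> A" if "x \<in> set ys" for x
        using ys that unfolding regular_def by (intro A_diff A_scale cA) blast
      then show ?thesis unfolding zs_def regular_def by simp
    qed
    define s where "s = (\<Sum>x\<leftarrow>ys. sc (l (snd x)) * fst x)"
    have pz: "at_point zs g = at_point ys g - sc (c g) * s" for g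
    proof -
      have "sc ((d - fscale (l d) c) g) * v = sc (d g) * v - sc (c g) * (sc (l d) * v)" for d v
      proof -
        have "(d - fscale (l d) c) g = d g - c g * l d"
          by (simp add: minus_apply[of d] fscale_apply[of _ c] mult.commute)
        then show ?thesis by (simp only: sc_diff sc_mult left_diff_distrib mult.assoc)
      qed
      note e = this
      show ?thesis unfolding zs_def s_def
        by (induction ys) (simp_all add: e distrib_left)
    qed
    (* evaluation at g0 shows that u is a combination of the other values *)
    have "sc (c g0) * s = at_point ys g0"
    proof -
      have e: "sc (c g0) * (sc (l d) * v) = sc (d g0) * v" for d and v :: "(('g \<Rightarrow> 'k) \<Rightarrow> 'k) mon \<Rightarrow>\<^sub>0 'k"
        using g0 by (simp add: l_def mult.assoc[symmetric] flip: sc_mult)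
      show ?thesis unfolding s_def
        by (induction ys) (simp_all add: e distrib_left)
    qed
    then have "sc (c g0) * (u + s) \<in> J" using Suc.prems(2)[OF g0(1)] by (simp add: xs distrib_left)
    then have "sc (1 / c g0) * (sc (c g0) * (u + s)) \<in> J" by (rule J_left)
    then have us: "u + s \<in> J" using g0 by (simp add: mult.assoc[symmetric] flip: sc_mult)
    have "at_point zs g \<in> J" if "g \<in> carrier G" for g
    proof -
      have "at_point zs g = at_point xs g - sc (c g) * (u + s)"
        by (simp add: pz xs distrib_left)
      then show ?thesis using Suc.prems(2)[OF that] us by (simp add: J_minus J_left)
    qed
    moreover have "n = length zs" using Suc.hyps(2) by (simp add: zs_def xs)
    ultimately have zJ: "at_dist zs y \<in> J" using Suc.hyps(1) rz by blast
    have yLF: "y \<in> LF" using assms(3) Dd_LF by blast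
    have cy: "ctr c y \<in> Dd N" using cA assms(3) by (rule ctr_Dd_A)
    have "at_dist ys y \<approx> at_dist zs y + s * br (ctr c y)"
      using ys unfolding zs_def s_def
    proof (induction ys)
      case (Cons x ys)
      obtain v d where x: "x = (v, d)" by (cases x)
      have dA: "d \<in> A" using Cons.prems x by simp
      let ?e = "d - fscale (l d) c"
      have eA: "?e \<in> A" using dA cA by (intro A_diff A_scale)
      have "d = ?e + fscale (l d) c" by simp
      then have "ctr d y = ctr ?e y + fscale (l d) (ctr c y)"
        using ctr_add_left[OF yLF eA A_scale[OF cA]] ctr_scale_left[OF yLF cA] by metis
      then have "br (ctr d y) \<approx> br (ctr ?e y) + br (fscale (l d) (ctr c y))"
        using br_add[OF ctr_Dd_A[OF eA assms(3)] Dd_fscale[OF cy]] by simp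
      also have "\<dots> \<approx> br (ctr ?e y) + sc (l d) * br (ctr c y)" by (intro eqJ_add eqJ_refl br_scale cy)
      finally have "v * br (ctr d y) \<approx> v * (br (ctr ?e y) + sc (l d) * br (ctr c y))"
        by (rule eqJ_mult[OF eqJ_refl])
      moreover have "v * (br (ctr ?e y) + sc (l d) * br (ctr c y)) = v * br (ctr ?e y) + sc (l d) * v * br (ctr c y)"
        by (simp add: distrib_left mult.assoc[symmetric] sc_central[of "l d" v])
      ultimately have "v * br (ctr d y) \<approx> v * br (ctr ?e y) + sc (l d) * v * br (ctr c y)" by simp
      from eqJ_add[OF this Cons.IH] show ?case using Cons.prems by (simp add: x algebra_simps)
    qed simp
    then have "at_dist xs y \<approx> u * br (ctr c y) + (at_dist zs y + s * br (ctr c y))"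
      by (simp add: xs) (intro eqJ_add eqJ_refl)
    moreover have "u * br (ctr c y) + (at_dist zs y + s * br (ctr c y)) = (u + s) * br (ctr c y) + at_dist zs y"
      by (simp add: algebra_simps)
    moreover have "(u + s) * br (ctr c y) + at_dist zs y \<in> J" by (rule J_plus[OF J_right[OF us] zJ])
    ultimately show ?thesis unfolding eqJ_def using J_left_iff by metis
  qed
qed

text \<open>
  The list describes the orbit map of \<open>u\<close> under conjugation, and evaluating it at \<open>y\<close> moves \<open>y\<close> from the left of
  \<open>u\<close> to the right. For a single distribution this is \<open>dm_swap\<close>.
\<close>

definition exchange_via :: "(((('g \<Rightarrow> 'k) \<Rightarrow> 'k) mon \<Rightarrow>\<^sub>0 'k) \<times> ('g \<Rightarrow> 'k)) list \<Rightarrow> ((('g \<Rightarrow> 'k) \<Rightarrow> 'k) mon \<Rightarrow>\<^sub>0 'k) \<Rightarrow> bool" where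
  "exchange_via xs u \<longleftrightarrow> regular xs \<and> (\<forall>g\<in>carrier G. AdF g u \<approx> at_point xs g) \<and>
     (\<forall>y\<in>Dd (Suc q). br y * u \<approx> at_dist xs y)"

definition exchangeable :: "((('g \<Rightarrow> 'k) \<Rightarrow> 'k) mon \<Rightarrow>\<^sub>0 'k) \<Rightarrow> bool" where
  "exchangeable u \<longleftrightarrow> (\<exists>xs. exchange_via xs u)"

lemma exchange_viaD: assumes "exchange_via xs u"
  shows "regular xs" "g \<in> carrier G \<Longrightarrow> AdF g u \<approx> at_point xs g"
    "y \<in> Dd (Suc q) \<Longrightarrow> br y * u \<approx> at_dist xs y"
  using assms unfolding exchange_via_def by blast+

lemma exchangeableI:
  assumes "regular xs" "\<And>g. g \<in> carrier G \<Longrightarrow> AdF g u \<approx> at_point xs g"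
    "\<And>y. y \<in> Dd (Suc q) \<Longrightarrow> br y * u \<approx> at_dist xs y"
  shows "exchangeable u"
proof -
  have "exchange_via xs u" unfolding exchange_via_def
    by (rule conjI[OF assms(1) conjI[OF ballI ballI]]) (fact assms(2), fact assms(3))
  then show ?thesis unfolding exchangeable_def by (rule exI)
qed

lemma exchangeable_eqJ: assumes u: "exchangeable u" and e: "v \<approx> u" shows "exchangeable v"
proof -
  obtain xs where "exchange_via xs u" using u unfolding exchangeable_def by (rule exE)
  note xs = exchange_viaD[OF this]
  show ?thesis
    by (rule exchangeableI[OF xs(1)])
      (rule eqJ_trans[OF AdF_eqJ[OF _ e] xs(2)], assumption+, rule eqJ_trans[OF eqJ_mult[OF eqJ_refl e] xs(3)])
qed

lemma exchangeable_add: assumes u: "exchangeable u" and v: "exchangeable v" shows "exchangeable (u + v)"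
proof -
  obtain xs where "exchange_via xs u" using u unfolding exchangeable_def by (rule exE)
  note xs = exchange_viaD[OF this]
  obtain ys where "exchange_via ys v" using v unfolding exchangeable_def by (rule exE)
  note ys = exchange_viaD[OF this]
  show ?thesis
  proof (rule exchangeableI[of "xs @ ys"])
    show "regular (xs @ ys)" using xs(1) ys(1) by (simp add: regular_append)
    show "AdF g (u + v) \<approx> at_point (xs @ ys) g" if "g \<in> carrier G" for g
      using eqJ_add[OF xs(2)[OF that] ys(2)[OF that]] by (simp add: AdF_hom at_point_append)
    show "br y * (u + v) \<approx> at_dist (xs @ ys) y" if "y \<in> Dd (Suc q)" for y
      using eqJ_add[OF xs(3)[OF that] ys(3)[OF that]] by (simp add: distrib_left at_dist_append)
  qed
qed

lemma exchangeable_sc: "exchangeable (sc c)"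
proof (rule exchangeableI[of "[(sc c, one_A)]"])
  show "br y * sc c \<approx> at_dist [(sc c, one_A)] y" if "y \<in> Dd (Suc q)" for y
    using ctr_one[OF Dd_LF[OF that]] by (simp add: sc_central[of c "br y"])
qed (simp_all add: AdF_hom)

text \<open>
  Conjugation is multiplicative and \<open>y\<close> moves past one factor after the other; the coefficient
  functions multiply.
\<close>

lemma exchangeable_mult: assumes u: "exchangeable u" and v: "exchangeable v" shows "exchangeable (u * v)"
proof -
  obtain xs where "exchange_via xs u" using u unfolding exchangeable_def by (rule exE)
  note xs = exchange_viaD[OF this]
  obtain ys where "exchange_via ys v" using v unfolding exchangeable_def by (rule exE)
  note ys = exchange_viaD[OF this]
  define t where "t x = map (\<lambda>y. (fst x * fst y, snd x * snd y)) ys" for x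
  define zs where "zs = concat (map t xs)"
  have rt: "regular (t x)" if "snd x \<in> A" for x
    using ys(1) unfolding t_def by (induction ys) (simp_all add: A_mult[OF that])
  have pt: "at_point (t x) g = sc (snd x g) * fst x * at_point ys g" for x g
    unfolding t_def
    by (induction ys) (simp_all add: times_fun_apply[of "snd x"] sc_mult_mult distrib_left)
  have dt: "at_dist (t x) y = fst x * at_dist ys (ctr (snd x) y)" if "snd x \<in> A" for x y
    using ys(1) that unfolding t_def
    by (induction ys) (simp_all add: distrib_left mult.assoc ctr_ctr mult.commute[of "snd x"])
  have "regular zs" using xs(1) unfolding zs_def by (induction xs) (simp_all add: regular_append rt)
  moreover have "at_point zs g = at_point xs g * at_point ys g" for g
    unfolding zs_def by (induction xs) (simp_all add: at_point_append pt distrib_right)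
  moreover have "at_dist xs y * v \<approx> at_dist zs y" if y: "y \<in> Dd (Suc q)" for y
    using xs(1) unfolding zs_def
  proof (induction xs)
    case (Cons x xs)
    then have xA: "snd x \<in> A" by simp
    have "br (ctr (snd x) y) * v \<approx> at_dist ys (ctr (snd x) y)"
      using xA y by (intro ys(3) ctr_Dd_A)
    then have "fst x * (br (ctr (snd x) y) * v) \<approx> fst x * at_dist ys (ctr (snd x) y)"
      by (rule eqJ_mult[OF eqJ_refl])
    from eqJ_add[OF this Cons.IH] Cons.prems show ?case
      by (simp add: at_dist_append dt[OF xA] distrib_right mult.assoc)
  qed simp
  ultimately show ?thesis
  proof (intro exchangeableI[of zs])
    assume p: "\<And>g. at_point zs g = at_point xs g * at_point ys g"
      and d: "\<And>y. y \<in> Dd (Suc q) \<Longrightarrow> at_dist xs y * v \<approx> at_dist zs y"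
    show "AdF g (u * v) \<approx> at_point zs g" if "g \<in> carrier G" for g
      using eqJ_mult[OF xs(2)[OF that] ys(2)[OF that]] by (simp add: AdF_hom p)
    show "br y * (u * v) \<approx> at_dist zs y" if "y \<in> Dd (Suc q)" for y
      using eqJ_trans[OF eqJ_mult[OF xs(3)[OF that] eqJ_refl[of v]] d[OF that]] by (simp add: mult.assoc)
  qed
qed

lemma br_sum: "(\<And>i. i \<in> S \<Longrightarrow> z i \<in> Dd N) \<Longrightarrow> br (sum z S) \<approx> (\<Sum>i\<in>S. br (z i))"
proof (induction S rule: infinite_finite_induct)
  case (insert x S)
  have "br (z x + sum z S) \<approx> br (z x) + br (sum z S)"
    using insert.prems by (intro br_add Dd_sum) auto
  also have "\<dots> \<approx> br (z x) + (\<Sum>i\<in>S. br (z i))" using insert by (intro eqJ_add) auto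
  finally show ?case using insert by simp
qed (auto simp: br_0)

lemma gen_sum_scale: "(\<And>h. h \<in> H \<Longrightarrow> d h \<in> V) \<Longrightarrow> gen (\<Sum>h\<in>H. fscale (a h) (d h)) \<approx> (\<Sum>h\<in>H. sc (a h) * gen (d h))"
  by (rule eqJ_trans[OF gen_sum eqJ_sum]) (auto intro: V_fscale gen_scale)

text \<open>
  In the identity \<open>dm_swap\<close> the products have degree up to \<open>2 q\<close>, which is too large for the product relation
  when \<open>p = 2\<close>. Splitting off the values \<open>c h \<one>\<close> of the coefficient functions leaves a commutator and products of
  degree at most \<open>2 q - 1\<close>, for which the relations suffice.
\<close>

lemma exchangeable_gen: assumes v: "v \<in> Dp q" shows "exchangeable (gen v)"
proof -
  obtain H c d where e: "Adm_expansion q v H c d" using Adm_coeffs[OF v] by blast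
  note E = Adm_expansionD[OF e]
  have vV: "v \<in> V" using v Dq_V by blast
  have dV: "d h \<in> V" if "h \<in> H" for h using E(3)[OF that] Dq_V by blast
  obtain hs where hs: "set hs = H" "distinct hs" using finite_distinct_list[OF E(1)] by blast
  define xs where "xs = map (\<lambda>h. (gen (d h) :: (('g \<Rightarrow> 'k) \<Rightarrow> 'k) mon \<Rightarrow>\<^sub>0 'k, c h)) hs"
  have P: "at_point xs g = (\<Sum>h\<in>H. sc (c h g) * gen (d h))" for g
    unfolding at_point_def xs_def hs(1)[symmetric] using sum_list_distinct_conv_sum_set[OF hs(2)]
    by (simp add: o_def)
  have D: "at_dist xs y = (\<Sum>h\<in>H. gen (d h) * br (ctr (c h) y))" for y
    unfolding at_dist_def xs_def hs(1)[symmetric] using sum_list_distinct_conv_sum_set[OF hs(2)]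
    by (simp add: o_def)
  show ?thesis
  proof (rule exchangeableI[of xs])
    show "regular xs" using E(2) hs(1) by (auto simp: regular_def xs_def)
    show "AdF g (gen v) \<approx> at_point xs g" if g: "g \<in> carrier G" for g
      unfolding AdF_gen[OF vV] P E(4)[OF g] by (rule gen_sum_scale[OF dV])
    fix y assume y: "y \<in> Dd (Suc q)"
    have yL: "y \<in> LF" and vL: "v \<in> LF" using y v Dd_LF Dp_LF by blast+
    have yN: "y \<in> Dd N" using y q_less_N by (rule Dd_N)
    let ?n = "\<lambda>h. normalized (c h)"
    have nA: "?n h \<in> aug" if "h \<in> H" for h using E(2)[OF that] by (rule aug_normalize)
    have cn: "ctr (?n h) y \<in> Dd (Suc (q - 1))" if "h \<in> H" for h
      using ctr_aug_Dd[OF nA[OF that] y] by simp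
    have cnN: "ctr (?n h) y \<in> Dd N" if "h \<in> H" for h
      using Dd_mono[OF less_imp_le[OF q_less_N], of "ctr (?n h) y"] cn[OF that] by simp
    have qq: "q + (q - 1) < N" using two_q_le q_pos by linarith
    have ce: "ctr (c h) y = ctr (?n h) y + fscale (c h \<one>) y" if "h \<in> H" for h
    proof -
      have "c h = ?n h + fscale (c h \<one>) one_A" by simp
      then have "ctr (c h) y = ctr (?n h) y + ctr (fscale (c h \<one>) one_A) y"
        using ctr_add_left[OF yL aug_A[OF nA[OF that]] A_scale[OF A_one]] by metis
      then show ?thesis by (simp add: ctr_scale_left[OF yL] ctr_one[OF yL])
    qed
    have dn: "d h \<star> ctr (?n h) y \<in> Dd N" if "h \<in> H" for h
      using dm_Dd[OF Dp_Dd[OF E(3)[OF that]] cn[OF that]] Dd_mono[OF two_q_le] by simp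
    have v1: "v = (\<Sum>h\<in>H. fscale (c h \<one>) (d h))" using E(4)[of \<one>] Adm_one[OF vL] by simp
    have f1: "at_dist xs y \<approx> (\<Sum>h\<in>H. br (d h \<star> ctr (?n h) y) + sc (c h \<one>) * gen (d h) * br y)"
      unfolding D
    proof (rule eqJ_sum)
      fix h assume h: "h \<in> H"
      have "br (ctr (c h) y) \<approx> br (ctr (?n h) y) + br (fscale (c h \<one>) y)"
        unfolding ce[OF h] by (rule br_add[OF cnN[OF h] Dd_fscale[OF yN]])
      also have "\<dots> \<approx> br (ctr (?n h) y) + sc (c h \<one>) * br y" by (intro eqJ_add eqJ_refl br_scale yN)
      finally have e1: "gen (d h) * br (ctr (c h) y) \<approx> gen (d h) * (br (ctr (?n h) y) + sc (c h \<one>) * br y)"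
        by (rule eqJ_mult[OF eqJ_refl])
      have e2: "gen (d h) * (br (ctr (?n h) y) + sc (c h \<one>) * br y)
          = gen (d h) * br (ctr (?n h) y) + sc (c h \<one>) * gen (d h) * br y"
        by (simp add: distrib_left mult.assoc[symmetric] sc_central[of "c h \<one>" "gen (d h)"])
      have e3: "gen (d h) * br (ctr (?n h) y) \<approx> br (d h \<star> ctr (?n h) y)"
        using br_mult[OF Dp_Dd[OF E(3)[OF h]] cn[OF h] qq] br_Dp[OF E(3)[OF h]] by simp
      show "gen (d h) * br (ctr (c h) y) \<approx> br (d h \<star> ctr (?n h) y) + sc (c h \<one>) * gen (d h) * br y"
        by (rule eqJ_trans[OF e1[unfolded e2] eqJ_add[OF e3 eqJ_refl]])
    qed
    have f2: "(\<Sum>h\<in>H. br (d h \<star> ctr (?n h) y) + sc (c h \<one>) * gen (d h) * br y)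
       = (\<Sum>h\<in>H. br (d h \<star> ctr (?n h) y)) + (\<Sum>h\<in>H. sc (c h \<one>) * gen (d h)) * br y"
      by (simp add: sum.distrib sum_distrib_right)
    have f3: "(\<Sum>h\<in>H. br (d h \<star> ctr (?n h) y)) + (\<Sum>h\<in>H. sc (c h \<one>) * gen (d h)) * br y
       \<approx> br (\<Sum>h\<in>H. d h \<star> ctr (?n h) y) + gen v * br y"
    proof (intro eqJ_add eqJ_mult eqJ_refl eqJ_sym[OF br_sum] dn)
      show "(\<Sum>h\<in>H. sc (c h \<one>) * gen (d h)) \<approx> gen v"
        by (subst v1) (rule eqJ_sym[OF gen_sum_scale[OF dV]])
    qed
    have f4: "(\<Sum>h\<in>H. d h \<star> ctr (?n h) y) = y \<star> v - v \<star> y"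
    proof -
      have "y \<star> v = (\<Sum>h\<in>H. d h \<star> ctr (c h) y)" by (rule dm_swap[OF yL vL e])
      moreover have "d h \<star> ctr (c h) y = d h \<star> ctr (?n h) y + fscale (c h \<one>) (d h \<star> y)" if h: "h \<in> H" for h
      proof -
        have dL: "d h \<in> LF" using E(3)[OF h] Dp_LF by blast
        show ?thesis
          unfolding ce[OF h] using dL yL Dd_LF[OF cn[OF h]]
          by (simp add: dm_add_right LF_fscale dm_scale_right)
      qed
      ultimately have "y \<star> v = (\<Sum>h\<in>H. d h \<star> ctr (?n h) y + fscale (c h \<one>) (d h \<star> y))"
        by (simp cong: sum.cong)
      moreover have "v \<star> y = (\<Sum>h\<in>H. fscale (c h \<one>) (d h \<star> y))"
        by (subst v1) (simp add: dm_sum_left dm_scale_left)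
      ultimately show ?thesis by (simp add: sum.distrib)
    qed
    have f5: "br (y \<star> v - v \<star> y) \<approx> br y * gen v - gen v * br y"
      using br_comm[OF y Dp_Dd[OF v] two_q_le q_pos q_pos] br_Dp[OF v] by (simp add: eqJ_sym)
    have "at_dist xs y \<approx> (br y * gen v - gen v * br y) + gen v * br y"
      by (rule eqJ_trans[OF eqJ_trans[OF f1[unfolded f2] f3[unfolded f4]] eqJ_add[OF f5 eqJ_refl]])
    then show "br y * gen v \<approx> at_dist xs y" by (simp add: eqJ_sym)
  qed
qed

end

section \<open>Centrality\<close>

context higher_env
begin

lemma not_power_between: "q < n \<Longrightarrow> n < N \<Longrightarrow> n \<noteq> p ^ s"
proof
  assume "q < n" "n < N" "n = p ^ s"
  then have "p ^ r < p ^ s" "p ^ s < p ^ (r + 1)" by (simp_all only: q_def N_eq)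
  then have "r < s" "s < r + 1" using power_less_imp_less_exp[OF p_gt_1] by blast+
  then show False by simp
qed

text \<open>
  The distributions of order at most \<open>q\<close> generate: between \<open>q\<close> and \<open>N\<close> there is no power of \<open>p\<close>, so every
  distribution of such an order is decomposable.
\<close>

lemma generated_induct:
  assumes eq: "\<And>n u v. P n u \<Longrightarrow> v \<approx> u \<Longrightarrow> P n v"
    and add: "\<And>n u v. P n u \<Longrightarrow> P n v \<Longrightarrow> P n (u + v)"
    and scale: "\<And>n u c. P n u \<Longrightarrow> P n (sc c * u)"
    and mult: "\<And>m n u v. P m u \<Longrightarrow> P n v \<Longrightarrow> P (m + n) (u * v)"
    and mono: "\<And>m n u. P m u \<Longrightarrow> m \<le> n \<Longrightarrow> P n u"
    and base: "\<And>n x. n \<le> q \<Longrightarrow> x \<in> Dp n \<Longrightarrow> P n (gen x)"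
  shows "n < N \<Longrightarrow> z \<in> Dp n \<Longrightarrow> P n (gen z)"
proof (induction n arbitrary: z rule: less_induct)
  case (less n)
  show ?case
  proof (cases "n \<le> q")
    case True
    then show ?thesis using base less.prems by blast
  next
    case False
    then have n1: "n \<ge> 1" by simp
    have dec: "z \<in> decomposables n"
      using indecomposables[OF less.prems(2) n1] not_power_between[of n] less.prems(1) False by auto
    let ?W = "{z \<in> Dp n. P n (gen z)}"
    have V: "x \<in> V" if "x \<in> Dp n" for x using Dp_V[OF that less.prems(1)] .
    have "fs.subspace ?W"
    proof (rule fs.subspaceI)
      have "P 0 (gen 0)" by (rule base) simp_all
      then show "0 \<in> ?W" using mono[of 0 "gen 0" n] by simp
      fix x y c assume x: "x \<in> ?W"
      then have "P n (gen (fscale c x))" using eq[OF scale gen_scale[OF V]] by blast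
      then show "fscale c x \<in> ?W" using x Dp_fscale by blast
      assume y: "y \<in> ?W"
      then have "P n (gen (x + y))" using x eq[OF add gen_add[OF V V]] by blast
      then show "x + y \<in> ?W" using x y Dp_plus by blast
    qed
    moreover have "w \<in> ?W" if w: "w \<in> {x \<star> y | x y i j. x \<in> Dp i \<and> y \<in> Dp j \<and> 0 < i \<and> 0 < j \<and> i + j = n} \<union> Dp (n - 1)" for w
    proof (cases "w \<in> Dp (n - 1)")
      case True
      then have "P (n - 1) (gen w)" using less.IH[of "n - 1" w] less.prems(1) n1 by simp
      then have "P n (gen w)" by (rule mono) simp
      then show ?thesis using Dp_mono[of "n - 1" n w] True by simp
    next
      case False
      then obtain x y i j where xy: "w = x \<star> y" "x \<in> Dp i" "y \<in> Dp j" "0 < i" "0 < j" "i + j = n"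
        using w by blast
      have "P i (gen x)" "P j (gen y)" using less.IH[of i x] less.IH[of j y] xy less.prems(1) by simp_all
      then have "P (i + j) (gen x * gen y)" by (rule mult)
      moreover have "gen x * gen y \<approx> gen (x \<star> y)"
        unfolding eqJ_def by (rule J_mult_rel[OF xy(2,3)]) (simp only: xy(6) less.prems(1))
      ultimately have "P (i + j) (gen (x \<star> y))" using eq eqJ_sym by blast
      then have "P n (gen w)" unfolding xy(1,6) .
      then show ?thesis using dm_Dp[OF xy(2,3)] xy(1,6) by simp
    qed
    ultimately have "decomposables n \<subseteq> ?W" unfolding decomposables_def
      by (intro fs.span_minimal) blast+
    then show ?thesis using dec by blast
  qed
qed

lemma exchangeable_V: "z \<in> V \<Longrightarrow> exchangeable (gen z)"
proof -
  assume "z \<in> V"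
  then have "z \<in> Dp (N - 1)" by (simp add: V_def)
  then show ?thesis
    by (intro generated_induct[of "\<lambda>_. exchangeable" "N - 1" z])
      (auto intro: exchangeable_eqJ exchangeable_add exchangeable_mult exchangeable_sc exchangeable_gen Dp_mono)
qed

lemma exchangeable_power: "exchangeable u \<Longrightarrow> exchangeable (u ^ n)"
  using exchangeable_sc[of 1] by (induction n) (simp_all add: exchangeable_mult)

lemma exchangeable_xi: assumes "\<delta> \<in> Dp q" shows "exchangeable (xi \<delta>)"
proof -
  have "exchangeable (gen \<delta> ^ p + sc (-1) * gen (pow \<delta> p))"
    using assms by (intro exchangeable_add exchangeable_mult exchangeable_sc exchangeable_power exchangeable_V pow_p_V Dq_V)
  moreover have "sc (-1) * u = - u" for u :: "(('g \<Rightarrow> 'k) \<Rightarrow> 'k) mon \<Rightarrow>\<^sub>0 'k"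
    using sc_diff[of 0 1] by (metis diff_0 mult_minus1 sc_0 sc_1)
  ultimately show ?thesis by (simp add: xi_def)
qed

text \<open>
  Coordinates for the restriction of distributions of order at most \<open>q\<close> to \<open>q\<close>-th powers.
\<close>

definition frobenius_frame :: "('g \<Rightarrow> 'k) set \<Rightarrow> (('g \<Rightarrow> 'k) \<Rightarrow> ('g \<Rightarrow> 'k) \<Rightarrow> 'k) \<Rightarrow> bool" where
  "frobenius_frame H d \<longleftrightarrow> finite H \<and> H \<subseteq> A \<and> (\<forall>h\<in>H. d h \<in> Dp q) \<and>
    (\<forall>\<mu>\<in>Dp q. \<forall>f\<in>A. \<mu> (f ^ q) = (\<Sum>h\<in>H. \<mu> (h ^ q) * d h (f ^ q)))"

lemma frobenius_frame_ex:
  assumes S: "generates S"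
  shows "\<exists>H d. frobenius_frame H d \<and> H \<subseteq> S"
proof -
  obtain H d where H: "H \<subseteq> S" and d: "\<forall>h\<in>H. d h \<in> Dp q"
    and ex: "\<forall>\<mu>\<in>Dp q. \<forall>f\<in>A. \<mu> (f ^ q) = (\<Sum>h\<in>H. \<mu> (h ^ q) * d h (f ^ q))"
    using frobenius_dual[OF S, of r, folded q_def] by blast
  have fin: "finite H" and HA: "H \<subseteq> A" using S H finite_subset by (auto simp: generates_def)
  have "frobenius_frame H d" unfolding frobenius_frame_def
    by (rule conjI[OF fin conjI[OF HA conjI[OF d ex]]])
  then show ?thesis using H by blast
qed

lemma frobenius_frameD:
  assumes "frobenius_frame H d"
  shows "finite H" "h \<in> H \<Longrightarrow> h \<in> A" "h \<in> H \<Longrightarrow> d h \<in> Dp q"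
    "\<mu> \<in> Dp q \<Longrightarrow> f \<in> A \<Longrightarrow> \<mu> (f ^ q) = (\<Sum>h\<in>H. \<mu> (h ^ q) * d h (f ^ q))"
  using assms unfolding frobenius_frame_def by blast+

text \<open>
  The difference of \<open>\<mu>\<close> and its expansion in the frame kills all \<open>q\<close>-th powers.
\<close>

lemma xi_expand:
  assumes fr: "frobenius_frame H d" and \<mu>: "\<mu> \<in> Dp q"
  shows "xi \<mu> \<approx> (\<Sum>h\<in>H. sc (\<mu> (h ^ q) ^ p) * xi (d h))"
proof -
  note F = frobenius_frameD[OF fr]
  define \<sigma> where "\<sigma> = (\<Sum>h\<in>H. fscale (\<mu> (h ^ q)) (d h))"
  have \<sigma>: "\<sigma> \<in> Dp q" unfolding \<sigma>_def using F(3) by (intro Dp_sum Dp_fscale)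
  have \<nu>: "\<mu> - \<sigma> \<in> Dp q" using \<mu> \<sigma> by (rule Dp_minus)
  have "(\<mu> - \<sigma>) (f ^ q) = 0" if "f \<in> A" for f
    using F(4)[OF \<mu> that] by (simp add: \<sigma>_def minus_apply[of \<mu>] sum_fun_apply fscale_apply)
  then have "xi (\<mu> - \<sigma>) \<approx> 0" by (rule xi_frobenius_kernel[OF \<nu>])
  moreover have "xi ((\<mu> - \<sigma>) + \<sigma>) \<approx> xi (\<mu> - \<sigma>) + xi \<sigma>" by (rule xi_add[OF \<nu> \<sigma>])
  ultimately have 1: "xi \<mu> \<approx> 0 + xi \<sigma>" using eqJ_trans[OF _ eqJ_add[OF _ eqJ_refl]] by fastforce
  have 2: "xi \<sigma> \<approx> (\<Sum>h\<in>H. xi (fscale (\<mu> (h ^ q)) (d h)))"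
    unfolding \<sigma>_def using F(3) by (intro xi_sum Dp_fscale)
  have 3: "(\<Sum>h\<in>H. xi (fscale (\<mu> (h ^ q)) (d h))) \<approx> (\<Sum>h\<in>H. sc (\<mu> (h ^ q) ^ p) * xi (d h))"
    using F(3) by (intro eqJ_sum xi_scale)
  show ?thesis by (rule eqJ_trans[OF 1[unfolded add_0] eqJ_trans[OF 2 3]])
qed

text \<open>
  Conjugation commutes with taking \<open>q\<close>-th powers, and the field is perfect.
\<close>

lemma Adm_frobenius:
  assumes h: "h \<in> A" and \<delta>: "\<delta> \<in> Dp q"
  shows "\<exists>B\<in>A. \<forall>g\<in>carrier G. Adm g \<delta> (h ^ q) = B g ^ q"
proof -
  obtain K :: "(nat \<times> nat) set" and a b where K: "\<forall>i\<in>K. a i \<in> A \<and> b i \<in> A"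
     "\<forall>g\<in>carrier G. conj_fun g h = (\<Sum>i\<in>K. fscale (a i g) (b i))"
    using conj_fun_coeffs[OF h] by blast
  have "\<forall>c::'k. \<exists>d. d ^ q = c" unfolding q_def using frobenius_root by metis
  then obtain rt where rt: "\<And>c::'k. rt c ^ q = c" by metis
  define B where "B = (\<Sum>i\<in>K. fscale (rt (\<delta> (b i ^ q))) (a i))"
  have "B \<in> A" unfolding B_def using K(1) by (intro A_sum A_scale) blast
  moreover have "Adm g \<delta> (h ^ q) = B g ^ q" if g: "g \<in> carrier G" for g
  proof -
    have hq: "h ^ q \<in> A" using h by (intro A_power) auto
    have "conj_fun g (h ^ q) = (\<Sum>i\<in>K. fscale (a i g) (b i)) ^ q"
      using K(2) g by (simp add: conj_fun_power)
    also have "\<dots> = (\<Sum>i\<in>K. fscale (a i g ^ q) (b i ^ q))"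
      unfolding q_def frobenius_sum by (simp only: fscale_power)
    finally have "Adm g \<delta> (h ^ q) = \<delta> (\<Sum>i\<in>K. fscale (a i g ^ q) (b i ^ q))"
      by (simp only: Adm_apply[OF hq])
    also have "\<dots> = (\<Sum>i\<in>K. a i g ^ q * \<delta> (b i ^ q))"
      using K(1) by (intro LF_sum_scale[OF Dp_LF[OF \<delta>]] A_power) auto
    also have "\<dots> = (\<Sum>i\<in>K. (rt (\<delta> (b i ^ q)) * a i g) ^ q)"
      by (simp only: power_mult_distrib rt mult.commute)
    also have "\<dots> = B g ^ q"
      unfolding B_def sum_fun_apply fscale_apply q_def frobenius_sum_field by (rule refl)
    finally show ?thesis .
  qed
  ultimately show ?thesis by blast
qed

lemma AdF_xi: "g \<in> carrier G \<Longrightarrow> \<delta> \<in> Dp q \<Longrightarrow> AdF g (xi \<delta>) = xi (Adm g \<delta>)"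
  by (simp add: xi_def AdF_hom AdF_gen Dq_V pow_p_V Adm_pow Dp_LF[of \<delta> q])

text \<open>
  An \<open>N\<close>-th power differs from its value at the identity by an element of the \<open>N\<close>-th power of the augmentation
  ideal.
\<close>

lemma ctr_power_N:
  assumes B: "B \<in> A" and y: "y \<in> Dd (Suc q)"
  shows "ctr (B ^ N) y = fscale (B \<one> ^ N) y"
proof -
  have yL: "y \<in> LF" using y Dd_LF by blast
  let ?n = "normalized B"
  have nN: "?n ^ N \<in> I N" using B by (intro aug_power aug_normalize) auto
  have nA: "?n ^ N \<in> A" using nN I_subset_A by blast
  have BN: "B ^ N = ?n ^ N + fscale (B \<one> ^ N) one_A"
    unfolding N_eq using frobenius_add[of ?n "fscale (B \<one>) one_A" "r + 1"]
    by (simp add: fscale_power one_A_power)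
  have "ctr (?n ^ N) y \<in> Dd (Suc q - N)" by (rule ctr_Dd[OF nN y])
  then have "ctr (?n ^ N) y = 0" using q_less_N by (simp add: Dd_0)
  then show ?thesis
    by (subst BN) (simp add: ctr_add_left[OF yL nA A_scale[OF A_one]] ctr_scale_left[OF yL] ctr_one[OF yL])
qed

text \<open>
  There are two descriptions of the orbit map of \<open>\<xi> \<delta>\<close>: the one that comes from \<open>\<xi> \<delta>\<close> as an
  expression in generators moves \<open>x\<close> past \<open>\<xi> \<delta>\<close>, and the one from the frame has \<open>N\<close>-th powers as coefficient
  functions. They agree at points, hence also at \<open>x\<close>.
\<close>

lemma xi_commutes:
  assumes \<delta>: "\<delta> \<in> Dp q" and x: "x \<in> Dp q"
  shows "gen x * xi \<delta> \<approx> xi \<delta> * gen x"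
proof -
  obtain S where S: "generates S" using generates_ex by blast
  obtain H d where fr: "frobenius_frame H d" using frobenius_frame_ex[OF S] by blast
  note F = frobenius_frameD[OF fr]
  have "\<forall>h\<in>H. \<exists>B. B \<in> A \<and> (\<forall>g\<in>carrier G. Adm g \<delta> (h ^ q) = B g ^ q)"
    using Adm_frobenius[OF _ \<delta>] F(2) by blast
  then obtain B where B: "\<And>h. h \<in> H \<Longrightarrow> B h \<in> A \<and> (\<forall>g\<in>carrier G. Adm g \<delta> (h ^ q) = B h g ^ q)" by metis
  obtain hs where hs: "set hs = H" "distinct hs" using finite_distinct_list[OF F(1)] by blast
  (* the description of the orbit map by the frame *)
  define ys where "ys = map (\<lambda>h. (xi (d h), B h ^ N)) hs"
  have P: "at_point ys g = (\<Sum>h\<in>H. sc (B h g ^ N) * xi (d h))" for g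
    unfolding at_point_def ys_def hs(1)[symmetric] using sum_list_distinct_conv_sum_set[OF hs(2)]
    by (simp add: o_def power_fun_apply)
  have D: "at_dist ys y = (\<Sum>h\<in>H. xi (d h) * br (ctr (B h ^ N) y))" for y
    unfolding at_dist_def ys_def hs(1)[symmetric] using sum_list_distinct_conv_sum_set[OF hs(2)]
    by (simp add: o_def)
  have ry: "regular ys"
    unfolding regular_def ys_def using A_power[of "B h" N for h] B hs(1) by auto
  have pt: "xi (Adm g \<delta>) \<approx> at_point ys g" if g: "g \<in> carrier G" for g
  proof -
    have "Adm g \<delta> (h ^ q) ^ p = B h g ^ N" if "h \<in> H" for h
      using B[OF that] g by (simp add: N_def power_mult[symmetric] mult.commute)
    then have "(\<Sum>h\<in>H. sc (Adm g \<delta> (h ^ q) ^ p) * xi (d h)) = at_point ys g" unfolding P by simp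
    then show ?thesis using xi_expand[OF fr Adm_Dp[OF g \<delta>]] by simp
  qed
  obtain xs where "exchange_via xs (xi \<delta>)" using exchangeable_xi[OF \<delta>] unfolding exchangeable_def by (rule exE)
  note X = exchange_viaD[OF this]
  (* appending the negative of a list represents the difference of the two functions *)
  define ng where "ng = map (\<lambda>x. (- fst x, snd x)) ys"
  have ng: "at_point ng g = - at_point ys g" "at_dist ng y = - at_dist ys y" "regular ng \<longleftrightarrow> regular ys" for g y
    unfolding ng_def by (induction ys) (simp_all)
  have yy: "gen x = br x" using br_Dp[OF x] by simp
  have xD: "x \<in> Dd (Suc q)" using Dp_Dd[OF x] .
  have "at_dist (xs @ ng) x \<in> J"
  proof (rule regular_zero_imp)
    show "regular (xs @ ng)" using X(1) ry ng by (simp add: regular_append)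
    show "x \<in> Dd N" by (rule Dd_N[OF xD q_less_N])
    fix g assume g: "g \<in> carrier G"
    have "at_point xs g \<approx> xi (Adm g \<delta>)" using X(2)[OF g] AdF_xi[OF g \<delta>] by (simp add: eqJ_sym)
    then have "at_point xs g \<approx> at_point ys g" using pt[OF g] by (rule eqJ_trans)
    then show "at_point (xs @ ng) g \<in> J" by (simp add: at_point_append ng eqJ_def)
  qed
  then have "at_dist xs x \<approx> at_dist ys x" by (simp add: at_dist_append ng eqJ_def)
  then have 1: "br x * xi \<delta> \<approx> at_dist ys x" by (rule eqJ_trans[OF X(3)[OF xD]])
  have 2: "at_dist ys x \<approx> (\<Sum>h\<in>H. sc (B h \<one> ^ N) * xi (d h) * br x)"
    unfolding D
  proof (rule eqJ_sum)
    fix h assume h: "h \<in> H"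
    have BA: "B h \<in> A" using B[OF h] by blast
    have "br (ctr (B h ^ N) x) \<approx> sc (B h \<one> ^ N) * br x"
      unfolding ctr_power_N[OF BA xD] by (rule br_scale[OF Dd_N[OF xD q_less_N]])
    then have "xi (d h) * br (ctr (B h ^ N) x) \<approx> xi (d h) * (sc (B h \<one> ^ N) * br x)"
      by (rule eqJ_mult[OF eqJ_refl])
    then show "xi (d h) * br (ctr (B h ^ N) x) \<approx> sc (B h \<one> ^ N) * xi (d h) * br x"
      by (simp only: mult.assoc[symmetric] sc_central[of "B h \<one> ^ N" "xi (d h)"])
  qed
  have 3: "at_point ys \<one> * br x = (\<Sum>h\<in>H. sc (B h \<one> ^ N) * xi (d h) * br x)"
    unfolding P by (rule sum_distrib_right)
  have "xi \<delta> \<approx> at_point ys \<one>" using pt[of \<one>] Adm_one[OF Dp_LF[OF \<delta>]] by simp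
  from eqJ_mult[OF this eqJ_refl[of "br x"]] have 4: "xi \<delta> * br x \<approx> (\<Sum>h\<in>H. sc (B h \<one> ^ N) * xi (d h) * br x)"
    unfolding 3 .
  show ?thesis unfolding yy by (rule eqJ_trans[OF eqJ_trans[OF 1 2] eqJ_sym[OF 4]])
qed

lemma commutes_V:
  assumes c: "\<And>x. x \<in> Dp q \<Longrightarrow> gen x * z \<approx> z * gen x"
  shows "u * z \<approx> z * u"
proof (induction u rule: free_induct)
  case (word c w)
  have V: "gen v * z \<approx> z * gen v" for v
  proof (cases "v \<in> V")
    case True
    then have "v \<in> Dp (N - 1)" by (simp add: V_def)
    then show ?thesis
    proof (rule generated_induct[of "\<lambda>_ u. u * z \<approx> z * u", rotated 7])
      fix u v assume u: "u * z \<approx> z * u" and e: "v \<approx> u"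
      show "v * z \<approx> z * v"
        by (rule eqJ_trans[OF eqJ_mult[OF e eqJ_refl] eqJ_trans[OF u eqJ_mult[OF eqJ_refl eqJ_sym[OF e]]]])
    next
      fix u v assume "u * z \<approx> z * u" "v * z \<approx> z * v"
      then show "(u + v) * z \<approx> z * (u + v)" by (simp add: distrib_left distrib_right eqJ_add)
    next
      fix u c assume u: "u * z \<approx> z * u"
      have "z * (sc c * u) = sc c * (z * u)" by (simp only: mult.assoc[symmetric] sc_central[of c z])
      then show "sc c * u * z \<approx> z * (sc c * u)" using eqJ_mult[OF eqJ_refl[of "sc c"] u] by (simp add: mult.assoc)
    next
      fix u v assume u: "u * z \<approx> z * u" and v: "v * z \<approx> z * v"
      have "u * (v * z) \<approx> u * (z * v)" by (rule eqJ_mult[OF eqJ_refl v])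
      moreover have "(u * z) * v \<approx> (z * u) * v" by (rule eqJ_mult[OF u eqJ_refl])
      ultimately show "u * v * z \<approx> z * (u * v)" using eqJ_trans by (simp add: mult.assoc)
    next
      show "gen x * z \<approx> z * gen x" if "n \<le> q" "x \<in> Dp n" for n x using c Dp_mono[OF that] by blast
    qed simp_all
  next
    case False
    then have "gen v * z - z * gen v \<in> J" using J_out by (intro J_minus J_left J_right)
    then show ?thesis by (simp add: eqJ_def)
  qed
  have W: "prod_list (map gen w) * z \<approx> z * prod_list (map gen w)"
  proof (induction w)
    case (Cons v w)
    have "gen v * (prod_list (map gen w) * z) \<approx> gen v * (z * prod_list (map gen w))"
      by (rule eqJ_mult[OF eqJ_refl Cons])
    moreover have "(gen v * z) * prod_list (map gen w) \<approx> (z * gen v) * prod_list (map gen w)"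
      by (rule eqJ_mult[OF V eqJ_refl])
    ultimately show ?case using eqJ_trans by (simp add: mult.assoc)
  qed simp
  have "z * (sc c * u) = sc c * (z * u)" for u by (simp only: mult.assoc[symmetric] sc_central[of c z])
  then show ?case using eqJ_mult[OF eqJ_refl[of "sc c"] W] by (simp add: mult.assoc)
qed (simp add: distrib_left distrib_right eqJ_add)

lemma xi_central: "\<delta> \<in> Dp q \<Longrightarrow> u * xi \<delta> \<approx> xi \<delta> * u"
  by (rule commutes_V) (rule xi_commutes)

end

section \<open>Finite generation over the central elements\<close>

context higher_env
begin

type_synonym ('x, 'y) letter = "nat \<times> (('x \<Rightarrow> 'y) \<Rightarrow> 'y)"

text \<open>
  Finitely many letters that span the distributions of each positive order at most \<open>q\<close>. A letter
  records an order, since the same distribution may occur with several.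
\<close>

definition alphabet :: "('g, 'k) letter set \<Rightarrow> bool" where
  "alphabet L \<longleftrightarrow> finite L \<and> (\<forall>l\<in>L. 0 < fst l \<and> fst l \<le> q \<and> snd l \<in> Dp (fst l)) \<and>
     (\<forall>k x. 0 < k \<longrightarrow> k \<le> q \<longrightarrow> x \<in> Dp k \<longrightarrow> (\<exists>c. x = (\<Sum>l\<in>{l\<in>L. fst l = k}. fscale (c l) (snd l))))"

lemma alphabet_expand:
  assumes "alphabet L" "0 < k" "k \<le> q" "x \<in> Dp k"
  shows "\<exists>c. x = (\<Sum>l\<in>{l\<in>L. fst l = k}. fscale (c l) (snd l))"
  using assms(1)[unfolded alphabet_def, THEN conjunct2, THEN conjunct2, rule_format, OF assms(2-4)] .

lemma alphabet_ex: "\<exists>L. alphabet L"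
proof -
  have "\<forall>k. \<exists>H d. dual_frame k H d" using dual_frame_ex by blast
  then obtain H d where fr: "\<And>k. dual_frame k (H k) (d k)" by metis
  define L where "L = Sigma {0<..q} (\<lambda>k. d k ` H k)"
  have "finite L" unfolding L_def using dual_frameD(1)[OF fr] by blast
  moreover have "0 < fst l \<and> fst l \<le> q \<and> snd l \<in> Dp (fst l)" if "l \<in> L" for l
    using that dual_frameD(3)[OF fr] by (auto simp: L_def)
  moreover have "\<exists>c. x = (\<Sum>l\<in>{l\<in>L. fst l = k}. fscale (c l) (snd l))" if k: "0 < k" "k \<le> q" and x: "x \<in> Dp k" for k x
  proof -
    (* different indices may carry the same letter *)
    define c where "c l = (\<Sum>h\<in>{h\<in>H k. d k h = snd l}. x h)" for l :: "('g, 'k) letter"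
    have S: "{l \<in> L. fst l = k} = Pair k ` (d k ` H k)" using k by (auto simp: L_def)
    have "(\<Sum>l\<in>{l\<in>L. fst l = k}. fscale (c l) (snd l)) = (\<Sum>b\<in>d k ` H k. fscale (c (k, b)) b)"
      unfolding S by (subst sum.reindex) (auto simp: inj_on_def)
    also have "\<dots> = (\<Sum>b\<in>d k ` H k. \<Sum>h\<in>{h\<in>H k. d k h = b}. fscale (x h) (d k h))"
      by (rule sum.cong) (auto simp: c_def fs.scale_sum_left)
    also have "\<dots> = (\<Sum>h\<in>H k. fscale (x h) (d k h))"
      using dual_frameD(1)[OF fr] by (rule sum.image_gen[symmetric])
    finally have "x = (\<Sum>l\<in>{l\<in>L. fst l = k}. fscale (c l) (snd l))"
      using dual_frameD(4)[OF fr x] by (rule trans[OF _ sym, rotated])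
    then show ?thesis by (intro exI[of _ c])
  qed
  ultimately have "alphabet L" unfolding alphabet_def by simp
  then show ?thesis by (rule exI)
qed

definition deg :: "('g, 'k) letter list \<Rightarrow> nat" where "deg w = sum_list (map fst w)"
definition val :: "('g, 'k) letter list \<Rightarrow> (('g \<Rightarrow> 'k) \<Rightarrow> 'k) mon \<Rightarrow>\<^sub>0 'k" where
  "val w = prod_list (map (\<lambda>l. gen (snd l)) w)"

lemma deg_simps [simp]: "deg [] = 0" "deg (l # w) = fst l + deg w" "deg (v @ w) = deg v + deg w"
  and val_simps [simp]: "val [] = 1" "val (l # w) = gen (snd l) * val w" "val (v @ w) = val v * val w"
  by (simp_all add: deg_def val_def)

text \<open>
  The degree filtration as it is seen by words in the alphabet. Including \<open>J\<close> makes membership invariant under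
  congruence.
\<close>

inductive_set Fil :: "('g, 'k) letter set \<Rightarrow> nat \<Rightarrow> ((('g \<Rightarrow> 'k) \<Rightarrow> 'k) mon \<Rightarrow>\<^sub>0 'k) set"
  for L :: "('g, 'k) letter set" and n :: nat where
  Fil_J: "u \<in> J \<Longrightarrow> u \<in> Fil L n"
| Fil_word: "set w \<subseteq> L \<Longrightarrow> deg w < n \<Longrightarrow> val w \<in> Fil L n"
| Fil_add: "u \<in> Fil L n \<Longrightarrow> v \<in> Fil L n \<Longrightarrow> u + v \<in> Fil L n"
| Fil_scale: "u \<in> Fil L n \<Longrightarrow> sc c * u \<in> Fil L n"

lemma Fil_eqJ: "u \<in> Fil L n \<Longrightarrow> v \<approx> u \<Longrightarrow> v \<in> Fil L n"
proof -
  assume u: "u \<in> Fil L n" and vu: "v \<approx> u"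
  have "v - u \<in> J" using vu by (simp add: eqJ_def)
  then have "(v - u) + u \<in> Fil L n" by (intro Fil_add[OF Fil_J u])
  then show ?thesis by simp
qed

lemma Fil_mono: assumes "m \<le> n" shows "u \<in> Fil L m \<Longrightarrow> u \<in> Fil L n"
proof (induction rule: Fil.induct)
  case (Fil_word w)
  then show ?case using assms by (intro Fil.Fil_word) auto
qed (auto intro: Fil.intros)

lemma Fil_sum: "(\<And>i. i \<in> S \<Longrightarrow> f i \<in> Fil L n) \<Longrightarrow> sum f S \<in> Fil L n"
  by (induction S rule: infinite_finite_induct) (auto intro: Fil_add Fil_J)

lemma Fil_mult: "u \<in> Fil L (Suc m) \<Longrightarrow> v \<in> Fil L (Suc n) \<Longrightarrow> u * v \<in> Fil L (Suc (m + n))"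
proof (induction rule: Fil.induct)
  case (Fil_J u)
  then show ?case by (intro Fil.Fil_J J_right)
next
  case (Fil_word w)
  from Fil_word(3) show ?case
  proof (induction rule: Fil.induct)
    case (Fil_J u)
    then show ?case by (intro Fil.Fil_J J_left)
  next
    case (Fil_word w')
    have "val (w @ w') \<in> Fil L (Suc (m + n))"
      using Fil_word \<open>set w \<subseteq> L\<close> \<open>deg w < Suc m\<close> by (intro Fil.Fil_word) auto
    then show ?case by simp
  next
    case (Fil_add u v)
    then show ?case by (simp add: distrib_left Fil.Fil_add)
  next
    case (Fil_scale u c)
    have "val w * (sc c * u) = sc c * (val w * u)" by (simp only: mult.assoc[symmetric] sc_central[of c "val w"])
    then show ?case using Fil_scale by (simp add: Fil.Fil_scale)
  qed
next
  case (Fil_add u v)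
  then show ?case by (simp add: distrib_right Fil.Fil_add)
next
  case (Fil_scale u c)
  then show ?case by (simp add: mult.assoc Fil.Fil_scale)
qed

context
  fixes L assumes L: "alphabet L"
begin

lemma L_simps: "finite L" "l \<in> L \<Longrightarrow> 0 < fst l" "l \<in> L \<Longrightarrow> fst l \<le> q" "l \<in> L \<Longrightarrow> snd l \<in> Dp (fst l)"
  using L unfolding alphabet_def by blast+

lemma gen_Fil: assumes n: "n < N" and z: "z \<in> Dp n" shows "gen z \<in> Fil L (Suc n)"
proof (rule generated_induct[of "\<lambda>n u. u \<in> Fil L (Suc n)", OF _ _ _ _ _ _ n z])
  fix k x assume k: "k \<le> q" and x: "x \<in> Dp k"
  show "gen x \<in> Fil L (Suc k)"
  proof (cases "k = 0")
    case True
    then have "x = 0" using x Dp_0 by simp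
    then show ?thesis using gen_0 Fil_J[of "gen x"] by (simp add: eqJ_0)
  next
    case False
    let ?S = "{l\<in>L. fst l = k}"
    obtain c where c: "x = (\<Sum>l\<in>?S. fscale (c l) (snd l))"
      using alphabet_expand[OF L _ k x] False by (auto simp only: neq0_conv)
    have "snd l \<in> V" if "l \<in> ?S" for l using Dq_V[OF Dp_mono[OF k]] that L_simps(4)[of l] by auto
    then have "gen (\<Sum>l\<in>?S. fscale (c l) (snd l)) \<approx> (\<Sum>l\<in>?S. sc (c l) * gen (snd l))" by (rule gen_sum_scale)
    moreover have "(\<Sum>l\<in>?S. sc (c l) * gen (snd l)) \<in> Fil L (Suc k)"
    proof (rule Fil_sum)
      fix l assume l: "l \<in> ?S"
      then have "val [l] \<in> Fil L (Suc k)" by (intro Fil_word) auto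
      then have "gen (snd l) \<in> Fil L (Suc k)" by simp
      then show "sc (c l) * gen (snd l) \<in> Fil L (Suc k)" by (rule Fil_scale)
    qed
    ultimately show ?thesis unfolding c[symmetric] using Fil_eqJ by blast
  qed
qed (auto intro: Fil_eqJ Fil_add Fil_scale Fil_mult Fil_mono)

lemma letter_comm:
  assumes a: "a \<in> L" and b: "b \<in> L"
  shows "gen (snd a) * gen (snd b) - gen (snd b) * gen (snd a) \<in> Fil L (fst a + fst b)"
proof -
  let ?x = "snd a" and ?y = "snd b" and ?i = "fst a" and ?j = "fst b"
  have ij: "?i + ?j \<le> N" "0 < ?i" "0 < ?j" using L_simps(2,3)[OF a] L_simps(2,3)[OF b] two_q_le by auto
  have "?x \<star> ?y - ?y \<star> ?x \<in> Dp (?i + ?j - 1)"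
    using ij by (intro dm_commutator_Dp L_simps(4) a b) auto
  moreover have "?i + ?j - 1 < N" using ij N_pos by linarith
  ultimately have "gen (?x \<star> ?y - ?y \<star> ?x) \<in> Fil L (Suc (?i + ?j - 1))" by (intro gen_Fil)
  then have "gen (?x \<star> ?y - ?y \<star> ?x) \<in> Fil L (?i + ?j)" using ij by simp
  moreover have "gen ?x * gen ?y - gen ?y * gen ?x \<approx> gen (?x \<star> ?y - ?y \<star> ?x)"
    unfolding eqJ_def by (rule J_comm_rel[OF L_simps(4)[OF a] L_simps(4)[OF b] ij(2,3,1)])
  ultimately show ?thesis by (rule Fil_eqJ)
qed

text \<open>
  Moving a letter through a word produces only words of smaller degree.
\<close>

lemma word_comm:
  assumes b: "b \<in> L"
  shows "set w \<subseteq> L \<Longrightarrow> val w * gen (snd b) - gen (snd b) * val w \<in> Fil L (deg w + fst b)"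
proof (induction w)
  case Nil
  show ?case by (simp add: Fil_J)
next
  case (Cons a w)
  have a: "a \<in> L" and w: "set w \<subseteq> L" using Cons.prems by auto
  have pos: "0 < fst b" using L_simps(2)[OF b] .
  have "val [a] \<in> Fil L (Suc (fst a))" using a by (intro Fil_word) auto
  moreover have "val w * gen (snd b) - gen (snd b) * val w \<in> Fil L (Suc (deg w + fst b - 1))"
    using Cons.IH[OF w] pos by simp
  ultimately have 1: "val [a] * (val w * gen (snd b) - gen (snd b) * val w) \<in> Fil L (Suc (fst a + (deg w + fst b - 1)))"
    by (rule Fil_mult)
  have "gen (snd a) * gen (snd b) - gen (snd b) * gen (snd a) \<in> Fil L (Suc (fst a + fst b - 1))"
    using letter_comm[OF a b] pos by simp
  moreover have "val w \<in> Fil L (Suc (deg w))" using w by (intro Fil_word) auto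
  ultimately have 2: "(gen (snd a) * gen (snd b) - gen (snd b) * gen (snd a)) * val w \<in> Fil L (Suc (fst a + fst b - 1 + deg w))"
    by (rule Fil_mult)
  have "Suc (fst a + (deg w + fst b - 1)) = deg (a # w) + fst b" "Suc (fst a + fst b - 1 + deg w) = deg (a # w) + fst b"
    using pos by auto
  with 1 2 have "val [a] * (val w * gen (snd b) - gen (snd b) * val w) +
      (gen (snd a) * gen (snd b) - gen (snd b) * gen (snd a)) * val w \<in> Fil L (deg (a # w) + fst b)"
    by (simp only: Fil_add)
  then show ?case by (simp add: algebra_simps)
qed

text \<open>
  Copies of one letter are moved to the front one at a time.
\<close>

lemma extract_power:
  assumes b: "b \<in> L" and w: "set w \<subseteq> L"
  shows "j \<le> count_list w b \<Longrightarrow> \<exists>w'. set w' \<subseteq> L \<and> deg w = j * fst b + deg w' \<and>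
     count_list w b = j + count_list w' b \<and> val w - gen (snd b) ^ j * val w' \<in> Fil L (deg w)"
proof (induction j)
  case 0
  show ?case by (rule exI[of _ w]) (simp add: w Fil_J)
next
  case (Suc j)
  then obtain w' where w': "set w' \<subseteq> L" "deg w = j * fst b + deg w'" "count_list w b = j + count_list w' b"
     "val w - gen (snd b) ^ j * val w' \<in> Fil L (deg w)" by auto
  have "count_list w' b \<noteq> 0" using Suc.prems w'(3) by simp
  then have "b \<in> set w'" using count_notin by metis
  then obtain x y where xy: "w' = x @ b # y" using split_list by metis
  have sub: "set x \<subseteq> L" "set y \<subseteq> L" using w'(1) xy by auto
  have pos: "0 < fst b" using L_simps(2)[OF b] .
  have "val x * gen (snd b) - gen (snd b) * val x \<in> Fil L (Suc (deg x + fst b - 1))"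
    using word_comm[OF b sub(1)] pos by simp
  moreover have "val y \<in> Fil L (Suc (deg y))" using sub by (intro Fil_word) auto
  ultimately have "(val x * gen (snd b) - gen (snd b) * val x) * val y \<in> Fil L (Suc (deg x + fst b - 1 + deg y))"
    by (rule Fil_mult)
  moreover have "gen (snd b) ^ j \<in> Fil L (Suc (j * fst b))"
  proof -
    have "set (replicate j b) \<subseteq> L" using b by auto
    moreover have "deg (replicate j b) = j * fst b" "val (replicate j b) = gen (snd b) ^ j"
      by (induction j) simp_all
    ultimately show ?thesis using Fil_word[of "replicate j b" L "Suc (j * fst b)"] by simp
  qed
  ultimately have "gen (snd b) ^ j * ((val x * gen (snd b) - gen (snd b) * val x) * val y)
      \<in> Fil L (Suc (j * fst b + (deg x + fst b - 1 + deg y)))"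
    by (rule_tac Fil_mult)
  moreover have "Suc (j * fst b + (deg x + fst b - 1 + deg y)) = deg w" using pos by (simp add: w'(2) xy)
  ultimately have "(val w - gen (snd b) ^ j * val w') + gen (snd b) ^ j * ((val x * gen (snd b) - gen (snd b) * val x) * val y)
      \<in> Fil L (deg w)" using w'(4) by (simp only: Fil_add)
  moreover have "(val w - gen (snd b) ^ j * val w') + gen (snd b) ^ j * ((val x * gen (snd b) - gen (snd b) * val x) * val y)
      = val w - gen (snd b) ^ Suc j * val (x @ y)"
    by (simp add: xy algebra_simps power_Suc2 del: power_Suc)
  ultimately have "val w - gen (snd b) ^ Suc j * val (x @ y) \<in> Fil L (deg w)" by simp
  moreover have "deg w = Suc j * fst b + deg (x @ y)" "count_list w b = Suc j + count_list (x @ y) b"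
    using w'(2,3) by (simp_all add: xy)
  ultimately show ?case using sub by (intro exI[of _ "x @ y"]) simp
qed

lemma exhaust_Fil: "\<exists>n. u \<in> Fil L (Suc n)"
proof (induction u rule: free_induct)
  case (word c w)
  have "gen v \<in> Fil L (Suc (N - 1))" for v
  proof (cases "v \<in> V")
    case True
    then show ?thesis by (intro gen_Fil) (auto simp: V_def)
  qed (intro Fil_J J_out)
  then have "\<exists>n. prod_list (map gen w) \<in> Fil L (Suc n)"
  proof (induction w)
    case Nil
    have "val [] \<in> Fil L (Suc 0)" by (rule Fil_word) auto
    then show ?case by auto
  next
    case (Cons v w)
    then obtain n where n: "prod_list (map gen w) \<in> Fil L (Suc n)" by blast
    have "gen v * prod_list (map gen w) \<in> Fil L (Suc (N - 1 + n))"
      by (rule Fil_mult[OF Cons.prems n])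
    then show ?case by auto
  qed
  then show ?case using Fil_scale by blast
next
  case (add x y)
  then obtain m n where "x \<in> Fil L (Suc m)" "y \<in> Fil L (Suc n)" by blast
  then have "x \<in> Fil L (Suc (m + n))" "y \<in> Fil L (Suc (m + n))"
    using Fil_mono[of "Suc m" "Suc (m + n)" x] Fil_mono[of "Suc n" "Suc (m + n)" y] by auto
  then have "x + y \<in> Fil L (Suc (m + n))" by (rule Fil_add)
  then show ?case by blast
qed

end

text \<open>
  Modulo the maximal left ideal, the algebra is spanned over the polynomials in the \<open>\<zeta> i = \<xi> (d h)\<close> by the finitely many
  words in which no letter has to occur \<open>p\<close> times. So \<open>central_character\<close> applies, and the scalars are then
  written as \<open>p\<close>-th powers.
\<close>

theorem xi_acts_by_scalars:
  assumes JM: "J \<subseteq> M" and M_add: "\<And>u v. u \<in> M \<Longrightarrow> v \<in> M \<Longrightarrow> u + v \<in> M"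
    and M_mult: "\<And>a u. u \<in> M \<Longrightarrow> a * u \<in> M" and M_1: "1 \<notin> M"
    and M_max: "\<And>u. u \<notin> M \<Longrightarrow> \<exists>a. a * u - 1 \<in> M"
    and fr: "frobenius_frame H d"
  shows "\<exists>c. \<forall>\<mu>\<in>Dp q. \<forall>v. (xi \<mu> - sc ((\<Sum>h\<in>H. \<mu> (h ^ q) * c h) ^ p)) * v \<in> M"
proof -
  note F = frobenius_frameD[OF fr]
  obtain hs where hs: "set hs = H" "distinct hs" using finite_distinct_list[OF F(1)] by blast
  define n where "n = length hs"
  define \<zeta> where "\<zeta> i = xi (d (hs ! i))" for i
  have hsi: "hs ! i \<in> H" if "i < n" for i using that hs(1) by (auto simp: n_def)
  interpret S: maximal_left_ideal "sc :: 'k \<Rightarrow> (('g \<Rightarrow> 'k) \<Rightarrow> 'k) mon \<Rightarrow>\<^sub>0 'k" M n \<zeta>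
  proof
    fix i u v assume i: "i < n"
    have "u * \<zeta> i \<approx> \<zeta> i * u" unfolding \<zeta>_def by (rule xi_central[OF F(3)[OF hsi[OF i]]])
    then have "(\<zeta> i * u - u * \<zeta> i) * v \<in> J" using eqJ_sym J_right unfolding eqJ_def by blast
    then show "(\<zeta> i * u - u * \<zeta> i) * v \<in> M" using JM by blast
  qed (fact sc_add sc_mult sc_1 sc_central M_add M_mult M_1 M_max)+
  have JP: "u \<in> S.P" if "u \<in> J" for u using that JM J_right by (auto simp: S.P_def)
  have eqP: "S.eqP u v" if "u \<approx> v" for u v using that JP by (simp add: S.eqP_def eqJ_def)
  have sumH: "(\<Sum>h\<in>H. f h) = (\<Sum>i<n. f (hs ! i))" for f :: "('g \<Rightarrow> 'k) \<Rightarrow> 'x::comm_monoid_add"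
  proof -
    have "bij_betw ((!) hs) {..<n} H" unfolding n_def hs(1)[symmetric] using hs(2) by (rule bij_betw_nth) auto
    then show ?thesis by (rule sum.reindex_bij_betw[symmetric])
  qed
  have xiz: "xi \<mu> \<approx> (\<Sum>i<n. sc (\<mu> ((hs ! i) ^ q) ^ p) * \<zeta> i)" if "\<mu> \<in> Dp q" for \<mu>
    using xi_expand[OF fr that] unfolding sumH \<zeta>_def .
  obtain L where L: "alphabet L" using alphabet_ex by blast
  note Ls = L_simps[OF L]
  define T where "T = val ` {w. set w \<subseteq> L \<and> length w \<le> card L * p}"
  have finT: "finite T" unfolding T_def using finite_lists_length_le[OF Ls(1)] by blast
  let ?B = "S.adjoin_vars n" and ?e = S.subst_zeta
  have B: "a \<in> ?B \<Longrightarrow> b \<in> ?B \<Longrightarrow> a + b \<in> ?B \<and> a * b \<in> ?B" "0 \<in> ?B" "1 \<in> ?B" for a b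
    using S.subring_vars[of n] by (auto simp: S.Q.subring_set_def)
  (* the elements that are combinations of T modulo M; it has to be shown that every element is one *)
  define Y where "Y = {u. \<exists>c. (\<forall>t. c t \<in> ?B) \<and> u - (\<Sum>t\<in>T. ?e (c t) * t) \<in> M}"
  have e0: "?e 0 = 0" using S.subst_zeta_const[of 0] by simp
  have e1: "?e 1 = 1" using S.subst_zeta_const[of 1] by simp
  have Y_M: "u \<in> Y" if "u \<in> M" for u
    unfolding Y_def using that B(2) e0 by (intro CollectI exI[of _ "\<lambda>_. 0"]) simp
  have Y_add: "u + v \<in> Y" if "u \<in> Y" "v \<in> Y" for u v
  proof -
    obtain a where a: "\<forall>t. a t \<in> ?B" "u - (\<Sum>t\<in>T. ?e (a t) * t) \<in> M" using \<open>u \<in> Y\<close> by (auto simp: Y_def)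
    obtain b where b: "\<forall>t. b t \<in> ?B" "v - (\<Sum>t\<in>T. ?e (b t) * t) \<in> M" using \<open>v \<in> Y\<close> by (auto simp: Y_def)
    have "(u - (\<Sum>t\<in>T. ?e (a t) * t)) + (v - (\<Sum>t\<in>T. ?e (b t) * t)) \<in> M" by (rule M_add[OF a(2) b(2)])
    then have "u + v - (\<Sum>t\<in>T. ?e (a t + b t) * t) \<in> M"
      by (simp add: S.subst_zeta_add distrib_right sum.distrib algebra_simps)
    then show ?thesis unfolding Y_def using a(1) b(1) B(1) by (intro CollectI exI[of _ "\<lambda>t. a t + b t"]) simp
  qed
  have Y_mult: "?e z * u \<in> Y" if z: "z \<in> ?B" and u: "u \<in> Y" for z u
  proof -
    obtain a where a: "\<forall>t. a t \<in> ?B" "u - (\<Sum>t\<in>T. ?e (a t) * t) \<in> M" using u by (auto simp: Y_def)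
    have 1: "?e z * (u - (\<Sum>t\<in>T. ?e (a t) * t)) \<in> M" by (rule M_mult[OF a(2)])
    have "(\<Sum>t\<in>T. ?e z * ?e (a t) * t) - (\<Sum>t\<in>T. ?e (z * a t) * t) \<in> M"
    proof -
      have "?e z * ?e (a t) * t - ?e (z * a t) * t \<in> M" for t
        using S.eqP_mult[OF S.eqP_sym[OF S.subst_zeta_mult] S.eqP_refl, of z "a t" t] S.P_M
        unfolding S.eqP_def by blast
      then show ?thesis by (simp only: sum_subtractf[symmetric]) (rule S.M_sum)
    qed
    from M_add[OF 1 this] have "?e z * u - (\<Sum>t\<in>T. ?e (z * a t) * t) \<in> M"
      by (simp add: right_diff_distrib sum_distrib_left mult.assoc)
    then show ?thesis unfolding Y_def using a(1) z B(1) by (intro CollectI exI[of _ "\<lambda>t. z * a t"]) simp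
  qed
  have Y_T: "t \<in> Y" if "t \<in> T" for t
  proof -
    have "(\<Sum>s\<in>T. ?e (if s = t then 1 else 0) * s) = (\<Sum>s\<in>T. if s = t then s else 0)"
      by (rule sum.cong) (auto simp: e0 e1)
    then have "t - (\<Sum>s\<in>T. ?e (if s = t then 1 else 0) * s) = 0" using that finT by simp
    then show ?thesis unfolding Y_def using B(2,3) S.M_0
      by (intro CollectI exI[of _ "\<lambda>s. if s = t then 1 else 0"]) simp
  qed
  have Y_eqJ: "u \<in> Y" if "u \<approx> v" "v \<in> Y" for u v
    using Y_add[OF Y_M[of "u - v"] that(2)] that(1) JM by (auto simp: eqJ_def)
  have Y_sc: "sc c * u \<in> Y" if "u \<in> Y" for u c
    using Y_mult[OF S.const_vars that, of c] by (simp add: S.subst_zeta_const)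
  have Y_Fil: "u \<in> Y" if "\<And>w. set w \<subseteq> L \<Longrightarrow> deg w < m \<Longrightarrow> val w \<in> Y" "u \<in> Fil L m" for u m
    using that(2) by (induction rule: Fil.induct) (use that(1) Y_M JM Y_add Y_sc in auto)
  have Y_xi: "xi \<mu> * u \<in> Y" if \<mu>: "\<mu> \<in> Dp q" and u: "u \<in> Y" for \<mu> u
  proof -
    have "(\<Sum>i<m. sc (\<mu> ((hs ! i) ^ q) ^ p) * \<zeta> i) * u \<in> Y" if "m \<le> n" for m
      using that
    proof (induction m)
      case 0
      show ?case by (simp add: Y_M S.M_0)
    next
      case (Suc m)
      have "?e (S.var m) * u \<in> Y" using Suc.prems by (intro Y_mult S.var_vars u) auto
      then have "sc (\<mu> ((hs ! m) ^ q) ^ p) * (\<zeta> m * u) \<in> Y" using Suc.prems S.subst_zeta_var[of m] by (intro Y_sc) simp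
      then show ?case using Suc by (simp add: distrib_right Y_add mult.assoc)
    qed
    then have "(\<Sum>i<n. sc (\<mu> ((hs ! i) ^ q) ^ p) * \<zeta> i) * u \<in> Y" by simp
    then show ?thesis using Y_eqJ[OF eqJ_mult[OF xiz[OF \<mu>] eqJ_refl]] by blast
  qed
  have words: "set w \<subseteq> L \<Longrightarrow> val w \<in> Y" for w
  proof (induction "deg w" arbitrary: w rule: less_induct)
    case less
    have Fil: "u \<in> Y" if "u \<in> Fil L (deg w)" for u using Y_Fil[OF _ that] less.hyps by blast
    show ?case
    proof (cases "length w \<le> card L * p")
      case True
      then have "val w \<in> T" using less.prems by (auto simp: T_def)
      then show ?thesis by (rule Y_T)
    next
      case False
      (* pigeonhole principle *)
      have "\<exists>b\<in>L. p \<le> count_list w b"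
      proof (rule ccontr)
        assume no: "\<not> ?thesis"
        have "length w = (\<Sum>b\<in>set w. count_list w b)" using sum_count_set[of w "set w"] by simp
        also have "\<dots> \<le> (\<Sum>b\<in>L. count_list w b)" by (rule sum_mono2[OF Ls(1) less.prems]) simp
        also have "\<dots> \<le> (\<Sum>b\<in>L. p)" using no by (intro sum_mono) (auto simp: not_le intro: less_imp_le)
        finally show False using False by simp
      qed
      then obtain b where b: "b \<in> L" "p \<le> count_list w b" by blast
      obtain w' where w': "set w' \<subseteq> L" "deg w = p * fst b + deg w'" "val w - gen (snd b) ^ p * val w' \<in> Fil L (deg w)"
        using extract_power[OF L b(1) less.prems b(2)] by blast
      have k: "0 < fst b" "fst b \<le> q" "snd b \<in> Dp (fst b)" using Ls b(1) by auto
      have bq: "snd b \<in> Dp q" using k(3) by (rule Dp_mono[OF k(2)])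
      have pk: "p * fst b > 0" "p * fst b - 1 < N"
      proof -
        show "p * fst b > 0" using k(1) by simp
        moreover have "p * fst b \<le> N" using k(2) by (simp add: N_def)
        ultimately show "p * fst b - 1 < N" by linarith
      qed
      have "gen (pow (snd b) p) \<in> Fil L (Suc (p * fst b - 1))"
        by (rule gen_Fil[OF L pk(2) pow_p_Dp[OF k(3,1)]])
      moreover have "val w' \<in> Fil L (Suc (deg w'))" using w'(1) by (intro Fil_word) auto
      ultimately have "gen (pow (snd b) p) * val w' \<in> Fil L (Suc (p * fst b - 1 + deg w'))" by (rule Fil_mult)
      moreover have "Suc (p * fst b - 1 + deg w') = deg w" using pk(1) w'(2) by linarith
      ultimately have 1: "gen (pow (snd b) p) * val w' \<in> Y" using Fil by simp
      have "val w' \<in> Y" using less.hyps[of w'] w'(1,2) pk(1) by simp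
      then have 2: "xi (snd b) * val w' \<in> Y" by (rule Y_xi[OF bq])
      have 3: "val w - gen (snd b) ^ p * val w' \<in> Y" using w'(3) by (rule Fil)
      (* collect p copies of b and replace the p-th power by \<xi> and the p-th power of distributions, which has smaller degree *)
      have "val w = (val w - gen (snd b) ^ p * val w') + (xi (snd b) * val w' + gen (pow (snd b) p) * val w')"
        by (simp add: xi_def algebra_simps)
      also have "\<dots> \<in> Y" by (intro Y_add 1 2 3)
      finally show ?thesis .
    qed
  qed
  have "u \<in> Y" for u
    using exhaust_Fil[OF L, of u] Y_Fil words by blast
  then have "S.spans T 1" unfolding S.spans_def e1 by (simp add: Y_def)
  then obtain c where c: "\<And>i. i < n \<Longrightarrow> \<zeta> i - sc (c i) \<in> S.P" using S.central_character[OF finT] by blast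
  have "\<exists>b. i < n \<longrightarrow> b ^ p = c i" for i using frobenius_root[of 1 "c i"] by auto
  then obtain rt where rt: "\<And>i. i < n \<Longrightarrow> rt i ^ p = c i" by metis
  (* reindex the scalars from positions to functions *)
  define c' where "c' h = rt (SOME i. i < n \<and> hs ! i = h)" for h
  have c': "c' (hs ! i) = rt i" if i: "i < n" for i
  proof -
    have "(SOME j. j < n \<and> hs ! j = hs ! i) = i"
      using i hs(2) by (intro some_equality) (auto simp: n_def nth_eq_iff_index_eq)
    then show ?thesis by (simp add: c'_def)
  qed
  have "(xi \<mu> - sc ((\<Sum>h\<in>H. \<mu> (h ^ q) * c' h) ^ p)) * v \<in> M" if \<mu>: "\<mu> \<in> Dp q" for \<mu> v
  proof -
    have e: "sc ((\<Sum>h\<in>H. \<mu> (h ^ q) * c' h) ^ p) = (\<Sum>i<n. sc (\<mu> ((hs ! i) ^ q) ^ p) * sc (c i) :: (('g \<Rightarrow> 'k) \<Rightarrow> 'k) mon \<Rightarrow>\<^sub>0 'k)"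
    proof -
      have "(\<Sum>h\<in>H. \<mu> (h ^ q) * c' h) ^ p = (\<Sum>i<n. \<mu> ((hs ! i) ^ q) ^ p * c i)"
        unfolding sumH using frobenius_sum_field[of "\<lambda>i. \<mu> ((hs ! i) ^ q) * c' (hs ! i)" "{..<n}" 1] c' rt
        by (simp add: power_mult_distrib)
      moreover have "sc (\<Sum>i\<in>I. f i) = (\<Sum>i\<in>I. sc (f i) :: (('g \<Rightarrow> 'k) \<Rightarrow> 'k) mon \<Rightarrow>\<^sub>0 'k)" for f :: "nat \<Rightarrow> 'k" and I
        by (induction I rule: infinite_finite_induct) (simp_all add: sc_add)
      ultimately show ?thesis by (simp add: sc_mult)
    qed
    have "S.eqP (\<Sum>i<m. sc (\<mu> ((hs ! i) ^ q) ^ p) * \<zeta> i) (\<Sum>i<m. sc (\<mu> ((hs ! i) ^ q) ^ p) * sc (c i))" if "m \<le> n" for m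
      using that
    proof (induction m)
      case (Suc m)
      have "S.eqP (\<zeta> m) (sc (c m))" using c[of m] Suc.prems by (simp add: S.eqP_def)
      then show ?case using Suc by (simp add: S.eqP_add[OF _ S.eqP_mult[OF S.eqP_refl]])
    qed simp
    then have "S.eqP (xi \<mu>) (sc ((\<Sum>h\<in>H. \<mu> (h ^ q) * c' h) ^ p))"
      unfolding e using S.eqP_trans[OF eqP[OF xiz[OF \<mu>]]] by blast
    then show ?thesis by (simp add: S.eqP_def S.P_def)
  qed
  then show ?thesis by blast
qed

end

section \<open>The Frobenius twist over a form\<close>

lemma span_finite_subset:
  fixes B :: "('y \<Rightarrow> 'k::field) set"
  assumes "finite S" "S \<subseteq> fs.span B"
  shows "\<exists>T. finite T \<and> T \<subseteq> B \<and> S \<subseteq> fs.span T"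
  using assms
proof (induction S rule: finite_induct)
  case empty
  show ?case by (rule exI[of _ "{}"]) simp
next
  case (insert s S)
  then obtain T where T: "finite T" "T \<subseteq> B" "S \<subseteq> fs.span T" by auto
  have "s \<in> fs.span B" using insert.prems by blast
  then obtain t c where t: "finite t" "t \<subseteq> B" "s = (\<Sum>a\<in>t. fscale (c a) a)"
    unfolding fs.span_explicit by blast
  have "s \<in> fs.span t" unfolding t(3) by (intro fs.span_sum fs.span_scale fs.span_base)
  then have "s \<in> fs.span (T \<union> t)" using fs.span_mono[of t "T \<union> t"] by blast
  moreover have "S \<subseteq> fs.span (T \<union> t)" using T(3) fs.span_mono[of T "T \<union> t"] by blast
  ultimately show ?case using T t by (intro exI[of _ "T \<union> t"]) simp
qed

lemma linear_extend_field:
  fixes B :: "('y \<Rightarrow> 'k::field) set"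
  assumes "\<not> fs.dependent B"
  shows "\<exists>g. Vector_Spaces.linear fscale ((*) :: 'k \<Rightarrow> 'k \<Rightarrow> 'k) g \<and> (\<forall>b\<in>B. g b = \<phi> b)"
proof -
  interpret vector_space_pair "fscale :: 'k \<Rightarrow> ('y \<Rightarrow> 'k) \<Rightarrow> 'y \<Rightarrow> 'k" "(*) :: 'k \<Rightarrow> 'k \<Rightarrow> 'k"
    by unfold_locales (simp_all add: distrib_left distrib_right)
  show ?thesis by (rule linear_independent_extend[OF assms])
qed

context higher_env
begin

text \<open>
  Generators may be taken from any spanning set, as each generator involves finitely many of its
  elements.
\<close>

lemma generates_subset_spanning:
  assumes "fs.span B = A"
  shows "\<exists>T\<subseteq>B. generates T"
proof -
  obtain S where S: "generates S" using generates_ex by blast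
  obtain T where T: "finite T" "T \<subseteq> B" "S \<subseteq> fs.span T"
    using span_finite_subset[of S B] S assms by (auto simp: generates_def)
  have BA: "B \<subseteq> A" using fs.span_superset assms by blast
  have "A \<subseteq> C" if C: "function_algebra (carrier G) C" "T \<subseteq> C" for C
  proof -
    have C0: "fscale 0 one_A \<in> C" using C(1) unfolding function_algebra_def by blast
    have "fs.subspace C"
    proof (rule fs.subspaceI)
      show "0 \<in> C" using C0 by simp
    qed (use C(1) in \<open>simp_all add: function_algebra_def\<close>)
    then have "fs.span T \<subseteq> C" using C(2) by (intro fs.span_minimal)
    then show ?thesis using S C(1) T(3) by (auto simp: generates_def)
  qed
  then have "generates T" using T BA unfolding generates_def by blast
  then show ?thesis using T(2) by blast
qed

lemma prime_subfield_power_q: "c \<in> prime_subfield \<Longrightarrow> c ^ q = (c :: 'k)"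
proof -
  assume "c \<in> prime_subfield"
  then obtain n where c: "c = of_nat n" by (auto simp: prime_subfield_def)
  have "(of_nat n :: 'k) ^ q = of_nat n"
    by (induction n) (simp_all add: q_def frobenius_add_field power_0_left)
  then show ?thesis by (simp add: c)
qed

lemma LF_eq_on_span:
  assumes "fs.span B = A" "\<mu> \<in> LF" "\<nu> \<in> LF" "\<And>b. b \<in> B \<Longrightarrow> \<mu> b = \<nu> b"
  shows "\<mu> = \<nu>"
proof (rule LF_eqI[OF assms(2,3)])
  fix f assume f: "f \<in> A"
  have BA: "B \<subseteq> A" using fs.span_superset assms(1) by blast
  have "fs.subspace {f \<in> A. \<mu> f = \<nu> f}"
    by (rule fs.subspaceI) (simp_all add: A_zero A_add A_scale LF_0 LF_add LF_scale assms(2,3))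
  moreover have "B \<subseteq> {f \<in> A. \<mu> f = \<nu> f}" using BA assms(4) by blast
  ultimately have "fs.span B \<subseteq> {f \<in> A. \<mu> f = \<nu> f}" by (intro fs.span_minimal)
  then show "\<mu> f = \<nu> f" using f assms(1) by blast
qed

context
  fixes A0 B
  assumes B_indep: "\<not> fs.dependent B" and B_span: "fs.span B = A" and B_form: "Fp_span B = A0"
begin

lemma B_A: "B \<subseteq> A"
  using fs.span_superset B_span by blast

lemma B_A0: "B \<subseteq> A0"
proof
  fix b assume b: "b \<in> B"
  have "(1::'k) \<in> prime_subfield" unfolding prime_subfield_def by (rule range_eqI[of _ _ 1]) simp
  moreover have "b = (\<Sum>x\<in>{b}. fscale 1 x)" by simp
  ultimately have "b \<in> Fp_span B" unfolding Fp_span_def using b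
    by (intro CollectI exI[of _ "{b}"] exI[of _ "\<lambda>_. 1"]) simp
  then show "b \<in> A0" by (simp only: B_form)
qed

lemma A0_form:
  assumes "f \<in> A0"
  shows "\<exists>t c. t \<subseteq> B \<and> (\<forall>b\<in>t. c b ^ q = c b) \<and> f = (\<Sum>b\<in>t. fscale (c b) b)"
  using assms prime_subfield_power_q unfolding B_form[symmetric] Fp_span_def by blast

lemma A0_A: "A0 \<subseteq> A"
proof
  fix f assume "f \<in> A0"
  then obtain t c where "t \<subseteq> B" "f = (\<Sum>b\<in>t. fscale (c b) b)" using A0_form by blast
  then show "f \<in> A" using B_A by (auto intro!: A_sum A_scale)
qed

text \<open>
  Prescribed on a basis, and then valid on its combinations over the prime field, since these are compatible
  with \<open>q\<close>-th powers.
\<close>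

lemma frobenius_twist_ex:
  assumes \<delta>: "\<delta> \<in> LF"
  shows "\<exists>\<mu>\<in>LF. \<forall>f\<in>A0. \<mu> f = \<delta> (f ^ q)"
proof -
  obtain g where g: "Vector_Spaces.linear fscale ((*) :: 'k \<Rightarrow> 'k \<Rightarrow> 'k) g" "\<forall>b\<in>B. g b = \<delta> (b ^ q)"
    using linear_extend_field[OF B_indep, of "\<lambda>b. \<delta> (b ^ q)"] by blast
  define \<mu> where "\<mu> f = (if f \<in> A then g f else 0)" for f
  interpret g: Vector_Spaces.linear "fscale :: 'k \<Rightarrow> ('g \<Rightarrow> 'k) \<Rightarrow> 'g \<Rightarrow> 'k" "(*) :: 'k \<Rightarrow> 'k \<Rightarrow> 'k" g by (rule g(1))
  have \<mu>: "\<mu> \<in> LF" by (rule LF_I) (simp_all add: \<mu>_def A_add A_scale g.add g.scale)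
  have "\<mu> f = \<delta> (f ^ q)" if f: "f \<in> A0" for f
  proof -
    obtain t c where t: "t \<subseteq> B" "\<forall>b\<in>t. c b ^ q = c b" "f = (\<Sum>b\<in>t. fscale (c b) b)"
      using A0_form[OF f] by blast
    have tA: "b \<in> A" if "b \<in> t" for b using that t(1) B_A by blast
    have "f ^ q = (\<Sum>b\<in>t. fscale (c b ^ q) (b ^ q))"
      unfolding t(3) q_def frobenius_sum by (simp only: fscale_power)
    also have "\<dots> = (\<Sum>b\<in>t. fscale (c b) (b ^ q))"
      by (rule sum.cong[OF refl]) (simp only: t(2)[rule_format])
    finally have "\<delta> (f ^ q) = (\<Sum>b\<in>t. c b * \<delta> (b ^ q))"
      using LF_sum_scale[OF \<delta>, of t "\<lambda>b. b ^ q" c] tA A_power by simp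
    also have "\<dots> = (\<Sum>b\<in>t. c b * \<mu> b)"
    proof (rule sum.cong[OF refl])
      fix b assume b: "b \<in> t"
      have "\<mu> b = \<delta> (b ^ q)" using g(2)[rule_format, of b] tA[OF b] t(1) b unfolding \<mu>_def by auto
      then show "c b * \<delta> (b ^ q) = c b * \<mu> b" by simp
    qed
    also have "\<dots> = \<mu> f" unfolding t(3) by (rule LF_sum_scale[OF \<mu> tA, symmetric])
    finally show ?thesis by simp
  qed
  then show ?thesis using \<mu> by blast
qed

lemma dist_frobenius_eq:
  assumes \<delta>: "\<delta> \<in> LF" and \<mu>: "\<mu> \<in> LF" and tw: "\<And>f. f \<in> A0 \<Longrightarrow> \<mu> f = \<delta> (f ^ q)"
  shows "dist_frobenius A A0 r \<delta> = \<mu>"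
proof -
  have e: "(\<lambda>x. f x ^ (CHAR('k) ^ r)) = f ^ q" for f :: "'g \<Rightarrow> 'k"
    by (rule ext) (simp only: power_fun_apply q_def p_CHAR[symmetric])
  have sc: "\<nu> (fscale a f) = \<delta> (fscale a (f ^ q)) \<longleftrightarrow> a * \<nu> f = a * \<delta> (f ^ q)"
    if "\<nu> \<in> LF" "f \<in> A0" for \<nu> f a
  proof -
    have "f \<in> A" using that A0_A by blast
    then show ?thesis using LF_scale[OF that(1)] LF_scale[OF \<delta> A_power[of f q]] by simp
  qed
  show ?thesis unfolding dist_frobenius_def e
  proof (rule the_equality)
    show "\<mu> \<in> LF \<and> (\<forall>f\<in>A0. \<forall>a. \<mu> (fscale a f) = \<delta> (fscale a (f ^ q)))"
    proof (intro conjI \<mu> ballI allI)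
      fix f a assume f: "f \<in> A0"
      show "\<mu> (fscale a f) = \<delta> (fscale a (f ^ q))"
        unfolding sc[OF \<mu> f] tw[OF f] by (rule refl)
    qed
  next
    fix \<nu> assume \<nu>: "\<nu> \<in> LF \<and> (\<forall>f\<in>A0. \<forall>a. \<nu> (fscale a f) = \<delta> (fscale a (f ^ q)))"
    show "\<nu> = \<mu>"
    proof (rule LF_eq_on_span[OF B_span conjunct1[OF \<nu>] \<mu>])
      fix b assume "b \<in> B"
      then have b: "b \<in> A0" using B_A0 by blast
      have "\<nu> (fscale 1 b) = \<delta> (fscale 1 (b ^ q))" by (rule conjunct2[OF \<nu>, rule_format, OF b])
      then have "\<nu> b = \<delta> (b ^ q)" unfolding fs.scale_one .
      then show "\<nu> b = \<mu> b" using tw[OF b] by (rule trans[OF _ sym])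
    qed
  qed
qed

text \<open>
  Normalization is linear and the identity on the augmentation ideal.
\<close>

lemma aug_span_normalized: "aug \<subseteq> fs.span (normalized ` B)"
proof
  fix f assume f: "f \<in> aug"
  have "fs.subspace {f. normalized f \<in> fs.span (normalized ` B)}"
  proof (rule fs.subspaceI)
    have n: "normalized (f + g) = normalized f + normalized g" "normalized (fscale c f) = fscale c (normalized f)"
      "normalized (0 :: 'g \<Rightarrow> 'k) = 0" for f g :: "'g \<Rightarrow> 'k" and c
      by (simp_all add: fun_eq_iff pointwise algebra_simps)
    show "0 \<in> {f. normalized f \<in> fs.span (normalized ` B)}" using fs.span_zero by (simp only: mem_Collect_eq n)
    fix f g c assume f: "f \<in> {f. normalized f \<in> fs.span (normalized ` B)}"
    show "fscale c f \<in> {f. normalized f \<in> fs.span (normalized ` B)}"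
      using f by (simp only: mem_Collect_eq n fs.span_scale)
    assume "g \<in> {f. normalized f \<in> fs.span (normalized ` B)}"
    then show "f + g \<in> {f. normalized f \<in> fs.span (normalized ` B)}"
      using f by (simp only: mem_Collect_eq n fs.span_add)
  qed
  moreover have "B \<subseteq> {f. normalized f \<in> fs.span (normalized ` B)}"
  proof
    fix b assume "b \<in> B"
    then have "normalized b \<in> fs.span (normalized ` B)" by (intro fs.span_base imageI)
    then show "b \<in> {f. normalized f \<in> fs.span (normalized ` B)}" by (simp only: mem_Collect_eq)
  qed
  ultimately have "fs.span B \<subseteq> {f. normalized f \<in> fs.span (normalized ` B)}" by (intro fs.span_minimal)
  moreover have "f \<in> fs.span B" unfolding B_span using f by (rule aug_A)
  ultimately have "f \<in> {f. normalized f \<in> fs.span (normalized ` B)}" by (rule subsetD)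
  then have "normalized f \<in> fs.span (normalized ` B)" by (simp only: mem_Collect_eq)
  moreover have "normalized f = f" using f by (simp add: aug_iff)
  ultimately show "f \<in> fs.span (normalized ` B)" by simp
qed

text \<open>
  On products of two normalized basis elements the twist is the value of \<open>\<delta>\<close> on a \<open>q\<close>-th power that lies in
  the power of the augmentation ideal with exponent \<open>2 q > q\<close>.
\<close>

lemma frobenius_twist_Dp_1:
  assumes \<delta>: "\<delta> \<in> Dp q" and \<mu>: "\<mu> \<in> LF" and twist: "\<forall>f\<in>A0. \<mu> f = \<delta> (f ^ q)"
    and one: "one_A \<in> A0" and A0_mult: "\<forall>f\<in>A0. \<forall>g\<in>A0. f * g \<in> A0"
    and A0_at_1: "\<forall>f\<in>A0. f \<one> \<in> prime_subfield"
  shows "\<mu> \<in> Dp 1"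
proof -
  note tw = twist[rule_format] and mult = A0_mult[rule_format] and at_1 = A0_at_1[rule_format]
  have \<delta>L: "\<delta> \<in> LF" by (rule Dp_LF[OF \<delta>])
  (* a subspace over the prime field, which contains the products of normalized basis elements *)
  define K where "K = {f \<in> A. \<mu> f = \<delta> (f ^ q)}"
  have K_A0: "f \<in> K" if "f \<in> A0" for f using tw[OF that] subsetD[OF A0_A that] unfolding K_def by (intro CollectI conjI)
  have K_add: "f + g \<in> K" if "f \<in> K" "g \<in> K" for f g
  proof -
    have "(f + g) ^ q = f ^ q + g ^ q" unfolding q_def by (rule frobenius_add)
    then show ?thesis using that LF_add[OF \<mu>, of f g] LF_add[OF \<delta>L A_power[of f q] A_power[of g q]] by (simp add: K_def A_add)
  qed
  have K_scale: "fscale c f \<in> K" if "c ^ q = c" "f \<in> K" for c f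
    using that LF_scale[OF \<mu>, of f c] LF_scale[OF \<delta>L A_power[of f q], of c] by (simp add: K_def A_scale fscale_power)
  have "\<mu> (normalized b * normalized b') = 0" if b: "b \<in> B" "b' \<in> B" for b b'
  proof -
    have bA0: "b \<in> A0" "b' \<in> A0" and bA: "b \<in> A" "b' \<in> A" using b B_A0 B_A by blast+
    have c: "b \<one> ^ q = b \<one>" "b' \<one> ^ q = b' \<one>" using at_1 bA0 prime_subfield_power_q by blast+
    have m: "(- (b \<one>)) ^ q = - (b \<one>)" "(- (b' \<one>)) ^ q = - (b' \<one>)"
      using frobenius_diff_field[of 0 "b \<one>" r] frobenius_diff_field[of 0 "b' \<one>" r] c
      by (simp_all add: q_def power_0_left)
    have "normalized b * normalized b' = b * b' + (fscale (- (b' \<one>)) b + (fscale (- (b \<one>)) b' + fscale (b \<one>) (fscale (b' \<one>) one_A)))"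
      using A_supp[OF bA(1)] A_supp[OF bA(2)] by (auto simp: fun_eq_iff pointwise algebra_simps indicator_def)
    also have "\<dots> \<in> K" by (intro K_add K_scale K_A0 mult bA0 one c m)
    finally have "\<mu> (normalized b * normalized b') = \<delta> ((normalized b * normalized b') ^ q)" by (simp add: K_def)
    moreover have "(normalized b * normalized b') ^ q \<in> I (q + q)"
      unfolding power_mult_distrib by (intro I_mult aug_power aug_normalize bA) simp_all
    then have "(normalized b * normalized b') ^ q \<in> I (Suc q)"
      using I_antimono[of "Suc q" "q + q"] q_pos by auto
    then have "\<delta> ((normalized b * normalized b') ^ q) = 0"
      using \<delta> by (simp add: dist_plus_def dist_def)
    ultimately show ?thesis by simp
  qed
  note nn = this
  have V0: "fs.subspace {f \<in> A. \<mu> f = 0}"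
    by (rule fs.subspaceI) (simp_all add: A_zero A_add A_scale LF_0 LF_add LF_scale \<mu>)
  have "f * g \<in> {f \<in> A. \<mu> f = 0}" if "f \<in> aug" "g \<in> aug" for f g
  proof (rule span_mult_mem[OF _ _ V0])
    show "f \<in> fs.span (normalized ` B)" "g \<in> fs.span (normalized ` B)" using that aug_span_normalized by blast+
    fix s t assume "s \<in> normalized ` B" "t \<in> normalized ` B"
    then obtain b b' where b: "b \<in> B" "b' \<in> B" "s = normalized b" "t = normalized b'" by blast
    have "normalized b * normalized b' \<in> A" using b B_A by (intro A_mult aug_A[OF aug_normalize]) auto
    then show "s * t \<in> {f \<in> A. \<mu> f = 0}" using nn[OF b(1,2)] b by simp
  qed
  then have "f \<in> {f \<in> A. \<mu> f = 0}" if "f \<in> I (Suc 1)" for f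
    using that I_1 by (intro I_Suc_induct[OF that V0]) simp
  then have "\<forall>f\<in>I (1 + 1). \<mu> f = 0" by simp
  moreover have "\<mu> one_A = 0"
    using tw[OF one] Dp_one[OF \<delta>] by (simp add: one_A_power)
  ultimately show ?thesis using \<mu> unfolding dist_plus_def dist_def by blast
qed

end

lemma Fp_form_frame:
  assumes "Fp_form G A A0"
  shows "\<exists>H d. frobenius_frame H d \<and> H \<subseteq> A0"
proof -
  obtain B where B: "\<not> fs.dependent B" "fs.span B = A" "Fp_span B = A0"
    using assms unfolding Fp_form_def by blast
  obtain T where T: "T \<subseteq> B" "generates T" using generates_subset_spanning[OF B(2)] by blast
  obtain H d where "frobenius_frame H d" "H \<subseteq> T" using frobenius_frame_ex[OF T(2)] by blast
  moreover have "T \<subseteq> A0" using T(1) B_A0[OF B] by (rule order_trans)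
  ultimately have "frobenius_frame H d \<and> H \<subseteq> A0" by (auto intro: order_trans)
  then show ?thesis by (intro exI[of _ H] exI[of _ d])
qed

lemma dist_frobenius_Fp_form:
  assumes A0: "Fp_form G A A0" and \<delta>: "\<delta> \<in> Dp q"
  shows "dist_frobenius A A0 r \<delta> \<in> Dp 1"
    and "f \<in> A0 \<Longrightarrow> dist_frobenius A A0 r \<delta> f = \<delta> (f ^ q)"
proof -
  obtain B where B: "\<not> fs.dependent B" "fs.span B = A" "Fp_span B = A0"
    using A0 unfolding Fp_form_def by blast
  have \<delta>L: "\<delta> \<in> LF" by (rule Dp_LF[OF \<delta>])
  obtain \<mu> where \<mu>: "\<mu> \<in> LF" and tw: "\<forall>f\<in>A0. \<mu> f = \<delta> (f ^ q)" using frobenius_twist_ex[OF B \<delta>L] by blast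
  have e: "dist_frobenius A A0 r \<delta> = \<mu>" by (rule dist_frobenius_eq[OF B \<delta>L \<mu> tw[rule_format]])
  note F = A0[unfolded Fp_form_def, THEN conjunct2]
  note one = F[THEN conjunct1] and mult = F[THEN conjunct2, THEN conjunct1]
    and at_1 = F[THEN conjunct2, THEN conjunct2, THEN conjunct2, THEN conjunct2]
  show "dist_frobenius A A0 r \<delta> \<in> Dp 1" unfolding e
    by (rule frobenius_twist_Dp_1[OF B \<delta> \<mu> tw one mult at_1])
  show "dist_frobenius A A0 r \<delta> f = \<delta> (f ^ q)" if "f \<in> A0" unfolding e by (rule tw[rule_format, OF that])
qed

end

section \<open>Modules over quotients and the final argument\<close>

context left_module
begin

lemma act_zero_left: assumes x: "x \<in> carrier M" shows "act \<zero>\<^bsub>R\<^esub> x = \<zero>\<^bsub>M\<^esub>"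
proof -
  have c: "act \<zero>\<^bsub>R\<^esub> x \<in> carrier M" by (rule act_closed[OF R.zero_closed x])
  have "act \<zero>\<^bsub>R\<^esub> x \<oplus>\<^bsub>M\<^esub> act \<zero>\<^bsub>R\<^esub> x = act \<zero>\<^bsub>R\<^esub> x"
    using act_add_left[OF R.zero_closed R.zero_closed x] by simp
  then show ?thesis using M.add.r_cancel_one[OF c c] by simp
qed

lemma act_zero_right: assumes a: "a \<in> carrier R" shows "act a \<zero>\<^bsub>M\<^esub> = \<zero>\<^bsub>M\<^esub>"
proof -
  have c: "act a \<zero>\<^bsub>M\<^esub> \<in> carrier M" by (rule act_closed[OF a M.zero_closed])
  have "act a \<zero>\<^bsub>M\<^esub> \<oplus>\<^bsub>M\<^esub> act a \<zero>\<^bsub>M\<^esub> = act a \<zero>\<^bsub>M\<^esub>"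
    using act_add_right[OF a M.zero_closed M.zero_closed] by simp
  then show ?thesis using M.add.r_cancel_one[OF c c] by simp
qed

lemma act_a_inv: assumes a: "a \<in> carrier R" and x: "x \<in> carrier M" shows "act (\<ominus>\<^bsub>R\<^esub> a) x = \<ominus>\<^bsub>M\<^esub> act a x"
proof -
  have "act (\<ominus>\<^bsub>R\<^esub> a) x \<oplus>\<^bsub>M\<^esub> act a x = \<zero>\<^bsub>M\<^esub>"
    using act_add_left[OF R.a_inv_closed[OF a] a x] act_zero_left[OF x] a by (simp add: R.l_neg)
  then show ?thesis using a x by (intro M.minus_equality[symmetric] act_closed) simp_all
qed

lemma act_minus: assumes "a \<in> carrier R" "b \<in> carrier R" "x \<in> carrier M"
  shows "act (a \<ominus>\<^bsub>R\<^esub> b) x = act a x \<ominus>\<^bsub>M\<^esub> act b x"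
  using assms by (simp add: a_minus_def act_add_left act_a_inv)

definition kernel where "kernel = {a \<in> carrier R. \<forall>x\<in>carrier M. act a x = \<zero>\<^bsub>M\<^esub>}"

lemma kernel_ideal: "ideal kernel R"
proof (rule idealI)
  show "subgroup kernel (add_monoid R)"
  proof (rule R.add.subgroupI)
    show "kernel \<subseteq> carrier R" by (auto simp: kernel_def)
    show "kernel \<noteq> {}" using act_zero_left by (auto simp: kernel_def)
    show "\<And>a. a \<in> kernel \<Longrightarrow> \<ominus>\<^bsub>R\<^esub> a \<in> kernel" by (auto simp: kernel_def act_a_inv)
    show "\<And>a b. a \<in> kernel \<Longrightarrow> b \<in> kernel \<Longrightarrow> a \<oplus>\<^bsub>R\<^esub> b \<in> kernel" by (auto simp: kernel_def act_add_left)
  qed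
qed (auto simp: kernel_def act_mult act_zero_right act_closed R.ring_axioms)

text \<open>
  The action of a coset is the action of any of its elements.
\<close>

lemma quotient_module:
  assumes I: "ideal I R" and IK: "I \<subseteq> kernel"
  shows "\<exists>act'. left_module (R Quot I) M act' \<and>
    (\<forall>u\<in>carrier R. \<forall>x\<in>carrier M. act u x = act' (I +>\<^bsub>R\<^esub> u) x)"
proof -
  interpret I: ideal I R by (rule I)
  define act' where "act' X x = act (SOME u. u \<in> X) x" for X x
  have coset: "act' (I +>\<^bsub>R\<^esub> a) x = act a x" if a: "a \<in> carrier R" and x: "x \<in> carrier M" for a x
  proof -
    define u where "u = (SOME u. u \<in> I +>\<^bsub>R\<^esub> a)"
    have "u \<in> I +>\<^bsub>R\<^esub> a" unfolding u_def using I.a_rcos_self[OF a] by (rule someI)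
    then obtain i where i: "i \<in> I" "u = i \<oplus>\<^bsub>R\<^esub> a" unfolding a_r_coset_def' by blast
    have "i \<in> carrier R" "act i x = \<zero>\<^bsub>M\<^esub>" using i(1) IK x by (auto simp: kernel_def)
    then have "act u x = act a x" using a x by (simp add: i(2) act_add_left act_closed)
    then show ?thesis by (simp add: act'_def u_def)
  qed
  interpret h: ring_hom_ring R "R Quot I" "(+>\<^bsub>R\<^esub>) I" by (rule I.rcos_ring_hom_ring)
  have car: "\<exists>a\<in>carrier R. X = I +>\<^bsub>R\<^esub> a" if "X \<in> carrier (R Quot I)" for X
    using that unfolding FactRing_def A_RCOSETS_def' by simp
  have "left_module (R Quot I) M act'"
  proof (intro left_module.intro left_module_axioms.intro)
    show "ring (R Quot I)" by (rule I.quotient_is_ring)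
    show "abelian_group M" by (rule M.abelian_group_axioms)
    fix X x assume "X \<in> carrier (R Quot I)" and x: "x \<in> carrier M"
    then obtain a where a: "a \<in> carrier R" "X = I +>\<^bsub>R\<^esub> a" using car by blast
    show "act' X x \<in> carrier M" using a x by (simp add: coset act_closed)
    show "act' X (x \<oplus>\<^bsub>M\<^esub> y) = act' X x \<oplus>\<^bsub>M\<^esub> act' X y" if "y \<in> carrier M" for y
      using a x that by (simp add: coset act_add_right)
    fix Y assume "Y \<in> carrier (R Quot I)"
    then obtain b where b: "b \<in> carrier R" "Y = I +>\<^bsub>R\<^esub> b" using car by blast
    have XY: "X \<oplus>\<^bsub>R Quot I\<^esub> Y = I +>\<^bsub>R\<^esub> (a \<oplus>\<^bsub>R\<^esub> b)" "X \<otimes>\<^bsub>R Quot I\<^esub> Y = I +>\<^bsub>R\<^esub> (a \<otimes>\<^bsub>R\<^esub> b)"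
      using a b by (simp_all del: h.hom_add h.hom_mult add: h.hom_add[symmetric] h.hom_mult[symmetric])
    show "act' (X \<oplus>\<^bsub>R Quot I\<^esub> Y) x = act' X x \<oplus>\<^bsub>M\<^esub> act' Y x"
      "act' (X \<otimes>\<^bsub>R Quot I\<^esub> Y) x = act' X (act' Y x)"
      unfolding XY using a(1) b(1) x by (simp_all del: h.hom_add h.hom_mult add: a(2) b(2) coset act_add_left act_mult act_closed)
  next
    fix x assume x: "x \<in> carrier M"
    show "act' \<one>\<^bsub>R Quot I\<^esub> x = x" unfolding h.hom_one[symmetric] coset[OF R.one_closed x] by (rule act_one[OF x])
  qed
  then show ?thesis using coset by (intro exI[of _ act']) simp
qed

lemma cyclic_submodule:
  assumes m: "m \<in> carrier M"
  shows "submodule_of R M act {act a m | a. a \<in> carrier R}"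
proof -
  let ?N = "{act a m | a. a \<in> carrier R}"
  have "subgroup ?N (add_monoid M)"
  proof (rule M.add.subgroupI)
    show "?N \<subseteq> carrier M" using m act_closed by auto
    show "?N \<noteq> {}" by auto
    show "\<ominus>\<^bsub>M\<^esub> x \<in> ?N" if "x \<in> ?N" for x
      using that m act_a_inv[symmetric] R.a_inv_closed by fastforce
    show "x \<oplus>\<^bsub>M\<^esub> y \<in> ?N" if "x \<in> ?N" "y \<in> ?N" for x y
      using that m act_add_left[symmetric] R.a_closed by fastforce
  qed
  moreover have "act a x \<in> ?N" if "a \<in> carrier R" "x \<in> ?N" for a x
    using that m act_mult[symmetric] R.m_closed by fastforce
  ultimately show ?thesis unfolding submodule_of_def by (blast intro: additive_subgroup.intro)
qed

end

lemma irreducible_cyclic: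
  assumes irr: "irreducible_module R M act" and m: "m \<in> carrier M" "m \<noteq> \<zero>\<^bsub>M\<^esub>" and x: "x \<in> carrier M"
  shows "\<exists>a\<in>carrier R. x = act a m"
proof -
  interpret left_module R M act using irr by (simp add: irreducible_module_def)
  have "submodule_of R M act {act a m | a. a \<in> carrier R}" using m(1) by (rule cyclic_submodule)
  then have "{act a m | a. a \<in> carrier R} = {\<zero>\<^bsub>M\<^esub>} \<or> {act a m | a. a \<in> carrier R} = carrier M"
    using irr by (simp add: irreducible_module_def)
  moreover have "act \<one>\<^bsub>R\<^esub> m = m" using m(1) by (rule act_one)
  then have "m \<in> {act a m | a. a \<in> carrier R}" by force
  ultimately have "x \<in> {act a m | a. a \<in> carrier R}" using m x by blast
  then show ?thesis by blast
qed

lemma zero_FactRing: "\<zero>\<^bsub>R Quot I\<^esub> = I"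
  by (simp add: FactRing_def)

text \<open>
  The defining quotient is presented by the free algebra on all linear forms, where the ideal \<open>J\<close> lives.
\<close>

locale env_presentation = higher_env G A p r
  for G :: "('g, 'm) monoid_scheme" (structure) and A :: "('g \<Rightarrow> 'k::alg_closed_field) set" and p r
begin

abbreviation Fr :: "((('g \<Rightarrow> 'k) \<Rightarrow> 'k) mon \<Rightarrow>\<^sub>0 'k) ring" where "Fr \<equiv> free_algebra V"
abbreviation TA :: "('g, 'k) tensor ring" where "TA \<equiv> tensor_algebra V"
abbreviation E :: "('g, 'k) tensor set ring" where "E \<equiv> env G A r"

lemma env_generators_V: "env_generators G A r = V"
  by (simp only: env_generators_def V_def N_eq p_CHAR[symmetric])

lemma Fr_simps: "monoid.mult Fr = (*)" "\<one>\<^bsub>Fr\<^esub> = 1" "\<zero>\<^bsub>Fr\<^esub> = 0" "ring.add Fr = (+)"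
  by (simp_all add: free_algebra_def)

lemma Fr_gen: "v \<in> V \<Longrightarrow> gen v \<in> carrier Fr" and Fr_sc: "sc c \<in> carrier Fr"
  by (auto simp: free_algebra_def free_generator_def free_scalar_def zero_mon_def)

sublocale Fr: ring Fr by (rule ring_free_algebra)

lemma Fr_a_inv: "u \<in> carrier Fr \<Longrightarrow> \<ominus>\<^bsub>Fr\<^esub> u = - u"
  using Fr.minus_equality[of "- u" u] by (simp add: Fr_simps) (simp add: free_algebra_def)

lemma Fr_minus: "u \<in> carrier Fr \<Longrightarrow> v \<in> carrier Fr \<Longrightarrow> u \<ominus>\<^bsub>Fr\<^esub> v = u - v"
  by (simp add: a_minus_def Fr_a_inv Fr_simps)

lemma Fr_closed: "u \<in> carrier Fr \<Longrightarrow> v \<in> carrier Fr \<Longrightarrow> u + v \<in> carrier Fr \<and> u * v \<in> carrier Fr \<and> u - v \<in> carrier Fr"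
  using Fr.a_closed[of u v] Fr.m_closed[of u v] Fr.minus_closed[of u v] by (simp add: Fr_simps Fr_minus)

lemma linear_relations_Fr: "linear_relations V \<subseteq> carrier Fr"
  unfolding linear_relations_def
  by (auto intro!: Fr_closed[THEN conjunct2, THEN conjunct2] Fr_closed[THEN conjunct2, THEN conjunct1] Fr_gen Fr_sc V_plus V_fscale)

sublocale lin: ideal "linear_ideal V" Fr
  unfolding linear_ideal_def by (rule Fr.genideal_ideal[OF linear_relations_Fr])

sublocale T: ring TA unfolding tensor_algebra_def by (rule lin.quotient_is_ring)

sublocale \<pi>: ring_hom_ring Fr TA "(+>\<^bsub>Fr\<^esub>) (linear_ideal V)"
  unfolding tensor_algebra_def by (rule lin.rcos_ring_hom_ring)

lemma tensor_generator_closed: "v \<in> V \<Longrightarrow> tensor_generator V v \<in> carrier TA"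
  unfolding tensor_generator_def by (intro \<pi>.hom_closed Fr_gen)

lemma dm_V: "x \<in> Dp i \<Longrightarrow> y \<in> Dp j \<Longrightarrow> i + j < N \<Longrightarrow> x \<in> V \<and> y \<in> V \<and> x \<star> y \<in> V"
  using dm_Dp[of x i y j] Dp_V[of x i] Dp_V[of y j] Dp_V[of "x \<star> y" "i + j"] by simp

lemma commutator_V:
  assumes "x \<in> Dp i" "y \<in> Dp j" "0 < i" "0 < j" "i + j \<le> N"
  shows "x \<in> V \<and> y \<in> V \<and> x \<star> y - y \<star> x \<in> V"
proof -
  have "x \<star> y - y \<star> x \<in> Dp (i + j - 1)" using assms by (intro dm_commutator_Dp) auto
  then show ?thesis using assms Dp_V[of x i] Dp_V[of y j] Dp_V[of "x \<star> y - y \<star> x" "i + j - 1"] by simp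
qed

lemma env_relations_TA: "env_relations G A r \<subseteq> carrier TA"
proof -
  have "u \<in> carrier TA" if "u \<in> env_relations G A r" for u
    using that unfolding env_relations_def Let_def env_generators_V p_CHAR[symmetric] N_eq[symmetric]
  proof (elim UnE CollectE exE conjE)
    fix x y i j
    assume u: "u = tensor_generator V x \<otimes>\<^bsub>TA\<^esub> tensor_generator V y \<ominus>\<^bsub>TA\<^esub> tensor_generator V (x \<star> y)"
      and xy: "x \<in> Dp i" "y \<in> Dp j" "i + j < N"
    show ?thesis unfolding u using dm_V[OF xy]
      by (intro T.minus_closed T.m_closed tensor_generator_closed) auto
  next
    fix x y i j
    assume u: "u = (tensor_generator V x \<otimes>\<^bsub>TA\<^esub> tensor_generator V y \<ominus>\<^bsub>TA\<^esub> tensor_generator V y \<otimes>\<^bsub>TA\<^esub> tensor_generator V x)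
        \<ominus>\<^bsub>TA\<^esub> tensor_generator V (x \<star> y - y \<star> x)"
      and xy: "x \<in> Dp i" "y \<in> Dp j" "0 < i" "0 < j" "i + j \<le> N"
    show ?thesis unfolding u using commutator_V[OF xy]
      by (intro T.minus_closed T.m_closed tensor_generator_closed) auto
  qed
  then show ?thesis by blast
qed

sublocale rel: ideal "env_ideal G A r" TA
  unfolding env_ideal_def env_generators_V by (rule T.genideal_ideal[OF env_relations_TA])

lemma E_eq: "E = TA Quot env_ideal G A r"
  by (simp add: env_def env_generators_V)

sublocale E: ring E unfolding E_eq by (rule rel.quotient_is_ring)

sublocale \<rho>: ring_hom_ring TA E "(+>\<^bsub>TA\<^esub>) (env_ideal G A r)"
  unfolding E_eq by (rule rel.rcos_ring_hom_ring)

definition proj :: "((('g \<Rightarrow> 'k) \<Rightarrow> 'k) mon \<Rightarrow>\<^sub>0 'k) \<Rightarrow> ('g, 'k) tensor set" where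
  "proj u = env_ideal G A r +>\<^bsub>TA\<^esub> (linear_ideal V +>\<^bsub>Fr\<^esub> u)"

text \<open>
  Deletes the words with letters that are not generators, and so maps to the free algebra on
  the generators.
\<close>

definition restrict_letters :: "((('g \<Rightarrow> 'k) \<Rightarrow> 'k) mon \<Rightarrow>\<^sub>0 'k) \<Rightarrow> (('g \<Rightarrow> 'k) \<Rightarrow> 'k) mon \<Rightarrow>\<^sub>0 'k" where
  "restrict_letters = subst (\<lambda>v. if v \<in> V then gen v else 0)"

definition pres :: "((('g \<Rightarrow> 'k) \<Rightarrow> 'k) mon \<Rightarrow>\<^sub>0 'k) \<Rightarrow> ('g, 'k) tensor set" where
  "pres u = proj (restrict_letters u)"

lemma restrict_Fr: "restrict_letters u \<in> carrier Fr"
proof (induction u rule: free_induct)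
  case (word c w)
  have "prod_list (map (\<lambda>v. if v \<in> V then gen v else 0 :: (('g \<Rightarrow> 'k) \<Rightarrow> 'k) mon \<Rightarrow>\<^sub>0 'k) w) \<in> carrier Fr"
  proof (induction w)
    case Nil
    show ?case using Fr.one_closed by (simp add: Fr_simps)
  next
    case (Cons v w)
    have "(if v \<in> V then gen v else 0 :: (('g \<Rightarrow> 'k) \<Rightarrow> 'k) mon \<Rightarrow>\<^sub>0 'k) \<in> carrier Fr"
      using Fr_gen Fr.zero_closed by (simp add: Fr_simps)
    then show ?case using Fr_closed[OF _ Cons.IH] by simp
  qed
  then show ?case unfolding restrict_letters_def subst_word using Fr_closed[OF Fr_sc] by blast
next
  case (add x y)
  then show ?case using Fr_closed unfolding restrict_letters_def subst_add by blast
qed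

lemma proj_hom:
  assumes "u \<in> carrier Fr" "v \<in> carrier Fr"
  shows "proj u \<in> carrier E" "proj (u + v) = proj u \<oplus>\<^bsub>E\<^esub> proj v" "proj (u * v) = proj u \<otimes>\<^bsub>E\<^esub> proj v"
    "proj (u - v) = proj u \<ominus>\<^bsub>E\<^esub> proj v"
proof -
  have c: "linear_ideal V +>\<^bsub>Fr\<^esub> u \<in> carrier TA" "linear_ideal V +>\<^bsub>Fr\<^esub> v \<in> carrier TA"
    by (rule \<pi>.hom_closed[OF assms(1)], rule \<pi>.hom_closed[OF assms(2)])
  show "proj u \<in> carrier E" unfolding proj_def by (rule \<rho>.hom_closed[OF c(1)])
  show "proj (u + v) = proj u \<oplus>\<^bsub>E\<^esub> proj v"
    unfolding proj_def using \<pi>.hom_add[OF assms] \<rho>.hom_add[OF c] by (simp only: Fr_simps)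
  show "proj (u * v) = proj u \<otimes>\<^bsub>E\<^esub> proj v"
    unfolding proj_def using \<pi>.hom_mult[OF assms] \<rho>.hom_mult[OF c] by (simp only: Fr_simps)
  have "proj (- v) = \<ominus>\<^bsub>E\<^esub> proj v"
    unfolding proj_def using \<pi>.hom_a_inv[OF assms(2)] \<rho>.hom_a_inv[OF c(2)] by (simp only: Fr_a_inv[OF assms(2)])
  moreover have "proj (u + - v) = proj u \<oplus>\<^bsub>E\<^esub> proj (- v)"
    unfolding proj_def using \<pi>.hom_add[OF assms(1) Fr.a_inv_closed[OF assms(2)]]
      \<rho>.hom_add[OF c(1) \<pi>.hom_closed[OF Fr.a_inv_closed[OF assms(2)]]] by (simp only: Fr_simps Fr_a_inv[OF assms(2)])
  ultimately show "proj (u - v) = proj u \<ominus>\<^bsub>E\<^esub> proj v" by (simp add: a_minus_def)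
qed

lemma restrict_hom: "restrict_letters (u + v) = restrict_letters u + restrict_letters v"
    "restrict_letters (u * v) = restrict_letters u * restrict_letters v"
    "restrict_letters (u - v) = restrict_letters u - restrict_letters v"
    "restrict_letters (u ^ n) = restrict_letters u ^ n"
    "restrict_letters 1 = 1" "restrict_letters (sc c) = sc c"
    "restrict_letters (gen x) = (if x \<in> V then gen x else 0)"
  unfolding restrict_letters_def by (simp_all only: subst_add subst_mult subst_diff subst_power subst_1 subst_sc subst_gen)

lemma pres_closed: "pres u \<in> carrier E"
  and pres_add: "pres (u + v) = pres u \<oplus>\<^bsub>E\<^esub> pres v"
  and pres_mult: "pres (u * v) = pres u \<otimes>\<^bsub>E\<^esub> pres v"
  and pres_minus: "pres (u - v) = pres u \<ominus>\<^bsub>E\<^esub> pres v"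
  unfolding pres_def restrict_hom by (rule proj_hom[OF restrict_Fr restrict_Fr])+

lemma pres_1: "pres 1 = \<one>\<^bsub>E\<^esub>"
  unfolding pres_def restrict_hom proj_def using \<pi>.hom_one \<rho>.hom_one by (simp only: Fr_simps)

lemma pres_power: "pres (u ^ n) = pres u [^]\<^bsub>E\<^esub> n"
proof (induction n)
  case (Suc n)
  have "pres (u ^ Suc n) = pres (u ^ n) \<otimes>\<^bsub>E\<^esub> pres u" by (simp only: power_Suc2 pres_mult)
  then show ?case using Suc by simp
qed (simp add: pres_1)

lemma pres_gen: "v \<in> V \<Longrightarrow> pres (gen v) = env_generator G A r v"
  by (simp add: pres_def restrict_hom proj_def env_generator_def env_generators_V tensor_generator_def Let_def)

lemma pres_sc: "pres (sc c) = env_scalar G A r c"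
  by (simp add: pres_def restrict_hom proj_def env_scalar_def env_generators_V tensor_scalar_def Let_def)

lemma pres_xi: assumes "\<delta> \<in> Dp q" shows "pres (xi \<delta>) = env_xi G A r \<delta>"
  using assms by (simp add: xi_def pres_minus pres_power pres_gen Dq_V pow_p_V env_xi_def p_CHAR[symmetric])

lemma restrict_id: "u \<in> carrier Fr \<Longrightarrow> restrict_letters u = u"
proof -
  assume u: "u \<in> carrier Fr"
  have "restrict_letters u = (\<Sum>w\<in>Poly_Mapping.keys u. sc (Poly_Mapping.lookup u w) * prod_list (map (\<lambda>v. if v \<in> V then gen v else 0) (letters w)))"
    unfolding restrict_letters_def subst_def lin_ext_def by (rule refl)
  also have "\<dots> = (\<Sum>w\<in>Poly_Mapping.keys u. Poly_Mapping.single w (Poly_Mapping.lookup u w))"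
  proof (rule sum.cong[OF refl])
    fix w assume "w \<in> Poly_Mapping.keys u"
    then have "set (letters w) \<subseteq> V" using u by (auto simp: free_algebra_def)
    then have "map (\<lambda>v. if v \<in> V then gen v else 0 :: (('g \<Rightarrow> 'k) \<Rightarrow> 'k) mon \<Rightarrow>\<^sub>0 'k) (letters w) = map gen (letters w)"
      by (intro map_cong refl) auto
    from this show "sc (Poly_Mapping.lookup u w) * prod_list (map (\<lambda>v. if v \<in> V then gen v else 0) (letters w)) = Poly_Mapping.single w (Poly_Mapping.lookup u w)"
      using single_word[of "letters w" "Poly_Mapping.lookup u w"] by (simp only: mon.collapse)
  qed
  also have "\<dots> = u"
    by (rule poly_mapping_eqI) (simp add: lookup_sum lookup_single when_def in_keys_iff)
  finally show ?thesis .
qed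

lemma pres_surj: "e \<in> carrier E \<Longrightarrow> \<exists>u. e = pres u"
proof -
  assume "e \<in> carrier E"
  then obtain t where t: "t \<in> carrier TA" "e = env_ideal G A r +>\<^bsub>TA\<^esub> t"
    unfolding E_eq FactRing_def A_RCOSETS_def' by auto
  then obtain u where u: "u \<in> carrier Fr" "t = linear_ideal V +>\<^bsub>Fr\<^esub> u"
    unfolding tensor_algebra_def FactRing_def A_RCOSETS_def' by auto
  then show ?thesis using t(2) by (intro exI[of _ u]) (simp add: pres_def restrict_id proj_def)
qed

lemma proj_linear: "u \<in> linear_relations V \<Longrightarrow> proj u = \<zero>\<^bsub>E\<^esub>"
proof -
  assume u: "u \<in> linear_relations V"
  have "u \<in> linear_ideal V"
    unfolding linear_ideal_def by (rule subsetD[OF Fr.genideal_self[OF linear_relations_Fr] u])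
  then have "linear_ideal V +>\<^bsub>Fr\<^esub> u = \<zero>\<^bsub>TA\<^esub>"
    unfolding tensor_algebra_def zero_FactRing by (rule lin.a_rcos_const)
  then show ?thesis unfolding proj_def by (simp only: \<rho>.hom_zero)
qed

lemma proj_relation: "(linear_ideal V +>\<^bsub>Fr\<^esub> u) \<in> env_relations G A r \<Longrightarrow> proj u = \<zero>\<^bsub>E\<^esub>"
proof -
  assume u: "(linear_ideal V +>\<^bsub>Fr\<^esub> u) \<in> env_relations G A r"
  have "(linear_ideal V +>\<^bsub>Fr\<^esub> u) \<in> env_ideal G A r"
    unfolding env_ideal_def env_generators_V by (rule subsetD[OF T.genideal_self[OF env_relations_TA] u])
  then show ?thesis unfolding proj_def E_eq zero_FactRing by (rule rel.a_rcos_const)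
qed

lemma coset_minus: "u \<in> carrier Fr \<Longrightarrow> v \<in> carrier Fr \<Longrightarrow>
    linear_ideal V +>\<^bsub>Fr\<^esub> (u - v) = (linear_ideal V +>\<^bsub>Fr\<^esub> u) \<ominus>\<^bsub>TA\<^esub> (linear_ideal V +>\<^bsub>Fr\<^esub> v)"
  by (simp add: Fr_minus[symmetric] a_minus_def)

lemma coset_mult: "v \<in> V \<Longrightarrow> w \<in> V \<Longrightarrow>
    linear_ideal V +>\<^bsub>Fr\<^esub> (gen v * gen w) = tensor_generator V v \<otimes>\<^bsub>TA\<^esub> tensor_generator V w"
  unfolding tensor_generator_def using \<pi>.hom_mult[OF Fr_gen[of v] Fr_gen[of w]] by (simp only: Fr_simps)

text \<open>
  The inductive rules for \<open>J\<close> mirror the two layers of relations: linear relations of the tensor algebra,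
  and relations of the enveloping algebra.
\<close>

lemma pres_J: "u \<in> J \<Longrightarrow> pres u = \<zero>\<^bsub>E\<^esub>"
proof (induction rule: J.induct)
  case (J_add_rel v w)
  then have "v + w \<in> V" by (rule V_plus)
  then have "pres (gen (v + w) - gen v - gen w) = proj (gen (v + w) - gen v - gen w)"
    using J_add_rel by (simp add: pres_def restrict_hom)
  also have "\<dots> = \<zero>\<^bsub>E\<^esub>" by (rule proj_linear) (use J_add_rel in \<open>auto simp: linear_relations_def\<close>)
  finally show ?case .
next
  case (J_scale_rel v c)
  then have "fscale c v \<in> V" by (rule V_fscale)
  then have "pres (gen (fscale c v) - sc c * gen v) = proj (gen (fscale c v) - sc c * gen v)"
    using J_scale_rel by (simp add: pres_def restrict_hom)
  also have "\<dots> = \<zero>\<^bsub>E\<^esub>" by (rule proj_linear) (use J_scale_rel in \<open>auto simp: linear_relations_def\<close>)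
  finally show ?case .
next
  case (J_mult_rel x i y j)
  note V = dm_V[OF J_mult_rel]
  have "pres (gen x * gen y - gen (x \<star> y)) = proj (gen x * gen y - gen (x \<star> y))"
    using V by (simp add: pres_def restrict_hom)
  also have "\<dots> = \<zero>\<^bsub>E\<^esub>"
  proof (rule proj_relation)
    have g: "gen x * gen y \<in> carrier Fr" "gen (x \<star> y) \<in> carrier Fr" using V Fr_closed Fr_gen by blast+
    have e: "linear_ideal V +>\<^bsub>Fr\<^esub> (gen x * gen y - gen (x \<star> y)) =
        tensor_generator V x \<otimes>\<^bsub>TA\<^esub> tensor_generator V y \<ominus>\<^bsub>TA\<^esub> tensor_generator V (x \<star> y)"
      unfolding coset_minus[OF g] using V by (simp only: coset_mult) (simp only: tensor_generator_def)
    show "linear_ideal V +>\<^bsub>Fr\<^esub> (gen x * gen y - gen (x \<star> y)) \<in> env_relations G A r"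
      unfolding e env_relations_def Let_def env_generators_V p_CHAR[symmetric] N_eq[symmetric]
      by (intro UnI1 CollectI exI[of _ x] exI[of _ y] exI[of _ i] exI[of _ j] conjI refl J_mult_rel)
  qed
  finally show ?case .
next
  case (J_comm_rel x i y j)
  note V = commutator_V[OF J_comm_rel]
  have "pres (gen x * gen y - gen y * gen x - gen (x \<star> y - y \<star> x)) = proj (gen x * gen y - gen y * gen x - gen (x \<star> y - y \<star> x))"
    using V by (simp add: pres_def restrict_hom)
  also have "\<dots> = \<zero>\<^bsub>E\<^esub>"
  proof (rule proj_relation)
    have g: "gen x * gen y \<in> carrier Fr" "gen y * gen x \<in> carrier Fr" "gen (x \<star> y - y \<star> x) \<in> carrier Fr"
      using V Fr_closed Fr_gen by blast+
    have g': "gen x * gen y - gen y * gen x \<in> carrier Fr" using g Fr_closed by blast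
    have e: "linear_ideal V +>\<^bsub>Fr\<^esub> (gen x * gen y - gen y * gen x - gen (x \<star> y - y \<star> x)) =
        (tensor_generator V x \<otimes>\<^bsub>TA\<^esub> tensor_generator V y \<ominus>\<^bsub>TA\<^esub> tensor_generator V y \<otimes>\<^bsub>TA\<^esub> tensor_generator V x)
          \<ominus>\<^bsub>TA\<^esub> tensor_generator V (x \<star> y - y \<star> x)"
      unfolding coset_minus[OF g' g(3)] coset_minus[OF g(1,2)] using V by (simp only: coset_mult) (simp only: tensor_generator_def)
    show "linear_ideal V +>\<^bsub>Fr\<^esub> (gen x * gen y - gen y * gen x - gen (x \<star> y - y \<star> x)) \<in> env_relations G A r"
      unfolding e env_relations_def Let_def env_generators_V p_CHAR[symmetric] N_eq[symmetric]
      by (intro UnI2 CollectI exI[of _ x] exI[of _ y] exI[of _ i] exI[of _ j] conjI refl J_comm_rel)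
  qed
  finally show ?case .
next
  case (J_out v)
  then have "pres (gen v) = pres (0 :: (('g \<Rightarrow> 'k) \<Rightarrow> 'k) mon \<Rightarrow>\<^sub>0 'k)" using restrict_hom(6)[of 0] by (simp add: pres_def restrict_hom)
  also have "\<dots> = \<zero>\<^bsub>E\<^esub>" using pres_minus[of 0 0] pres_closed[of 0] by (simp add: E.r_neg a_minus_def)
  finally show ?case .
next
  case (J_plus u v)
  then show ?case by (simp add: pres_add)
next
  case (J_left u a)
  then show ?case using pres_closed[of a] by (simp add: pres_mult)
next
  case (J_right u a)
  then show ?case using pres_closed[of a] by (simp add: pres_mult)
qed

text \<open>
  The annihilator of a nonzero vector, pulled back to the free algebra, is a maximal left ideal. The
  conclusion for this ideal concerns all multiples of the vector, that is, the whole module.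
\<close>

theorem xi_scalar_on_irreducible:
  assumes irr: "irreducible_module E M act" and fr: "frobenius_frame H d"
  shows "\<exists>c. \<forall>\<delta>\<in>Dp q. \<forall>x\<in>carrier M.
    act (env_xi G A r \<delta> \<ominus>\<^bsub>E\<^esub> env_scalar G A r ((\<Sum>h\<in>H. \<delta> (h ^ q) * c h) ^ p)) x = \<zero>\<^bsub>M\<^esub>"
proof -
  interpret M: left_module E M act using irr by (simp add: irreducible_module_def)
  have "carrier M \<noteq> {\<zero>\<^bsub>M\<^esub>}" using irr by (simp add: irreducible_module_def)
  then obtain m where m: "m \<in> carrier M" "m \<noteq> \<zero>\<^bsub>M\<^esub>" using M.M.zero_closed by blast
  define Ann where "Ann = {u. act (pres u) m = \<zero>\<^bsub>M\<^esub>}"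
  have act_c: "act (pres u) x \<in> carrier M" if "x \<in> carrier M" for u x by (rule M.act_closed[OF pres_closed that])
  have cyc: "\<exists>u. y = act (pres u) x" if "x \<in> carrier M" "x \<noteq> \<zero>\<^bsub>M\<^esub>" "y \<in> carrier M" for x y
    using irreducible_cyclic[OF irr that] pres_surj by blast
  have "\<exists>c. \<forall>\<mu>\<in>Dp q. \<forall>v. (xi \<mu> - sc ((\<Sum>h\<in>H. \<mu> (h ^ q) * c h) ^ p)) * v \<in> Ann"
  proof (rule xi_acts_by_scalars[OF _ _ _ _ _ fr])
    show "J \<subseteq> Ann" using pres_J M.act_zero_left m by (auto simp: Ann_def)
    show "u + v \<in> Ann" if "u \<in> Ann" "v \<in> Ann" for u v
      using that m by (simp add: Ann_def pres_add M.act_add_left pres_closed)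
    show "a * u \<in> Ann" if "u \<in> Ann" for a u
      using that m by (simp add: Ann_def pres_mult M.act_mult pres_closed M.act_zero_right)
    show "1 \<notin> Ann" using m by (simp add: Ann_def pres_1 M.act_one)
    show "\<exists>a. a * u - 1 \<in> Ann" if "u \<notin> Ann" for u
    proof -
      have "act (pres u) m \<noteq> \<zero>\<^bsub>M\<^esub>" using that by (simp add: Ann_def)
      then obtain a where a: "m = act (pres a) (act (pres u) m)" using cyc[OF act_c[OF m(1)] _ m(1)] by blast
      have "act (pres (a * u - 1)) m = act (pres (a * u)) m \<ominus>\<^bsub>M\<^esub> act (pres 1) m"
        unfolding pres_minus by (rule M.act_minus[OF pres_closed pres_closed m(1)])
      also have "act (pres (a * u)) m = m"
        unfolding pres_mult using M.act_mult[OF pres_closed pres_closed m(1), of a u] a by simp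
      also have "act (pres 1) m = m" unfolding pres_1 by (rule M.act_one[OF m(1)])
      also have "m \<ominus>\<^bsub>M\<^esub> m = \<zero>\<^bsub>M\<^esub>" using m(1) by (simp add: a_minus_def M.M.r_neg)
      finally show ?thesis by (auto simp: Ann_def)
    qed
  qed
  then obtain c where c: "\<forall>\<mu>\<in>Dp q. \<forall>v. (xi \<mu> - sc ((\<Sum>h\<in>H. \<mu> (h ^ q) * c h) ^ p)) * v \<in> Ann" by (rule exE)
  have "act (env_xi G A r \<delta> \<ominus>\<^bsub>E\<^esub> env_scalar G A r ((\<Sum>h\<in>H. \<delta> (h ^ q) * c h) ^ p)) x = \<zero>\<^bsub>M\<^esub>"
    if \<delta>: "\<delta> \<in> Dp q" and x: "x \<in> carrier M" for \<delta> x
  proof -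
    let ?s = "(\<Sum>h\<in>H. \<delta> (h ^ q) * c h) ^ p"
    obtain v where v: "x = act (pres v) m" using cyc[OF m x] by blast
    have "(xi \<delta> - sc ?s) * v \<in> Ann" by (rule c[rule_format, OF \<delta>])
    then have "act (pres (xi \<delta> - sc ?s) \<otimes>\<^bsub>E\<^esub> pres v) m = \<zero>\<^bsub>M\<^esub>" by (simp only: Ann_def mem_Collect_eq pres_mult)
    then have "act (pres (xi \<delta> - sc ?s)) x = \<zero>\<^bsub>M\<^esub>" unfolding v using M.act_mult[OF pres_closed pres_closed m(1)] by simp
    then show ?thesis by (simp only: pres_minus pres_xi[OF \<delta>] pres_sc)
  qed
  then show ?thesis by (intro exI[of _ c]) blast
qed

end

theorem proposition5p1p2:
  fixes G :: "('g, 'm) monoid_scheme"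
    and A A0 :: "('g \<Rightarrow> 'k::alg_closed_field) set"
    and r :: nat
    and M :: "('v, 'n) ring_scheme"
    and act :: "('g, 'k) tensor set \<Rightarrow> 'v \<Rightarrow> 'v"
  assumes "CHAR('k) > 0"
    and "reductive_group G A"
    and "split_Fp_form G A A0"
    and "irreducible_module (env G A r) M act"
  shows "\<exists>\<chi>\<in>linear_forms (dist_plus G A 1).
           \<exists>act'. left_module (reduced_env G A A0 r \<chi>) M act' \<and>
             (\<forall>u\<in>carrier (env G A r). \<forall>x\<in>carrier M.
                act u x = act' (reduced_env_ideal G A A0 r \<chi> +>\<^bsub>env G A r\<^esub> u) x)"
proof -
  have aff: "affine_algebraic_group G A" using assms(2) by (simp add: reductive_group_def)
  interpret env_presentation G A "CHAR('k)" r
    by (intro env_presentation.intro higher_env.intro char_p_group.intro char_p_group_axioms.intro aff refl assms(1))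
  interpret M: left_module E M act using assms(4) by (simp add: irreducible_module_def)
  have A0: "Fp_form G A A0" using assms(3) by (simp add: split_Fp_form_def)
  obtain H d where fr: "frobenius_frame H d" and H: "H \<subseteq> A0" using Fp_form_frame[OF A0] by blast
  obtain c where c: "\<forall>\<delta>\<in>Dp q. \<forall>x\<in>carrier M.
      act (env_xi G A r \<delta> \<ominus>\<^bsub>E\<^esub> env_scalar G A r ((\<Sum>h\<in>H. \<delta> (h ^ q) * c h) ^ CHAR('k))) x = \<zero>\<^bsub>M\<^esub>"
    using xi_scalar_on_irreducible[OF assms(4) fr] by (rule exE)
  (* outside its domain a linear form is zero by convention *)
  define \<chi> where "\<chi> \<eta> = (if \<eta> \<in> Dp 1 then \<Sum>h\<in>H. \<eta> h * c h else 0)" for \<eta>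
  have \<chi>: "\<chi> \<in> linear_forms (Dp 1)"
    unfolding linear_forms_def
  proof (intro CollectI conjI ballI allI impI)
    fix \<mu> \<nu> a assume \<mu>: "\<mu> \<in> Dp 1"
    have "fscale a \<mu> \<in> Dp 1" using \<mu> by (rule Dp_fscale)
    then show "\<chi> (fscale a \<mu>) = a * \<chi> \<mu>"
      using \<mu> by (simp add: \<chi>_def fscale_apply[of a \<mu>] sum_distrib_left mult.assoc)
    assume \<nu>: "\<nu> \<in> Dp 1"
    have "\<mu> + \<nu> \<in> Dp 1" using \<mu> \<nu> by (rule Dp_plus)
    then show "\<chi> (\<mu> + \<nu>) = \<chi> \<mu> + \<chi> \<nu>"
      using \<mu> \<nu> by (simp add: \<chi>_def plus_fun_apply[of \<mu>] sum.distrib distrib_right)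
  next
    fix \<mu> assume "\<mu> \<notin> Dp 1"
    then show "\<chi> \<mu> = 0" by (simp add: \<chi>_def)
  qed
  have \<chi>_twist: "\<chi> (dist_frobenius A A0 r \<delta>) = (\<Sum>h\<in>H. \<delta> (h ^ q) * c h)" if \<delta>: "\<delta> \<in> Dp q" for \<delta>
  proof -
    have "\<chi> (dist_frobenius A A0 r \<delta>) = (\<Sum>h\<in>H. dist_frobenius A A0 r \<delta> h * c h)"
      using dist_frobenius_Fp_form(1)[OF A0 \<delta>] by (simp only: \<chi>_def if_True)
    also have "\<dots> = (\<Sum>h\<in>H. \<delta> (h ^ q) * c h)"
    proof (rule sum.cong[OF refl])
      fix h assume "h \<in> H"
      then have "h \<in> A0" using H by (rule rev_subsetD)
      then show "dist_frobenius A A0 r \<delta> h * c h = \<delta> (h ^ q) * c h"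
        by (simp only: dist_frobenius_Fp_form(2)[OF A0 \<delta>])
    qed
    finally show ?thesis .
  qed
  define R where "R = {env_xi G A r \<delta> \<ominus>\<^bsub>E\<^esub> env_scalar G A r (\<chi> (dist_frobenius A A0 r \<delta>) ^ CHAR('k)) | \<delta>. \<delta> \<in> Dp q}"
  have q: "CHAR('k) ^ r = q" by (simp add: q_def)
  have R: "R \<subseteq> M.kernel"
  proof
    fix e assume "e \<in> R"
    then obtain \<delta> where \<delta>: "\<delta> \<in> Dp q"
      and e: "e = env_xi G A r \<delta> \<ominus>\<^bsub>E\<^esub> env_scalar G A r (\<chi> (dist_frobenius A A0 r \<delta>) ^ CHAR('k))"
      unfolding R_def by blast
    have "e \<in> carrier E" unfolding e pres_xi[OF \<delta>, symmetric] pres_sc[symmetric]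
      by (intro E.minus_closed pres_closed)
    moreover have "\<forall>x\<in>carrier M. act e x = \<zero>\<^bsub>M\<^esub>"
      unfolding e \<chi>_twist[OF \<delta>] by (rule bspec[OF c \<delta>])
    ultimately show "e \<in> M.kernel" unfolding M.kernel_def by blast
  qed
  have RE: "R \<subseteq> carrier E" using R by (auto simp: M.kernel_def)
  have Id: "reduced_env_ideal G A A0 r \<chi> = Idl\<^bsub>E\<^esub> R" unfolding reduced_env_ideal_def q R_def by (rule refl)
  have "ideal (reduced_env_ideal G A A0 r \<chi>) E" unfolding Id by (rule E.genideal_ideal[OF RE])
  moreover have "reduced_env_ideal G A A0 r \<chi> \<subseteq> M.kernel"
    unfolding Id by (rule E.genideal_minimal[OF M.kernel_ideal R])
  ultimately show ?thesis
    using M.quotient_module[of "reduced_env_ideal G A A0 r \<chi>"] \<chi> unfolding reduced_env_def by blast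
qed

end
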